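(* Let $\mathcal{H}=L^2(\mathcal{Z})$ and let $X_i=\mu_i+\varepsilon_i$, $i=1,\ldots,n$, where the errors satisfy the following two conditions. (A1) $\{\varepsilon_i\}_{i\in\mathbb{Z}}$ is a centered, strictly stationary sequence of $\mathcal{H}$-valued random variables with $\mathsf{E}\|\varepsilon_1\|^k<\infty$ for some $k>2$. With $C_r=\mathsf{E}[\varepsilon_0\otimes\varepsilon_r]$ one has $\sum_r\|C_r\|<\infty$, and $C_\varepsilon=\sum_rC_r\neq0$. Write $C_\varepsilon=\sum_{p\ge1}\lambda_{p,\varepsilon}v_{p,\varepsilon}\otimes v_{p,\varepsilon}$ with $\lambda_{1,\varepsilon}\ge\lambda_{2,\varepsilon}\ge\cdots$ and orthonormal basis $\{v_{p,\varepsilon}\}$. Moreover $\sum_{p\ge1}\sum_{h\in\mathbb{Z}}|\mathsf{Cov}(\langle\varepsilon_0,v_{p,\varepsilon}\rangle,\langle\varepsilon_h,v_{p,\varepsilon}\rangle)|<\infty$. (A2) $\{n^{-1/2}\sum_{i=1}^{\lfloor tn\rfloor}\varepsilon_i\}_{t\in[0,1]}$ converges weakly in $D^{\mathcal{H}}[0,1]$ to an $\mathcal{H}$-valued Brownian motion with covariance operator $C_\varepsilon$. Let $h:[-1,1]\to\mathbb{R}$ be non-constant with $h(x)=0$ for $x\le0$, of bounded total variation, and $\alpha$-Hölder continuous on $[0,1]$ for some $\alpha>0$; that is, there is $\beta>0$ with $|h(t)-h(s)|\le\beta|s-t|^\alpha$ for all $s,t\in[0,1]$. Define $$T_{n,\mathrm{FF}}(h)=\max_{1\le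 k<n}\Big\|\frac1{\sqrt n}\sum_{i=1}^nh\!\left(\tfrac{i-k}{n}\right)(X_i-\bar X_n)\Big\|,$$ $$T_{n,\mathrm{WF}}(h;\hat C)=\max_{1\le k<n}\Big\|(\hat C+\hat\lambda_1\mathrm{Id})^{-1/2}\frac1{\sqrt n}\sum_{i=1}^nh\!\left(\tfrac{i-k}{n}\right)(X_i-\bar X_n)\Big\|,$$ where $\hat C$ is a random bounded self-adjoint positive semidefinite operator computed from the data and $\hat\lambda_1$ is its largest eigenvalue. Let $G_p(t)=\int_0^{1-t}B_p(1-t-y)\,dh(y)$, where $B_1,B_2,\ldots$ are i.i.d. standard Brownian bridges on $[0,1]$. (a) Under $H_0:\mu_1=\cdots=\mu_n$, as $n\to\infty$, $$T_{n,\mathrm{FF}}(h)\xrightarrow{\mathcal D}\sup_{0<t<1}\sqrt{\sum_{p=1}^\infty\lambda_{p,\varepsilon}G_p^2(t)}.$$ (b) If additionally $\|\hat C-C_\varepsilon\|=o_P(1)$, then under $H_0$ $$T_{n,\mathrm{WF}}(h;\hat C)\xrightarrow{\mathcal D}\sup_{0<t<1}\sqrt{\sum_{p=1}^\infty\frac{\lambda_{p,\varepsilon}}{\lambda_{1,\varepsilon}+\lambda_{p,\varepsilon}}G_p^2(t)}.$$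
   Context: $\mathcal{H}=L^2(\mathcal{Z})$ is the real separable Hilbert space of square-integrable functions on a domain $\mathcal{Z}$ with a $\sigma$-finite measure $\nu$, with inner product $\langle f,g\rangle=\int fg\,d\nu$ and norm $\|\cdot\|$. The tensor product is $(v\otimes w)(h)=\langle v,h\rangle w$. Operator norms are used for operators. $\bar X_n=n^{-1}\sum_{i=1}^n X_i$. The integral defining $G_p$ is a Riemann–Stieltjes integral with respect to $h$. $A^{-1/2}$ denotes the positive definite inverse square root of a positive definite bounded self-adjoint operator $A$. *)

theory Defs
  imports "HOL-Probability.Probability"
begin

definition covar :: "'a measure \<Rightarrow> ('a \<Rightarrow> real) \<Rightarrow> ('a \<Rightarrow> real) \<Rightarrow> real" where
  "covar M X Y = (LINT \<omega>|M. X \<omega> * Y \<omega>) - (LINT \<omega>|M. X \<omega>) * (LINT \<omega>|M. Y \<omega>)"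

definition is_normal :: "'a measure \<Rightarrow> ('a \<Rightarrow> real) \<Rightarrow> real \<Rightarrow> real \<Rightarrow> bool" where
  "is_normal M Y m s2 \<longleftrightarrow> Y \<in> borel_measurable M \<and>
     ((s2 > 0 \<and> distributed M lborel Y (normal_density m (sqrt s2))) \<or>
      (s2 = 0 \<and> (AE \<omega> in M. Y \<omega> = m)))"

definition std_brownian_bridge :: "'a measure \<Rightarrow> ('a \<Rightarrow> real \<Rightarrow> real) \<Rightarrow> bool" where
  "std_brownian_bridge N B \<longleftrightarrow>
     (\<forall>t. (\<lambda>\<omega>. B \<omega> t) \<in> borel_measurable N) \<and>
     (\<forall>\<omega>\<in>space N. continuous_on {0..1} (B \<omega>)) \<and>
     (\<forall>(ts::real list) (cs::real list). length cs = length ts \<and> set ts \<subseteq> {0..1} \<longrightarrow>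
        is_normal N (\<lambda>\<omega>. \<Sum>j<length ts. cs!j * B \<omega> (ts!j)) 0
          (\<Sum>i<length ts. \<Sum>j<length ts. cs!i * cs!j * (min (ts!i) (ts!j) - ts!i * ts!j)))"

definition self_adjoint_op :: "'h::real_inner \<Rightarrow>\<^sub>L 'h \<Rightarrow> bool" where
  "self_adjoint_op A \<longleftrightarrow> (\<forall>x y. inner (A x) y = inner x (A y))"

definition psd_op :: "'h::real_inner \<Rightarrow>\<^sub>L 'h \<Rightarrow> bool" where
  "psd_op A \<longleftrightarrow> self_adjoint_op A \<and> (\<forall>x. inner (A x) x \<ge> 0)"

definition pd_op :: "'h::real_inner \<Rightarrow>\<^sub>L 'h \<Rightarrow> bool" where
  "pd_op A \<longleftrightarrow> self_adjoint_op A \<and> (\<forall>x. x \<noteq> 0 \<longrightarrow> inner (A x) x > 0)"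

definition inv_sqrt_op :: "'h::real_inner \<Rightarrow>\<^sub>L 'h \<Rightarrow> 'h \<Rightarrow>\<^sub>L 'h" where
  "inv_sqrt_op A = (THE S. pd_op S \<and> (\<forall>x. S (S (A x)) = x) \<and> (\<forall>x. A (S (S x)) = x))"

definition is_largest_eigenvalue :: "'h::real_inner \<Rightarrow>\<^sub>L 'h \<Rightarrow> real \<Rightarrow> bool" where
  "is_largest_eigenvalue A l \<longleftrightarrow> (\<exists>x. x \<noteq> 0 \<and> A x = l *\<^sub>R x) \<and>
     (\<forall>m x. x \<noteq> 0 \<and> A x = m *\<^sub>R x \<longrightarrow> m \<le> l)"

definition largest_eigenvalue :: "'h::real_inner \<Rightarrow>\<^sub>L 'h \<Rightarrow> real" where
  "largest_eigenvalue A = (THE l. is_largest_eigenvalue A l)"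

text \<open>Lag-r autocovariance operator C_r = E[eps_0 (x) eps_r], (v (x) w)(h) = <v,h> w.\<close>
definition autocov_op :: "'a measure \<Rightarrow> (int \<Rightarrow> 'a \<Rightarrow> 'h::{real_inner,banach,second_countable_topology})
     \<Rightarrow> int \<Rightarrow> 'h \<Rightarrow>\<^sub>L 'h" where
  "autocov_op M eps r = Blinfun (\<lambda>x. LINT \<omega>|M. inner (eps 0 \<omega>) x *\<^sub>R eps r \<omega>)"

definition strictly_stationary :: "'a measure \<Rightarrow> (int \<Rightarrow> 'a \<Rightarrow> 'h::topological_space) \<Rightarrow> bool" where
  "strictly_stationary M X \<longleftrightarrow> (\<forall>s::int.
     distr M (PiM UNIV (\<lambda>_. borel)) (\<lambda>\<omega> i. X (i + s) \<omega>) =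
     distr M (PiM UNIV (\<lambda>_. borel)) (\<lambda>\<omega> i. X i \<omega>))"

definition hilbert_brownian_motion :: "'a measure \<Rightarrow> ('a \<Rightarrow> real \<Rightarrow> 'h::{real_inner,topological_space})
     \<Rightarrow> ('h \<Rightarrow>\<^sub>L 'h) \<Rightarrow> bool" where
  "hilbert_brownian_motion N W C \<longleftrightarrow>
     (\<forall>t. (\<lambda>\<omega>. W \<omega> t) \<in> borel_measurable N) \<and>
     (\<forall>\<omega>\<in>space N. continuous_on {0..1} (W \<omega>)) \<and>
     (\<forall>(ts::real list) (xs::'h list) (cs::real list).
        length xs = length ts \<and> length cs = length ts \<and> set ts \<subseteq> {0..1} \<longrightarrow>
        is_normal N (\<lambda>\<omega>. \<Sum>j<length ts. cs!j * inner (W \<omega> (ts!j)) (xs!j)) 0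
          (\<Sum>i<length ts. \<Sum>j<length ts.
              cs!i * cs!j * min (ts!i) (ts!j) * inner (C (xs!i)) (xs!j)))"

definition cadlag01 :: "(real \<Rightarrow> 'h::metric_space) \<Rightarrow> bool" where
  "cadlag01 x \<longleftrightarrow> (\<forall>t\<in>{0..<1}. (x \<longlongrightarrow> x t) (at_right t)) \<and>
                   (\<forall>t\<in>{0<..1}. \<exists>l. (x \<longlongrightarrow> l) (at_left t))"

definition time_changes01 :: "(real \<Rightarrow> real) set" where
  "time_changes01 = {l. strict_mono_on {0..1} l \<and> continuous_on {0..1} l \<and> l 0 = 0 \<and> l 1 = 1}"

definition skorokhod_dist :: "(real \<Rightarrow> 'h::metric_space) \<Rightarrow> (real \<Rightarrow> 'h) \<Rightarrow> real" where
  "skorokhod_dist x y = (INF l\<in>time_changes01.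
      max (SUP t\<in>{0..1}. \<bar>l t - t\<bar>) (SUP t\<in>{0..1}. dist (x t) (y (l t))))"

definition weak_conv_D :: "'a measure \<Rightarrow> (nat \<Rightarrow> 'a \<Rightarrow> real \<Rightarrow> 'h::metric_space)
     \<Rightarrow> 'b measure \<Rightarrow> ('b \<Rightarrow> real \<Rightarrow> 'h) \<Rightarrow> bool" where
  "weak_conv_D M Z N W \<longleftrightarrow>
     (\<forall>f :: (real \<Rightarrow> 'h) \<Rightarrow> real.
        (\<exists>B. \<forall>x. cadlag01 x \<longrightarrow> \<bar>f x\<bar> \<le> B) \<and>
        (\<forall>x. cadlag01 x \<longrightarrow> (\<forall>e>0. \<exists>d>0. \<forall>y. cadlag01 y \<and> skorokhod_dist x y < d \<longrightarrow>
                                        \<bar>f y - f x\<bar> < e)) \<longrightarrow>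
        (\<lambda>n. LINT \<omega>|M. f (Z n \<omega>)) \<longlonglongrightarrow> (LINT \<omega>|N. f (W \<omega>)))"

definition total_variation_on :: "(real \<Rightarrow> real) \<Rightarrow> real \<Rightarrow> real \<Rightarrow> ereal" where
  "total_variation_on g a b = (SUP (p, m)\<in>{(p::nat \<Rightarrow> real, m::nat). p 0 = a \<and> p m = b \<and>
        (\<forall>j<m. p j \<le> p (Suc j))}. ereal (\<Sum>j<m. \<bar>g (p (Suc j)) - g (p j)\<bar>))"

definition bounded_variation_on :: "(real \<Rightarrow> real) \<Rightarrow> real \<Rightarrow> real \<Rightarrow> bool" where
  "bounded_variation_on g a b \<longleftrightarrow> total_variation_on g a b < \<infinity>"

definition has_RS_integral :: "(real \<Rightarrow> real) \<Rightarrow> (real \<Rightarrow> real) \<Rightarrow> real \<Rightarrow> real \<Rightarrow> real \<Rightarrow> bool" where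
  "has_RS_integral f g a b I \<longleftrightarrow> (\<forall>e>0. \<exists>d>0. \<forall>(p::nat \<Rightarrow> real) (\<xi>::nat \<Rightarrow> real) (m::nat).
      p 0 = a \<and> p m = b \<and> (\<forall>j<m. p j \<le> \<xi> j \<and> \<xi> j \<le> p (Suc j) \<and> p (Suc j) - p j < d) \<longrightarrow>
      \<bar>(\<Sum>j<m. f (\<xi> j) * (g (p (Suc j)) - g (p j))) - I\<bar> < e)"

definition RS_integral :: "(real \<Rightarrow> real) \<Rightarrow> (real \<Rightarrow> real) \<Rightarrow> real \<Rightarrow> real \<Rightarrow> real" where
  "RS_integral f g a b = (THE I. has_RS_integral f g a b I)"

end

theory Submission
  imports Defs
begin

text \<open>Summation by parts writes the statistic as a functional \<open>Phi\<close> of the partial sum process: the maximum over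
  the grid of the norms of Riemann-Stieltjes sums of its tied-down version against \<open>h\<close>. This functional depends
  on \<open>n\<close> and is not Skorokhod continuous, so the path is first averaged over short windows. On smoothed
  paths the functional is continuous and, by the Hoelder condition, nearly independent of \<open>n\<close>; the
  error of smoothing is itself controlled by a Skorokhod continuous functional. Hence the partial sum
  process may be replaced by the Hilbert space Brownian motion with \<open>n\<close> kept. For fixed \<open>n\<close> only
  finitely many times matter, and characteristic functions show that the coordinates of the tied-down Brownian
  motion have the law of independent scaled Brownian bridges, reversed in time. Letting \<open>n\<close> tend to infinity,
  the Riemann-Stieltjes sums of the bridges converge uniformly.

  For the weighted statistic, perturbation bounds for the largest eigenvalue and for the inverse square
  root replace the estimated operator by \<open>C + lam 0 * Id\<close>, which acts diagonally.\<close>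

section \<open>Inverse square roots of operators\<close>

text \<open>\<open>weak_conv_D\<close> admits only functionals that are Skorokhod continuous at
  every cadlag path; continuity at the paths of the limit would not do. Hence the smoothing error
  must itself be such a functional: its expectation is small under the Brownian motion, so weak
  convergence makes it small under the partial sums, which takes the place of a tightness argument.
  \<open>W\<close> and the bridges \<open>B\<close> live on unrelated probability spaces and are
  never coupled; only integrals of functions of finitely many coordinates are compared. Facts about
  the limit come through this channel: the series of squared bridges has uniformly small tails
  because the paths of \<open>W\<close> are continuous in the Hilbert space, and \<open>lam\<close>
  is nonnegative and tends to zero because \<open>W\<close> exists. Time is reversed since summation
  by parts evaluates the tied-down path at \<open>t + y\<close>, while \<open>G\<close> uses
  \<open>1 - t - y\<close>; the covariance min(s, t) - s t is invariant under u -> 1 - u. In the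
  weighted case the error of the inverse root is a small multiple of the unweighted statistic, and
  the first claim keeps that statistic bounded in probability.\<close>

lemma quadratic_nonneg_imp_discrim:
  fixes a b c :: real
  assumes "\<And>t. a * t\<^sup>2 + 2 * b * t + c \<ge> 0" "a \<ge> 0"
  shows "b\<^sup>2 \<le> a * c"
proof (cases "a = 0")
  case True
  have "b = 0"
  proof (rule ccontr)
    assume "b \<noteq> 0"
    \<comment> \<open>With \<open>a = 0\<close> the polynomial is affine, and at this point its
      value is -1.\<close>
    with assms(1)[of "- (c + 1) / (2 * b)"] True show False by (simp add: field_simps)
  qed
  with True show ?thesis by simp
next
  case False
  with assms have "a > 0" by simp
  with assms(1)[of "- b / a"] show ?thesis
    by (simp add: field_simps power2_eq_square)
qed

lemma psd_op_Cauchy_Schwarz: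
  assumes "psd_op P"
  shows "(inner (P x) y)\<^sup>2 \<le> inner (P x) x * inner (P y) y"
proof -
  have sa: "inner (P u) w = inner u (P w)" and nn: "inner (P u) u \<ge> 0" for u w
    using assms by (auto simp: psd_op_def self_adjoint_op_def)
  have "inner (P y) y * t\<^sup>2 + 2 * inner (P x) y * t + inner (P x) x \<ge> 0" for t
    using nn[of "x + t *\<^sub>R y"] sa[of y x]
    by (simp add: blinfun.bilinear_simps inner_add_left inner_add_right inner_commute
        algebra_simps power2_eq_square)
  from quadratic_nonneg_imp_discrim[OF this nn] show ?thesis by (simp add: mult.commute)
qed

text \<open>Cauchy-Schwarz for the form of \<open>P\<close>, taken at \<open>y = P x\<close>, after
  which one factor \<open>(norm (P x))^2\<close> cancels. Besides norm bounds, it shows that a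
  vector on which the form is almost zero is almost in the kernel.\<close>

lemma psd_op_norm_apply_sq_le:
  assumes "psd_op P" "\<And>x. inner (P x) x \<le> q * (norm x)\<^sup>2"
  shows "(norm (P x))\<^sup>2 \<le> q * inner (P x) x"
proof (cases "P x = 0")
  case False
  have nn: "inner (P x) x \<ge> 0" using assms by (auto simp: psd_op_def)
  have "((norm (P x))\<^sup>2)\<^sup>2 \<le> inner (P x) x * inner (P (P x)) (P x)"
    using psd_op_Cauchy_Schwarz[OF assms(1), of x "P x"] by (simp add: power2_norm_eq_inner)
  also have "\<dots> \<le> inner (P x) x * (q * (norm (P x))\<^sup>2)"
    using assms(2) nn by (intro mult_left_mono) auto
  finally have "(norm (P x))\<^sup>2 * (norm (P x))\<^sup>2 \<le> (q * inner (P x) x) * (norm (P x))\<^sup>2"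
    by (simp only: power2_eq_square mult_ac)
  then show ?thesis by (rule mult_right_le_imp_le) (use False in auto)
qed (use assms in \<open>auto simp: psd_op_def\<close>)

lemma psd_op_norm_apply_le:
  assumes "psd_op P" "\<And>x. inner (P x) x \<le> q * (norm x)\<^sup>2" "q \<ge> 0"
  shows "norm (P x) \<le> q * norm x"
proof -
  have "(norm (P x))\<^sup>2 \<le> q * inner (P x) x" by (rule psd_op_norm_apply_sq_le[OF assms(1,2)])
  also have "\<dots> \<le> q * (q * (norm x)\<^sup>2)" using assms by (intro mult_left_mono) auto
  finally show ?thesis using assms(3)
    by (intro power2_le_imp_le[of "norm (P x)"]) (auto simp: power_mult_distrib power2_eq_square mult_ac)
qed

text \<open>If \<open>Y\<close> solves this equation, then the square of \<open>Id - Y\<close> is \<open>Id - T\<close>.\<close>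
lemma contraction_sqrt_ex:
  fixes T :: "'h::{real_inner,banach} \<Rightarrow>\<^sub>L 'h"
  assumes T: "self_adjoint_op T" "norm T \<le> q" and q: "0 \<le> q" "q < 1"
  obtains Y where "self_adjoint_op Y" "norm Y < 1" "\<And>x. Y (Y x) - 2 *\<^sub>R Y x + T x = 0"
    "\<And>U x. (\<And>x. T (blinfun_apply U x) = U (T x)) \<Longrightarrow> Y (blinfun_apply U x) = U (Y x)"
proof -
  \<comment> \<open>\<open>\<rho>\<close> is the smaller fixed point of the scalar majorant sending
    \<open>y\<close> to \<open>(q + y^2) / 2\<close>. The ball of radius \<open>\<rho>\<close> is
    therefore mapped into itself, and on it \<open>f\<close> contracts with constant
    \<open>\<rho>\<close>.\<close>
  define \<rho> where "\<rho> = 1 - sqrt (1 - q)"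
  have \<rho>: "0 \<le> \<rho>" "\<rho> < 1" "(q + \<rho> * \<rho>) / 2 = \<rho>"
  proof -
    have "sqrt (1 - q) * sqrt (1 - q) = 1 - q" "sqrt (1 - q) \<le> 1" "sqrt (1 - q) > 0"
      using q by auto
    then show "0 \<le> \<rho>" "\<rho> < 1" "(q + \<rho> * \<rho>) / 2 = \<rho>"
      by (auto simp: \<rho>_def field_simps)
  qed
  \<comment> \<open>The third set asks \<open>Y\<close> to commute with everything that commutes
    with \<open>T\<close>. It is closed and kept by the iteration, so the fixed point inherits it;
    uniqueness of the inverse square root rests on this.\<close>
  define s where "s = cball 0 \<rho> \<inter> {Y. self_adjoint_op Y} \<inter>
    {Y::'h \<Rightarrow>\<^sub>L 'h. \<forall>U. (\<forall>x. T (blinfun_apply U x) = U (T x)) \<longrightarrow> (\<forall>x. Y (blinfun_apply U x) = U (Y x))}"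
  define f where "f Y = (1/2) *\<^sub>R (T + (Y o\<^sub>L Y))" for Y
  have cl: "closed {Y::'h \<Rightarrow>\<^sub>L 'h. self_adjoint_op Y}"
    unfolding self_adjoint_op_def by (intro closed_Collect_all closed_Collect_eq continuous_intros)
  have cl2: "closed {Y::'h \<Rightarrow>\<^sub>L 'h. \<forall>U. (\<forall>x. T (blinfun_apply U x) = U (T x)) \<longrightarrow> (\<forall>x. Y (blinfun_apply U x) = U (Y x))}"
  proof -
    have "closed {Y::'h \<Rightarrow>\<^sub>L 'h. (\<forall>x. T (blinfun_apply U x) = U (T x)) \<longrightarrow> (\<forall>x. Y (blinfun_apply U x) = U (Y x))}" for U
    proof (cases "\<forall>x. T (blinfun_apply U x) = U (T x)")
      case True
      then show ?thesis
        by simp (intro closed_Collect_all closed_Collect_eq continuous_intros)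
    next
      case False
      then have "{Y::'h \<Rightarrow>\<^sub>L 'h. (\<forall>x. T (blinfun_apply U x) = U (T x)) \<longrightarrow> (\<forall>x. Y (blinfun_apply U x) = U (Y x))} = UNIV"
        by blast
      then show ?thesis by (simp only: closed_UNIV)
    qed
    then show ?thesis by (intro closed_Collect_all)
  qed
  have "Topological_Spaces.complete s" unfolding s_def complete_eq_closed
    by (intro closed_Int cl cl2 closed_cball)
  moreover have "0 \<in> s" using \<rho> by (auto simp: s_def self_adjoint_op_def)
  moreover have "f Y \<in> s" if "Y \<in> s" for Y
  proof -
    have Y: "norm Y \<le> \<rho>" "self_adjoint_op Y" using that by (simp_all add: s_def)
    have YU: "\<forall>U. (\<forall>x. T (blinfun_apply U x) = U (T x)) \<longrightarrow> (\<forall>x. Y (blinfun_apply U x) = U (Y x))"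
      using that unfolding s_def by blast
    have "norm (f Y) \<le> (norm T + norm (Y o\<^sub>L Y)) / 2"
      unfolding f_def using norm_triangle_ineq[of T "Y o\<^sub>L Y"] by simp
    also have "\<dots> \<le> (q + \<rho> * \<rho>) / 2"
      using T norm_blinfun_compose[of Y Y] mult_mono[OF Y(1) Y(1)] \<rho> by simp
    finally have "norm (f Y) \<le> \<rho>" using \<rho> by simp
    moreover have "self_adjoint_op (f Y)"
      using T(1) Y(2) by (simp add: self_adjoint_op_def f_def blinfun.bilinear_simps inner_add_left inner_add_right)
    moreover have "f Y (blinfun_apply U x) = U (f Y x)" if "\<forall>x. T (blinfun_apply U x) = U (T x)" for U x
    proof -
      have "Y (blinfun_apply U x) = U (Y x)" for x using YU that by blast
      then show ?thesis using that by (simp add: f_def blinfun.bilinear_simps)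
    qed
    ultimately show ?thesis by (simp add: s_def)
  qed
  moreover have "dist (f Y) (f Z) \<le> \<rho> * dist Y Z" if "Y \<in> s" "Z \<in> s" for Y Z
  proof -
    have n: "norm Y \<le> \<rho>" "norm Z \<le> \<rho>" "0 \<le> \<rho>" using that \<rho> by (auto simp: s_def)
    have "f Y - f Z = (1/2) *\<^sub>R ((Y o\<^sub>L (Y - Z)) + ((Y - Z) o\<^sub>L Z))"
      by (rule blinfun_eqI) (simp add: f_def blinfun.bilinear_simps algebra_simps)
    then have "dist (f Y) (f Z) \<le> (norm (Y o\<^sub>L (Y - Z)) + norm ((Y - Z) o\<^sub>L Z)) / 2"
      using norm_triangle_ineq[of "(Y o\<^sub>L (Y - Z))" "((Y - Z) o\<^sub>L Z)"] by (simp add: dist_norm)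
    also have "\<dots> \<le> (norm Y * norm (Y - Z) + norm (Y - Z) * norm Z) / 2"
      using norm_blinfun_compose[of Y "Y - Z"] norm_blinfun_compose[of "Y - Z" Z] by simp
    also have "\<dots> \<le> (\<rho> * norm (Y - Z) + norm (Y - Z) * \<rho>) / 2"
      using n by (intro divide_right_mono add_mono mult_mono) auto
    finally show ?thesis by (simp add: dist_norm)
  qed
  ultimately have "\<exists>!Y\<in>s. f Y = Y"
    using \<rho> by (intro Banach_fix) auto
  then obtain Y where Y: "Y \<in> s" "f Y = Y" by blast
  show ?thesis
  proof (rule that[of Y])
    show "self_adjoint_op Y" "norm Y < 1" using Y \<rho> by (auto simp: s_def)
    show "Y (Y x) - 2 *\<^sub>R Y x + T x = 0" for x
    proof -
      have "2 *\<^sub>R Y x = 2 *\<^sub>R f Y x" using Y by simp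
      also have "\<dots> = T x + Y (Y x)" by (simp add: f_def blinfun.bilinear_simps)
      finally show ?thesis by simp
    qed
    show "Y (blinfun_apply U x) = U (Y x)" if "\<And>x. T (blinfun_apply U x) = U (T x)" for U x
    proof -
      have "\<forall>U. (\<forall>x. T (blinfun_apply U x) = U (T x)) \<longrightarrow> (\<forall>x. Y (blinfun_apply U x) = U (Y x))"
        using Y(1) unfolding s_def by blast
      with that show ?thesis by blast
    qed
  qed
qed

text \<open>The map sending \<open>Z\<close> to \<open>Id + Y Z\<close> contracts with constant
  \<open>norm Y\<close>, and its fixed point is a right inverse of \<open>Id - Y\<close>.
  Injectivity of \<open>Id - Y\<close> makes it two-sided.\<close>

lemma neumann_inverse_ex:
  fixes Y :: "'h::banach \<Rightarrow>\<^sub>L 'h"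
  assumes "norm Y < 1"
  obtains Z :: "'h \<Rightarrow>\<^sub>L 'h" where "\<And>x. Z (x - Y x) = x" "\<And>x. Z x - Y (Z x) = x"
proof -
  have "\<exists>!Z\<in>UNIV. id_blinfun + (Y o\<^sub>L Z) = Z"
  proof (rule Banach_fix[where c = "norm Y"])
    show "dist (id_blinfun + (Y o\<^sub>L Z)) (id_blinfun + (Y o\<^sub>L Z')) \<le> norm Y * dist Z Z'" for Z Z'
    proof -
      have "(id_blinfun + (Y o\<^sub>L Z)) - (id_blinfun + (Y o\<^sub>L Z')) = (Y o\<^sub>L (Z - Z'))"
        by (simp add: bounded_bilinear.diff_right[OF bounded_bilinear_blinfun_compose])
      then show ?thesis using norm_blinfun_compose[of Y "Z - Z'"] by (simp add: dist_norm)
    qed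
  qed (use assms complete_UNIV in auto)
  then obtain Z where Z: "id_blinfun + (Y o\<^sub>L Z) = Z" by blast
  have r: "Z x - Y (Z x) = x" for x
  proof -
    have "Z x = (id_blinfun + (Y o\<^sub>L Z)) x" by (simp only: Z)
    also have "\<dots> = x + Y (Z x)" by (simp add: blinfun.add_left)
    finally show ?thesis by (metis add_diff_cancel_right')
  qed
  have inj: "x = 0" if "x - Y x = 0" for x
  proof (rule ccontr)
    assume "x \<noteq> 0"
    from that have "norm x = norm (Y x)" by simp
    also have "\<dots> \<le> norm Y * norm x" by (rule norm_blinfun)
    also have "\<dots> < norm x" using assms \<open>x \<noteq> 0\<close> by simp
    finally show False by simp
  qed
  have "Z (x - Y x) = x" for x
    using r[of "x - Y x"] inj[of "Z (x - Y x) - x"] by (simp add: blinfun.bilinear_simps algebra_simps)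
  with r that show ?thesis by blast
qed

definition is_inv_sqrt :: "'h::real_inner \<Rightarrow>\<^sub>L 'h \<Rightarrow> 'h \<Rightarrow>\<^sub>L 'h \<Rightarrow> bool" where
  "is_inv_sqrt A S \<longleftrightarrow> pd_op S \<and> (\<forall>x. S (S (A x)) = x) \<and> (\<forall>x. A (S (S x)) = x)"

text \<open>Scaled to \<open>T = Id - A / K\<close>, the operator has norm at most
  \<open>q < 1\<close>, so \<open>A / K\<close> is the square of \<open>Id - Y\<close>, and the
  Neumann inverse of \<open>Id - Y\<close>, rescaled, is an inverse root \<open>S\<close>. Another
  one, \<open>S'\<close>, commutes with \<open>A\<close>, hence with \<open>Y\<close> and with
  \<open>S\<close>; both squares invert \<open>A\<close>, so \<open>S + S'\<close> kills every
  \<open>S' x - S x\<close>, and positive definiteness forces these differences to vanish.\<close>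

lemma is_inv_sqrt_ex1:
  fixes A :: "'h::{real_inner,banach} \<Rightarrow>\<^sub>L 'h"
  assumes A: "self_adjoint_op A" and c: "c > 0" "\<And>x. c * (norm x)\<^sup>2 \<le> inner (A x) x"
  shows "\<exists>!S. is_inv_sqrt A S"
proof -
  \<comment> \<open>Adding \<open>c\<close> keeps \<open>K\<close> positive and \<open>q\<close>
    nonnegative also on the trivial space, where \<open>c\<close> is not bounded by
    \<open>norm A\<close>.\<close>
  define K where "K = norm A + c"
  have K: "K > 0" "norm A \<le> K" "c \<le> K" using c by (auto simp: K_def add_nonneg_pos)
  define T where "T = id_blinfun - (1 / K) *\<^sub>R A"
  have Tx: "T x = x - (1 / K) *\<^sub>R A x" for x by (simp add: T_def blinfun.bilinear_simps)
  have saA: "inner (A x) y = inner x (A y)" for x y using A by (auto simp: self_adjoint_op_def)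
  have saT: "self_adjoint_op T"
    using saA by (simp add: self_adjoint_op_def Tx inner_diff_left inner_diff_right)
  have Tq: "inner (T x) x = (norm x)\<^sup>2 - inner (A x) x / K" for x
    by (simp add: Tx inner_diff_left power2_norm_eq_inner)
  have Aup: "inner (A x) x \<le> K * (norm x)\<^sup>2" for x
  proof -
    have "inner (A x) x \<le> norm (A x) * norm x" by (rule norm_cauchy_schwarz)
    also have "\<dots> \<le> (norm A * norm x) * norm x" by (intro mult_right_mono norm_blinfun) auto
    also have "\<dots> \<le> (K * norm x) * norm x" using K by (intro mult_right_mono) auto
    finally show ?thesis by (simp add: power2_eq_square mult_ac)
  qed
  have psdT: "psd_op T"
    using saT Aup K by (auto simp: psd_op_def Tq field_simps)
  define q where "q = 1 - c / K"
  have q: "0 \<le> q" "q < 1" using K c by (auto simp: q_def)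
  have "inner (T x) x \<le> q * (norm x)\<^sup>2" for x
    using c(2)[of x] K by (simp add: Tq q_def field_simps)
  then have "norm (T x) \<le> q * norm x" for x
    using psd_op_norm_apply_le[OF psdT] q by blast
  then have nT: "norm T \<le> q" using q by (intro norm_blinfun_bound) auto
  obtain Y where Y: "self_adjoint_op Y" "norm Y < 1" "\<And>x. Y (Y x) - 2 *\<^sub>R Y x + T x = 0"
    "\<And>U x. (\<And>x. T (blinfun_apply U x) = U (T x)) \<Longrightarrow> Y (blinfun_apply U x) = U (Y x)"
    using contraction_sqrt_ex[OF saT nT q] by metis
  obtain Z :: "'h \<Rightarrow>\<^sub>L 'h" where Z: "\<And>x. Z (x - Y x) = x" "\<And>x. Z x - Y (Z x) = x"
    using neumann_inverse_ex[OF Y(2)] by metis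
  have saY: "inner (Y x) y = inner x (Y y)" for x y using Y(1) by (auto simp: self_adjoint_op_def)
  have QQ: "(x - Y x) - Y (x - Y x) = (1 / K) *\<^sub>R A x" for x
  proof -
    have "T x = 2 *\<^sub>R Y x - Y (Y x)" using Y(3)[of x] by (simp add: algebra_simps)
    then have "x - (1 / K) *\<^sub>R A x = 2 *\<^sub>R Y x - Y (Y x)" by (simp add: Tx)
    then have "(1 / K) *\<^sub>R A x = x - (2 *\<^sub>R Y x - Y (Y x))" by (metis diff_diff_eq2 add_diff_cancel_left' diff_add_cancel)
    then show ?thesis by (simp add: blinfun.bilinear_simps scaleR_2)
  qed
  define S where "S = (1 / sqrt K) *\<^sub>R Z"
  have sK: "sqrt K * sqrt K = K" "sqrt K > 0" using K by auto
  have SS: "S (S x) = (1 / K) *\<^sub>R Z (Z x)" for x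
    using sK by (simp add: S_def blinfun.bilinear_simps)
  have S1: "S (S (A x)) = x" for x
  proof -
    have "A x = K *\<^sub>R ((x - Y x) - Y (x - Y x))" using QQ[of x] K by simp
    then show ?thesis using K Z(1) by (simp only: SS blinfun.scaleR_right) simp
  qed
  have S2: "A (S (S x)) = x" for x
  proof -
    have "A (Z (Z x)) = K *\<^sub>R x" using arg_cong[OF QQ[of "Z (Z x)"], of "\<lambda>u. K *\<^sub>R u"] K Z(2) by simp
    then show ?thesis using K by (simp add: SS blinfun.scaleR_right)
  qed
  have saZ: "inner (Z x) y = inner x (Z y)" for x y
  proof -
    have "inner (Z x) y = inner (Z x) (Z y - Y (Z y))" by (simp add: Z)
    also have "\<dots> = inner (Z x - Y (Z x)) (Z y)" by (simp add: inner_diff_left inner_diff_right saY)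
    finally show ?thesis by (simp add: Z)
  qed
  have pdS: "pd_op S"
    unfolding pd_op_def
  proof safe
    show "self_adjoint_op S" by (simp add: self_adjoint_op_def S_def blinfun.bilinear_simps saZ)
    show "inner (S x) x > 0" if "x \<noteq> 0" for x
    proof -
      have z: "Z x \<noteq> 0" using that Z(2)[of x] by auto
      have "inner (Y (Z x)) (Z x) \<le> norm (Y (Z x)) * norm (Z x)" by (rule norm_cauchy_schwarz)
      also have "\<dots> \<le> (norm Y * norm (Z x)) * norm (Z x)" by (intro mult_right_mono norm_blinfun) auto
      also have "\<dots> < 1 * (norm (Z x) * norm (Z x))"
        unfolding mult.assoc using Y(2) z by (intro mult_strict_right_mono) auto
      finally have "inner (Z x) (Z x - Y (Z x)) > 0"
        by (simp add: inner_diff_right inner_commute power2_norm_eq_inner power2_eq_square[symmetric])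
      then show ?thesis using Z(2) sK by (simp add: S_def blinfun.bilinear_simps)
    qed
  qed
  have un: "S' = S" if S': "is_inv_sqrt A S'" for S'
  proof -
    have s1: "S' (S' (A x)) = x" and s2: "A (S' (S' x)) = x" and sa': "inner (S' x) y = inner x (S' y)"
      and p': "x \<noteq> 0 \<Longrightarrow> inner (S' x) x > 0" for x y
      using S' by (auto simp: is_inv_sqrt_def pd_op_def self_adjoint_op_def)
    have comA: "A (S' x) = S' (A x)" for x
    proof -
      have "A (S' x) = A (S' (S' (S' (A x))))" using s1 by simp
      also have "\<dots> = S' (A x)" using s2 by simp
      finally show ?thesis .
    qed
    have "Y (blinfun_apply S' x) = S' (Y x)" for x
      by (rule Y(4)) (simp add: Tx comA blinfun.bilinear_simps)
    then have comZ: "Z (S' x) = S' (Z x)" for x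
      by (metis Z blinfun.diff_right)
    then have comS: "S (S' x) = S' (S x)" for x
      by (simp add: S_def blinfun.bilinear_simps)
    have sq: "S (S x) = S' (S' x)" for x
      by (metis S1 s2)
    have saS: "inner (S x) y = inner x (S y)" and pS: "x \<noteq> 0 \<Longrightarrow> inner (S x) x > 0" for x y
      using pdS by (auto simp: pd_op_def self_adjoint_op_def)
    show ?thesis
    proof (rule blinfun_eqI)
      fix x
      let ?d = "S' x - S x"
      have "S ?d + S' ?d = 0"
        by (simp add: blinfun.bilinear_simps comS sq)
      then have "inner (S ?d) ?d + inner (S' ?d) ?d = 0"
        by (metis inner_add_left inner_zero_left)
      then have "?d = 0" using p'[of ?d] pS[of ?d] by force
      then show "S' x = S x" by simp
    qed
  qed
  show ?thesis
    by (rule ex1I[of _ S]) (use un S1 S2 pdS in \<open>auto simp: is_inv_sqrt_def\<close>)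
qed

lemma inv_sqrt_op_eq: "inv_sqrt_op A = (THE S. is_inv_sqrt A S)"
  by (simp add: inv_sqrt_op_def is_inv_sqrt_def)

lemma is_inv_sqrt_inv_sqrt_op:
  fixes A :: "'h::{real_inner,banach} \<Rightarrow>\<^sub>L 'h"
  assumes "self_adjoint_op A" "c > 0" "\<And>x. c * (norm x)\<^sup>2 \<le> inner (A x) x"
  shows "is_inv_sqrt A (inv_sqrt_op A)"
  unfolding inv_sqrt_op_eq by (rule theI'[OF is_inv_sqrt_ex1[OF assms]])

lemma is_inv_sqrt_norm_sq:
  assumes "is_inv_sqrt A S"
  shows "(norm (S y))\<^sup>2 = inner (S (S y)) y"
  using assms by (simp add: is_inv_sqrt_def pd_op_def self_adjoint_op_def power2_norm_eq_inner)

text \<open>\<open>S (S y)\<close> solves \<open>A w = y\<close>, and coercivity of \<open>A\<close>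
  bounds this solution.\<close>

lemma is_inv_sqrt_norm_le:
  assumes S: "is_inv_sqrt A S" and c: "c > 0" "\<And>x. c * (norm x)\<^sup>2 \<le> inner (A x) x"
  shows "norm (S (S y)) \<le> norm y / c"
proof (cases "S (S y) = 0")
  case False
  have "c * (norm (S (S y)))\<^sup>2 \<le> inner (A (S (S y))) (S (S y))" by (rule c)
  also have "\<dots> = inner y (S (S y))" using S by (simp add: is_inv_sqrt_def)
  also have "\<dots> \<le> norm y * norm (S (S y))" by (rule norm_cauchy_schwarz)
  finally show ?thesis using False c by (simp add: field_simps power2_eq_square)
qed (use c in auto)

text \<open>The squared norm of \<open>S y\<close> is the quadratic form of the inverse of
  \<open>A\<close> at \<open>y\<close>, hence the maximum of a concave functional of
  \<open>x\<close> in which no inverse occurs, attained at \<open>S (S y)\<close>. For a random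
  operator this yields measurability.\<close>

lemma is_inv_sqrt_variational:
  assumes S: "is_inv_sqrt A S" and A: "psd_op A"
  shows "2 * inner x y - inner (A x) x \<le> (norm (S y))\<^sup>2"
    and "2 * inner (S (S y)) y - inner (A (S (S y))) (S (S y)) = (norm (S y))\<^sup>2"
proof -
  let ?w = "S (S y)"
  have Aw: "A ?w = y" using S by (simp add: is_inv_sqrt_def)
  have sa: "inner (A u) w = inner u (A w)" and nn: "inner (A u) u \<ge> 0" for u w
    using A by (auto simp: psd_op_def self_adjoint_op_def)
  show "2 * inner ?w y - inner (A ?w) ?w = (norm (S y))\<^sup>2"
    by (simp add: is_inv_sqrt_norm_sq[OF S] Aw inner_commute)
  have "inner (A (x - ?w)) (x - ?w) = inner (A x) x - 2 * inner x y + inner ?w y"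
    using sa[of ?w x] by (simp add: blinfun.bilinear_simps inner_diff_left inner_diff_right Aw inner_commute)
  with nn[of "x - ?w"] show "2 * inner x y - inner (A x) x \<le> (norm (S y))\<^sup>2"
    by (simp add: is_inv_sqrt_norm_sq[OF S])
qed

lemma abs_diff_le_sqrt:
  fixes a b :: real
  assumes "a \<ge> 0" "b \<ge> 0" "\<bar>a\<^sup>2 - b\<^sup>2\<bar> \<le> c"
  shows "\<bar>a - b\<bar> \<le> sqrt c"
proof (rule real_le_rsqrt)
  have "\<bar>a - b\<bar>\<^sup>2 \<le> \<bar>a - b\<bar> * (a + b)"
    unfolding power2_eq_square using assms by (intro mult_left_mono) auto
  also have "\<dots> = \<bar>(a - b) * (a + b)\<bar>" using assms by (simp add: abs_mult)
  also have "(a - b) * (a + b) = a\<^sup>2 - b\<^sup>2" by (simp add: power2_eq_square algebra_simps)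
  finally show "\<bar>a - b\<bar>\<^sup>2 \<le> c" using assms by linarith
qed

text \<open>The squared norms are the quadratic forms of the two inverses, whose difference factors
  as inverse of \<open>A\<close> times \<open>A' - A\<close> times inverse of \<open>A'\<close> and
  is thus of order \<open>norm (A - A') / c^2\<close>. Returning from squares to norms costs the
  square root.\<close>

lemma is_inv_sqrt_perturb:
  assumes S: "is_inv_sqrt A S" "is_inv_sqrt A' S'" and A: "self_adjoint_op A'"
    and c: "c > 0" "\<And>x. c * (norm x)\<^sup>2 \<le> inner (A x) x" "\<And>x. c * (norm x)\<^sup>2 \<le> inner (A' x) x"
  shows "\<bar>norm (S y) - norm (S' y)\<bar> \<le> sqrt (norm (A - A')) / c * norm y"
proof -
  let ?w = "S (S y)" and ?w' = "S' (S' y)"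
  have Aw: "A ?w = y" "A' ?w' = y" using S by (auto simp: is_inv_sqrt_def)
  have sa: "inner (A' u) w = inner u (A' w)" for u w
    using A by (auto simp: self_adjoint_op_def)
  have "(norm (S y))\<^sup>2 - (norm (S' y))\<^sup>2 = inner ?w (A' ?w') - inner (A ?w) ?w'"
    by (simp add: is_inv_sqrt_norm_sq[OF S(1)] is_inv_sqrt_norm_sq[OF S(2)] Aw inner_commute)
  also have "\<dots> = - inner ((A - A') ?w) ?w'"
    by (simp add: sa[symmetric] blinfun.bilinear_simps inner_diff_left)
  finally have "\<bar>(norm (S y))\<^sup>2 - (norm (S' y))\<^sup>2\<bar> = \<bar>inner ((A - A') ?w) ?w'\<bar>" by simp
  also have "\<dots> \<le> norm ((A - A') ?w) * norm ?w'" by (rule Cauchy_Schwarz_ineq2)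
  also have "\<dots> \<le> (norm (A - A') * (norm y / c)) * (norm y / c)"
    using is_inv_sqrt_norm_le[OF S(1) c(1,2), of y] is_inv_sqrt_norm_le[OF S(2) c(1,3), of y] c
    by (intro mult_mono order.trans[OF norm_blinfun[of "A - A'"]] mult_left_mono) auto
  also have "\<dots> = norm (A - A') * (norm y / c)\<^sup>2" by (simp add: power2_eq_square)
  finally have "\<bar>norm (S y) - norm (S' y)\<bar> \<le> sqrt (norm (A - A') * (norm y / c)\<^sup>2)"
    by (intro abs_diff_le_sqrt) auto
  also have "\<dots> = sqrt (norm (A - A')) / c * norm y"
    using c by (simp add: real_sqrt_mult)
  finally show ?thesis .
qed

section \<open>Spectral expansions and largest eigenvalues\<close>

locale orthonormal_basis =
  fixes v :: "nat \<Rightarrow> 'h::real_inner"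
  assumes orthonormal: "\<And>p q. inner (v p) (v q) = (if p = q then 1 else 0)"
    and complete: "closure (span (range v)) = UNIV"
begin

lemma norm_v [simp]: "norm (v p) = 1"
  using orthonormal[of p p] by (simp add: norm_eq_sqrt_inner)

definition proj :: "nat \<Rightarrow> 'h \<Rightarrow> 'h" where
  "proj n x = (\<Sum>p<n. inner (v p) x *\<^sub>R v p)"

lemma proj_add: "proj n (x + y) = proj n x + proj n y"
  by (simp add: proj_def inner_add_right scaleR_add_left sum.distrib)

lemma proj_diff: "proj n (x - y) = proj n x - proj n y"
  by (simp add: proj_def inner_diff_right scaleR_diff_left sum_subtractf)

lemma proj_scaleR: "proj n (c *\<^sub>R x) = c *\<^sub>R proj n x"
  by (simp add: proj_def scaleR_sum_right)

lemma inner_proj: "inner (proj n x) y = (\<Sum>p<n. inner (v p) x * inner (v p) y)"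
  by (simp add: proj_def inner_sum_left)

lemma norm_proj_sq: "(norm (proj n x))\<^sup>2 = (\<Sum>p<n. (inner (v p) x)\<^sup>2)"
proof -
  have "inner (v p) (proj n x) = inner (v p) x" if "p < n" for p
    using that by (simp add: proj_def inner_sum_right orthonormal if_distrib cong: if_cong)
  then have "inner (proj n x) (proj n x) = (\<Sum>p<n. (inner (v p) x)\<^sup>2)"
    by (simp add: inner_proj power2_eq_square)
  then show ?thesis by (simp only: power2_norm_eq_inner)
qed

lemma norm_diff_proj_sq: "(norm (x - proj n x))\<^sup>2 = (norm x)\<^sup>2 - (\<Sum>p<n. (inner (v p) x)\<^sup>2)"
proof -
  have "(norm (x - proj n x))\<^sup>2 = (norm x)\<^sup>2 - 2 * inner (proj n x) x + (norm (proj n x))\<^sup>2"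
    by (simp add: power2_norm_eq_inner inner_diff_left inner_diff_right inner_commute)
  moreover have "inner (proj n x) x = (\<Sum>p<n. (inner (v p) x)\<^sup>2)"
    by (simp add: inner_proj power2_eq_square)
  ultimately show ?thesis by (simp add: norm_proj_sq)
qed

lemma norm_diff_proj_le: "norm (x - proj n x) \<le> norm x"
  by (rule power2_le_imp_le) (auto simp: norm_diff_proj_sq intro!: sum_nonneg)

lemma proj_v: "q < n \<Longrightarrow> proj n (v q) = v q"
proof -
  assume "q < n"
  have "proj n (v q) = (\<Sum>p<n. if p = q then v q else 0)"
    unfolding proj_def by (intro sum.cong) (auto simp: orthonormal)
  with \<open>q < n\<close> show ?thesis by simp
qed

text \<open>Completeness gives only density of finite combinations. On such a combination the
  projections are eventually the identity, and \<open>x - proj n x\<close> is never longer than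
  \<open>x\<close>, so the approximation error is not enlarged.\<close>

lemma proj_tendsto: "(\<lambda>n. proj n x) \<longlonglongrightarrow> x"
proof (rule LIMSEQ_I)
  fix e :: real assume "e > 0"
  have "x \<in> closure (span (range v))" using complete by simp
  with \<open>e > 0\<close> obtain y where y: "y \<in> span (range v)" "dist y x < e"
    by (meson closure_approachable)
  from y(1) have "\<exists>N. \<forall>n\<ge>N. proj n y = y"
  proof (induction rule: span_induct_alt)
    case base
    show ?case by (simp add: proj_def)
  next
    case (step c a y)
    then obtain q N where "a = v q" "\<forall>n\<ge>N. proj n y = y" by auto
    then have "\<forall>n\<ge>max N (Suc q). proj n (c *\<^sub>R a + y) = c *\<^sub>R a + y"
      by (auto simp: proj_add proj_scaleR proj_v)
    then show ?case by blast
  qed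
  then obtain N where N: "\<And>n. n \<ge> N \<Longrightarrow> proj n y = y" by blast
  have "norm (proj n x - x) < e" if "n \<ge> N" for n
  proof -
    have "x - proj n x = (x - y) - proj n (x - y)" using N[OF that] by (simp add: proj_diff)
    then have "norm (x - proj n x) \<le> norm (x - y)" by (metis norm_diff_proj_le)
    with y(2) show ?thesis by (simp add: dist_norm norm_minus_commute)
  qed
  then show "\<exists>no. \<forall>n\<ge>no. norm (proj n x - x) < e" by blast
qed

lemma expansion_sums: "(\<lambda>p. inner (v p) x *\<^sub>R v p) sums x"
  using proj_tendsto[of x] by (simp add: sums_def proj_def)

lemma inner_sums: "(\<lambda>p. inner (v p) x * inner (v p) y) sums inner x y"
  using bounded_linear.sums[OF bounded_linear_inner_left expansion_sums[of x], of y] by simp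

lemma norm_sq_sums: "(\<lambda>p. (inner (v p) x)\<^sup>2) sums (norm x)\<^sup>2"
  using inner_sums[of x x] by (simp only: power2_norm_eq_inner power2_eq_square[of "inner _ x"])

end

locale spectral_expansion = orthonormal_basis v for v :: "nat \<Rightarrow> 'h::real_inner" +
  fixes C :: "'h \<Rightarrow>\<^sub>L 'h" and lam :: "nat \<Rightarrow> real"
  assumes spectral: "\<And>x. (\<lambda>p. (lam p * inner (v p) x) *\<^sub>R v p) sums (C x)"
begin

lemma inner_C_sums: "(\<lambda>p. lam p * inner (v p) x * inner (v p) y) sums inner (C x) y"
  using bounded_linear.sums[OF bounded_linear_inner_left spectral[of x], of y] by simp

lemma C_v: "C (v p) = lam p *\<^sub>R v p"
proof -
  have "(\<lambda>q. (lam q * inner (v q) (v p)) *\<^sub>R v q) = (\<lambda>q. if q = p then lam q *\<^sub>R v q else 0)"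
    by (auto simp: orthonormal)
  with spectral[of "v p"] sums_single[of p "\<lambda>q. lam q *\<^sub>R v q"] show ?thesis
    using sums_unique2 by metis
qed

lemma inner_C_v: "inner (C (v p)) (v q) = (if p = q then lam p else 0)"
  by (simp add: C_v orthonormal)

end

text \<open>Separate from \<open>spectral_expansion\<close> because nonnegativity of
  \<open>lam\<close> has to be derived from the Brownian motion with covariance \<open>C\<close>,
  and that derivation already uses the expansion.\<close>

locale spectral_op = spectral_expansion v C lam for v :: "nat \<Rightarrow> 'h::real_inner" and C lam +
  assumes lam_nonneg: "\<And>p. lam p \<ge> 0" and lam_Suc_le: "\<And>p. lam (Suc p) \<le> lam p"
begin

lemma lam_antimono: "p \<le> q \<Longrightarrow> lam q \<le> lam p"
  using lam_Suc_le by (rule lift_Suc_antimono_le)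

lemma psd_C: "psd_op C"
proof -
  have "inner (C x) y = inner x (C y)" for x y
  proof -
    have "(\<lambda>p. lam p * inner (v p) x * inner (v p) y) sums inner x (C y)"
      using inner_C_sums[of y x] unfolding inner_commute[of "C y" x]
      by (simp add: mult.assoc mult.commute[of "inner (v _) y"])
    with inner_C_sums[of x y] show ?thesis by (rule sums_unique2)
  qed
  moreover have "inner (C x) x \<ge> 0" for x
    by (rule sums_le[OF _ sums_zero inner_C_sums[of x x]])
      (simp add: mult.assoc lam_nonneg)
  ultimately show ?thesis by (simp add: psd_op_def self_adjoint_op_def)
qed

text \<open>\<open>lam P\<close> dominates all later eigenvalues. When it is small, the form of
  \<open>C\<close> is a finite sum of squared coordinates up to a small multiple of the squared
  norm; compactness of \<open>C\<close> enters in this shape.\<close>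

lemma quadratic_form_le:
  "inner (C x) x \<le> (\<Sum>p<P. lam p * (inner (v p) x)\<^sup>2) + lam P * (norm x)\<^sup>2"
proof -
  have "(\<lambda>p. (if p < P then lam p * (inner (v p) x)\<^sup>2 else 0) + lam P * (inner (v p) x)\<^sup>2)
      sums ((\<Sum>p<P. lam p * (inner (v p) x)\<^sup>2) + lam P * (norm x)\<^sup>2)"
    using sums_If_finite[of "\<lambda>p. p < P" "\<lambda>p. lam p * (inner (v p) x)\<^sup>2"]
    by (intro sums_add sums_mult norm_sq_sums) (simp add: lessThan_def)
  note * = this
  have "lam p * inner (v p) x * inner (v p) x \<le>
      (if p < P then lam p * (inner (v p) x)\<^sup>2 else 0) + lam P * (inner (v p) x)\<^sup>2" for p
  proof -
    have "lam p \<le> (if p < P then lam p else 0) + lam P"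
      using lam_nonneg lam_antimono[of P p] by (auto simp: not_less)
    from mult_right_mono[OF this, of "(inner (v p) x)\<^sup>2"] show ?thesis
      by (simp add: power2_eq_square algebra_simps split: if_splits)
  qed
  from sums_le[OF this inner_C_sums[of x x] *] show ?thesis .
qed

lemma quadratic_form_le_lam0: "inner (C x) x \<le> lam 0 * (norm x)\<^sup>2"
  using quadratic_form_le[of x 0] by simp

lemma lam0_pos: "C \<noteq> 0 \<Longrightarrow> lam 0 > 0"
proof (rule ccontr)
  assume "C \<noteq> 0" "\<not> lam 0 > 0"
  then have "lam p = 0" for p using lam_antimono[of 0 p] lam_nonneg[of p] by simp
  then have "(\<lambda>p. 0) sums C x" for x using spectral[of x] by simp
  then have "C x = 0" for x using sums_unique2[OF sums_zero] by metis
  with \<open>C \<noteq> 0\<close> show False by (metis blinfun_eqI zero_blinfun.rep_eq)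
qed

end

lemma bounded_finite_family_subseq:
  fixes f :: "nat \<Rightarrow> nat \<Rightarrow> real"
  assumes "\<And>p n. \<bar>f p n\<bar> \<le> B"
  shows "\<exists>r::nat \<Rightarrow> nat. strict_mono r \<and> (\<forall>p<P. convergent (\<lambda>n. f p (r n)))"
proof (induction P)
  case 0
  then show ?case by (auto intro: strict_mono_id[unfolded id_def])
next
  case (Suc P)
  then obtain r where r: "strict_mono r" "\<And>p. p < P \<Longrightarrow> convergent (\<lambda>n. f p (r n))" by blast
  have "bounded (range (\<lambda>n. f P (r n)))" using assms by (auto simp: bounded_iff)
  from bounded_imp_convergent_subsequence[OF this] obtain l r'
    where r': "strict_mono r'" "((\<lambda>n. f P (r n)) \<circ> r') \<longlonglongrightarrow> l" by blast
  have "convergent (\<lambda>n. f p ((r \<circ> r') n))" if "p < Suc P" for p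
  proof (cases "p = P")
    case True
    then show ?thesis using r'(2) by (auto simp: o_def convergent_def)
  next
    case False
    with that r(2)[of p] obtain l where "(\<lambda>n. f p (r n)) \<longlonglongrightarrow> l" by (auto simp: convergent_def)
    from LIMSEQ_subseq_LIMSEQ[OF this r'(1)] show ?thesis by (auto simp: o_def convergent_def)
  qed
  with strict_mono_o[OF r(1) r'(1)] show ?case by blast
qed

lemma largest_eigenvalueI:
  "is_largest_eigenvalue A l \<Longrightarrow> largest_eigenvalue A = l"
  unfolding largest_eigenvalue_def
  by (rule the_equality) (auto simp: is_largest_eigenvalue_def intro: antisym)

lemma largest_eigenvalue_is_largest:
  "\<exists>l. is_largest_eigenvalue A l \<Longrightarrow> is_largest_eigenvalue A (largest_eigenvalue A)"
  using largest_eigenvalueI by metis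

lemma psd_eigenvalue_nonneg:
  assumes "psd_op A" "x \<noteq> 0" "A x = l *\<^sub>R x"
  shows "l \<ge> 0"
proof -
  have "inner (A x) x \<ge> 0" using assms(1) by (auto simp: psd_op_def)
  then have "0 \<le> l * inner x x" by (simp add: assms(3))
  moreover have "inner x x > 0" using assms by simp
  ultimately show ?thesis by (meson mult_neg_pos not_less)
qed

context spectral_op
begin

text \<open>Compactness of \<open>C\<close> forces the top of the spectrum of a nearby operator to be attained.\<close>
lemma perturbed_eigenvalue_ex:
  fixes A :: "'h \<Rightarrow>\<^sub>L 'h"
  assumes "Topological_Spaces.complete (UNIV :: 'h set)"
  assumes A: "psd_op A" "norm (A - C) \<le> \<delta>" and \<delta>: "2 * \<delta> < lam 0" and lam: "lam \<longlonglongrightarrow> 0"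
  obtains l x where "l \<ge> lam 0 - \<delta>" "x \<noteq> 0" "A x = l *\<^sub>R x"
proof -
  have sa: "inner (A x) y = inner x (A y)" for x y
    using A(1) by (auto simp: psd_op_def self_adjoint_op_def)
  have close: "\<bar>inner (A x) x - inner (C x) x\<bar> \<le> \<delta> * (norm x)\<^sup>2" for x
  proof -
    have "\<bar>inner ((A - C) x) x\<bar> \<le> norm ((A - C) x) * norm x" by (rule Cauchy_Schwarz_ineq2)
    also have "\<dots> \<le> (norm (A - C) * norm x) * norm x" by (intro mult_right_mono norm_blinfun) auto
    also have "\<dots> \<le> (\<delta> * norm x) * norm x" using A by (intro mult_right_mono) auto
    finally show ?thesis by (simp add: blinfun.bilinear_simps inner_diff_left power2_eq_square mult_ac)
  qed
  define s where "s = (SUP x\<in>sphere 0 1. inner (A x) x)"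
  have bdd: "bdd_above ((\<lambda>x. inner (A x) x) ` sphere 0 1)"
  proof (rule bdd_aboveI2)
    fix x :: 'h assume "x \<in> sphere 0 1"
    then show "inner (A x) x \<le> lam 0 + \<delta>"
      using close[of x] quadratic_form_le_lam0[of x] by simp
  qed
  have s_unit: "inner (A x) x \<le> s" if "norm x = 1" for x
    unfolding s_def by (rule cSUP_upper[OF _ bdd]) (use that in auto)
  have s_le: "inner (A x) x \<le> s * (norm x)\<^sup>2" for x
  proof (cases "x = 0")
    case False
    have "inner (A (x /\<^sub>R norm x)) (x /\<^sub>R norm x) \<le> s" using False by (intro s_unit) auto
    then have "inner (A x) x / (norm x * norm x) \<le> s"
      by (simp add: blinfun.scaleR_right divide_inverse mult_ac)
    with False show ?thesis by (simp add: divide_le_eq power2_eq_square)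
  qed auto
  have s0: "lam 0 - \<delta> \<le> s"
    using s_unit[of "v 0"] close[of "v 0"] by (simp add: inner_C_v)
  have "\<delta> \<ge> 0" using A(2) norm_ge_zero[of "A - C"] by linarith
  with s0 \<delta> have s: "s > \<delta>" "s > 0" by linarith+
  \<comment> \<open>\<open>D\<close> is positive semidefinite by the choice of \<open>s\<close>, so
    \<open>psd_op_norm_apply_sq_le\<close> turns near-maximality of \<open>x n\<close> into
    \<open>D (x n)\<close> tending to zero.\<close>
  define D where "D = s *\<^sub>R id_blinfun - A"
  have Dx: "D x = s *\<^sub>R x - A x" for x by (simp add: D_def blinfun.bilinear_simps)
  have psdD: "psd_op D"
    using s_le by (auto simp: psd_op_def self_adjoint_op_def Dx inner_diff_left inner_diff_right sa
        power2_norm_eq_inner)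
  have D_le: "inner (D x) x \<le> s * (norm x)\<^sup>2" for x
    using A(1) by (auto simp: Dx inner_diff_left power2_norm_eq_inner psd_op_def)
  have "\<exists>x. norm x = 1 \<and> s - 1 / real (Suc n) < inner (A x) x" for n
  proof -
    have "\<exists>x\<in>sphere 0 1. s - 1 / real (Suc n) < inner (A x) x"
    proof (subst less_cSUP_iff[OF _ bdd, symmetric])
      show "sphere (0::'h) 1 \<noteq> {}" using norm_v[of 0] by (metis empty_iff mem_sphere_0)
      show "s - 1 / real (Suc n) < (SUP x\<in>sphere 0 1. inner (A x) x)"
        unfolding s_def[symmetric] by (simp del: of_nat_Suc)
    qed
    then show ?thesis by auto
  qed
  then obtain x where x: "\<And>n. norm (x n) = 1" "\<And>n. s - 1 / real (Suc n) < inner (A (x n)) (x n)"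
    by metis
  have Dx_le: "(norm (D (x n)))\<^sup>2 \<le> s * (1 / real (Suc n))" for n
  proof -
    have "inner (D (x n)) (x n) \<le> 1 / real (Suc n)"
    proof -
      have "inner (x n) (x n) = 1" using x(1)[of n] by (simp add: norm_eq_sqrt_inner)
      then show ?thesis using x(2)[of n] by (simp add: Dx inner_diff_left del: of_nat_Suc)
    qed
    with psd_op_norm_apply_sq_le[OF psdD D_le, of "x n"] s mult_left_mono[of "inner (D (x n)) (x n)" "1 / real (Suc n)" s]
    show ?thesis by linarith
  qed
  have "(\<lambda>n. s * (1 / real (Suc n))) \<longlonglongrightarrow> s * 0"
    by (intro tendsto_mult tendsto_const LIMSEQ_Suc[OF lim_1_over_n])
  then have Dx_lim: "(\<lambda>n. s * (1 / real (Suc n))) \<longlonglongrightarrow> 0" by (simp only: mult_zero_right)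
  have "(\<lambda>n. (norm (D (x n)))\<^sup>2) \<longlonglongrightarrow> 0"
    by (rule real_tendsto_sandwich[OF _ _ tendsto_const Dx_lim])
      (intro always_eventually allI Dx_le zero_le_power2)+
  then have "(\<lambda>n. sqrt ((norm (D (x n)))\<^sup>2)) \<longlonglongrightarrow> sqrt 0" by (rule tendsto_real_sqrt)
  then have Dx0: "(\<lambda>n. norm (D (x n))) \<longlonglongrightarrow> 0" by simp
  \<comment> \<open>On a difference of near-maximizers the form of \<open>A\<close> is bounded by a
    finite sum plus \<open>\<delta> + lam P\<close> times the squared norm. With
    \<open>lam P < \<kappa>\<close>, the coefficient left over from
    \<open>s = \<delta> + 2 \<kappa>\<close> is again \<open>\<kappa>\<close>.\<close>
  define \<kappa> where "\<kappa> = (s - \<delta>) / 2"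
  have \<kappa>: "\<kappa> > 0" using s by (simp add: \<kappa>_def)
  obtain P where P: "lam P < \<kappa>"
    using order_tendstoD(2)[OF lam \<kappa>] by (auto simp: eventually_sequentially)
  have "\<bar>inner (v p) (x n)\<bar> \<le> 1" for p n
    using Cauchy_Schwarz_ineq2[of "v p" "x n"] by (simp add: x)
  from bounded_finite_family_subseq[of "\<lambda>p n. inner (v p) (x n)", OF this] obtain r u
    where r: "strict_mono (r::nat \<Rightarrow> nat)" and u: "\<And>p. p < P \<Longrightarrow> (\<lambda>n. inner (v p) (x (r n))) \<longlonglongrightarrow> u p"
    unfolding convergent_def by metis
  define y where "y n = x (r n)" for n
  \<comment> \<open>\<open>g n\<close> gathers the vanishing terms that belong to one index; the
    coordinates converge along the subsequence, so \<open>main\<close> makes it a Cauchy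
    sequence.\<close>
  define g where "g n = 2 * norm (D (y n)) + (\<Sum>p<P. lam p * (2 * (inner (v p) (y n) - u p)\<^sup>2))" for n
  have "(\<lambda>n. norm (D (y n))) \<longlonglongrightarrow> 0"
    using LIMSEQ_subseq_LIMSEQ[OF Dx0 r] by (simp add: y_def o_def)
  moreover have "(\<lambda>n. \<Sum>p<P. lam p * (2 * (inner (v p) (y n) - u p)\<^sup>2)) \<longlonglongrightarrow> (\<Sum>p<P. lam p * (2 * (u p - u p)\<^sup>2))"
    unfolding y_def by (intro tendsto_sum tendsto_mult tendsto_const tendsto_power tendsto_diff u) simp
  ultimately have "(\<lambda>n. 2 * norm (D (y n)) + (\<Sum>p<P. lam p * (2 * (inner (v p) (y n) - u p)\<^sup>2))) \<longlonglongrightarrow>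
      2 * 0 + (\<Sum>p<P. lam p * (2 * (u p - u p)\<^sup>2))"
    by (intro tendsto_add tendsto_mult tendsto_const)
  then have g0: "g \<longlonglongrightarrow> 0" by (simp add: g_def[abs_def])
  have main: "\<kappa> * (norm (y a - y b))\<^sup>2 \<le> g a + g b" for a b
  proof -
    let ?z = "y a - y b"
    have nz: "norm ?z \<le> 2" using norm_triangle_ineq4[of "y a" "y b"] by (simp add: y_def x)
    have "inner (D ?z) ?z \<le> norm (D ?z) * norm ?z" by (rule norm_cauchy_schwarz)
    also have "\<dots> \<le> (norm (D (y a)) + norm (D (y b))) * 2"
      using nz norm_triangle_ineq4[of "D (y a)" "D (y b)"]
      by (intro mult_mono) (auto simp: blinfun.diff_right)
    finally have 1: "inner (D ?z) ?z \<le> 2 * norm (D (y a)) + 2 * norm (D (y b))" by simp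
    have "(\<Sum>p<P. lam p * (inner (v p) ?z)\<^sup>2) \<le>
      (\<Sum>p<P. lam p * (2 * (inner (v p) (y a) - u p)\<^sup>2) + lam p * (2 * (inner (v p) (y b) - u p)\<^sup>2))"
    proof (rule sum_mono)
      fix p
      have "(inner (v p) ?z)\<^sup>2 \<le> 2 * (inner (v p) (y a) - u p)\<^sup>2 + 2 * (inner (v p) (y b) - u p)\<^sup>2"
        using sum_squares_bound[of "inner (v p) (y a) - u p" "- (inner (v p) (y b) - u p)"]
        by (simp add: inner_diff_right power2_eq_square algebra_simps)
      from mult_left_mono[OF this lam_nonneg[of p]]
      show "lam p * (inner (v p) ?z)\<^sup>2 \<le> lam p * (2 * (inner (v p) (y a) - u p)\<^sup>2) + lam p * (2 * (inner (v p) (y b) - u p)\<^sup>2)"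
        by (simp add: algebra_simps)
    qed
    then have 2: "inner (C ?z) ?z \<le> (\<Sum>p<P. lam p * (2 * (inner (v p) (y a) - u p)\<^sup>2))
        + (\<Sum>p<P. lam p * (2 * (inner (v p) (y b) - u p)\<^sup>2)) + lam P * (norm ?z)\<^sup>2"
      using quadratic_form_le[of ?z P] by (simp add: sum.distrib)
    have 3: "lam P * (norm ?z)\<^sup>2 \<le> \<kappa> * (norm ?z)\<^sup>2" using P by (intro mult_right_mono) auto
    have "s * (norm ?z)\<^sup>2 = inner (D ?z) ?z + inner (A ?z) ?z"
      by (simp add: Dx inner_diff_left power2_norm_eq_inner)
    then have "s * (norm ?z)\<^sup>2 - \<delta> * (norm ?z)\<^sup>2 - \<kappa> * (norm ?z)\<^sup>2 \<le> g a + g b"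
      using 1 2 3 close[of ?z] by (simp add: g_def)
    moreover have "s = \<delta> + 2 * \<kappa>" by (simp add: \<kappa>_def field_simps)
    ultimately show ?thesis by (simp add: algebra_simps)
  qed
  have "Cauchy y"
  proof (rule metric_CauchyI)
    fix e :: real assume "e > 0"
    then have "\<kappa> * e\<^sup>2 / 2 > 0" using \<kappa> by simp
    from order_tendstoD(2)[OF g0 this] obtain N where N: "\<And>n. n \<ge> N \<Longrightarrow> g n < \<kappa> * e\<^sup>2 / 2"
      by (auto simp: eventually_sequentially)
    have "dist (y a) (y b) < e" if "a \<ge> N" "b \<ge> N" for a b
    proof -
      have "\<kappa> * (norm (y a - y b))\<^sup>2 < \<kappa> * e\<^sup>2"
        using main[of a b] N[OF that(1)] N[OF that(2)] by linarith
      then have "(norm (y a - y b))\<^sup>2 < e\<^sup>2" using \<kappa> by simp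
      then show ?thesis using \<open>e > 0\<close> by (simp add: dist_norm power2_less_imp_less)
    qed
    then show "\<exists>M. \<forall>m\<ge>M. \<forall>n\<ge>M. dist (y m) (y n) < e" by blast
  qed
  then obtain z where z: "y \<longlonglongrightarrow> z"
    using assms(1) by (auto simp: complete_def)
  have "(\<lambda>n. norm (y n)) \<longlonglongrightarrow> norm z" by (intro tendsto_intros z)
  then have "norm z = 1" by (simp add: y_def x LIMSEQ_const_iff)
  moreover have "(\<lambda>n. norm (D (y n))) \<longlonglongrightarrow> norm (D z)" by (intro tendsto_intros z)
  with \<open>(\<lambda>n. norm (D (y n))) \<longlonglongrightarrow> 0\<close> have "norm (D z) = 0" using LIMSEQ_unique by blast
  then have "A z = s *\<^sub>R z" by (simp add: Dx)
  ultimately show ?thesis using that[of s z] s0 by force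
qed

text \<open>Testing with an eigenvector gives the upper bound. The lower bound needs a genuine
  eigenvalue of \<open>A\<close> close to \<open>lam 0\<close>: \<open>is_largest_eigenvalue\<close>
  compares with eigenvalues only and says nothing about the rest of the spectrum.\<close>

lemma largest_eigenvalue_perturb:
  assumes "Topological_Spaces.complete (UNIV :: 'h set)"
  assumes A: "psd_op A" "norm (A - C) \<le> \<delta>" and \<delta>: "2 * \<delta> < lam 0" and lam: "lam \<longlonglongrightarrow> 0"
    and ex: "\<exists>l. is_largest_eigenvalue A l"
  shows "\<bar>largest_eigenvalue A - lam 0\<bar> \<le> \<delta>"
proof -
  let ?l = "largest_eigenvalue A"
  have l: "is_largest_eigenvalue A ?l" by (rule largest_eigenvalue_is_largest[OF ex])
  obtain m x where "m \<ge> lam 0 - \<delta>" "x \<noteq> 0" "A x = m *\<^sub>R x"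
    using perturbed_eigenvalue_ex[OF assms(1) A \<delta> lam] by metis
  with l have low: "?l \<ge> lam 0 - \<delta>" by (force simp: is_largest_eigenvalue_def)
  obtain x where x: "x \<noteq> 0" "A x = ?l *\<^sub>R x" using l by (auto simp: is_largest_eigenvalue_def)
  have "?l * (norm x)\<^sup>2 = inner (C x) x + inner ((A - C) x) x"
    by (simp add: blinfun.bilinear_simps inner_diff_left x power2_norm_eq_inner)
  also have "\<dots> \<le> lam 0 * (norm x)\<^sup>2 + \<delta> * (norm x)\<^sup>2"
  proof (rule add_mono[OF quadratic_form_le_lam0])
    have "inner ((A - C) x) x \<le> norm ((A - C) x) * norm x" by (rule norm_cauchy_schwarz)
    also have "\<dots> \<le> (norm (A - C) * norm x) * norm x" by (intro mult_right_mono norm_blinfun) auto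
    also have "\<dots> \<le> (\<delta> * norm x) * norm x" using A by (intro mult_right_mono) auto
    finally show "inner ((A - C) x) x \<le> \<delta> * (norm x)\<^sup>2" by (simp add: power2_eq_square mult_ac)
  qed
  finally have "?l * (norm x)\<^sup>2 \<le> (lam 0 + \<delta>) * (norm x)\<^sup>2" by (simp add: algebra_simps)
  then have "?l \<le> lam 0 + \<delta>" using x by simp
  with low show ?thesis by linarith
qed

end

section \<open>Measurability of suprema and of spectral quantities\<close>

lemma rational_near:
  fixes a b t :: real
  assumes "a < b" "t \<in> {a..b}" "d > 0"
  obtains q where "q \<in> \<rat>" "q \<in> {a..b}" "\<bar>q - t\<bar> < d"
proof -
  have "max a (t - d) < min b (t + d)" using assms by auto
  from Rats_dense_in_real[OF this] obtain q where "q \<in> \<rat>" "max a (t - d) < q" "q < min b (t + d)" by blast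
  then show ?thesis by (intro that[of q]) auto
qed

text \<open>By compactness the quantifier over the uncountable interval can be moved inside
  the one over the index, where continuity makes it countable.\<close>
lemma measurable_ex_interval_all_nonneg:
  fixes \<phi> :: "nat \<Rightarrow> real \<Rightarrow> 'a \<Rightarrow> real"
  assumes "a < b"
    and meas: "\<And>n t. t \<in> {a..b} \<Longrightarrow> \<phi> n t \<in> borel_measurable M"
    and cont: "\<And>n \<omega>. \<omega> \<in> space M \<Longrightarrow> continuous_on {a..b} (\<lambda>t. \<phi> n t \<omega>)"
    and dec: "\<And>n t \<omega>. \<omega> \<in> space M \<Longrightarrow> t \<in> {a..b} \<Longrightarrow> \<phi> (Suc n) t \<omega> \<le> \<phi> n t \<omega>"
  shows "{\<omega>\<in>space M. \<exists>t\<in>{a..b}. \<forall>n. \<phi> n t \<omega> \<ge> 0} \<in> sets M"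
proof -
  have eq: "(\<exists>t\<in>{a..b}. \<forall>n. \<phi> n t \<omega> \<ge> 0) \<longleftrightarrow>
      (\<forall>n. \<exists>q\<in>\<rat> \<inter> {a..b}. \<phi> n q \<omega> > - 1 / real (Suc n))" if \<omega>: "\<omega> \<in> space M" for \<omega>
  proof
    assume "\<exists>t\<in>{a..b}. \<forall>n. \<phi> n t \<omega> \<ge> 0"
    then obtain t where t: "t \<in> {a..b}" "\<And>n. \<phi> n t \<omega> \<ge> 0" by blast
    show "\<forall>n. \<exists>q\<in>\<rat> \<inter> {a..b}. \<phi> n q \<omega> > - 1 / real (Suc n)"
    proof
      fix n
      have "1 / real (Suc n) > 0" by simp
      with cont[OF \<omega>, of n] t(1) obtain d where d: "d > 0"
        "\<And>s. s \<in> {a..b} \<Longrightarrow> \<bar>s - t\<bar> < d \<Longrightarrow> \<bar>\<phi> n s \<omega> - \<phi> n t \<omega>\<bar> < 1 / real (Suc n)"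
        unfolding continuous_on_iff dist_real_def by metis
      obtain q where q: "q \<in> \<rat>" "q \<in> {a..b}" "\<bar>q - t\<bar> < d"
        using rational_near[OF \<open>a < b\<close> t(1) d(1)] by blast
      from d(2)[OF q(2,3)] t(2)[of n] have "\<phi> n q \<omega> > - (1 / real (Suc n))" by linarith
      with q show "\<exists>q\<in>\<rat> \<inter> {a..b}. \<phi> n q \<omega> > - 1 / real (Suc n)"
        by (intro bexI[of _ q]) (auto simp del: of_nat_Suc)
    qed
  next
    assume R: "\<forall>n. \<exists>q\<in>\<rat> \<inter> {a..b}. \<phi> n q \<omega> > - 1 / real (Suc n)"
    \<comment> \<open>The tolerance \<open>1 / (n + 1)\<close> lets every \<open>F n\<close> contain
      a rational point while the sets still shrink to the wanted one; being compact, nested and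
      nonempty they have a common point.\<close>
    define F where "F n = {t\<in>{a..b}. \<phi> n t \<omega> \<ge> - 1 / real (Suc n)}" for n
    have dec': "\<phi> n t \<omega> \<le> \<phi> m t \<omega>" if "m \<le> n" "t \<in> {a..b}" for m n t
      using that(1) by (rule lift_Suc_antimono_le[of "\<lambda>n. \<phi> n t \<omega>", rotated]) (use dec \<omega> that in auto)
    have "compact (F n)" for n
    proof -
      have "closed (F n)" unfolding F_def
        by (rule continuous_on_closed_Collect_le[OF continuous_on_const cont[OF \<omega>]]) simp
      moreover have "bounded (F n)" by (rule bounded_subset[of "{a..b}"]) (auto simp: F_def)
      ultimately show ?thesis by (simp add: compact_eq_bounded_closed)
    qed
    moreover have "F n \<noteq> {}" for n
    proof -
      obtain q where "q \<in> {a..b}" "\<phi> n q \<omega> > - 1 / real (Suc n)" using R by blast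
      then have "q \<in> F n" unfolding F_def by (intro CollectI conjI less_imp_le)
      then show ?thesis by blast
    qed
    moreover have "F n \<subseteq> F m" if "m \<le> n" for m n
    proof
      fix t assume t: "t \<in> F n"
      have "- 1 / real (Suc m) \<le> - 1 / real (Suc n)" using that by (simp add: frac_le)
      with t dec'[OF that, of t] show "t \<in> F m" by (auto simp: F_def simp del: of_nat_Suc)
    qed
    ultimately have "\<Inter> (range F) \<noteq> {}" by (rule compact_nest)
    then obtain t where t: "\<And>n. t \<in> F n" by auto
    have "\<phi> n t \<omega> \<ge> 0" for n
    proof (rule LIMSEQ_le_const2)
      show "(\<lambda>m. - 1 / real (Suc m)) \<longlonglongrightarrow> 0"
        using tendsto_minus[OF LIMSEQ_Suc[OF lim_1_over_n]] by simp
      have "- 1 / real (Suc m) \<le> \<phi> n t \<omega>" if "m \<ge> n" for m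
        using t[of m] dec'[OF that, of t] by (auto simp: F_def simp del: of_nat_Suc)
      then show "\<exists>N. \<forall>m\<ge>N. - 1 / real (Suc m) \<le> \<phi> n t \<omega>" by blast
    qed
    then show "\<exists>t\<in>{a..b}. \<forall>n. \<phi> n t \<omega> \<ge> 0" using t[of 0] by (intro bexI[of _ t]) (auto simp: F_def)
  qed
  have cQ: "countable (\<rat> \<inter> {a..b})" using countable_rat by (rule countable_subset[rotated]) auto
  have "{\<omega>\<in>space M. \<exists>t\<in>{a..b}. \<forall>n. \<phi> n t \<omega> \<ge> 0} =
     {\<omega>\<in>space M. \<forall>n. \<exists>q\<in>\<rat> \<inter> {a..b}. \<phi> n q \<omega> > - 1 / real (Suc n)}"
    by (rule Collect_cong) (use eq in blast)
  also have "\<dots> \<in> sets M"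
  proof (intro sets.sets_Collect_countable_All sets.sets_Collect_countable_Ex' cQ)
    fix n q assume "q \<in> \<rat> \<inter> {a..b}"
    then have [measurable]: "\<phi> n q \<in> borel_measurable M" using meas by auto
    show "{\<omega>\<in>space M. \<phi> n q \<omega> > - 1 / real (Suc n)} \<in> sets M" by measurable
  qed
  finally show ?thesis .
qed

lemma suminf_nonsummable: "\<not> summable f \<Longrightarrow> suminf f = (THE s. False)"
  unfolding suminf_def by (rule arg_cong[of _ _ The]) (auto simp: summable_def)

lemma Sup_real_unbounded:
  fixes X :: "real set"
  assumes "\<not> bdd_above X"
  shows "Sup X = (LEAST z. False)"
proof -
  have "\<not> (\<forall>x\<in>X. x \<le> z)" for z using assms by (auto simp: bdd_above_def)
  then have "(\<lambda>z. \<forall>x\<in>X. x \<le> z) = (\<lambda>z. False)" by (intro ext) blast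
  then show ?thesis by (simp add: Sup_real_def)
qed

text \<open>No exceptional null set is allowed here: on a measure space that is not complete the junk
  values of divergent series and of unbounded suprema matter, but they are constants.\<close>
lemma borel_measurable_SUP_sqrt_suminf:
  fixes f :: "nat \<Rightarrow> real \<Rightarrow> 'a \<Rightarrow> real"
  assumes meas: "\<And>p t. t \<in> {0<..<1} \<Longrightarrow> f p t \<in> borel_measurable M"
    and cont: "\<And>p \<omega>. \<omega> \<in> space M \<Longrightarrow> continuous_on {0<..<1} (\<lambda>t. f p t \<omega>)"
    and nn: "\<And>p t \<omega>. f p t \<omega> \<ge> 0"
  shows "(\<lambda>\<omega>. SUP t\<in>{0<..<1}. sqrt (\<Sum>p. f p t \<omega>)) \<in> borel_measurable M"
proof -
  define S where "S m t \<omega> = (\<Sum>p<m. f p t \<omega>)" for m t \<omega>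
  define g where "g t \<omega> = sqrt (\<Sum>p. f p t \<omega>)" for t \<omega>
  define d where "d = sqrt (THE s. False)"
  have S_meas: "S m t \<in> borel_measurable M" if "t \<in> {0<..<1}" for m t
    unfolding S_def[abs_def] using meas[OF that] by measurable
  have S_cont: "continuous_on {0<..<1} (\<lambda>t. S m t \<omega>)" if "\<omega> \<in> space M" for m \<omega>
    unfolding S_def using cont[OF that] by (intro continuous_intros)
  have S_mono: "S m t \<omega> \<le> S n t \<omega>" if "m \<le> n" for m n t \<omega>
    unfolding S_def using that nn by (intro sum_mono2) auto
  have S_nn: "S m t \<omega> \<ge> 0" for m t \<omega> unfolding S_def using nn by (intro sum_nonneg)
  have S_lim: "(\<lambda>m. S m t \<omega>) \<longlonglongrightarrow> (\<Sum>p. f p t \<omega>)" if "summable (\<lambda>p. f p t \<omega>)" for t \<omega>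
    unfolding S_def by (rule summable_LIMSEQ[OF that])
  have S_le: "S m t \<omega> \<le> (\<Sum>p. f p t \<omega>)" if "summable (\<lambda>p. f p t \<omega>)" for m t \<omega>
    unfolding S_def by (rule sum_le_suminf[OF that]) (auto simp: nn)
  have bd_summable: "summable (\<lambda>p. f p t \<omega>)" if "\<And>m. S m t \<omega> \<le> K" for t \<omega> K
    by (rule summableI_nonneg_bounded[of _ K]) (use that nn in \<open>auto simp: S_def\<close>)
  have g_gt: "g t \<omega> > c \<longleftrightarrow> (\<exists>m. sqrt (S m t \<omega>) > c)" if "summable (\<lambda>p. f p t \<omega>)" for t \<omega> c
  proof
    assume "g t \<omega> > c"
    from order_tendstoD(1)[OF tendsto_real_sqrt[OF S_lim[OF that]] this[unfolded g_def]]
    show "\<exists>m. sqrt (S m t \<omega>) > c" by (auto simp: eventually_sequentially)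
  next
    assume "\<exists>m. sqrt (S m t \<omega>) > c"
    then obtain m where "sqrt (S m t \<omega>) > c" ..
    moreover have "sqrt (S m t \<omega>) \<le> g t \<omega>" unfolding g_def using S_le[OF that] by simp
    ultimately show "g t \<omega> > c" by simp
  qed
  have g_ns: "g t \<omega> = d" if "\<not> summable (\<lambda>p. f p t \<omega>)" for t \<omega>
    using suminf_nonsummable[OF that] by (simp add: g_def d_def)
  have B: "{\<omega>\<in>space M. \<exists>t\<in>{0<..<1}. g t \<omega> > c} \<in> sets M" for c
  proof (cases "c < d")
    case True
    \<comment> \<open>For \<open>c\<close> below the default value \<open>d\<close>, a point of
      divergence exceeds \<open>c\<close>, and so do its unbounded partial sums. The condition is
      then open in \<open>t\<close>, and rational points suffice.\<close>
    have pw: "g t \<omega> > c \<longleftrightarrow> (\<exists>m. sqrt (S m t \<omega>) > c)" for t \<omega>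
    proof (cases "summable (\<lambda>p. f p t \<omega>)")
      case False
      have "\<exists>m. sqrt (S m t \<omega>) > c"
      proof (rule ccontr)
        assume "\<not> ?thesis"
        then have *: "sqrt (S m t \<omega>) \<le> c" for m by (simp add: not_less)
        then have "c \<ge> 0" using real_sqrt_ge_zero[OF S_nn[of 0 t \<omega>]] order_trans by blast
        with * have "S m t \<omega> \<le> c\<^sup>2" for m by (simp add: sqrt_le_D)
        with bd_summable False show False by blast
      qed
      with g_ns[OF False] True show ?thesis by simp
    qed (rule g_gt)
    have eq: "(\<exists>t\<in>{0<..<1}. g t \<omega> > c) \<longleftrightarrow> (\<exists>q\<in>\<rat> \<inter> {0<..<1}. \<exists>m. sqrt (S m q \<omega>) > c)"
      if \<omega>: "\<omega> \<in> space M" for \<omega>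
    proof
      assume "\<exists>t\<in>{0<..<1}. g t \<omega> > c"
      then obtain t m where t: "t \<in> {0<..<1}" "sqrt (S m t \<omega>) > c" using pw by blast
      have "open ({t\<in>{0<..<1}. sqrt (S m t \<omega>) > c} :: real set)"
      proof -
        have "open ({0<..<1} \<inter> (\<lambda>t. sqrt (S m t \<omega>)) -` {c<..})"
          by (intro continuous_open_preimage continuous_on_real_sqrt S_cont[OF \<omega>]) auto
        also have "{0<..<1} \<inter> (\<lambda>t. sqrt (S m t \<omega>)) -` {c<..} = {t\<in>{0<..<1}. sqrt (S m t \<omega>) > c}" by auto
        finally show ?thesis .
      qed
      with t obtain e where e: "e > 0" "ball t e \<subseteq> {t\<in>{0<..<1}. sqrt (S m t \<omega>) > c}"
        unfolding open_contains_ball by blast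
      obtain q where "q \<in> \<rat>" "t < q" "q < t + e" using Rats_dense_in_real[of t "t + e"] e by auto
      then have "q \<in> \<rat>" "q \<in> ball t e" by (auto simp: dist_real_def)
      with e show "\<exists>q\<in>\<rat> \<inter> {0<..<1}. \<exists>m. sqrt (S m q \<omega>) > c" by blast
    qed (use pw in auto)
    have cQ: "countable (\<rat> \<inter> {0<..<1::real})" using countable_rat by (rule countable_subset[rotated]) auto
    have "{\<omega>\<in>space M. \<exists>t\<in>{0<..<1}. g t \<omega> > c} =
      {\<omega>\<in>space M. \<exists>q\<in>\<rat> \<inter> {0<..<1}. \<exists>m. sqrt (S m q \<omega>) > c}"
      by (rule Collect_cong) (use eq in blast)
    also have "\<dots> \<in> sets M"
    proof (intro sets.sets_Collect_countable_Ex sets.sets_Collect_countable_Ex' cQ)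
      fix q m assume "q \<in> \<rat> \<inter> {0<..<1::real}"
      then have [measurable]: "S m q \<in> borel_measurable M" using S_meas by auto
      show "{\<omega>\<in>space M. sqrt (S m q \<omega>) > c} \<in> sets M" by measurable
    qed
    finally show ?thesis .
  next
    case False
    \<comment> \<open>The shift by 3 keeps \<open>a j\<close> below one half, so the intervals are
      nondegenerate; they exhaust the open unit interval.\<close>
    define a where "a j = 1 / real (j + 3)" for j :: nat
    have a: "0 < a j" "a j < 1 - a j" for j by (auto simp: a_def field_simps)
    \<comment> \<open>For \<open>c \<ge> d\<close> points of divergence must be excluded.
      Nonnegativity for all \<open>n\<close> says that the partial sums stay below \<open>K\<close>
      and that the \<open>m\<close>-th root exceeds \<open>c\<close> by a definite amount, which is
      a closed condition decreasing in \<open>n\<close>.\<close>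
    define \<phi> where "\<phi> K m i n t \<omega> = min (real K - S n t \<omega>) (sqrt (S m t \<omega>) - c - 1 / real (Suc i))"
      for K m i :: nat and n t \<omega>
    have eq: "(\<exists>t\<in>{0<..<1}. g t \<omega> > c) \<longleftrightarrow>
      (\<exists>K m i j. \<exists>t\<in>{a j..1 - a j}. \<forall>n. \<phi> K m i n t \<omega> \<ge> 0)" for \<omega>
    proof
      assume "\<exists>t\<in>{0<..<1}. g t \<omega> > c"
      then obtain t where t: "t \<in> {0<..<1}" "g t \<omega> > c" by blast
      with g_ns False have su: "summable (\<lambda>p. f p t \<omega>)" by fastforce
      obtain K :: nat where K: "(\<Sum>p. f p t \<omega>) \<le> real K" using real_arch_simple by blast
      obtain m where m: "sqrt (S m t \<omega>) > c" using g_gt[OF su] t by blast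
      obtain i where i: "inverse (real (Suc i)) < sqrt (S m t \<omega>) - c"
        using reals_Archimedean[of "sqrt (S m t \<omega>) - c"] m by auto
      obtain j where j: "inverse (real (Suc j)) < min t (1 - t)"
        using reals_Archimedean[of "min t (1 - t)"] t by auto
      have "a j \<le> inverse (real (Suc j))" by (simp add: a_def field_simps)
      then have "t \<in> {a j..1 - a j}" using j by (auto simp del: of_nat_Suc)
      moreover have "\<phi> K m i n t \<omega> \<ge> 0" for n
        using S_le[OF su, of n] K i by (simp add: \<phi>_def divide_inverse del: of_nat_Suc)
      ultimately show "\<exists>K m i j. \<exists>t\<in>{a j..1 - a j}. \<forall>n. \<phi> K m i n t \<omega> \<ge> 0" by blast
    next
      assume "\<exists>K m i j. \<exists>t\<in>{a j..1 - a j}. \<forall>n. \<phi> K m i n t \<omega> \<ge> 0"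
      then obtain K m i j t where t: "t \<in> {a j..1 - a j}" "\<And>n. \<phi> K m i n t \<omega> \<ge> 0" by blast
      have su: "summable (\<lambda>p. f p t \<omega>)"
        by (rule bd_summable[of _ _ "real K"]) (use t(2) in \<open>simp add: \<phi>_def\<close>)
      have "1 / real (Suc i) > 0" by simp
      moreover have "sqrt (S m t \<omega>) - c - 1 / real (Suc i) \<ge> 0"
        using t(2)[of 0] by (simp add: \<phi>_def del: of_nat_Suc)
      ultimately have "sqrt (S m t \<omega>) > c" by linarith
      with g_gt[OF su] have "g t \<omega> > c" by blast
      moreover have "t \<in> {0<..<1}" using t(1) a[of j] by auto
      ultimately show "\<exists>t\<in>{0<..<1}. g t \<omega> > c" by blast
    qed
    have "{\<omega>\<in>space M. \<exists>t\<in>{0<..<1}. g t \<omega> > c} =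
      {\<omega>\<in>space M. \<exists>K m i j. \<exists>t\<in>{a j..1 - a j}. \<forall>n. \<phi> K m i n t \<omega> \<ge> 0}"
      by (rule Collect_cong) (use eq in blast)
    also have "\<dots> \<in> sets M"
    proof (intro sets.sets_Collect_countable_Ex measurable_ex_interval_all_nonneg)
      fix K m i j n
      show "a j < 1 - a j" by (rule a)
      show "\<phi> K m i n t \<in> borel_measurable M" if "t \<in> {a j..1 - a j}" for t
      proof -
        have "t \<in> {0<..<1}" using that a[of j] by auto
        from S_meas[OF this] show ?thesis unfolding \<phi>_def[abs_def] by measurable
      qed
      show "continuous_on {a j..1 - a j} (\<lambda>t. \<phi> K m i n t \<omega>)" if "\<omega> \<in> space M" for \<omega>
      proof -
        have "{a j..1 - a j} \<subseteq> {0<..<1}" using a[of j] by auto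
        then show ?thesis unfolding \<phi>_def
          by (intro continuous_intros continuous_on_subset[OF S_cont[OF that]])
      qed
      show "\<phi> K m i (Suc n) t \<omega> \<le> \<phi> K m i n t \<omega>" for t \<omega>
        using S_mono[of n "Suc n" t \<omega>] by (simp add: \<phi>_def min_def)
    qed
    finally show ?thesis .
  qed
  have E: "{\<omega>\<in>space M. \<forall>t\<in>{0<..<1}. g t \<omega> \<le> c} \<in> sets M" for c
  proof -
    have "{\<omega>\<in>space M. \<forall>t\<in>{0<..<1}. g t \<omega> \<le> c} = space M - {\<omega>\<in>space M. \<exists>t\<in>{0<..<1}. g t \<omega> > c}"
      by (auto simp: not_less)
    then show ?thesis using B[of c] by simp
  qed
  \<comment> \<open>Off \<open>U\<close> the values are unbounded in \<open>t\<close> and the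
    supremum is one fixed default value.\<close>
  define U where "U = (\<Union>k::nat. {\<omega>\<in>space M. \<forall>t\<in>{0<..<1}. g t \<omega> \<le> real k})"
  have U: "U \<in> sets M" unfolding U_def using E by auto
  have U_iff: "\<omega> \<in> U \<longleftrightarrow> bdd_above ((\<lambda>t. g t \<omega>) ` {0<..<1})" if "\<omega> \<in> space M" for \<omega>
  proof
    assume "bdd_above ((\<lambda>t. g t \<omega>) ` {0<..<1})"
    then obtain b where "\<forall>x\<in>(\<lambda>t. g t \<omega>) ` {0<..<1}. x \<le> b" unfolding bdd_above_def by blast
    then have b: "\<And>t. t \<in> {0<..<1} \<Longrightarrow> g t \<omega> \<le> b" by blast
    obtain k :: nat where k: "b \<le> real k" using real_arch_simple by blast
    have "g t \<omega> \<le> real k" if "t \<in> {0<..<1}" for t using b[OF that] k by linarith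
    with that show "\<omega> \<in> U" unfolding U_def by blast
  next
    assume "\<omega> \<in> U"
    then obtain k :: nat where "\<forall>t\<in>{0<..<1}. g t \<omega> \<le> real k" unfolding U_def by blast
    then show "bdd_above ((\<lambda>t. g t \<omega>) ` {0<..<1})" by (intro bdd_aboveI2[of _ _ "real k"]) blast
  qed
  have "{\<omega>\<in>space M. (SUP t\<in>{0<..<1}. g t \<omega>) \<le> c} =
      (U \<inter> {\<omega>\<in>space M. \<forall>t\<in>{0<..<1}. g t \<omega> \<le> c}) \<union> (if (LEAST z::real. False) \<le> c then space M - U else {})"
    for c
  proof -
    have 1: "(SUP t\<in>{0<..<1}. g t \<omega>) \<le> c \<longleftrightarrow> (\<forall>t\<in>{0<..<1}. g t \<omega> \<le> c)" if "\<omega> \<in> U" "\<omega> \<in> space M" for \<omega>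
      using U_iff[OF that(2)] that(1) by (intro cSUP_le_iff) auto
    have 2: "(SUP t\<in>{0<..<1}. g t \<omega>) = (LEAST z. False)" if "\<omega> \<notin> U" "\<omega> \<in> space M" for \<omega>
      using U_iff[OF that(2)] that(1) by (intro Sup_real_unbounded) auto
    have 3: "U \<subseteq> space M" by (auto simp: U_def)
    show ?thesis
    proof (rule set_eqI)
      fix w
      show "w \<in> {\<omega>\<in>space M. (SUP t\<in>{0<..<1}. g t \<omega>) \<le> c} \<longleftrightarrow>
        w \<in> (U \<inter> {\<omega>\<in>space M. \<forall>t\<in>{0<..<1}. g t \<omega> \<le> c}) \<union> (if (LEAST z::real. False) \<le> c then space M - U else {})"
        using 1[of w] 2[of w] 3 by (cases "w \<in> U"; cases "w \<in> space M"; cases "(LEAST z::real. False) \<le> c") simp_all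
    qed
  qed
  then have "{\<omega>\<in>space M. (SUP t\<in>{0<..<1}. g t \<omega>) \<le> c} \<in> sets M" for c
    using U E[of c] by simp
  then show ?thesis unfolding g_def by (simp add: borel_measurable_iff_le)
qed

section \<open>Measurability for random operators that are measurable vector by vector\<close>

lemma measurable_blinfun_apply_ONB:
  fixes A :: "'a \<Rightarrow> 'h::{real_inner,banach,second_countable_topology} \<Rightarrow>\<^sub>L 'h"
  assumes v: "orthonormal_basis (v :: nat \<Rightarrow> 'h)"
    and A: "\<And>x. (\<lambda>\<omega>. A \<omega> x) \<in> borel_measurable M" and y: "y \<in> borel_measurable M"
  shows "(\<lambda>\<omega>. A \<omega> (y \<omega>)) \<in> borel_measurable M"
proof (rule borel_measurable_LIMSEQ_metric)
  interpret orthonormal_basis v by (rule v)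
  show "(\<lambda>\<omega>. \<Sum>p<n. inner (v p) (y \<omega>) *\<^sub>R A \<omega> (v p)) \<in> borel_measurable M" for n
    using A y by measurable
  fix \<omega>
  have "(\<lambda>n. A \<omega> (proj n (y \<omega>))) \<longlonglongrightarrow> A \<omega> (y \<omega>)"
    by (intro tendsto_intros proj_tendsto)
  then show "(\<lambda>n. \<Sum>p<n. inner (v p) (y \<omega>) *\<^sub>R A \<omega> (v p)) \<longlonglongrightarrow> A \<omega> (y \<omega>)"
    by (simp add: proj_def blinfun.bilinear_simps blinfun.sum_right)
qed

text \<open>A strict violation of the norm bound occurs on an open set of vectors, so a countable
  dense set detects it.\<close>

lemma borel_measurable_norm_blinfun:
  fixes A :: "'a \<Rightarrow> 'h::{real_normed_vector,second_countable_topology} \<Rightarrow>\<^sub>L 'h"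
  assumes A: "\<And>x. (\<lambda>\<omega>. A \<omega> x) \<in> borel_measurable M"
  shows "(\<lambda>\<omega>. norm (A \<omega>)) \<in> borel_measurable M"
  unfolding borel_measurable_iff_le
proof
  fix a :: real
  obtain D :: "'h set" where D: "countable D" "\<And>X. open X \<Longrightarrow> X \<noteq> {} \<Longrightarrow> \<exists>d\<in>D. d \<in> X"
    using countable_dense_setE by metis
  show "{\<omega>\<in>space M. norm (A \<omega>) \<le> a} \<in> sets M"
  proof (cases "a \<ge> 0")
    case True
    have "norm (A \<omega>) \<le> a \<longleftrightarrow> (\<forall>x\<in>D. norm (A \<omega> x) \<le> a * norm x)" for \<omega>
    proof
      assume R: "\<forall>x\<in>D. norm (A \<omega> x) \<le> a * norm x"
      have "open {x. norm (A \<omega> x) > a * norm x}"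
        by (intro open_Collect_less continuous_intros)
      then have "\<not> norm (A \<omega> x) > a * norm x" for x using D(2)[of "{x. norm (A \<omega> x) > a * norm x}"] R by force
      then show "norm (A \<omega>) \<le> a" using True by (intro norm_blinfun_bound) (auto simp: not_less)
    next
      assume le: "norm (A \<omega>) \<le> a"
      show "\<forall>x\<in>D. norm (A \<omega> x) \<le> a * norm x"
      proof
        fix x
        show "norm (A \<omega> x) \<le> a * norm x"
          using norm_blinfun[of "A \<omega>" x] mult_right_mono[OF le, of "norm x"] by simp
      qed
    qed
    then have "{\<omega>\<in>space M. norm (A \<omega>) \<le> a} = {\<omega>\<in>space M. \<forall>x\<in>D. norm (A \<omega> x) \<le> a * norm x}" by simp
    also have "\<dots> \<in> sets M"
      using A by (intro sets.sets_Collect_countable_All'[OF _ D(1)] borel_measurable_le) auto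
    finally show ?thesis .
  next
    case False
    have "{\<omega>\<in>space M. norm (A \<omega>) \<le> a} = {}"
    proof -
      have "\<not> norm (A \<omega>) \<le> a" for \<omega> using False norm_ge_zero[of "A \<omega>"] by linarith
      then show ?thesis by blast
    qed
    then show ?thesis by (simp only: sets.empty_sets)
  qed
qed

text \<open>For self-adjoint \<open>A\<close>, with \<open>l\<close> and the norm of \<open>A\<close> bounded by \<open>K\<close>, the powers of this operator converge to the projection onto the eigenspace of
  \<open>l\<close>, which makes being an eigenvalue a measurable condition.\<close>
definition peak_op :: "real \<Rightarrow> 'h::real_normed_vector \<Rightarrow>\<^sub>L 'h \<Rightarrow> real \<Rightarrow> 'h \<Rightarrow> 'h" where
  "peak_op K A l x = x - (1 / (4 * K\<^sup>2)) *\<^sub>R (A (A x - l *\<^sub>R x) - l *\<^sub>R (A x - l *\<^sub>R x))"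

locale peak =
  fixes K :: real and A :: "'h::{real_inner,banach} \<Rightarrow>\<^sub>L 'h" and l :: real
  assumes sa: "self_adjoint_op A" and nA: "norm A \<le> K" and l: "0 \<le> l" "l \<le> K" and K: "K > 0"
begin

abbreviation "T \<equiv> peak_op K A l"

lemma shift_bound: "norm (A x - l *\<^sub>R x) \<le> 2 * K * norm x"
proof -
  have "norm (A x - l *\<^sub>R x) \<le> norm (A x) + norm (l *\<^sub>R x)" by (rule norm_triangle_ineq4)
  also have "norm (A x) \<le> K * norm x"
    using norm_blinfun[of A x] mult_right_mono[OF nA, of "norm x"] by simp
  also have "norm (l *\<^sub>R x) \<le> K * norm x" using l by (simp add: mult_right_mono)
  finally show ?thesis by simp
qed

lemma shift_sa: "inner (A x - l *\<^sub>R x) y = inner x (A y - l *\<^sub>R y)"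
  using sa by (simp add: self_adjoint_op_def inner_diff_left inner_diff_right)

lemma T_sa: "inner (T x) y = inner x (T y)"
proof -
  have "inner (A (A x - l *\<^sub>R x) - l *\<^sub>R (A x - l *\<^sub>R x)) y = inner x (A (A y - l *\<^sub>R y) - l *\<^sub>R (A y - l *\<^sub>R y))"
    by (simp only: shift_sa)
  then show ?thesis by (simp add: peak_op_def inner_diff_left[of x] inner_diff_right[of x] inner_scaleR_left inner_scaleR_right)
qed

text \<open>\<open>A - l\<close> has norm at most \<open>2 K\<close>, so its square divided by
  \<open>4 * K^2\<close> lies between zero and the identity, and \<open>T\<close> is the identity
  minus it. The loss of norm controls \<open>A x - l x\<close>: a vector whose norm hardly drops is
  almost an eigenvector.\<close>

lemma norm_T_sq: "(norm (T x))\<^sup>2 \<le> (norm x)\<^sup>2 - (norm (A x - l *\<^sub>R x))\<^sup>2 / (4 * K\<^sup>2)"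
proof -
  define w where "w = A x - l *\<^sub>R x"
  define E where "E = (1 / (4 * K\<^sup>2)) *\<^sub>R (A w - l *\<^sub>R w)"
  have T: "T x = x - E" by (simp add: peak_op_def E_def w_def)
  have "inner x E = inner w w / (4 * K\<^sup>2)"
    unfolding E_def using shift_sa[of x w] by (simp add: w_def)
  then have xE: "inner x E = (norm w)\<^sup>2 / (4 * K\<^sup>2)" by (simp only: power2_norm_eq_inner)
  have "norm E = norm (A w - l *\<^sub>R w) / (4 * K\<^sup>2)" by (simp add: E_def)
  also have "\<dots> \<le> (2 * K * norm w) / (4 * K\<^sup>2)" by (intro divide_right_mono shift_bound) auto
  also have "\<dots> = norm w / (2 * K)" using K by (simp add: power2_eq_square field_simps)
  finally have "(norm E)\<^sup>2 \<le> (norm w / (2 * K))\<^sup>2" by (rule power_mono) auto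
  then have EE: "(norm E)\<^sup>2 \<le> (norm w)\<^sup>2 / (4 * K\<^sup>2)" by (simp add: power_divide power_mult_distrib)
  have "(norm (T x))\<^sup>2 = (norm x)\<^sup>2 - 2 * inner x E + (norm E)\<^sup>2"
    by (simp add: T power2_norm_eq_inner inner_diff_left inner_diff_right inner_commute)
  then show ?thesis using xE EE by (simp add: w_def)
qed

lemma T_pow_add: "(T ^^ (m + n)) x = (T ^^ m) ((T ^^ n) x)"
  by (simp add: funpow_add)

lemma T_pow_sa: "inner ((T ^^ n) x) y = inner x ((T ^^ n) y)"
proof (induction n arbitrary: x y)
  case (Suc n)
  have "inner ((T ^^ Suc n) x) y = inner ((T ^^ n) x) (T y)" by (simp add: T_sa)
  also have "\<dots> = inner x ((T ^^ n) (T y))" by (rule Suc)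
  finally show ?case by (simp add: funpow_swap1)
qed simp

lemma norm_T_pow_Suc_le: "(norm ((T ^^ Suc n) x))\<^sup>2 \<le> (norm ((T ^^ n) x))\<^sup>2"
proof -
  have "(norm (A ((T ^^ n) x) - l *\<^sub>R (T ^^ n) x))\<^sup>2 / (4 * K\<^sup>2) \<ge> 0" by simp
  moreover have "(T ^^ Suc n) x = T ((T ^^ n) x)" by simp
  ultimately show ?thesis using norm_T_sq[of "(T ^^ n) x"] by (simp only:)
qed

text \<open>\<open>T\<close> is self-adjoint and fixes \<open>y\<close>, so the component of
  \<open>x\<close> along \<open>y\<close> survives all powers.\<close>

lemma eigenvector_lower_bound:
  assumes "A y = l *\<^sub>R y"
  shows "\<bar>inner x y\<bar> \<le> norm ((T ^^ n) x) * norm y"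
proof -
  have "T y = y" by (simp add: peak_op_def assms)
  then have "(T ^^ n) y = y" by (induction n) simp_all
  then have "inner x y = inner ((T ^^ n) x) y" by (simp add: T_pow_sa)
  then show ?thesis by (simp add: Cauchy_Schwarz_ineq2)
qed

text \<open>Inner products of even iterates depend only on the sum of the indices and are squared
  norms \<open>b\<close>, so convergence of the decreasing sequence \<open>b\<close> makes the even
  iterates Cauchy. Their limit is nonzero by the lower bound \<open>e\<close>, and
  \<open>norm_T_sq\<close> makes it an eigenvector.\<close>

lemma eigenvector_ex:
  assumes e: "e > 0" "\<And>n. e \<le> (norm ((T ^^ n) x))\<^sup>2"
  shows "\<exists>y. y \<noteq> 0 \<and> A y = l *\<^sub>R y"
proof -
  define b where "b n = (norm ((T ^^ n) x))\<^sup>2" for n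
  have "decseq b" by (rule decseq_SucI) (simp only: b_def norm_T_pow_Suc_le)
  then obtain \<beta> where \<beta>: "b \<longlonglongrightarrow> \<beta>"
    using decseq_convergent[of b 0] by (auto simp: b_def)
  define u where "u n = (T ^^ (2 * n)) x" for n
  have inn: "inner (u m) (u n) = b (m + n)" for m n
  proof -
    have *: "(T ^^ (2 * m)) x = (T ^^ m) ((T ^^ m) x)" "(T ^^ (2 * n)) x = (T ^^ n) ((T ^^ n) x)" for m n
      by (simp_all only: T_pow_add[symmetric] mult_2)
    have "inner (u m) (u n) = inner x ((T ^^ (2 * m)) ((T ^^ (2 * n)) x))"
      unfolding u_def by (rule T_pow_sa)
    also have "\<dots> = inner x ((T ^^ ((m + n) + (m + n))) x)"
      by (simp add: T_pow_add[symmetric] mult_2 add_ac)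
    also have "\<dots> = inner ((T ^^ (m + n)) x) ((T ^^ (m + n)) x)"
      by (simp only: T_pow_add[of "m + n" "m + n"] T_pow_sa)
    finally show ?thesis by (simp only: b_def power2_norm_eq_inner)
  qed
  have "Cauchy u"
  proof (rule metric_CauchyI)
    fix r :: real assume "r > 0"
    then have "r\<^sup>2 / 4 > 0" by simp
    with \<beta> obtain N where N: "\<And>n. n \<ge> N \<Longrightarrow> \<bar>b n - \<beta>\<bar> < r\<^sup>2 / 4"
      using LIMSEQ_D[OF \<beta>] by (metis real_norm_def)
    have "dist (u m) (u n) < r" if "m \<ge> N" "n \<ge> N" for m n
    proof -
      have "(norm (u m - u n))\<^sup>2 = b (m + m) - 2 * b (m + n) + b (n + n)"
        by (simp add: power2_norm_eq_inner inner_diff_left inner_diff_right inn add.commute)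
      also have "\<dots> < r\<^sup>2"
        using N[of "m + m"] N[of "m + n"] N[of "n + n"] that by linarith
      finally show ?thesis using \<open>r > 0\<close> by (simp add: dist_norm power2_less_imp_less)
    qed
    then show "\<exists>M. \<forall>m\<ge>M. \<forall>n\<ge>M. dist (u m) (u n) < r" by blast
  qed
  then obtain y where y: "u \<longlonglongrightarrow> y" by (auto simp: Cauchy_convergent_iff convergent_def)
  have "(\<lambda>n. (norm (u n))\<^sup>2) \<longlonglongrightarrow> (norm y)\<^sup>2" by (intro tendsto_intros y)
  then have "e \<le> (norm y)\<^sup>2" by (rule LIMSEQ_le_const) (use e in \<open>auto simp: u_def\<close>)
  with e have "y \<noteq> 0" by auto
  have sub: "(\<lambda>n. b (2 * n)) \<longlonglongrightarrow> \<beta>" "(\<lambda>n. b (Suc (2 * n))) \<longlonglongrightarrow> \<beta>"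
    using LIMSEQ_subseq_LIMSEQ[OF \<beta>, of "\<lambda>n. 2 * n"] LIMSEQ_subseq_LIMSEQ[OF \<beta>, of "\<lambda>n. Suc (2 * n)"]
    by (auto simp: o_def strict_mono_def)
  have lim0: "(\<lambda>n. (4 * K\<^sup>2) * (b (2 * n) - b (Suc (2 * n)))) \<longlonglongrightarrow> (4 * K\<^sup>2) * (\<beta> - \<beta>)"
    by (intro tendsto_intros sub)
  have "(norm (A (u n) - l *\<^sub>R u n))\<^sup>2 \<le> (4 * K\<^sup>2) * (b (2 * n) - b (Suc (2 * n)))" for n
  proof -
    have "b (Suc (2 * n)) \<le> b (2 * n) - (norm (A (u n) - l *\<^sub>R u n))\<^sup>2 / (4 * K\<^sup>2)"
      using norm_T_sq[of "u n"] by (simp add: b_def u_def)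
    then show ?thesis using K by (simp add: field_simps)
  qed
  then have *: "\<exists>N. \<forall>n\<ge>N. (norm (A (u n) - l *\<^sub>R u n))\<^sup>2 \<le> (4 * K\<^sup>2) * (b (2 * n) - b (Suc (2 * n)))" by blast
  have "(\<lambda>n. (norm (A (u n) - l *\<^sub>R u n))\<^sup>2) \<longlonglongrightarrow> (norm (A y - l *\<^sub>R y))\<^sup>2"
    by (intro tendsto_intros y)
  from LIMSEQ_le[OF this lim0 *] have "(norm (A y - l *\<^sub>R y))\<^sup>2 \<le> (4 * K\<^sup>2) * (\<beta> - \<beta>)" .
  then have "A y = l *\<^sub>R y" by simp
  with \<open>y \<noteq> 0\<close> show ?thesis by blast
qed

end

text \<open>The largest eigenvalue reaches \<open>c > 0\<close> iff some \<open>t\<close> between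
  \<open>c\<close> and a norm bound \<open>K\<close> is an eigenvalue, that is, iff the powers of
  \<open>peak_op\<close> at \<open>t\<close> keep some basis vector away from zero. This is
  continuous in \<open>t\<close> and decreasing in the power, so
  \<open>measurable_ex_interval_all_nonneg\<close> applies.\<close>

lemma borel_measurable_largest_eigenvalue:
  fixes A :: "'a \<Rightarrow> 'h::{real_inner,banach,second_countable_topology} \<Rightarrow>\<^sub>L 'h"
  assumes v: "orthonormal_basis (v :: nat \<Rightarrow> 'h)"
    and A: "\<And>x. (\<lambda>\<omega>. A \<omega> x) \<in> borel_measurable M"
    and psd: "\<And>\<omega>. \<omega> \<in> space M \<Longrightarrow> psd_op (A \<omega>)"
    and ex: "\<And>\<omega>. \<omega> \<in> space M \<Longrightarrow> \<exists>l. is_largest_eigenvalue (A \<omega>) l"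
  shows "(\<lambda>\<omega>. largest_eigenvalue (A \<omega>)) \<in> borel_measurable M"
  unfolding borel_measurable_iff_ge
proof
  interpret orthonormal_basis v by (rule v)
  fix c :: real
  let ?l = "\<lambda>\<omega>. largest_eigenvalue (A \<omega>)"
  have l: "is_largest_eigenvalue (A \<omega>) (?l \<omega>)" if "\<omega> \<in> space M" for \<omega>
    by (rule largest_eigenvalue_is_largest[OF ex[OF that]])
  have l0: "?l \<omega> \<ge> 0" if "\<omega> \<in> space M" for \<omega>
    using l[OF that] psd_eigenvalue_nonneg[OF psd[OF that]] by (auto simp: is_largest_eigenvalue_def)
  have c_iff: "c \<le> ?l \<omega> \<longleftrightarrow> (\<exists>m\<ge>c. \<exists>x. x \<noteq> 0 \<and> A \<omega> x = m *\<^sub>R x)" if "\<omega> \<in> space M" for \<omega>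
    using l[OF that] unfolding is_largest_eigenvalue_def by (meson order_trans)
  show "{\<omega>\<in>space M. c \<le> ?l \<omega>} \<in> sets M"
  proof (cases "c > 0")
    case False
    then have "{\<omega>\<in>space M. c \<le> ?l \<omega>} = space M" using l0 by force
    then show ?thesis by simp
  next
    case True
    \<comment> \<open>The value -1 makes the test fail for operators of norm above \<open>K\<close>,
      without disturbing continuity in \<open>t\<close> or monotonicity in \<open>n\<close>.\<close>
    define \<phi> where "\<phi> K p j n t \<omega> = (if norm (A \<omega>) \<le> real K
        then (norm ((peak_op (real K) (A \<omega>) t ^^ n) (v p)))\<^sup>2 - 1 / real (Suc j) else - 1)"
      for K p j n :: nat and t \<omega>
    have nA[measurable]: "(\<lambda>\<omega>. norm (A \<omega>)) \<in> borel_measurable M" by (rule borel_measurable_norm_blinfun[OF A])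
    have eq: "c \<le> ?l \<omega> \<longleftrightarrow> (\<exists>K\<in>{K. real K > c}. \<exists>p j. \<exists>t\<in>{c..real K}. \<forall>n. \<phi> K p j n t \<omega> \<ge> 0)"
      if \<omega>: "\<omega> \<in> space M" for \<omega>
    proof
      assume "c \<le> ?l \<omega>"
      then obtain m y where m: "m \<ge> c" "y \<noteq> 0" "A \<omega> y = m *\<^sub>R y" using c_iff[OF \<omega>] by blast
      \<comment> \<open>\<open>c + 1\<close> makes \<open>K\<close> strictly larger than
        \<open>c\<close>, since the interval of candidates must be nondegenerate.\<close>
      obtain K :: nat where K: "max (norm (A \<omega>)) (c + 1) \<le> real K" using real_arch_simple by blast
      have "m * norm y \<le> norm (A \<omega>) * norm y"
        using norm_blinfun[of "A \<omega>" y] m True by simp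
      then have "m \<le> norm (A \<omega>)" using m(2) by simp
      with K have mK: "m \<le> real K" by simp
      interpret P: peak "real K" "A \<omega>" m
        using psd[OF \<omega>] K True mK m(1) by unfold_locales (auto simp: psd_op_def)
      have "\<exists>p. inner (v p) y \<noteq> 0"
      proof (rule ccontr)
        assume "\<not> ?thesis"
        then have "(\<lambda>p. 0) sums (norm y)\<^sup>2" using norm_sq_sums[of y] by simp
        then have "(norm y)\<^sup>2 = 0" using sums_unique2[OF sums_zero] by metis
        with m show False by simp
      qed
      then obtain p where p: "inner (v p) y \<noteq> 0" by blast
      define e where "e = (\<bar>inner (v p) y\<bar> / norm y)\<^sup>2"
      have "e > 0" using p m by (simp add: e_def)
      then obtain j where j: "inverse (real (Suc j)) < e" using reals_Archimedean by blast
      have "\<phi> K p j n m \<omega> \<ge> 0" for n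
      proof -
        have "\<bar>inner (v p) y\<bar> / norm y \<le> norm ((peak_op (real K) (A \<omega>) m ^^ n) (v p))"
          using P.eigenvector_lower_bound[OF m(3), of "v p" n] m(2) by (simp add: divide_le_eq)
        then have "e \<le> (norm ((peak_op (real K) (A \<omega>) m ^^ n) (v p)))\<^sup>2"
          unfolding e_def by (rule power_mono) auto
        with j K show ?thesis by (simp add: \<phi>_def divide_inverse del: of_nat_Suc)
      qed
      moreover have "m \<in> {c..real K}" "K \<in> {K. real K > c}" using m(1) mK K by auto
      ultimately show "\<exists>K\<in>{K. real K > c}. \<exists>p j. \<exists>t\<in>{c..real K}. \<forall>n. \<phi> K p j n t \<omega> \<ge> 0" by blast
    next
      assume "\<exists>K\<in>{K. real K > c}. \<exists>p j. \<exists>t\<in>{c..real K}. \<forall>n. \<phi> K p j n t \<omega> \<ge> 0"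
      then obtain K p j t where K: "real K > c" and t: "t \<in> {c..real K}" "\<And>n. \<phi> K p j n t \<omega> \<ge> 0" by blast
      have nK: "norm (A \<omega>) \<le> real K" using t(2)[of 0] by (auto simp: \<phi>_def split: if_splits)
      interpret P: peak "real K" "A \<omega>" t
        using psd[OF \<omega>] K True t nK by unfold_locales (auto simp: psd_op_def)
      have "1 / real (Suc j) \<le> (norm ((peak_op (real K) (A \<omega>) t ^^ n) (v p)))\<^sup>2" for n
        using t(2)[of n] nK by (simp add: \<phi>_def del: of_nat_Suc)
      then have "\<exists>y. y \<noteq> 0 \<and> A \<omega> y = t *\<^sub>R y" by (rule P.eigenvector_ex[rotated]) simp
      with t(1) show "c \<le> ?l \<omega>" using c_iff[OF \<omega>] by auto
    qed
    have "{\<omega>\<in>space M. c \<le> ?l \<omega>} =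
        {\<omega>\<in>space M. \<exists>K\<in>{K. real K > c}. \<exists>p j. \<exists>t\<in>{c..real K}. \<forall>n. \<phi> K p j n t \<omega> \<ge> 0}"
      by (rule Collect_cong) (use eq in blast)
    also have "\<dots> \<in> sets M"
    proof (rule sets.sets_Collect_countable_Ex', rule sets.sets_Collect_countable_Ex, rule sets.sets_Collect_countable_Ex,
        rule measurable_ex_interval_all_nonneg)
      fix K p j n assume K: "K \<in> {K. real K > c}"
      then show "c < real K" by simp
      have it: "(\<lambda>\<omega>. (peak_op (real K) (A \<omega>) t ^^ n) (v p)) \<in> borel_measurable M" for t n
      proof (induction n)
        case (Suc n)
        define y where "y = (\<lambda>\<omega>. (peak_op (real K) (A \<omega>) t ^^ n) (v p))"
        have [measurable]: "y \<in> borel_measurable M" using Suc by (simp add: y_def)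
        have [measurable]: "(\<lambda>\<omega>. A \<omega> (y \<omega>)) \<in> borel_measurable M"
          by (intro measurable_blinfun_apply_ONB[OF v A]) simp
        define w where "w = (\<lambda>\<omega>. A \<omega> (y \<omega>) - t *\<^sub>R y \<omega>)"
        have [measurable]: "w \<in> borel_measurable M" unfolding w_def by measurable
        have [measurable]: "(\<lambda>\<omega>. A \<omega> (w \<omega>)) \<in> borel_measurable M"
          by (intro measurable_blinfun_apply_ONB[OF v A]) simp
        have "(\<lambda>\<omega>. (peak_op (real K) (A \<omega>) t ^^ Suc n) (v p)) =
          (\<lambda>\<omega>. y \<omega> - (1 / (4 * (real K)\<^sup>2)) *\<^sub>R (A \<omega> (w \<omega>) - t *\<^sub>R w \<omega>))"
          unfolding funpow.simps comp_apply by (simp only: peak_op_def[of _ _ _ "(peak_op _ _ _ ^^ n) (v p)"] y_def w_def)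
        then show ?case by simp
      qed simp
      show "\<phi> K p j n t \<in> borel_measurable M" for t
      proof -
        have [measurable]: "(\<lambda>\<omega>. (peak_op (real K) (A \<omega>) t ^^ n) (v p)) \<in> borel_measurable M" by (rule it)
        show ?thesis unfolding \<phi>_def[abs_def] by measurable
      qed
      show "continuous_on {c..real K} (\<lambda>t. \<phi> K p j n t \<omega>)" for \<omega>
      proof -
        have "continuous_on {c..real K} (\<lambda>t. (peak_op (real K) (A \<omega>) t ^^ n) (v p))" for n
          by (induction n) (auto simp: peak_op_def intro!: continuous_intros)
        then show ?thesis unfolding \<phi>_def by (cases "norm (A \<omega>) \<le> real K") (auto intro!: continuous_intros)
      qed
      show "\<phi> K p j (Suc n) t \<omega> \<le> \<phi> K p j n t \<omega>" if \<omega>: "\<omega> \<in> space M" and t: "t \<in> {c..real K}" for t \<omega>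
      proof (cases "norm (A \<omega>) \<le> real K")
        case nK: True
        interpret P: peak "real K" "A \<omega>" t
          using psd[OF \<omega>] K True t nK by unfold_locales (auto simp: psd_op_def)
        show ?thesis using P.norm_T_pow_Suc_le[of n "v p"] nK by (simp add: \<phi>_def)
      qed (simp add: \<phi>_def)
    qed auto
    finally show ?thesis .
  qed
qed

text \<open>Where the largest eigenvalue \<open>l\<close> is positive,
  \<open>is_inv_sqrt_variational\<close> gives the squared norm as a supremum, which a countable
  dense set attains. Where \<open>l = 0\<close>, an eigenvector is annihilated by the shifted
  operator, so no inverse root exists and \<open>inv_sqrt_op\<close> is the constant default
  operator \<open>S0\<close>.\<close>

lemma borel_measurable_norm_inv_sqrt_op:
  fixes A :: "'a \<Rightarrow> 'h::{real_inner,banach,second_countable_topology} \<Rightarrow>\<^sub>L 'h"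
  assumes v: "orthonormal_basis (v :: nat \<Rightarrow> 'h)"
    and A: "\<And>x. (\<lambda>\<omega>. A \<omega> x) \<in> borel_measurable M"
    and psd: "\<And>\<omega>. \<omega> \<in> space M \<Longrightarrow> psd_op (A \<omega>)"
    and ex: "\<And>\<omega>. \<omega> \<in> space M \<Longrightarrow> \<exists>l. is_largest_eigenvalue (A \<omega>) l"
    and y: "y \<in> borel_measurable M"
  shows "(\<lambda>\<omega>. norm (inv_sqrt_op (A \<omega> + largest_eigenvalue (A \<omega>) *\<^sub>R id_blinfun) (y \<omega>))) \<in> borel_measurable M"
proof -
  define l where "l \<omega> = largest_eigenvalue (A \<omega>)" for \<omega>
  define R where "R \<omega> = A \<omega> + l \<omega> *\<^sub>R id_blinfun" for \<omega>
  have l_meas[measurable]: "l \<in> borel_measurable M"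
    unfolding l_def[abs_def] by (rule borel_measurable_largest_eigenvalue[OF v A psd ex])
  have R: "R \<omega> x = A \<omega> x + l \<omega> *\<^sub>R x" for \<omega> x by (simp add: R_def blinfun.bilinear_simps)
  have is_l: "is_largest_eigenvalue (A \<omega>) (l \<omega>)" if "\<omega> \<in> space M" for \<omega>
    unfolding l_def by (rule largest_eigenvalue_is_largest[OF ex[OF that]])
  obtain D :: "'h set" where D: "countable D" "\<And>X. open X \<Longrightarrow> X \<noteq> {} \<Longrightarrow> \<exists>d\<in>D. d \<in> X"
    using countable_dense_setE by metis
  have Dne: "D \<noteq> {}" using D(2)[of UNIV] by auto
  define S0 :: "'h \<Rightarrow>\<^sub>L 'h" where "S0 = (THE S. False)"
  define q where "q x \<omega> = (if l \<omega> > 0 then 2 * inner x (y \<omega>) - inner (R \<omega> x) x else 0)" for x \<omega>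
  have pos: "is_inv_sqrt (R \<omega>) (inv_sqrt_op (R \<omega>))" "psd_op (R \<omega>)" if "\<omega> \<in> space M" "l \<omega> > 0" for \<omega>
  proof -
    have "inner (R \<omega> x) x \<ge> 0" for x
      using psd[OF that(1)] that(2) by (auto simp: psd_op_def R inner_add_left intro!: add_nonneg_nonneg)
    then show psdR: "psd_op (R \<omega>)" using psd[OF that(1)]
      by (simp add: psd_op_def self_adjoint_op_def R inner_add_left inner_add_right)
    show "is_inv_sqrt (R \<omega>) (inv_sqrt_op (R \<omega>))"
    proof (rule is_inv_sqrt_inv_sqrt_op[OF _ that(2)])
      show "l \<omega> * (norm x)\<^sup>2 \<le> inner (R \<omega> x) x" for x
        using psd[OF that(1)] by (simp add: psd_op_def R inner_add_left power2_norm_eq_inner)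
    qed (use psdR in \<open>simp add: psd_op_def\<close>)
  qed
  have q_le: "q x \<omega> \<le> (norm (inv_sqrt_op (R \<omega>) (y \<omega>)))\<^sup>2" if "\<omega> \<in> space M" for x \<omega>
    using is_inv_sqrt_variational(1)[OF pos[OF that]] by (simp add: q_def)
  have bdd: "bdd_above ((\<lambda>x. q x \<omega>) ` D)" if "\<omega> \<in> space M" for \<omega>
    by (rule bdd_aboveI2) (rule q_le[OF that])
  have sq: "(SUP x\<in>D. q x \<omega>) = (norm (inv_sqrt_op (R \<omega>) (y \<omega>)))\<^sup>2" if \<omega>: "\<omega> \<in> space M" "l \<omega> > 0" for \<omega>
  proof (rule antisym)
    show "(SUP x\<in>D. q x \<omega>) \<le> (norm (inv_sqrt_op (R \<omega>) (y \<omega>)))\<^sup>2"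
      by (rule cSUP_least[OF Dne q_le[OF \<omega>(1)]])
    show "(norm (inv_sqrt_op (R \<omega>) (y \<omega>)))\<^sup>2 \<le> (SUP x\<in>D. q x \<omega>)"
    proof (rule field_le_epsilon)
      fix e :: real assume "e > 0"
      let ?S = "inv_sqrt_op (R \<omega>)"
      define f where "f x = 2 * inner x (y \<omega>) - inner (R \<omega> x) x" for x
      have f: "f (?S (?S (y \<omega>))) = (norm (?S (y \<omega>)))\<^sup>2"
        unfolding f_def by (rule is_inv_sqrt_variational(2)[OF pos[OF \<omega>]])
      have "open {x. f x > (norm (?S (y \<omega>)))\<^sup>2 - e}"
        unfolding f_def by (intro open_Collect_less continuous_intros)
      moreover have "?S (?S (y \<omega>)) \<in> {x. f x > (norm (?S (y \<omega>)))\<^sup>2 - e}" using f \<open>e > 0\<close> by simp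
      ultimately obtain d where d: "d \<in> D" "f d > (norm (?S (y \<omega>)))\<^sup>2 - e" using D(2) by blast
      have "q d \<omega> \<le> (SUP x\<in>D. q x \<omega>)" by (rule cSUP_upper[OF d(1) bdd[OF \<omega>(1)]])
      with d \<omega> show "(norm (?S (y \<omega>)))\<^sup>2 \<le> (SUP x\<in>D. q x \<omega>) + e" by (simp add: q_def f_def)
    qed
  qed
  have zero: "inv_sqrt_op (R \<omega>) = S0" if \<omega>: "\<omega> \<in> space M" "\<not> l \<omega> > 0" for \<omega>
  proof -
    obtain x where x: "x \<noteq> 0" "A \<omega> x = l \<omega> *\<^sub>R x" using is_l[OF \<omega>(1)] by (auto simp: is_largest_eigenvalue_def)
    then have "l \<omega> = 0" using psd_eigenvalue_nonneg[OF psd[OF \<omega>(1)] x] \<omega>(2) by simp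
    with x have "R \<omega> x = 0" by (simp add: R)
    then have "\<not> is_inv_sqrt (R \<omega>) S" for S
    proof -
      have "S (S (R \<omega> x)) = 0" using \<open>R \<omega> x = 0\<close> by (simp add: blinfun.zero_right)
      with x(1) show ?thesis by (metis is_inv_sqrt_def)
    qed
    then show ?thesis by (simp add: inv_sqrt_op_eq S0_def)
  qed
  have q_meas: "q x \<in> borel_measurable M" for x
    unfolding q_def[abs_def] R using A[of x] y by measurable
  have [measurable]: "(\<lambda>\<omega>. SUP x\<in>D. q x \<omega>) \<in> borel_measurable M"
    using D(1) q_meas bdd by (intro borel_measurable_cSUP) auto
  have [measurable]: "(\<lambda>\<omega>. S0 (y \<omega>)) \<in> borel_measurable M"
    using y by (rule measurable_compose) (intro borel_measurable_continuous_onI continuous_intros)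
  have "(\<lambda>\<omega>. if l \<omega> > 0 then sqrt (SUP x\<in>D. q x \<omega>) else norm (S0 (y \<omega>))) \<in> borel_measurable M"
    by measurable
  then show ?thesis
    by (rule measurable_cong[THEN iffD1, rotated]) (auto simp: sq zero R_def[symmetric] l_def[symmetric])
qed

section \<open>Characteristic functions of finite-dimensional laws\<close>

lemma iexp_conv: "iexp x = complex_of_real (cos x) + \<i> * complex_of_real (sin x)"
  by (simp add: exp_eq_polar cis.code complex_eq_iff)

lemma integral_iexp_is_normal:
  assumes N: "prob_space N" and Y: "is_normal N Y 0 s2"
  shows "(CLINT \<omega>|N. iexp (Y \<omega>)) = complex_of_real (exp (- s2 / 2))"
proof -
  interpret prob_space N by (rule N)
  have [measurable]: "Y \<in> borel_measurable N" using Y by (simp add: is_normal_def)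
  from Y consider "s2 > 0" "distributed N lborel Y (normal_density 0 (sqrt s2))"
    | "s2 = 0" "AE \<omega> in N. Y \<omega> = 0" by (auto simp: is_normal_def)
  then show ?thesis
  proof cases
    case 1
    define \<sigma> where "\<sigma> = sqrt s2"
    have \<sigma>: "\<sigma> > 0" "\<sigma>\<^sup>2 = s2" using 1 by (auto simp: \<sigma>_def)
    have "distributed N lborel (\<lambda>x. (Y x - 0) / \<sigma>) std_normal_density"
      using normal_standard_normal_convert[OF \<sigma>(1)] 1 by (simp add: \<sigma>_def)
    then have "distributed N lborel (\<lambda>x. Y x / \<sigma>) std_normal_density" by simp
    from distributed_distr_eq_density[OF this]
    have d: "distr N borel (\<lambda>x. Y x / \<sigma>) = std_normal_distribution"
      by (simp add: distr_cong[OF refl sets_lborel[symmetric]])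
    have "(CLINT \<omega>|N. iexp (Y \<omega>)) = (CLINT \<omega>|N. iexp (\<sigma> * (Y \<omega> / \<sigma>)))"
      using \<sigma> by simp
    also have "\<dots> = char (distr N borel (\<lambda>x. Y x / \<sigma>)) \<sigma>"
      unfolding char_def by (subst integral_distr) auto
    also have "\<dots> = complex_of_real (exp (- s2 / 2))"
      unfolding d char_std_normal_distribution using \<sigma> by simp
    finally show ?thesis .
  next
    case 2
    have "(CLINT \<omega>|N. iexp (Y \<omega>)) = (CLINT \<omega>|N. 1)"
      by (rule integral_cong_AE) (use 2 in auto)
    then show ?thesis using 2 by (simp add: prob_space)
  qed
qed

text \<open>Reduction to Levy uniqueness for probability measures: the value at \<open>t = 0\<close>
  shows that the total masses agree, and both measures are divided by this mass unless it is
  zero.\<close>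

lemma finite_measure_eqI_char:
  fixes M1 M2 :: "real measure"
  assumes fin: "finite_measure M1" "finite_measure M2"
    and sets: "sets M1 = sets borel" "sets M2 = sets borel"
    and eq: "\<And>t. (CLINT x|M1. iexp (t * x)) = (CLINT x|M2. iexp (t * x))"
  shows "M1 = M2"
proof -
  interpret M1: finite_measure M1 by (rule fin)
  interpret M2: finite_measure M2 by (rule fin)
  have sp: "space M1 = UNIV" "space M2 = UNIV"
    using sets_eq_imp_space_eq[OF sets(1)] sets_eq_imp_space_eq[OF sets(2)] by simp_all
  define m where "m = measure M1 UNIV"
  have m1: "emeasure M1 UNIV = ennreal m" by (simp add: m_def M1.emeasure_eq_measure)
  have "complex_of_real (measure M1 (space M1)) = complex_of_real (measure M2 (space M2))"
    using eq[of 0] by (simp add: sp)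
  then have m2: "emeasure M2 UNIV = ennreal m" by (simp add: m_def M2.emeasure_eq_measure sp)
  show ?thesis
  proof (cases "m = 0")
    case True
    have "emeasure M1 A = emeasure M2 A" for A
      using m1 m2 True emeasure_mono[of A UNIV M1] emeasure_mono[of A UNIV M2] sets by auto
    then show ?thesis by (intro measure_eqI) (use sets in auto)
  next
    case False
    then have m: "m > 0" by (simp add: m_def less_le measure_nonneg)
    define r where "r = ennreal (1 / m)"
    have r: "r * ennreal m = 1" using m by (simp add: r_def ennreal_mult[symmetric])
    have pr: "prob_space (scale_measure r M1)" "prob_space (scale_measure r M2)"
      using r m1 m2 sp by (auto intro!: prob_spaceI simp: space_scale_measure)
    have rd: "real_distribution (scale_measure r M1)" "real_distribution (scale_measure r M2)"
      using pr sets by (auto simp: real_distribution_def real_distribution_axioms_def space_scale_measure sp)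
    have int: "(CLINT x|scale_measure r M. f x) = (1 / m) *\<^sub>R (CLINT x|M. f x)"
      if "sets M = sets borel" "f \<in> borel_measurable borel" for M :: "real measure" and f :: "real \<Rightarrow> complex"
    proof -
      have "scale_measure r M = density M (\<lambda>_. r)"
        by (rule measure_eqI) (auto simp: emeasure_density_const)
      then show ?thesis using that m
        by (simp add: r_def integral_density measurable_cong_sets[OF that(1) refl])
    qed
    have "char (scale_measure r M1) = char (scale_measure r M2)"
    proof (unfold char_def, rule ext)
      fix t :: real
      have m: "(\<lambda>x. iexp (t * x)) \<in> borel_measurable borel" by measurable
      show "(CLINT x|scale_measure r M1. iexp (t * x)) = (CLINT x|scale_measure r M2. iexp (t * x))"
        unfolding int[OF sets(1) m] int[OF sets(2) m] eq ..
    qed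
    from Levy_uniqueness[OF rd this] have e: "emeasure (scale_measure r M1) A = emeasure (scale_measure r M2) A" for A by simp
    have "emeasure M1 A = emeasure M2 A" for A
    proof -
      have "r * emeasure M1 A = r * emeasure M2 A" using e[of A] by simp
      then have "ennreal m * (r * emeasure M1 A) = ennreal m * (r * emeasure M2 A)" by simp
      then show ?thesis using r by (simp add: mult.assoc[symmetric] mult.commute[of "ennreal m"])
    qed
    then show ?thesis by (intro measure_eqI) (use sets in auto)
  qed
qed

lemma (in finite_measure) integrable_iexp_fun:
  "f \<in> borel_measurable M \<Longrightarrow> integrable M (\<lambda>x. iexp (f x))"
  by (rule integrable_const_bound[of _ 1]) auto

lemma finite_measure_density_one_plus:
  fixes k :: "real \<Rightarrow> real"
  assumes P: "finite_measure P" and [measurable]: "g \<in> borel_measurable P" "k \<in> borel_measurable borel"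
    and kb: "\<And>x. \<bar>k x\<bar> \<le> 1"
  shows "finite_measure (density P (\<lambda>\<omega>. ennreal (1 + k (g \<omega>))))"
proof (rule finite_measureI)
  interpret P: finite_measure P by (rule P)
  have "(\<integral>\<^sup>+\<omega>. ennreal (1 + k (g \<omega>)) \<partial>P) \<le> (\<integral>\<^sup>+\<omega>. 2 \<partial>P)"
  proof (rule nn_integral_mono)
    fix \<omega>
    have "1 + k (g \<omega>) \<le> 2" using kb[of "g \<omega>"] by linarith
    then have "ennreal (1 + k (g \<omega>)) \<le> ennreal 2" by (rule ennreal_leI)
    then show "ennreal (1 + k (g \<omega>)) \<le> 2" by simp
  qed
  also have "\<dots> < \<infinity>" by (simp add: P.emeasure_eq_measure ennreal_mult_less_top)
  finally show "emeasure (density P (\<lambda>\<omega>. ennreal (1 + k (g \<omega>)))) (space (density P (\<lambda>\<omega>. ennreal (1 + k (g \<omega>))))) \<noteq> \<infinity>"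
    by (simp add: emeasure_density cong: nn_integral_cong)
qed

text \<open>Since \<open>k\<close> is a combination of the exponentials of frequency 1 and -1,
  reweighting by \<open>1 + k (g)\<close> only shifts frequencies: joint characteristic functions of
  \<open>g\<close> and \<open>Y\<close> determine the law of \<open>Y\<close> under the new
  density.\<close>

lemma integral_iexp_density_one_plus:
  fixes k :: "real \<Rightarrow> real" and a b :: complex
  assumes P: "finite_measure P" and g[measurable]: "g \<in> borel_measurable P" and Y[measurable]: "Y \<in> borel_measurable P"
    and [measurable]: "k \<in> borel_measurable borel" and kb: "\<And>x. \<bar>k x\<bar> \<le> 1"
    and ab: "\<And>x. complex_of_real (k x) = a * iexp (1 * x) + b * iexp ((-1) * x)"
  shows "(CLINT x|distr (density P (\<lambda>\<omega>. ennreal (1 + k (g \<omega>)))) borel Y. iexp (\<theta> * x)) =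
    (CLINT \<omega>|P. iexp (0 * g \<omega> + \<theta> * Y \<omega>)) + a * (CLINT \<omega>|P. iexp (1 * g \<omega> + \<theta> * Y \<omega>)) + b * (CLINT \<omega>|P. iexp ((-1) * g \<omega> + \<theta> * Y \<omega>))"
proof -
  interpret P: finite_measure P by (rule P)
  have k0: "0 \<le> 1 + k x" for x using kb[of x] by linarith
  have int: "integrable P (\<lambda>\<omega>. iexp (s * g \<omega> + \<theta> * Y \<omega>))" for s
    by (rule P.integrable_iexp_fun) measurable
  have "(CLINT x|distr (density P (\<lambda>\<omega>. ennreal (1 + k (g \<omega>)))) borel Y. iexp (\<theta> * x)) =
    (CLINT \<omega>|density P (\<lambda>\<omega>. ennreal (1 + k (g \<omega>))). iexp (\<theta> * Y \<omega>))"
    by (rule integral_distr) measurable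
  also have "\<dots> = (CLINT \<omega>|P. (1 + k (g \<omega>)) *\<^sub>R iexp (\<theta> * Y \<omega>))"
    by (rule integral_density) (use k0 in auto)
  also have "\<dots> = (CLINT \<omega>|P. iexp (0 * g \<omega> + \<theta> * Y \<omega>) + (a * iexp (1 * g \<omega> + \<theta> * Y \<omega>) + b * iexp ((-1) * g \<omega> + \<theta> * Y \<omega>)))"
  proof (rule Bochner_Integration.integral_cong[OF refl])
    fix \<omega>
    have 1: "iexp (s * g \<omega> + \<theta> * Y \<omega>) = iexp (s * g \<omega>) * iexp (\<theta> * Y \<omega>)" for s
      by (simp add: exp_add[symmetric] algebra_simps)
    have "(1 + k (g \<omega>)) *\<^sub>R iexp (\<theta> * Y \<omega>) = (1 + complex_of_real (k (g \<omega>))) * iexp (\<theta> * Y \<omega>)"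
      by (simp add: scaleR_conv_of_real)
    also have "\<dots> = iexp (0 * g \<omega>) * iexp (\<theta> * Y \<omega>) + (a * (iexp (1 * g \<omega>) * iexp (\<theta> * Y \<omega>)) + b * (iexp ((-1) * g \<omega>) * iexp (\<theta> * Y \<omega>)))"
      unfolding ab by (simp add: algebra_simps)
    finally show "(1 + k (g \<omega>)) *\<^sub>R iexp (\<theta> * Y \<omega>) =
        iexp (0 * g \<omega> + \<theta> * Y \<omega>) + (a * iexp (1 * g \<omega> + \<theta> * Y \<omega>) + b * iexp ((-1) * g \<omega> + \<theta> * Y \<omega>))"
      unfolding 1 .
  qed
  also have "\<dots> = (CLINT \<omega>|P. iexp (0 * g \<omega> + \<theta> * Y \<omega>)) + (CLINT \<omega>|P. a * iexp (1 * g \<omega> + \<theta> * Y \<omega>) + b * iexp ((-1) * g \<omega> + \<theta> * Y \<omega>))"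
    by (intro Bochner_Integration.integral_add Bochner_Integration.integrable_add integrable_mult_right int)
  also have "(CLINT \<omega>|P. a * iexp (1 * g \<omega> + \<theta> * Y \<omega>) + b * iexp ((-1) * g \<omega> + \<theta> * Y \<omega>)) =
    (CLINT \<omega>|P. a * iexp (1 * g \<omega> + \<theta> * Y \<omega>)) + (CLINT \<omega>|P. b * iexp ((-1) * g \<omega> + \<theta> * Y \<omega>))"
    by (intro Bochner_Integration.integral_add integrable_mult_right int)
  finally show ?thesis by (simp only: integral_mult_right_zero add.assoc)
qed

lemma measure_distr_density_one_plus:
  fixes k :: "real \<Rightarrow> real"
  assumes [measurable]: "g \<in> borel_measurable P" "Y \<in> borel_measurable P" "k \<in> borel_measurable borel" "B \<in> sets borel"
    and kb: "\<And>x. \<bar>k x\<bar> \<le> 1"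
  shows "measure (distr (density P (\<lambda>\<omega>. ennreal (1 + k (g \<omega>)))) borel Y) B =
    (LINT \<omega>|P. (1 + k (g \<omega>)) * indicator B (Y \<omega>))"
proof -
  have k0: "0 \<le> 1 + k x" for x using kb[of x] by linarith
  have "measure (distr (density P (\<lambda>\<omega>. ennreal (1 + k (g \<omega>)))) borel Y) B =
    (LINT x|distr (density P (\<lambda>\<omega>. ennreal (1 + k (g \<omega>)))) borel Y. indicator B x)" by simp
  also have "\<dots> = (LINT \<omega>|density P (\<lambda>\<omega>. ennreal (1 + k (g \<omega>))). indicator B (Y \<omega>))"
    by (rule integral_distr) measurable
  also have "\<dots> = (LINT \<omega>|P. (1 + k (g \<omega>)) *\<^sub>R indicator B (Y \<omega>))"
    by (rule integral_density) (use k0 in auto)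
  finally show ?thesis by simp
qed

lemma integral_mult_iexp_split:
  assumes P: "finite_measure P" and [measurable]: "g \<in> borel_measurable P" "i \<in> borel_measurable P"
    and i: "\<And>\<omega>. \<bar>i \<omega>\<bar> \<le> (1::real)"
  shows "(CLINT \<omega>|P. complex_of_real (i \<omega>) * iexp (g \<omega>)) =
    complex_of_real (LINT \<omega>|P. cos (g \<omega>) * i \<omega>) + \<i> * complex_of_real (LINT \<omega>|P. sin (g \<omega>) * i \<omega>)"
proof -
  interpret P: finite_measure P by (rule P)
  have 1: "integrable P (\<lambda>\<omega>. cos (g \<omega>) * i \<omega>)" "integrable P (\<lambda>\<omega>. sin (g \<omega>) * i \<omega>)"
    by (rule P.integrable_const_bound[of _ 1], auto simp: abs_mult intro!: mult_le_one i)+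
  have "(CLINT \<omega>|P. complex_of_real (i \<omega>) * iexp (g \<omega>)) =
    (CLINT \<omega>|P. complex_of_real (cos (g \<omega>) * i \<omega>) + \<i> * complex_of_real (sin (g \<omega>) * i \<omega>))"
    by (rule Bochner_Integration.integral_cong) (simp_all only: iexp_conv of_real_mult algebra_simps)
  also have "\<dots> = (CLINT \<omega>|P. complex_of_real (cos (g \<omega>) * i \<omega>)) + (CLINT \<omega>|P. \<i> * complex_of_real (sin (g \<omega>) * i \<omega>))"
    using 1 by (intro Bochner_Integration.integral_add integrable_mult_right integrable_of_real)
  finally show ?thesis by (simp only: integral_complex_of_real integral_mult_right_zero)
qed

text \<open>Moves the constraint on coordinate \<open>j\<close> into the measure, so that an
  induction over coordinates can remove it.\<close>

lemma measure_density_indicator_box: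
  assumes I: "finite I" and Y: "\<And>i. i \<in> insert j I \<Longrightarrow> Y i \<in> borel_measurable P"
    and A: "\<And>i. i \<in> insert j I \<Longrightarrow> A i \<in> sets borel"
  shows "measure (density P (\<lambda>\<omega>. ennreal (indicator (A j) (Y j \<omega>)))) {\<omega>\<in>space P. \<forall>i\<in>I. Y i \<omega> \<in> A i}
    = measure P {\<omega>\<in>space P. \<forall>i\<in>insert j I. Y i \<omega> \<in> A i}"
proof -
  have [measurable]: "Y j \<in> borel_measurable P" "A j \<in> sets borel" using Y A by simp_all
  have S: "{\<omega>\<in>space P. \<forall>i\<in>I. Y i \<omega> \<in> A i} \<in> sets P"
  proof (rule sets.sets_Collect_finite_All[OF _ I])
    fix i assume "i \<in> I"
    then have [measurable]: "Y i \<in> borel_measurable P" "A i \<in> sets borel" using Y A by auto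
    show "{\<omega>\<in>space P. Y i \<omega> \<in> A i} \<in> sets P" by measurable
  qed
  have J: "{\<omega>\<in>space P. Y j \<omega> \<in> A j} \<in> sets P" by measurable
  have "emeasure (density P (\<lambda>\<omega>. ennreal (indicator (A j) (Y j \<omega>)))) {\<omega>\<in>space P. \<forall>i\<in>I. Y i \<omega> \<in> A i}
    = (\<integral>\<^sup>+\<omega>. ennreal (indicator (A j) (Y j \<omega>)) * indicator {\<omega>\<in>space P. \<forall>i\<in>I. Y i \<omega> \<in> A i} \<omega> \<partial>P)"
    using S by (intro emeasure_density) auto
  also have "\<dots> = (\<integral>\<^sup>+\<omega>. indicator ({\<omega>\<in>space P. Y j \<omega> \<in> A j} \<inter> {\<omega>\<in>space P. \<forall>i\<in>I. Y i \<omega> \<in> A i}) \<omega> \<partial>P)"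
    by (intro nn_integral_cong) (auto simp: indicator_def)
  also have "\<dots> = emeasure P ({\<omega>\<in>space P. Y j \<omega> \<in> A j} \<inter> {\<omega>\<in>space P. \<forall>i\<in>I. Y i \<omega> \<in> A i})"
    using S J by (intro nn_integral_indicator) auto
  also have "{\<omega>\<in>space P. Y j \<omega> \<in> A j} \<inter> {\<omega>\<in>space P. \<forall>i\<in>I. Y i \<omega> \<in> A i} = {\<omega>\<in>space P. \<forall>i\<in>insert j I. Y i \<omega> \<in> A i}" by auto
  finally show ?thesis by (simp add: measure_def)
qed

lemma finite_measure_density_indicator:
  assumes P: "finite_measure P" and [measurable]: "Y \<in> borel_measurable P" "B \<in> sets borel"
  shows "finite_measure (density P (\<lambda>\<omega>. ennreal (indicator B (Y \<omega>))))"
proof (rule finite_measureI)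
  interpret P: finite_measure P by (rule P)
  have "(\<integral>\<^sup>+\<omega>. ennreal (indicator B (Y \<omega>)) \<partial>P) \<le> (\<integral>\<^sup>+\<omega>. 1 \<partial>P)"
    by (rule nn_integral_mono) (simp add: indicator_def)
  also have "\<dots> < \<infinity>" by (simp add: P.emeasure_eq_measure)
  finally show "emeasure (density P (\<lambda>\<omega>. ennreal (indicator B (Y \<omega>)))) (space (density P (\<lambda>\<omega>. ennreal (indicator B (Y \<omega>))))) \<noteq> \<infinity>"
    by (simp add: emeasure_density cong: nn_integral_cong)
qed

text \<open>Conditioning on one coordinate at a time: the densities \<open>1 + cos\<close> and \<open>1 + sin\<close> of linear
  forms in the other coordinates are nonnegative, so the one-dimensional theorem applies.\<close>
lemma finite_measure_box_eqI_char:
  assumes "finite I"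
  shows "finite_measure M \<Longrightarrow> finite_measure N \<Longrightarrow>
    (\<And>i. i \<in> I \<Longrightarrow> U i \<in> borel_measurable M) \<Longrightarrow> (\<And>i. i \<in> I \<Longrightarrow> U' i \<in> borel_measurable N) \<Longrightarrow>
    (\<And>c. (CLINT \<omega>|M. iexp (\<Sum>i\<in>I. c i * U i \<omega>)) = (CLINT \<omega>|N. iexp (\<Sum>i\<in>I. c i * U' i \<omega>))) \<Longrightarrow>
    (\<And>i. i \<in> I \<Longrightarrow> A i \<in> sets borel) \<Longrightarrow>
    measure M {\<omega>\<in>space M. \<forall>i\<in>I. U i \<omega> \<in> A i} = measure N {\<omega>\<in>space N. \<forall>i\<in>I. U' i \<omega> \<in> A i}"
  using assms
proof (induction I arbitrary: M N rule: finite_induct)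
  case empty
  interpret M: finite_measure M by (rule empty)
  interpret N: finite_measure N by (rule empty)
  have "complex_of_real (measure M (space M)) = complex_of_real (measure N (space N))"
    using empty(5)[of "\<lambda>_. 0"] by simp
  then show ?case by simp
next
  case (insert j I)
  interpret M: finite_measure M by (rule insert)
  interpret N: finite_measure N by (rule insert)
  have [measurable]: "U j \<in> borel_measurable M" "U' j \<in> borel_measurable N" "A j \<in> sets borel"
    using insert.prems by auto
  have mU: "U i \<in> borel_measurable M" "U' i \<in> borel_measurable N" if "i \<in> I" for i
    using insert.prems that by auto
  define \<alpha> where "\<alpha> c \<omega> = (\<Sum>i\<in>I. c i * U i \<omega>)" for c \<omega>
  define \<alpha>' where "\<alpha>' c \<omega> = (\<Sum>i\<in>I. c i * U' i \<omega>)" for c \<omega>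
  have [measurable]: "\<alpha> c \<in> borel_measurable M" "\<alpha>' c \<in> borel_measurable N" for c
    unfolding \<alpha>_def[abs_def] \<alpha>'_def[abs_def] using mU by measurable
  have joint: "(CLINT \<omega>|M. iexp (s * \<alpha> c \<omega> + \<theta> * U j \<omega>)) = (CLINT \<omega>|N. iexp (s * \<alpha>' c \<omega> + \<theta> * U' j \<omega>))" for s \<theta> c
  proof -
    have "(\<Sum>i\<in>insert j I. (if i = j then \<theta> else s * c i) * W i) = s * (\<Sum>i\<in>I. c i * W i) + \<theta> * W j" for W :: "_ \<Rightarrow> real"
    proof -
      have "(\<Sum>i\<in>I. (if i = j then \<theta> else s * c i) * W i) = (\<Sum>i\<in>I. s * (c i * W i))"
        using insert.hyps by (intro sum.cong) auto
      then show ?thesis using insert.hyps by (simp add: sum_distrib_left)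
    qed
    from insert.prems(5)[of "\<lambda>i. if i = j then \<theta> else s * c i", unfolded this] show ?thesis
      by (simp add: \<alpha>_def \<alpha>'_def)
  qed
  let ?IM = "\<lambda>\<omega>. indicator (A j) (U j \<omega>) :: real" and ?IN = "\<lambda>\<omega>. indicator (A j) (U' j \<omega>) :: real"
  \<comment> \<open>The one-dimensional theorem for the law of \<open>U j\<close> under the density
    \<open>1 + k\<close>. The case \<open>k = 0\<close> provides the constant part that
    \<open>core2\<close> subtracts.\<close>
  have core: "(LINT \<omega>|M. (1 + k (\<alpha> c \<omega>)) * ?IM \<omega>) = (LINT \<omega>|N. (1 + k (\<alpha>' c \<omega>)) * ?IN \<omega>)"
    if k: "k = (\<lambda>x. cos x) \<or> k = (\<lambda>x. sin x) \<or> k = (\<lambda>x. 0)" for k :: "real \<Rightarrow> real" and c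
  proof -
    have [measurable]: "k \<in> borel_measurable borel" using k by auto
    have kb: "\<bar>k x\<bar> \<le> 1" for x using k by auto
    obtain a b :: complex where ab: "\<And>x. complex_of_real (k x) = a * iexp (1 * x) + b * iexp ((-1) * x)"
    proof -
      have e: "iexp (1 * x) = complex_of_real (cos x) + \<i> * complex_of_real (sin x)"
        "iexp ((-1) * x) = complex_of_real (cos x) - \<i> * complex_of_real (sin x)" for x
        by (subst iexp_conv, simp)+
      consider "k = (\<lambda>x. cos x)" | "k = (\<lambda>x. sin x)" | "k = (\<lambda>x. 0)" using k by blast
      then show ?thesis
      proof cases
        case 1
        show ?thesis by (rule that[of "1/2" "1/2"]) (simp only: 1 e, simp add: field_simps)
      next
        case 2
        show ?thesis by (rule that[of "-\<i>/2" "\<i>/2"]) (simp only: 2 e, simp add: field_simps)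
      next
        case 3
        show ?thesis by (rule that[of 0 0]) (simp add: 3)
      qed
    qed
    define DM where "DM = distr (density M (\<lambda>\<omega>. ennreal (1 + k (\<alpha> c \<omega>)))) borel (U j)"
    define DN where "DN = distr (density N (\<lambda>\<omega>. ennreal (1 + k (\<alpha>' c \<omega>)))) borel (U' j)"
    have "DM = DN"
    proof (rule finite_measure_eqI_char)
      show "finite_measure DM" unfolding DM_def
        by (intro finite_measure.finite_measure_distr finite_measure_density_one_plus M.finite_measure_axioms kb) measurable
      show "finite_measure DN" unfolding DN_def
        by (intro finite_measure.finite_measure_distr finite_measure_density_one_plus N.finite_measure_axioms kb) measurable
      show "sets DM = sets borel" "sets DN = sets borel" by (simp_all add: DM_def DN_def)
      fix \<theta>
      have "(CLINT x|DM. iexp (\<theta> * x)) = (CLINT \<omega>|M. iexp (0 * \<alpha> c \<omega> + \<theta> * U j \<omega>)) +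
          a * (CLINT \<omega>|M. iexp (1 * \<alpha> c \<omega> + \<theta> * U j \<omega>)) + b * (CLINT \<omega>|M. iexp ((-1) * \<alpha> c \<omega> + \<theta> * U j \<omega>))"
        unfolding DM_def by (intro integral_iexp_density_one_plus M.finite_measure_axioms kb ab) measurable
      also have "\<dots> = (CLINT \<omega>|N. iexp (0 * \<alpha>' c \<omega> + \<theta> * U' j \<omega>)) +
          a * (CLINT \<omega>|N. iexp (1 * \<alpha>' c \<omega> + \<theta> * U' j \<omega>)) + b * (CLINT \<omega>|N. iexp ((-1) * \<alpha>' c \<omega> + \<theta> * U' j \<omega>))"
        by (simp only: joint)
      also have "\<dots> = (CLINT x|DN. iexp (\<theta> * x))"
        unfolding DN_def by (intro integral_iexp_density_one_plus[symmetric] N.finite_measure_axioms kb ab) measurable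
      finally show "(CLINT x|DM. iexp (\<theta> * x)) = (CLINT x|DN. iexp (\<theta> * x))" .
    qed
    then have "measure DM (A j) = measure DN (A j)" by simp
    then show ?thesis unfolding DM_def DN_def
      by (subst (asm) (1 2) measure_distr_density_one_plus) (auto intro: kb)
  qed
  have intM: "integrable M (\<lambda>\<omega>. f \<omega> * ?IM \<omega>)" if "f \<in> borel_measurable M" "\<And>x. \<bar>f x\<bar> \<le> 1" for f
    using that by (intro M.integrable_const_bound[of _ 1]) (auto simp: indicator_def)
  have intN: "integrable N (\<lambda>\<omega>. f \<omega> * ?IN \<omega>)" if "f \<in> borel_measurable N" "\<And>x. \<bar>f x\<bar> \<le> 1" for f
    using that by (intro N.integrable_const_bound[of _ 1]) (auto simp: indicator_def)
  have core2: "(LINT \<omega>|M. k (\<alpha> c \<omega>) * ?IM \<omega>) = (LINT \<omega>|N. k (\<alpha>' c \<omega>) * ?IN \<omega>)"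
    if k: "k = (\<lambda>x. cos x) \<or> k = (\<lambda>x. sin x)" for k :: "real \<Rightarrow> real" and c
  proof -
    have [measurable]: "k \<in> borel_measurable borel" and kb: "\<bar>k x\<bar> \<le> 1" for x using k by auto
    have "(LINT \<omega>|M. (1 + k (\<alpha> c \<omega>)) * ?IM \<omega>) = (LINT \<omega>|M. 1 * ?IM \<omega>) + (LINT \<omega>|M. k (\<alpha> c \<omega>) * ?IM \<omega>)"
      unfolding distrib_right
      by (rule Bochner_Integration.integral_add; rule intM) (auto simp: kb)
    moreover have "(LINT \<omega>|N. (1 + k (\<alpha>' c \<omega>)) * ?IN \<omega>) = (LINT \<omega>|N. 1 * ?IN \<omega>) + (LINT \<omega>|N. k (\<alpha>' c \<omega>) * ?IN \<omega>)"
      unfolding distrib_right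
      by (rule Bochner_Integration.integral_add; rule intN) (auto simp: kb)
    moreover have "(LINT \<omega>|M. 1 * ?IM \<omega>) = (LINT \<omega>|N. 1 * ?IN \<omega>)"
      using core[of "\<lambda>x. 0" c] by simp
    ultimately show ?thesis using core[of k c] k by linarith
  qed
  \<comment> \<open>Restriction to the event of coordinate \<open>j\<close> destroys normalization,
    which is why the induction runs over finite measures. By \<open>core2\<close> the remaining
    coordinates have equal characteristic functions under \<open>MA\<close> and
    \<open>NA\<close>.\<close>
  define MA where "MA = density M (\<lambda>\<omega>. ennreal (?IM \<omega>))"
  define NA where "NA = density N (\<lambda>\<omega>. ennreal (?IN \<omega>))"
  have fin: "finite_measure MA" "finite_measure NA"
    unfolding MA_def NA_def
    by (rule finite_measure_density_indicator; simp add: M.finite_measure_axioms N.finite_measure_axioms)+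
  have "measure MA {\<omega>\<in>space MA. \<forall>i\<in>I. U i \<omega> \<in> A i} = measure NA {\<omega>\<in>space NA. \<forall>i\<in>I. U' i \<omega> \<in> A i}"
  proof (rule insert.IH[OF fin])
    fix c
    have "(CLINT \<omega>|MA. iexp (\<Sum>i\<in>I. c i * U i \<omega>)) = (CLINT \<omega>|M. complex_of_real (?IM \<omega>) * iexp (\<alpha> c \<omega>))"
      unfolding MA_def \<alpha>_def[symmetric] by (subst integral_density) (auto simp: scaleR_conv_of_real)
    also have "\<dots> = (CLINT \<omega>|N. complex_of_real (?IN \<omega>) * iexp (\<alpha>' c \<omega>))"
    proof -
      have i1: "\<bar>indicator B x :: real\<bar> \<le> 1" for B and x :: real by (simp add: indicator_def)
      have "(CLINT \<omega>|M. complex_of_real (?IM \<omega>) * iexp (\<alpha> c \<omega>)) =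
        complex_of_real (LINT \<omega>|M. cos (\<alpha> c \<omega>) * ?IM \<omega>) + \<i> * complex_of_real (LINT \<omega>|M. sin (\<alpha> c \<omega>) * ?IM \<omega>)"
        by (intro integral_mult_iexp_split M.finite_measure_axioms i1) measurable
      also have "\<dots> = complex_of_real (LINT \<omega>|N. cos (\<alpha>' c \<omega>) * ?IN \<omega>) + \<i> * complex_of_real (LINT \<omega>|N. sin (\<alpha>' c \<omega>) * ?IN \<omega>)"
        using core2[of "\<lambda>x. cos x" c] core2[of "\<lambda>x. sin x" c] by simp
      also have "\<dots> = (CLINT \<omega>|N. complex_of_real (?IN \<omega>) * iexp (\<alpha>' c \<omega>))"
        by (intro integral_mult_iexp_split[symmetric] N.finite_measure_axioms i1) measurable
      finally show ?thesis .
    qed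
    also have "\<dots> = (CLINT \<omega>|NA. iexp (\<Sum>i\<in>I. c i * U' i \<omega>))"
      unfolding NA_def \<alpha>'_def[symmetric] by (subst integral_density) (auto simp: scaleR_conv_of_real)
    finally show "(CLINT \<omega>|MA. iexp (\<Sum>i\<in>I. c i * U i \<omega>)) = (CLINT \<omega>|NA. iexp (\<Sum>i\<in>I. c i * U' i \<omega>))" .
  qed (use insert.prems in \<open>auto simp: MA_def NA_def\<close>)
  moreover have "measure MA {\<omega>\<in>space M. \<forall>i\<in>I. U i \<omega> \<in> A i} = measure M {\<omega>\<in>space M. \<forall>i\<in>insert j I. U i \<omega> \<in> A i}"
    unfolding MA_def using insert.hyps(1) insert.prems(3,6) by (rule measure_density_indicator_box)
  moreover have "measure NA {\<omega>\<in>space N. \<forall>i\<in>I. U' i \<omega> \<in> A i} = measure N {\<omega>\<in>space N. \<forall>i\<in>insert j I. U' i \<omega> \<in> A i}"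
    unfolding NA_def using insert.hyps(1) insert.prems(4,6) by (rule measure_density_indicator_box)
  moreover have "space MA = space M" "space NA = space N" by (simp_all add: MA_def NA_def)
  ultimately show ?case by simp
qed

lemma distr_eqI_char:
  assumes M: "prob_space M" and N: "prob_space N" and I: "finite I"
    and U: "\<And>i. i \<in> I \<Longrightarrow> U i \<in> borel_measurable M" and U': "\<And>i. i \<in> I \<Longrightarrow> U' i \<in> borel_measurable N"
    and eq: "\<And>c. (CLINT \<omega>|M. iexp (\<Sum>i\<in>I. c i * U i \<omega>)) = (CLINT \<omega>|N. iexp (\<Sum>i\<in>I. c i * U' i \<omega>))"
  shows "distr M (PiM I (\<lambda>_. borel)) (\<lambda>\<omega>. \<lambda>i\<in>I. U i \<omega>) = distr N (PiM I (\<lambda>_. borel)) (\<lambda>\<omega>. \<lambda>i\<in>I. U' i \<omega>)"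
    (is "?P = ?Q")
proof -
  interpret M: prob_space M by (rule M)
  interpret N: prob_space N by (rule N)
  have m: "(\<lambda>\<omega>. \<lambda>i\<in>I. U i \<omega>) \<in> measurable M (PiM I (\<lambda>_. borel))"
    "(\<lambda>\<omega>. \<lambda>i\<in>I. U' i \<omega>) \<in> measurable N (PiM I (\<lambda>_. borel))"
    using U U' by (auto intro!: measurable_restrict)
  show ?thesis
  proof (rule measure_eqI_PiM_finite[OF I])
    fix A :: "_ \<Rightarrow> real set" assume A: "\<And>i. i \<in> I \<Longrightarrow> A i \<in> sets borel"
    have B: "Pi\<^sub>E I A \<in> sets (PiM I (\<lambda>_. borel))" using I A by (intro sets_PiM_I_finite) auto
    have v: "(\<lambda>\<omega>. \<lambda>i\<in>I. U i \<omega>) -` Pi\<^sub>E I A \<inter> space M = {\<omega>\<in>space M. \<forall>i\<in>I. U i \<omega> \<in> A i}"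
      "(\<lambda>\<omega>. \<lambda>i\<in>I. U' i \<omega>) -` Pi\<^sub>E I A \<inter> space N = {\<omega>\<in>space N. \<forall>i\<in>I. U' i \<omega> \<in> A i}"
      by (auto simp: PiE_iff)
    have "measure M {\<omega>\<in>space M. \<forall>i\<in>I. U i \<omega> \<in> A i} = measure N {\<omega>\<in>space N. \<forall>i\<in>I. U' i \<omega> \<in> A i}"
      by (rule finite_measure_box_eqI_char[OF I M.finite_measure_axioms N.finite_measure_axioms U U' eq A])
    then show "emeasure ?P (Pi\<^sub>E I A) = emeasure ?Q (Pi\<^sub>E I A)"
      by (simp add: emeasure_distr[OF m(1) B] emeasure_distr[OF m(2) B] v M.emeasure_eq_measure N.emeasure_eq_measure)
  next
    show "range (\<lambda>_::nat. space (PiM I (\<lambda>_. borel :: real measure))) \<subseteq> prod_algebra I (\<lambda>_. borel)"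
      using prod_algebraI_finite[OF I, of "\<lambda>_. UNIV" "\<lambda>_. borel"] by (auto simp: space_PiM)
    show "emeasure ?P (space (PiM I (\<lambda>_. borel))) \<noteq> \<infinity>"
      using m(1) by (simp add: emeasure_distr M.emeasure_eq_measure)
  qed auto
qed

corollary integral_eqI_char:
  fixes F :: "('i \<Rightarrow> real) \<Rightarrow> real"
  assumes "prob_space M" "prob_space N" "finite I"
    and U: "\<And>i. i \<in> I \<Longrightarrow> U i \<in> borel_measurable M" and U': "\<And>i. i \<in> I \<Longrightarrow> U' i \<in> borel_measurable N"
    and "\<And>c. (CLINT \<omega>|M. iexp (\<Sum>i\<in>I. c i * U i \<omega>)) = (CLINT \<omega>|N. iexp (\<Sum>i\<in>I. c i * U' i \<omega>))"
    and F: "F \<in> borel_measurable (PiM I (\<lambda>_. borel))"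
  shows "(LINT \<omega>|M. F (\<lambda>i\<in>I. U i \<omega>)) = (LINT \<omega>|N. F (\<lambda>i\<in>I. U' i \<omega>))"
proof -
  have m: "(\<lambda>\<omega>. \<lambda>i\<in>I. U i \<omega>) \<in> measurable M (PiM I (\<lambda>_. borel))"
    "(\<lambda>\<omega>. \<lambda>i\<in>I. U' i \<omega>) \<in> measurable N (PiM I (\<lambda>_. borel))"
    using U U' by (auto intro!: measurable_restrict)
  have "(LINT \<omega>|M. F (\<lambda>i\<in>I. U i \<omega>)) = integral\<^sup>L (distr M (PiM I (\<lambda>_. borel)) (\<lambda>\<omega>. \<lambda>i\<in>I. U i \<omega>)) F"
    by (rule integral_distr[symmetric, OF m(1) F])
  also have "\<dots> = integral\<^sup>L (distr N (PiM I (\<lambda>_. borel)) (\<lambda>\<omega>. \<lambda>i\<in>I. U' i \<omega>)) F"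
    by (subst distr_eqI_char[OF assms(1-6)]) auto
  also have "\<dots> = (LINT \<omega>|N. F (\<lambda>i\<in>I. U' i \<omega>))"
    by (rule integral_distr[OF m(2) F])
  finally show ?thesis .
qed

section \<open>Riemann-Stieltjes convolutions\<close>

lemma Max_diff_le:
  fixes f g :: "'a \<Rightarrow> real"
  assumes "finite I" "I \<noteq> {}" "\<And>i. i \<in> I \<Longrightarrow> \<bar>f i - g i\<bar> \<le> e"
  shows "\<bar>Max (f ` I) - Max (g ` I)\<bar> \<le> e"
proof -
  have "Max (f ` I) \<le> Max (g ` I) + e" if "\<And>i. i \<in> I \<Longrightarrow> f i \<le> g i + e" for f g :: "'a \<Rightarrow> real"
  proof (subst Max_le_iff)
    show "\<forall>a\<in>f ` I. a \<le> Max (g ` I) + e"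
    proof
      fix a assume "a \<in> f ` I"
      then obtain i where i: "i \<in> I" "a = f i" by blast
      have "g i \<le> Max (g ` I)" using i assms by (intro Max_ge) auto
      with that[OF i(1)] i show "a \<le> Max (g ` I) + e" by linarith
    qed
  qed (use assms in auto)
  from this[of f g] this[of g f] show ?thesis using assms(3) by (force simp: abs_le_iff)
qed

lemma tendsto_Max_image:
  fixes f :: "nat \<Rightarrow> 'a \<Rightarrow> real"
  assumes I: "finite I" "I \<noteq> {}" and f: "\<And>i. i \<in> I \<Longrightarrow> (\<lambda>n. f n i) \<longlonglongrightarrow> g i"
  shows "(\<lambda>n. Max (f n ` I)) \<longlonglongrightarrow> Max (g ` I)"
proof (rule LIMSEQ_I)
  fix e :: real assume "e > 0"
  then have e: "e / 2 > 0" by simp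
  have "\<forall>i\<in>I. \<exists>N. \<forall>n\<ge>N. \<bar>f n i - g i\<bar> < e / 2" using LIMSEQ_D[OF f e] by auto
  then obtain N where N: "\<And>i n. i \<in> I \<Longrightarrow> n \<ge> N i \<Longrightarrow> \<bar>f n i - g i\<bar> < e / 2" by metis
  have "norm (Max (f n ` I) - Max (g ` I)) < e" if n: "n \<ge> Max (N ` I)" for n
  proof -
    have "\<bar>f n i - g i\<bar> \<le> e / 2" if "i \<in> I" for i
    proof -
      have "N i \<le> Max (N ` I)" using that I by (intro Max_ge) auto
      with N[OF that, of n] n show ?thesis by simp
    qed
    then have "\<bar>Max (f n ` I) - Max (g ` I)\<bar> \<le> e / 2" by (rule Max_diff_le[OF I])
    then show ?thesis using \<open>e > 0\<close> by simp
  qed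
  then show "\<exists>no. \<forall>n\<ge>no. norm (Max (f n ` I) - Max (g ` I)) < e" by blast
qed

lemma grid_Max_tendsto_SUP:
  fixes g :: "real \<Rightarrow> real"
  assumes g: "continuous_on {0..1} g"
  shows "(\<lambda>n. Max ((\<lambda>k. g (real k / real n)) ` {1..<n})) \<longlonglongrightarrow> (SUP t\<in>{0<..<1}. g t)"
proof (rule LIMSEQ_I)
  let ?S = "SUP t\<in>{0<..<1}. g t"
  fix e :: real assume e: "e > 0"
  have "bdd_above (g ` {0..1})"
    by (intro bounded_imp_bdd_above compact_imp_bounded compact_continuous_image g) simp
  then have bdd: "bdd_above (g ` {0<..<1})" by (rule bdd_above_mono) auto
  have "?S - e < ?S" using e by simp
  then obtain t where t: "t \<in> {0<..<1}" "g t > ?S - e"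
    using less_cSUP_iff[OF _ bdd, of "?S - e"] by auto
  define e' where "e' = g t - (?S - e)"
  have e': "e' > 0" using t by (simp add: e'_def)
  from t(1) have "t \<in> {0..1}" by auto
  with g e' obtain d where d: "d > 0" "\<And>s. s \<in> {0..1} \<Longrightarrow> \<bar>s - t\<bar> < d \<Longrightarrow> \<bar>g s - g t\<bar> < e'"
    unfolding continuous_on_iff dist_real_def by metis
  \<comment> \<open>\<open>1 / d\<close> puts the first grid point not before \<open>t\<close>
    within \<open>d\<close> of it, and \<open>1 / (1 - t)\<close> keeps its index below
    \<open>n\<close>.\<close>
  obtain n0 :: nat where n0: "max (1 / d) (max (1 / (1 - t)) 1) < real n0" using reals_Archimedean2 by blast
  have "norm (Max ((\<lambda>k. g (real k / real n)) ` {1..<n}) - ?S) < e" if n: "n \<ge> n0" for n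
  proof -
    have "real n \<ge> real n0" using n by simp
    then have n1: "1 / d < real n" "1 / (1 - t) < real n" "1 < real n" using n0 by auto
    define k where "k = nat \<lceil>real n * t\<rceil>"
    have nt: "real n * t > 0" using n1 t by simp
    then have k: "real n * t \<le> real k" "real k < real n * t + 1" unfolding k_def
      by (auto simp: le_nat_iff of_nat_ceiling nat_less_iff intro: ceiling_correct) linarith+
    have "1 < real n * (1 - t)" using n1(2) t by (simp add: divide_less_eq)
    with k(2) have "real k < real n" by (simp add: algebra_simps)
    moreover have "k > 0" using k nt by (cases k) auto
    ultimately have kn: "k \<in> {1..<n}" by auto
    have "real n * d > 1" using n1(1) d by (simp add: divide_less_eq)
    have "\<bar>real k / real n - t\<bar> = (real k - real n * t) / real n"
      using k n1 by (simp add: field_simps)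
    also have "\<dots> < 1 / real n" using k n1 by (intro divide_strict_right_mono) auto
    also have "\<dots> < d" using n1 d by (simp add: field_simps)
    finally have "\<bar>g (real k / real n) - g t\<bar> < e'" using kn by (intro d) auto
    then have "g (real k / real n) > ?S - e" by (simp add: e'_def)
    moreover have "g (real k / real n) \<le> Max ((\<lambda>k. g (real k / real n)) ` {1..<n})"
      using kn by (intro Max_ge) auto
    moreover have "Max ((\<lambda>k. g (real k / real n)) ` {1..<n}) \<le> ?S"
    proof (subst Max_le_iff)
      show "\<forall>a\<in>(\<lambda>k. g (real k / real n)) ` {1..<n}. a \<le> ?S"
        by (auto intro!: cSUP_upper bdd simp: divide_less_eq)
    qed (use kn in auto)
    ultimately show ?thesis by simp
  qed
  then show "\<exists>no. \<forall>n\<ge>no. norm (Max ((\<lambda>k. g (real k / real n)) ` {1..<n}) - ?S) < e" by blast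
qed

text \<open>Cauchy-Schwarz with weights \<open>\<bar>a j\<bar>\<close>, then interchange of the
  sums. With \<open>a\<close> the increments of \<open>h\<close>, a bound on the weighted squares
  that is uniform in time passes to Riemann-Stieltjes sums at the price of the squared total
  variation, independently of the number of coordinates.\<close>

lemma sum_weighted_square_le:
  fixes x :: "'p \<Rightarrow> 'j \<Rightarrow> real"
  assumes J: "finite J" and F: "finite F" and \<rho>: "\<And>p. p \<in> F \<Longrightarrow> \<rho> p \<ge> 0"
    and K: "\<And>j. j \<in> J \<Longrightarrow> (\<Sum>p\<in>F. \<rho> p * (x p j)\<^sup>2) \<le> K"
  shows "(\<Sum>p\<in>F. \<rho> p * (\<Sum>j\<in>J. x p j * a j)\<^sup>2) \<le> (\<Sum>j\<in>J. \<bar>a j\<bar>)\<^sup>2 * K"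
proof -
  let ?A = "\<Sum>j\<in>J. \<bar>a j\<bar>"
  have CS: "(\<Sum>j\<in>J. y j * a j)\<^sup>2 \<le> ?A * (\<Sum>j\<in>J. \<bar>a j\<bar> * (y j)\<^sup>2)" for y :: "'j \<Rightarrow> real"
  proof -
    have "\<bar>\<Sum>j\<in>J. y j * a j\<bar> \<le> (\<Sum>j\<in>J. sqrt \<bar>a j\<bar> * (sqrt \<bar>a j\<bar> * \<bar>y j\<bar>))"
    proof (rule order_trans[OF sum_abs sum_mono])
      fix j
      have "sqrt \<bar>a j\<bar> * (sqrt \<bar>a j\<bar> * \<bar>y j\<bar>) = (sqrt \<bar>a j\<bar> * sqrt \<bar>a j\<bar>) * \<bar>y j\<bar>" by (simp only: mult.assoc)
      also have "\<dots> = \<bar>a j\<bar> * \<bar>y j\<bar>" by simp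
      finally show "\<bar>y j * a j\<bar> \<le> sqrt \<bar>a j\<bar> * (sqrt \<bar>a j\<bar> * \<bar>y j\<bar>)" by (simp only: abs_mult mult.commute[of "\<bar>y j\<bar>"] order_refl)
    qed
    then have "(\<Sum>j\<in>J. y j * a j)\<^sup>2 \<le> (\<Sum>j\<in>J. sqrt \<bar>a j\<bar> * (sqrt \<bar>a j\<bar> * \<bar>y j\<bar>))\<^sup>2"
      by (rule power2_le_iff_abs_le[THEN iffD2, rotated]) (auto intro!: sum_nonneg)
    also have "\<dots> \<le> (\<Sum>j\<in>J. (sqrt \<bar>a j\<bar>)\<^sup>2) * (\<Sum>j\<in>J. (sqrt \<bar>a j\<bar> * \<bar>y j\<bar>)\<^sup>2)"
      by (rule Cauchy_Schwarz_ineq_sum)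
    finally show ?thesis by (simp add: power_mult_distrib)
  qed
  have "(\<Sum>p\<in>F. \<rho> p * (\<Sum>j\<in>J. x p j * a j)\<^sup>2) \<le> (\<Sum>p\<in>F. \<rho> p * (?A * (\<Sum>j\<in>J. \<bar>a j\<bar> * (x p j)\<^sup>2)))"
    using \<rho> CS by (intro sum_mono mult_left_mono) auto
  also have "\<dots> = ?A * (\<Sum>p\<in>F. \<Sum>j\<in>J. \<bar>a j\<bar> * (\<rho> p * (x p j)\<^sup>2))"
    by (simp add: sum_distrib_left mult_ac)
  also have "\<dots> = ?A * (\<Sum>j\<in>J. \<bar>a j\<bar> * (\<Sum>p\<in>F. \<rho> p * (x p j)\<^sup>2))"
    by (subst sum.swap) (simp add: sum_distrib_left)
  also have "\<dots> \<le> ?A * (\<Sum>j\<in>J. \<bar>a j\<bar> * K)"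
    using K by (intro mult_left_mono sum_mono) (auto intro: sum_nonneg)
  also have "\<dots> = ?A\<^sup>2 * K" by (simp add: sum_distrib_right[symmetric] power2_eq_square)
  finally show ?thesis .
qed

section \<open>Existence and uniform approximation of integrals against the kernel\<close>

locale kernel =
  fixes h :: "real \<Rightarrow> real" and \<alpha> \<beta> V :: real
  assumes \<alpha>: "\<alpha> > 0" and \<beta>: "\<beta> > 0"
    and h_zero: "\<And>x. x \<in> {-1..0} \<Longrightarrow> h x = 0"
    and hoelder01: "\<And>s t. s \<in> {0..1} \<Longrightarrow> t \<in> {0..1} \<Longrightarrow> \<bar>h t - h s\<bar> \<le> \<beta> * \<bar>s - t\<bar> powr \<alpha>"
    and variation_full: "\<And>p (m::nat). p 0 = -1 \<Longrightarrow> p m = 1 \<Longrightarrow> (\<And>j. j < m \<Longrightarrow> p j \<le> p (Suc j)) \<Longrightarrow>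
      (\<Sum>j<m. \<bar>h (p (Suc j)) - h (p j)\<bar>) \<le> V"
begin

text \<open>\<open>h\<close> vanishes left of zero, so replacing both points by their positive parts
  changes no value and does not increase the distance.\<close>

lemma hoelder:
  assumes "s \<in> {-1..1}" "t \<in> {-1..1}"
  shows "\<bar>h t - h s\<bar> \<le> \<beta> * \<bar>t - s\<bar> powr \<alpha>"
proof -
  have le: "\<bar>h t - h s\<bar> \<le> \<beta> * \<bar>t - s\<bar> powr \<alpha>" if "s \<in> {-1..1}" "t \<in> {-1..1}" "s \<le> t" for s t
  proof -
    define s' t' where "s' = max 0 s" and "t' = max 0 t"
    have "h s = h s'" "h t = h t'" using that h_zero[of s] h_zero[of t] h_zero[of 0]
      by (auto simp: s'_def t'_def max_def)
    then have "\<bar>h t - h s\<bar> \<le> \<beta> * \<bar>s' - t'\<bar> powr \<alpha>" using hoelder01[of s' t'] that by (simp add: s'_def t'_def)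
    also have "\<dots> \<le> \<beta> * \<bar>t - s\<bar> powr \<alpha>"
      using \<alpha> \<beta> that by (intro mult_left_mono powr_mono2) (auto simp: s'_def t'_def)
    finally show ?thesis .
  qed
  show ?thesis using le[of s t] le[of t s] assms by (cases "s \<le> t") (auto simp: abs_minus_commute)
qed

lemma continuous_h: "continuous_on {-1..1} h"
  unfolding continuous_on_iff dist_real_def
proof safe
  fix s e :: real assume s: "s \<in> {-1..1}" and e: "e > 0"
  define d where "d = (e / \<beta>) powr (1 / \<alpha>)"
  have "d > 0" using e \<beta> by (simp add: d_def)
  moreover have "\<bar>h t - h s\<bar> < e" if "t \<in> {-1..1}" "\<bar>t - s\<bar> < d" for t
  proof -
    have "\<bar>t - s\<bar> powr \<alpha> < d powr \<alpha>" using that \<alpha> by (intro powr_less_mono2) auto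
    also have "\<dots> = e / \<beta>" using \<alpha> e \<beta> by (simp add: d_def powr_powr)
    finally have "\<beta> * \<bar>t - s\<bar> powr \<alpha> < e" using \<beta> by (simp add: field_simps)
    with hoelder[OF s that(1)] show ?thesis by linarith
  qed
  ultimately show "\<exists>d>0. \<forall>t\<in>{-1..1}. \<bar>t - s\<bar> < d \<longrightarrow> \<bar>h t - h s\<bar> < e" by blast
qed

lemma variation:
  fixes p :: "nat \<Rightarrow> real"
  assumes p: "-1 \<le> p 0" "p m \<le> 1" "\<And>j. j < m \<Longrightarrow> p j \<le> p (Suc j)"
  shows "(\<Sum>j<m. \<bar>h (p (Suc j)) - h (p j)\<bar>) \<le> V"
proof -
  \<comment> \<open>Padding with -1 and 1 turns the chain into a partition of the whole interval,
    which only adds nonnegative terms.\<close>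
  define q where "q j = (if j = 0 then -1 else if j \<le> Suc m then p (j - 1) else 1)" for j
  have "(\<Sum>j<m. \<bar>h (p (Suc j)) - h (p j)\<bar>) = (\<Sum>j<m. \<bar>h (q (Suc (Suc j))) - h (q (Suc j))\<bar>)"
    by (rule sum.cong) (auto simp: q_def)
  also have "\<dots> = (\<Sum>j\<in>Suc ` {..<m}. \<bar>h (q (Suc j)) - h (q j)\<bar>)"
    by (subst sum.reindex) auto
  also have "\<dots> \<le> (\<Sum>j<Suc (Suc m). \<bar>h (q (Suc j)) - h (q j)\<bar>)"
    by (rule sum_mono2) auto
  also have "\<dots> \<le> V"
  proof (rule variation_full)
    fix j assume "j < Suc (Suc m)"
    then consider "j = 0" | "j > 0" "j \<le> m" | "j = Suc m" by linarith
    then show "q j \<le> q (Suc j)"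
    proof cases
      case 2
      then show ?thesis using p(3)[of "j - 1"] by (simp add: q_def)
    qed (use p in \<open>auto simp: q_def\<close>)
  qed (auto simp: q_def)
  finally show ?thesis .
qed

lemma V_nonneg: "V \<ge> 0"
  using variation[of "\<lambda>_. 0" 0] by simp

text \<open>These are the partitions that \<open>has_RS_integral\<close> quantifies over on [0, u]:
  nodes may repeat, and the mesh is strictly below \<open>d\<close>.\<close>

definition tagged_partition :: "real \<Rightarrow> real \<Rightarrow> (nat \<Rightarrow> real) \<Rightarrow> (nat \<Rightarrow> real) \<Rightarrow> nat \<Rightarrow> bool" where
  "tagged_partition u d p \<xi> m \<longleftrightarrow> p 0 = 0 \<and> p m = u \<and>
     (\<forall>j<m. p j \<le> \<xi> j \<and> \<xi> j \<le> p (Suc j) \<and> p (Suc j) - p j < d)"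

lemma tagged_partition_mono:
  assumes "tagged_partition u d p \<xi> m" "i \<le> j" "j \<le> m"
  shows "p i \<le> p j"
  using assms(2,3)
proof (induction j rule: dec_induct)
  case (step n)
  then have "n < m" by simp
  then have "p n \<le> p (Suc n)" using assms(1) unfolding tagged_partition_def by (meson order_trans)
  with step show ?case by simp
qed simp

lemma tagged_partition_range:
  assumes P: "tagged_partition u d p \<xi> m" and j: "j \<le> m"
  shows "p j \<in> {0..u}" "j < m \<Longrightarrow> \<xi> j \<in> {0..u}"
proof -
  have 1: "p j \<in> {0..u}" if "j \<le> m" for j
    using tagged_partition_mono[OF P, of 0 j] tagged_partition_mono[OF P, of j m] that P
    by (auto simp: tagged_partition_def)
  show "p j \<in> {0..u}" by (rule 1[OF j])
  assume "j < m"
  then have "p j \<le> \<xi> j" "\<xi> j \<le> p (Suc j)" using P by (auto simp: tagged_partition_def)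
  with 1[of j] 1[of "Suc j"] \<open>j < m\<close> show "\<xi> j \<in> {0..u}" by simp
qed

lemma tagged_partition_variation:
  assumes P: "tagged_partition u d p \<xi> m" and u: "u \<le> 1"
  shows "(\<Sum>j<m. \<bar>h (p (Suc j)) - h (p j)\<bar>) \<le> V"
  by (rule variation) (use P u in \<open>auto simp: tagged_partition_def intro: order_trans\<close>)

lemma uniform_tagged_partition:
  assumes "u \<ge> 0" "m > 0" "u / real m < d"
  shows "tagged_partition u d (\<lambda>j. u * real j / real m) (\<lambda>j. u * real j / real m) m"
proof -
  have "u * real (Suc j) / real m - u * real j / real m = u / real m" for j
    using assms by (simp add: field_simps)
  moreover have "u * real j / real m \<le> u * real (Suc j) / real m" for j
    using assms by (intro divide_right_mono mult_left_mono) auto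
  ultimately show ?thesis using assms by (auto simp: tagged_partition_def simp del: of_nat_Suc)
qed

lemma RS_sum_diff_le:
  assumes P: "tagged_partition u d p \<xi> m" and u: "u \<le> 1" and fg: "\<And>y. y \<in> {0..u} \<Longrightarrow> \<bar>f y - g y\<bar> \<le> e" and e: "e \<ge> 0"
  shows "\<bar>(\<Sum>j<m. f (\<xi> j) * (h (p (Suc j)) - h (p j))) - (\<Sum>j<m. g (\<xi> j) * (h (p (Suc j)) - h (p j)))\<bar> \<le> e * V"
proof -
  have "\<bar>(\<Sum>j<m. f (\<xi> j) * (h (p (Suc j)) - h (p j))) - (\<Sum>j<m. g (\<xi> j) * (h (p (Suc j)) - h (p j)))\<bar>
      = \<bar>\<Sum>j<m. (f (\<xi> j) - g (\<xi> j)) * (h (p (Suc j)) - h (p j))\<bar>"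
    by (simp add: sum_subtractf[symmetric] algebra_simps)
  also have "\<dots> \<le> (\<Sum>j<m. e * \<bar>h (p (Suc j)) - h (p j)\<bar>)"
    using fg tagged_partition_range(2)[OF P]
    by (intro order_trans[OF sum_abs sum_mono]) (auto simp: abs_mult intro!: mult_right_mono)
  also have "\<dots> \<le> e * V"
    using tagged_partition_variation[OF P u] e by (simp add: sum_distrib_left[symmetric] mult_left_mono)
  finally show ?thesis .
qed

text \<open>Integration by parts trades the integrator \<open>h\<close> for the smooth integrand, so that only
  the modulus of continuity of \<open>h\<close> enters.\<close>
lemma RS_sum_smooth:
  assumes P: "tagged_partition u d p \<xi> m" and u: "u \<le> 1" and d: "d > 0"
    and q: "\<And>x. (q has_real_derivative q' x) (at x)" and q': "continuous_on UNIV q'"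
    and L: "\<And>x. x \<in> {0..u} \<Longrightarrow> \<bar>q' x\<bar> \<le> L"
  shows "\<bar>(\<Sum>j<m. q (\<xi> j) * (h (p (Suc j)) - h (p j))) -
     (q u * h u - q 0 * h 0 - integral {0..u} (\<lambda>y. h y * q' y))\<bar> \<le> \<beta> * d powr \<alpha> * L * u"
proof -
  have p0: "p 0 = 0" and pm: "p m = u" and pj: "\<And>j. j < m \<Longrightarrow> p j \<le> \<xi> j \<and> \<xi> j \<le> p (Suc j) \<and> p (Suc j) - p j < d"
    using P by (auto simp: tagged_partition_def)
  note rng = tagged_partition_range[OF P]
  let ?f = "\<lambda>y. h y * q' y"
  have cf: "continuous_on {a..b} ?f" and ch: "continuous_on {a..b} h" and cq: "continuous_on {a..b} q'"
    if "0 \<le> a" "b \<le> u" for a b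
  proof -
    show ch: "continuous_on {a..b} h" by (rule continuous_on_subset[OF continuous_h]) (use that u in auto)
    show cq: "continuous_on {a..b} q'" by (rule continuous_on_subset[OF q']) auto
    show "continuous_on {a..b} ?f" by (intro continuous_intros ch cq)
  qed
  have split: "integral {0..p j} ?f = (\<Sum>i<j. integral {p i..p (Suc i)} ?f)" if "j \<le> m" for j
    using that
  proof (induction j)
    case (Suc j)
    have "integral {0..p (Suc j)} ?f = integral {0..p j} ?f + integral {p j..p (Suc j)} ?f"
      using rng(1)[of j] rng(1)[of "Suc j"] Suc.prems pj[of j]
      by (intro Henstock_Kurzweil_Integration.integral_combine[symmetric] integrable_continuous_interval cf) auto
    with Suc show ?case by simp
  qed (simp add: p0)
  \<comment> \<open>The error of one cell. Integration by parts on both sides of the tag writes it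
    as integrals of \<open>q'\<close> times the deviation of \<open>h\<close> from its value at the
    nearer end point of the cell.\<close>
  define E where "E j = q (\<xi> j) * (h (p (Suc j)) - h (p j)) -
      (q (p (Suc j)) * h (p (Suc j)) - q (p j) * h (p j)) + integral {p j..p (Suc j)} ?f" for j
  define \<omega> where "\<omega> = \<beta> * d powr \<alpha>"
  have Ej: "\<bar>E j\<bar> \<le> \<omega> * L * (p (Suc j) - p j)" if j: "j < m" for j
  proof -
    have o: "p j \<le> \<xi> j" "\<xi> j \<le> p (Suc j)" "p (Suc j) - p j < d" using pj[OF j] by auto
    have r: "p j \<in> {0..u}" "p (Suc j) \<in> {0..u}" using rng(1)[of j] rng(1)[of "Suc j"] j by auto
    have FTC: "(q' has_integral (q b - q a)) {a..b}" if "a \<le> b" for a b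
      using that q by (intro fundamental_theorem_of_calculus)
        (auto simp: has_real_derivative_iff_has_vector_derivative[symmetric] intro: has_field_derivative_at_within)
    have piece: "\<bar>integral {a..b} (\<lambda>y. (h y - h c) * q' y)\<bar> \<le> \<omega> * L * (b - a)"
      and piece_eq: "integral {a..b} (\<lambda>y. (h y - h c) * q' y) = integral {a..b} ?f - h c * (q b - q a)"
      if "p j \<le> a" "a \<le> b" "b \<le> p (Suc j)" "c \<in> {p j..p (Suc j)}" for a b c
    proof -
      have ab: "0 \<le> a" "b \<le> u" using that r by auto
      have "norm (integral {a..b} (\<lambda>y. (h y - h c) * q' y)) \<le> \<omega> * L * (b - a)"
      proof (rule integral_bound[OF that(2)])
        show "continuous_on {a..b} (\<lambda>y. (h y - h c) * q' y)"
          by (intro continuous_intros ch cq ab)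
        fix y assume y: "y \<in> {a..b}"
        have "\<bar>h y - h c\<bar> \<le> \<beta> * \<bar>y - c\<bar> powr \<alpha>"
          by (rule hoelder) (use y that r u in auto)
        also have "\<dots> \<le> \<omega>" unfolding \<omega>_def
          using \<beta> \<alpha> y that o(3) by (intro mult_left_mono powr_mono2) auto
        finally have "\<bar>h y - h c\<bar> \<le> \<omega>" .
        moreover have "\<bar>q' y\<bar> \<le> L" using y ab by (intro L) auto
        ultimately show "norm ((h y - h c) * q' y) \<le> \<omega> * L"
          by (simp add: abs_mult mult_mono')
      qed
      then show "\<bar>integral {a..b} (\<lambda>y. (h y - h c) * q' y)\<bar> \<le> \<omega> * L * (b - a)" by simp
      have "((\<lambda>y. h y * q' y - h c * q' y) has_integral integral {a..b} ?f - h c * (q b - q a)) {a..b}"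
        by (intro has_integral_diff integrable_integral integrable_continuous_interval cf ab has_integral_mult_right FTC that)
      then show "integral {a..b} (\<lambda>y. (h y - h c) * q' y) = integral {a..b} ?f - h c * (q b - q a)"
        by (intro integral_unique) (simp add: algebra_simps)
    qed
    have "integral {p j..p (Suc j)} ?f = integral {p j..\<xi> j} ?f + integral {\<xi> j..p (Suc j)} ?f"
      using r o by (intro Henstock_Kurzweil_Integration.integral_combine[symmetric] integrable_continuous_interval cf) auto
    then have "E j = integral {p j..\<xi> j} (\<lambda>y. (h y - h (p j)) * q' y) + integral {\<xi> j..p (Suc j)} (\<lambda>y. (h y - h (p (Suc j))) * q' y)"
      using piece_eq[of "p j" "\<xi> j" "p j"] piece_eq[of "\<xi> j" "p (Suc j)" "p (Suc j)"] o
      by (simp add: E_def algebra_simps)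
    then have "\<bar>E j\<bar> \<le> \<omega> * L * (\<xi> j - p j) + \<omega> * L * (p (Suc j) - \<xi> j)"
      using piece[of "p j" "\<xi> j" "p j"] piece[of "\<xi> j" "p (Suc j)" "p (Suc j)"] o by simp
    then show ?thesis by (simp add: algebra_simps)
  qed
  have "(\<Sum>j<m. q (\<xi> j) * (h (p (Suc j)) - h (p j))) - (q u * h u - q 0 * h 0 - integral {0..u} ?f) = (\<Sum>j<m. E j)"
  proof -
    have "(\<Sum>j<m. q (p (Suc j)) * h (p (Suc j)) - q (p j) * h (p j)) = q u * h u - q 0 * h 0"
      using sum_lessThan_telescope[of "\<lambda>j. q (p j) * h (p j)" m] by (simp add: p0 pm)
    then show ?thesis using split[of m] by (simp add: E_def sum.distrib sum_subtractf pm)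
  qed
  also have "\<bar>\<dots>\<bar> \<le> (\<Sum>j<m. \<omega> * L * (p (Suc j) - p j))"
    by (rule order_trans[OF sum_abs sum_mono]) (use Ej in auto)
  also have "\<dots> = \<omega> * L * u"
    using sum_lessThan_telescope[of p m] by (simp add: sum_distrib_left[symmetric] p0 pm)
  finally show ?thesis by (simp add: \<omega>_def)
qed

text \<open>One mesh serves all \<open>u\<close>: a polynomial uniformly close to \<open>f\<close>
  changes the sums by at most \<open>\<eta> * V\<close>, and for a polynomial
  \<open>RS_sum_smooth\<close> gives an error that depends only on the mesh and on a bound
  \<open>L\<close> of the derivative over the unit interval.\<close>

lemma RS_convolution_Cauchy:
  assumes f: "continuous_on {0..1} f" and e: "e > 0"
  shows "\<exists>d>0. \<forall>u\<in>{0..1}. \<exists>J. \<forall>p \<xi> m. tagged_partition u d p \<xi> m \<longrightarrow>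
     \<bar>(\<Sum>j<m. f (u - \<xi> j) * (h (p (Suc j)) - h (p j))) - J\<bar> < e"
proof -
  define \<eta> where "\<eta> = e / (2 * (V + 1))"
  have \<eta>: "\<eta> > 0" using e V_nonneg by (simp add: \<eta>_def)
  have \<eta>V: "\<eta> * V \<le> e / 2"
  proof -
    have "\<eta> * V \<le> \<eta> * (V + 1)" using \<eta> by simp
    also have "\<dots> = e / 2" using V_nonneg by (simp add: \<eta>_def field_simps)
    finally show ?thesis .
  qed
  obtain g where g: "real_polynomial_function g" "\<And>x. x \<in> {0..1} \<Longrightarrow> \<bar>f x - g x\<bar> < \<eta>"
    using Stone_Weierstrass_real_polynomial_function[OF compact_Icc f \<eta>] by metis
  obtain g' where g': "real_polynomial_function g'" "\<And>x. (g has_real_derivative g' x) (at x)"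
    using has_real_derivative_polynomial_function[OF g(1)] by metis
  obtain g'' where g'': "\<And>x. (g' has_real_derivative g'' x) (at x)"
    using has_real_derivative_polynomial_function[OF g'(1)] by metis
  have cg': "continuous_on UNIV g'" using g'' by (intro continuous_at_imp_continuous_on) (auto intro: DERIV_isCont)
  have "bounded (g' ` {0..1})"
    by (intro compact_imp_bounded compact_continuous_image continuous_on_subset[OF cg']) auto
  then obtain L where L: "L > 0" "\<And>x. x \<in> {0..1} \<Longrightarrow> \<bar>g' x\<bar> \<le> L"
    by (auto simp: bounded_pos)
  \<comment> \<open>Chosen so that \<open>\<beta> * d powr \<alpha> * L\<close> equals
    \<open>e / 4\<close>.\<close>
  define d where "d = (e / (4 * \<beta> * L)) powr (1 / \<alpha>)"
  have d: "d > 0" using e \<beta> L by (simp add: d_def)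
  have dL: "\<beta> * d powr \<alpha> * L = e / 4" using e \<beta> L \<alpha> by (simp add: d_def powr_powr)
  show ?thesis
  proof (rule exI[of _ d], intro conjI ballI d)
    fix u :: real assume u: "u \<in> {0..1}"
    define q where "q y = g (u - y)" for y
    define q' where "q' y = - g' (u - y)" for y
    have q: "(q has_real_derivative q' x) (at x)" for x
      unfolding q_def[abs_def] q'_def
      by (rule DERIV_cong[OF DERIV_chain2[OF g'(2)]]) (auto intro!: derivative_eq_intros)
    have q': "continuous_on UNIV q'" unfolding q'_def[abs_def]
      by (intro continuous_intros continuous_on_compose2[OF cg']) auto
    define J where "J = q u * h u - q 0 * h 0 - integral {0..u} (\<lambda>y. h y * q' y)"
    have "\<bar>(\<Sum>j<m. f (u - \<xi> j) * (h (p (Suc j)) - h (p j))) - J\<bar> < e" if P: "tagged_partition u d p \<xi> m" for p \<xi> m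
    proof -
      have 1: "\<bar>(\<Sum>j<m. f (u - \<xi> j) * (h (p (Suc j)) - h (p j))) - (\<Sum>j<m. q (\<xi> j) * (h (p (Suc j)) - h (p j)))\<bar> \<le> \<eta> * V"
        using u \<eta> g(2) by (intro RS_sum_diff_le[OF P, of "\<lambda>y. f (u - y)"]) (auto simp: q_def intro!: less_imp_le)
      have "\<bar>(\<Sum>j<m. q (\<xi> j) * (h (p (Suc j)) - h (p j))) - J\<bar> \<le> \<beta> * d powr \<alpha> * L * u"
        unfolding J_def using u by (intro RS_sum_smooth[OF P _ d q q']) (auto simp: q'_def intro!: L)
      also have "\<dots> \<le> e / 4 * 1" unfolding dL using u e by (intro mult_left_mono) auto
      finally show ?thesis using 1 \<eta>V e by linarith
    qed
    then show "\<exists>J. \<forall>p \<xi> m. tagged_partition u d p \<xi> m \<longrightarrow>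
     \<bar>(\<Sum>j<m. f (u - \<xi> j) * (h (p (Suc j)) - h (p j))) - J\<bar> < e" by blast
  qed
qed

lemma tagged_partition_anti: "tagged_partition u d p \<xi> m \<Longrightarrow> d \<le> d' \<Longrightarrow> tagged_partition u d' p \<xi> m"
  by (force simp: tagged_partition_def)

lemma tagged_partition_ex:
  assumes "u \<ge> 0" "d > 0"
  obtains p \<xi> m where "tagged_partition u d p \<xi> m"
proof -
  obtain m :: nat where m: "u / d < real m" using reals_Archimedean2 by blast
  have "real m > 0" using m assms by (meson divide_nonneg_pos le_less_trans)
  then show ?thesis using m assms by (intro that[OF uniform_tagged_partition[of u m d]]) (auto simp: field_simps)
qed

text \<open>For \<open>f\<close> a bridge path and \<open>u = 1 - t\<close> this is the variable
  \<open>G\<close> of the theorem.\<close>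

definition convolution :: "(real \<Rightarrow> real) \<Rightarrow> real \<Rightarrow> real" where
  "convolution f u = RS_integral (\<lambda>y. f (u - y)) h 0 u"

text \<open>The approximate values \<open>J k\<close> are Cauchy in \<open>k\<close>, since two
  meshes share a common finer partition; their limit is the integral. A sufficiently fine partition
  also separates two different candidates, so the description in \<open>RS_integral\<close> is
  proper.\<close>

lemma convolution_uniform:
  assumes f: "continuous_on {0..1} f" and e: "e > 0"
  shows "\<exists>d>0. \<forall>u\<in>{0..1}. \<forall>p \<xi> m. tagged_partition u d p \<xi> m \<longrightarrow>
     \<bar>(\<Sum>j<m. f (u - \<xi> j) * (h (p (Suc j)) - h (p j))) - convolution f u\<bar> < e"
proof -
  define s where "s u p \<xi> m = (\<Sum>j<m. f (u - \<xi> j) * (h (p (Suc j)) - h (p j)))" for u p \<xi> and m :: nat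
  have "\<forall>k::nat. \<exists>d>0. \<forall>u\<in>{0..1}. \<exists>J. \<forall>p \<xi> m. tagged_partition u d p \<xi> m \<longrightarrow> \<bar>s u p \<xi> m - J\<bar> < 1 / real (Suc k)"
    unfolding s_def by (intro allI RS_convolution_Cauchy[OF f]) simp
  then obtain d where d: "\<And>k. d k > 0"
    and "\<forall>k. \<forall>u\<in>{0..1}. \<exists>J. \<forall>p \<xi> m. tagged_partition u (d k) p \<xi> m \<longrightarrow> \<bar>s u p \<xi> m - J\<bar> < 1 / real (Suc k)" by metis
  then obtain J where J: "\<And>k u p \<xi> m. u \<in> {0..1} \<Longrightarrow> tagged_partition u (d k) p \<xi> m \<Longrightarrow> \<bar>s u p \<xi> m - J k u\<bar> < 1 / real (Suc k)" by metis
  have JJ: "\<bar>J k u - J l u\<bar> \<le> 1 / real (Suc k) + 1 / real (Suc l)" if u: "u \<in> {0..1}" for k l u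
  proof -
    have "u \<ge> 0" "min (d k) (d l) > 0" using u d by auto
    then obtain p \<xi> m where P: "tagged_partition u (min (d k) (d l)) p \<xi> m"
      by (rule tagged_partition_ex)
    from J[OF u, of k p \<xi> m] J[OF u, of l p \<xi> m] tagged_partition_anti[OF P] show ?thesis by (fastforce simp: abs_le_iff abs_less_iff)
  qed
  have "Cauchy (\<lambda>k. J k u)" if u: "u \<in> {0..1}" for u
  proof (rule metric_CauchyI)
    fix r :: real assume "r > 0"
    then have "r / 2 > 0" by simp
    then obtain N where N: "inverse (real (Suc N)) < r / 2" using reals_Archimedean by blast
    have "dist (J a u) (J b u) < r" if "a \<ge> N" "b \<ge> N" for a b
    proof -
      have "1 / real (Suc a) \<le> inverse (real (Suc N))" "1 / real (Suc b) \<le> inverse (real (Suc N))"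
        using that by (auto simp: divide_inverse)
      with JJ[OF u, of a b] N show ?thesis by (simp add: dist_real_def)
    qed
    then show "\<exists>M. \<forall>m\<ge>M. \<forall>n\<ge>M. dist (J m u) (J n u) < r" by blast
  qed
  then have "\<forall>u\<in>{0..1}. \<exists>I. (\<lambda>k. J k u) \<longlonglongrightarrow> I" by (simp add: Cauchy_convergent_iff convergent_def)
  then obtain I where I: "\<And>u. u \<in> {0..1} \<Longrightarrow> (\<lambda>k. J k u) \<longlonglongrightarrow> I u" by metis
  have JI: "\<bar>J k u - I u\<bar> \<le> 1 / real (Suc k)" if u: "u \<in> {0..1}" for k u
  proof (rule LIMSEQ_le)
    show "(\<lambda>l. \<bar>J k u - J l u\<bar>) \<longlonglongrightarrow> \<bar>J k u - I u\<bar>" by (intro tendsto_intros I u)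
    have "(\<lambda>l. 1 / real (Suc k) + 1 / real (Suc l)) \<longlonglongrightarrow> 1 / real (Suc k) + 0"
      by (intro tendsto_intros LIMSEQ_Suc[OF lim_1_over_n])
    then show "(\<lambda>l. 1 / real (Suc k) + 1 / real (Suc l)) \<longlonglongrightarrow> 1 / real (Suc k)" by simp
  qed (use JJ[OF u] in blast)
  have uni: "\<exists>d>0. \<forall>u\<in>{0..1}. \<forall>p \<xi> m. tagged_partition u d p \<xi> m \<longrightarrow> \<bar>s u p \<xi> m - I u\<bar> < r" if r: "r > 0" for r
  proof -
    from r have "r / 2 > 0" by simp
    then obtain k where k: "inverse (real (Suc k)) < r / 2" using reals_Archimedean by blast
    show ?thesis
    proof (rule exI[of _ "d k"], intro conjI ballI allI impI d)
      fix u p \<xi> m assume u: "u \<in> {0..1}" and P: "tagged_partition u (d k) p \<xi> m"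
      have "\<bar>s u p \<xi> m - J k u\<bar> < inverse (real (Suc k))" "\<bar>J k u - I u\<bar> \<le> inverse (real (Suc k))"
        using J[OF u P] JI[OF u, of k] by (simp_all only: inverse_eq_divide)
      with k show "\<bar>s u p \<xi> m - I u\<bar> < r" by linarith
    qed
  qed
  have "convolution f u = I u" if u: "u \<in> {0..1}" for u
    unfolding convolution_def RS_integral_def
  proof (rule the_equality)
    show H: "has_RS_integral (\<lambda>y. f (u - y)) h 0 u (I u)"
      unfolding has_RS_integral_def
    proof (intro allI impI)
      fix r :: real assume "0 < r"
      then obtain d where d: "d > 0" "\<forall>u\<in>{0..1}. \<forall>p \<xi> m. tagged_partition u d p \<xi> m \<longrightarrow> \<bar>s u p \<xi> m - I u\<bar> < r"
        using uni by blast
      have "\<forall>p \<xi> m. tagged_partition u d p \<xi> m \<longrightarrow> \<bar>s u p \<xi> m - I u\<bar> < r" by (rule bspec[OF d(2) u])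
      with d(1) show "\<exists>d>0. \<forall>p \<xi> m. p 0 = 0 \<and> p m = u \<and> (\<forall>j<m. p j \<le> \<xi> j \<and> \<xi> j \<le> p (Suc j) \<and> p (Suc j) - p j < d) \<longrightarrow>
          \<bar>(\<Sum>j<m. f (u - \<xi> j) * (h (p (Suc j)) - h (p j))) - I u\<bar> < r"
        unfolding tagged_partition_def s_def by (intro exI[of _ d] conjI)
    qed
    fix I' assume H': "has_RS_integral (\<lambda>y. f (u - y)) h 0 u I'"
    show "I' = I u"
    proof (rule ccontr)
      assume "I' \<noteq> I u"
      then have r: "\<bar>I' - I u\<bar> / 2 > 0" by simp
      obtain d1 where d1: "d1 > 0" "\<And>p \<xi> m. tagged_partition u d1 p \<xi> m \<Longrightarrow> \<bar>s u p \<xi> m - I u\<bar> < \<bar>I' - I u\<bar> / 2"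
        using uni[OF r] u by blast
      obtain d2 where d2: "d2 > 0" "\<And>p \<xi> m. tagged_partition u d2 p \<xi> m \<Longrightarrow> \<bar>s u p \<xi> m - I'\<bar> < \<bar>I' - I u\<bar> / 2"
      proof -
        from H' have "\<exists>d>0. \<forall>p \<xi> m. tagged_partition u d p \<xi> m \<longrightarrow> \<bar>s u p \<xi> m - I'\<bar> < \<bar>I' - I u\<bar> / 2"
          unfolding has_RS_integral_def tagged_partition_def s_def using r by (elim allE impE)
        then show thesis using that by blast
      qed
      have "u \<ge> 0" "min d1 d2 > 0" using u d1(1) d2(1) by auto
      then obtain p \<xi> m where P: "tagged_partition u (min d1 d2) p \<xi> m"
        by (rule tagged_partition_ex)
      have "\<bar>s u p \<xi> m - I u\<bar> < \<bar>I' - I u\<bar> / 2" "\<bar>s u p \<xi> m - I'\<bar> < \<bar>I' - I u\<bar> / 2"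
        by (rule d1(2) d2(2), rule tagged_partition_anti[OF P], simp)+
      then show False using abs_triangle_ineq4[of "s u p \<xi> m - I u" "s u p \<xi> m - I'"] by simp
    qed
  qed
  with uni[OF e] show ?thesis unfolding s_def by auto
qed

text \<open>The nodes scale with \<open>u\<close>, so each sum is continuous in \<open>u\<close> and
  involves \<open>f\<close> at finitely many points; continuity and measurability of
  \<open>convolution\<close> are inherited from these sums.\<close>

definition Rsum :: "nat \<Rightarrow> (real \<Rightarrow> real) \<Rightarrow> real \<Rightarrow> real" where
  "Rsum m f u = (\<Sum>j<m. f (u - u * real j / real m) * (h (u * real (Suc j) / real m) - h (u * real j / real m)))"

lemma Rsum_uniform:
  assumes f: "continuous_on {0..1} f" and e: "e > 0"
  shows "\<exists>M. \<forall>m\<ge>M. \<forall>u\<in>{0..1}. \<bar>Rsum m f u - convolution f u\<bar> < e"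
proof -
  obtain d where d: "d > 0" "\<And>u p \<xi> m. u \<in> {0..1} \<Longrightarrow> tagged_partition u d p \<xi> m \<Longrightarrow>
     \<bar>(\<Sum>j<m. f (u - \<xi> j) * (h (p (Suc j)) - h (p j))) - convolution f u\<bar> < e"
    using convolution_uniform[OF f e] by blast
  obtain M :: nat where M: "1 / d < real M" using reals_Archimedean2 by blast
  have "\<bar>Rsum m f u - convolution f u\<bar> < e" if "m \<ge> M" and u: "u \<in> {0..1}" for m u
  proof -
    have m: "1 / d < real m" using M that by linarith
    then have "real m > 0" using d by (meson less_trans zero_less_divide_1_iff)
    moreover have "u / real m \<le> 1 / real m" using u by (intro divide_right_mono) auto
    moreover have "1 / real m < d" using m d \<open>real m > 0\<close> by (simp add: field_simps)
    ultimately have "tagged_partition u d (\<lambda>j. u * real j / real m) (\<lambda>j. u * real j / real m) m"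
      using u by (intro uniform_tagged_partition) auto
    from d(2)[OF u this] show ?thesis by (simp add: Rsum_def)
  qed
  then show ?thesis by blast
qed

lemma Rsum_LIMSEQ:
  assumes f: "continuous_on {0..1} f" and u: "u \<in> {0..1}"
  shows "(\<lambda>m. Rsum m f u) \<longlonglongrightarrow> convolution f u"
  by (rule LIMSEQ_I) (use Rsum_uniform[OF f] u in force)

lemma continuous_convolution:
  assumes f: "continuous_on {0..1} f"
  shows "continuous_on {0..1} (convolution f)"
proof (rule uniform_limit_theorem[of _ "\<lambda>m. Rsum m f" sequentially])
  show "uniform_limit {0..1} (\<lambda>m. Rsum m f) (convolution f) sequentially"
    unfolding uniform_limit_sequentially_iff dist_real_def using Rsum_uniform[OF f] by blast
  have "continuous_on {0..1} (Rsum m f)" for m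
    unfolding Rsum_def[abs_def]
  proof (intro continuous_on_sum continuous_on_mult continuous_on_diff)
    fix j assume j: "j \<in> {..<m}"
    have a: "u * real i / real m \<in> {0..u}" if "u \<in> {0..1}" "i \<le> m" for u i
    proof -
      have "u * real i \<le> u * real m" using that by (intro mult_left_mono) auto
      then show ?thesis using that j by (auto simp: divide_le_eq)
    qed
    show "continuous_on {0..1} (\<lambda>u. f (u - u * real j / real m))"
    proof (rule continuous_on_compose2[OF f])
      show "(\<lambda>u. u - u * real j / real m) ` {0..1} \<subseteq> {0..1}"
      proof (rule image_subsetI)
        fix u :: real assume u: "u \<in> {0..1}"
        have "u * real j / real m \<in> {0..u}" using j by (intro a u) simp
        with u show "u - u * real j / real m \<in> {0..1}" unfolding atLeastAtMost_iff by linarith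
      qed
    qed (use j in \<open>auto intro!: continuous_intros\<close>)
    have "continuous_on {0..1} (\<lambda>u. h (u * real i / real m))" if "i \<le> m" for i
    proof (rule continuous_on_compose2[OF continuous_h])
      show "(\<lambda>u. u * real i / real m) ` {0..1} \<subseteq> {-1..1}"
      proof (rule image_subsetI)
        fix u :: real assume u: "u \<in> {0..1}"
        from a[OF u that] u show "u * real i / real m \<in> {-1..1}" unfolding atLeastAtMost_iff by linarith
      qed
    qed (use j in \<open>auto intro!: continuous_intros\<close>)
    from this[of j] this[of "Suc j"] j
    show "continuous_on {0..1} (\<lambda>u. h (u * real (Suc j) / real m))" "continuous_on {0..1} (\<lambda>u. h (u * real j / real m))"
      by auto
  qed
  then show "\<forall>\<^sub>F m in sequentially. continuous_on {0..1} (Rsum m f)" by simp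
qed simp

text \<open>The sum for \<open>convolution f (1 - k / n)\<close> over multiples of
  \<open>1 / n\<close>, which is what the statistic becomes after time reversal.\<close>

definition grid_sum :: "nat \<Rightarrow> nat \<Rightarrow> (real \<Rightarrow> real) \<Rightarrow> real" where
  "grid_sum n k f = (\<Sum>j<n - k. f (1 - real (k + j) / real n) * (h (real (Suc j) / real n) - h (real j / real n)))"

lemma grid_sum_uniform:
  assumes f: "continuous_on {0..1} f" and e: "e > 0"
  shows "\<exists>M. \<forall>n\<ge>M. \<forall>k\<le>n. \<bar>grid_sum n k f - convolution f (1 - real k / real n)\<bar> < e"
proof -
  obtain d where d: "d > 0" "\<And>u p \<xi> m. u \<in> {0..1} \<Longrightarrow> tagged_partition u d p \<xi> m \<Longrightarrow>
     \<bar>(\<Sum>j<m. f (u - \<xi> j) * (h (p (Suc j)) - h (p j))) - convolution f u\<bar> < e"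
    using convolution_uniform[OF f e] by blast
  obtain M :: nat where M: "1 / d < real M" using reals_Archimedean2 by blast
  have "\<bar>grid_sum n k f - convolution f (1 - real k / real n)\<bar> < e" if "n \<ge> M" and k: "k \<le> n" for n k
  proof -
    have n: "1 / d < real n" using M that by linarith
    then have n0: "real n > 0" using d by (meson less_trans zero_less_divide_1_iff)
    define u where "u = 1 - real k / real n"
    have u: "u \<in> {0..1}" using k n0 by (auto simp: u_def divide_le_eq)
    have "1 / real n < d" using n d n0 by (simp add: field_simps)
    then have "tagged_partition u d (\<lambda>j. real j / real n) (\<lambda>j. real j / real n) (n - k)"
      using k n0 by (auto simp: tagged_partition_def u_def of_nat_diff diff_divide_distrib add_divide_distrib)
    from d(2)[OF u this] show ?thesis
      by (simp add: grid_sum_def u_def add_divide_distrib algebra_simps)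
  qed
  then show ?thesis by blast
qed

end

context kernel begin

text \<open>With \<open>F\<close> a block of high indices, uniformly small tails of the integrands
  give uniformly small tails of the integrals: \<open>sum_weighted_square_le\<close> holds for the
  Riemann sums and passes to their limit.\<close>

lemma convolution_tail_le:
  assumes F: "finite F" and \<rho>: "\<And>p. p \<in> F \<Longrightarrow> \<rho> p \<ge> 0" and f: "\<And>p. p \<in> F \<Longrightarrow> continuous_on {0..1} (f p)"
    and K: "\<And>s. s \<in> {0..1} \<Longrightarrow> (\<Sum>p\<in>F. \<rho> p * (f p s)\<^sup>2) \<le> K" and u: "u \<in> {0..1}"
  shows "(\<Sum>p\<in>F. \<rho> p * (convolution (f p) u)\<^sup>2) \<le> V\<^sup>2 * K"
proof (rule LIMSEQ_le_const2)
  show "(\<lambda>m. \<Sum>p\<in>F. \<rho> p * (Rsum m (f p) u)\<^sup>2) \<longlonglongrightarrow> (\<Sum>p\<in>F. \<rho> p * (convolution (f p) u)\<^sup>2)"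
    by (intro tendsto_sum tendsto_mult tendsto_const tendsto_power Rsum_LIMSEQ f u)
  have "0 \<le> (\<Sum>p\<in>F. \<rho> p * (f p 0)\<^sup>2)" using \<rho> by (intro sum_nonneg mult_nonneg_nonneg) auto
  also have "\<dots> \<le> K" by (rule K) simp
  finally have K0: "K \<ge> 0" .
  have "(\<Sum>p\<in>F. \<rho> p * (Rsum m (f p) u)\<^sup>2) \<le> V\<^sup>2 * K" if "m \<ge> 1" for m
  proof -
    have P: "tagged_partition u (u / real m + 1) (\<lambda>j. u * real j / real m) (\<lambda>j. u * real j / real m) m"
      using u that by (intro uniform_tagged_partition) auto
    let ?a = "\<lambda>j. h (u * real (Suc j) / real m) - h (u * real j / real m)"
    have "(\<Sum>p\<in>F. \<rho> p * (Rsum m (f p) u)\<^sup>2) \<le> (\<Sum>j<m. \<bar>?a j\<bar>)\<^sup>2 * K"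
      unfolding Rsum_def
    proof (rule sum_weighted_square_le[OF _ F \<rho>])
      fix j assume "j \<in> {..<m}"
      then have "u * real j / real m \<in> {0..u}" using tagged_partition_range(2)[OF P, of j] by simp
      then have "u - u * real j / real m \<in> {0..1}" using u unfolding atLeastAtMost_iff by linarith
      then show "(\<Sum>p\<in>F. \<rho> p * (f p (u - u * real j / real m))\<^sup>2) \<le> K" by (rule K)
    qed auto
    also have "\<dots> \<le> V\<^sup>2 * K"
      using tagged_partition_variation[OF P] u K0 by (intro mult_right_mono power_mono sum_nonneg) auto
    finally show ?thesis .
  qed
  then show "\<exists>N. \<forall>n\<ge>N. (\<Sum>p\<in>F. \<rho> p * (Rsum n (f p) u)\<^sup>2) \<le> V\<^sup>2 * K" by blast
qed

lemma grid_sum_tail_le: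
  assumes F: "finite F" and \<rho>: "\<And>p. p \<in> F \<Longrightarrow> \<rho> p \<ge> 0"
    and K: "\<And>s. s \<in> {0..1} \<Longrightarrow> (\<Sum>p\<in>F. \<rho> p * (f p s)\<^sup>2) \<le> K" and k: "k \<le> n"
  shows "(\<Sum>p\<in>F. \<rho> p * (grid_sum n k (f p))\<^sup>2) \<le> V\<^sup>2 * K"
proof -
  have "0 \<le> (\<Sum>p\<in>F. \<rho> p * (f p 0)\<^sup>2)" using \<rho> by (intro sum_nonneg mult_nonneg_nonneg) auto
  also have "\<dots> \<le> K" by (rule K) simp
  finally have K0: "K \<ge> 0" .
  let ?a = "\<lambda>j. h (real (Suc j) / real n) - h (real j / real n)"
  have "(\<Sum>p\<in>F. \<rho> p * (grid_sum n k (f p))\<^sup>2) \<le> (\<Sum>j<n - k. \<bar>?a j\<bar>)\<^sup>2 * K"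
    unfolding grid_sum_def
  proof (rule sum_weighted_square_le[OF _ F \<rho>])
    fix j assume "j \<in> {..<n - k}"
    then have "1 - real (k + j) / real n \<in> {0..1}" by (auto simp: divide_le_eq)
    then show "(\<Sum>p\<in>F. \<rho> p * (f p (1 - real (k + j) / real n))\<^sup>2) \<le> K" by (rule K)
  qed auto
  also have "\<dots> \<le> V\<^sup>2 * K"
  proof -
    have "(\<Sum>j<n - k. \<bar>?a j\<bar>) \<le> V"
      by (rule variation[of "\<lambda>j. real j / real n"]) (auto simp: divide_le_eq intro!: divide_right_mono)
    then show ?thesis using K0 by (intro mult_right_mono power_mono sum_nonneg) auto
  qed
  finally show ?thesis .
qed

end

lemma sqrt_suminf_tail:
  fixes a :: "nat \<Rightarrow> real"
  assumes a: "\<And>p. a p \<ge> 0" and tail: "\<And>Q. (\<Sum>p\<in>{P..<Q}. a p) \<le> e"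
  shows "summable a" "\<bar>sqrt (\<Sum>p. a p) - sqrt (\<Sum>p<P. a p)\<bar> \<le> sqrt e"
proof -
  have part: "(\<Sum>p<Q. a p) \<le> (\<Sum>p<P. a p) + e" for Q
  proof -
    have "(\<Sum>p<Q. a p) \<le> (\<Sum>p\<in>{..<P} \<union> {P..<Q}. a p)" by (rule sum_mono2) (auto simp: a)
    also have "\<dots> = (\<Sum>p<P. a p) + (\<Sum>p\<in>{P..<Q}. a p)" by (rule sum.union_disjoint) auto
    finally show ?thesis using tail[of Q] by linarith
  qed
  show su: "summable a" by (rule summableI_nonneg_bounded[OF a part])
  have up: "(\<Sum>p. a p) \<le> (\<Sum>p<P. a p) + e" by (rule suminf_le_const[OF su part])
  have lo: "(\<Sum>p<P. a p) \<le> (\<Sum>p. a p)" by (rule sum_le_suminf[OF su]) (auto simp: a)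
  have e: "e \<ge> 0" using tail[of P] by simp
  have "sqrt (\<Sum>p. a p) \<le> sqrt ((\<Sum>p<P. a p) + e)" using up by simp
  also have "\<dots> \<le> sqrt (\<Sum>p<P. a p) + sqrt e" by (rule sqrt_add_le_add_sqrt) (auto simp: e a sum_nonneg)
  finally show "\<bar>sqrt (\<Sum>p. a p) - sqrt (\<Sum>p<P. a p)\<bar> \<le> sqrt e" using lo e by (simp add: abs_le_iff)
qed

lemma sqrt_sum_weighted_diff_le:
  fixes x y :: "'p \<Rightarrow> real"
  assumes "\<And>p. p \<in> F \<Longrightarrow> \<rho> p \<ge> 0"
  shows "\<bar>sqrt (\<Sum>p\<in>F. \<rho> p * (x p)\<^sup>2) - sqrt (\<Sum>p\<in>F. \<rho> p * (y p)\<^sup>2)\<bar> \<le> (\<Sum>p\<in>F. sqrt (\<rho> p) * \<bar>x p - y p\<bar>)"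
proof -
  have L2: "sqrt (\<Sum>p\<in>F. \<rho> p * (z p)\<^sup>2) = L2_set (\<lambda>p. sqrt (\<rho> p) * z p) F" for z
    unfolding L2_set_def using assms by (intro arg_cong[of _ _ sqrt] sum.cong) (auto simp: power_mult_distrib)
  have tri: "L2_set (\<lambda>p. sqrt (\<rho> p) * x p) F \<le> L2_set (\<lambda>p. sqrt (\<rho> p) * y p) F + (\<Sum>p\<in>F. sqrt (\<rho> p) * \<bar>x p - y p\<bar>)"
    for x y :: "'p \<Rightarrow> real"
  proof -
    have "L2_set (\<lambda>p. sqrt (\<rho> p) * x p) F = L2_set (\<lambda>p. sqrt (\<rho> p) * y p + sqrt (\<rho> p) * (x p - y p)) F"
      by (simp add: algebra_simps)
    also have "\<dots> \<le> L2_set (\<lambda>p. sqrt (\<rho> p) * y p) F + L2_set (\<lambda>p. sqrt (\<rho> p) * (x p - y p)) F"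
      by (rule L2_set_triangle_ineq)
    also have "L2_set (\<lambda>p. sqrt (\<rho> p) * (x p - y p)) F \<le> (\<Sum>p\<in>F. \<bar>sqrt (\<rho> p) * (x p - y p)\<bar>)"
      by (rule L2_set_le_sum_abs)
    also have "\<dots> = (\<Sum>p\<in>F. sqrt (\<rho> p) * \<bar>x p - y p\<bar>)"
      using assms by (intro sum.cong) (auto simp: abs_mult)
    finally show ?thesis by simp
  qed
  from tri[of x y] tri[of y x] show ?thesis
    unfolding L2 by (simp add: abs_minus_commute abs_le_iff)
qed

text \<open>The tail bounds allow truncation at one \<open>P\<close> for all \<open>t\<close> and
  all grids at once; the finitely many remaining coordinates converge uniformly. The limit function
  is itself a uniform limit of continuous truncations, so its maxima over the grids tend to the
  supremum.\<close>

lemma (in kernel) Max_grid_sum_tendsto: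
  assumes \<rho>: "\<And>p. \<rho> p \<ge> (0::real)" and f: "\<And>p. continuous_on {0..1} (f p)"
    and tails: "\<And>e. e > 0 \<Longrightarrow> \<exists>P. \<forall>Q. \<forall>s\<in>{0..1}. (\<Sum>p\<in>{P..<Q}. \<rho> p * (f p s)\<^sup>2) \<le> e"
  shows "(\<lambda>n. Max ((\<lambda>k. sqrt (\<Sum>p. \<rho> p * (grid_sum n k (f p))\<^sup>2)) ` {1..<n})) \<longlonglongrightarrow>
    (SUP t\<in>{0<..<1}. sqrt (\<Sum>p. \<rho> p * (convolution (f p) (1 - t))\<^sup>2))"
proof -
  define g where "g t = sqrt (\<Sum>p. \<rho> p * (convolution (f p) (1 - t))\<^sup>2)" for t
  define gn where "gn n k = sqrt (\<Sum>p. \<rho> p * (grid_sum n k (f p))\<^sup>2)" for n k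
  have tl: "\<exists>P. (\<forall>t\<in>{0..1}. \<bar>g t - sqrt (\<Sum>p<P. \<rho> p * (convolution (f p) (1 - t))\<^sup>2)\<bar> \<le> e) \<and>
     (\<forall>n k. k \<le> n \<longrightarrow> \<bar>gn n k - sqrt (\<Sum>p<P. \<rho> p * (grid_sum n k (f p))\<^sup>2)\<bar> \<le> e)" if e: "e > 0" for e
  proof -
    \<comment> \<open>The tail lemmas lose a factor \<open>V^2\<close> and the square root is taken
      afterwards, so this choice leaves at most \<open>e\<close>.\<close>
    define e' where "e' = (e / (V + 1))\<^sup>2"
    have "e' > 0" using e V_nonneg by (simp add: e'_def)
    then obtain P where P: "\<And>Q s. s \<in> {0..1} \<Longrightarrow> (\<Sum>p\<in>{P..<Q}. \<rho> p * (f p s)\<^sup>2) \<le> e'" using tails by blast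
    have "sqrt (V\<^sup>2 * e') = V * (e / (V + 1))" using V_nonneg e by (simp add: e'_def real_sqrt_mult)
    also have "\<dots> \<le> e" using V_nonneg e by (simp add: field_simps)
    finally have le: "sqrt (V\<^sup>2 * e') \<le> e" .
    show ?thesis
    proof (intro exI[of _ P] conjI ballI allI impI)
      fix t :: real assume t: "t \<in> {0..1}"
      have "\<bar>g t - sqrt (\<Sum>p<P. \<rho> p * (convolution (f p) (1 - t))\<^sup>2)\<bar> \<le> sqrt (V\<^sup>2 * e')"
        unfolding g_def using t by (intro sqrt_suminf_tail convolution_tail_le \<rho> f P) (auto simp: \<rho>)
      with le show "\<bar>g t - sqrt (\<Sum>p<P. \<rho> p * (convolution (f p) (1 - t))\<^sup>2)\<bar> \<le> e" by linarith
    next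
      fix n k :: nat assume k: "k \<le> n"
      have "\<bar>gn n k - sqrt (\<Sum>p<P. \<rho> p * (grid_sum n k (f p))\<^sup>2)\<bar> \<le> sqrt (V\<^sup>2 * e')"
        unfolding gn_def using k by (intro sqrt_suminf_tail grid_sum_tail_le \<rho> P) (auto simp: \<rho>)
      with le show "\<bar>gn n k - sqrt (\<Sum>p<P. \<rho> p * (grid_sum n k (f p))\<^sup>2)\<bar> \<le> e" by linarith
    qed
  qed
  have cont: "continuous_on {0..1} g"
  proof -
    have "\<forall>j. \<exists>P. \<forall>t\<in>{0..1}. \<bar>g t - sqrt (\<Sum>p<P. \<rho> p * (convolution (f p) (1 - t))\<^sup>2)\<bar> \<le> 1 / real (Suc j)"
      using tl by (meson zero_less_divide_1_iff of_nat_0_less_iff zero_less_Suc)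
    then obtain P where P: "\<And>j t. t \<in> {0..1} \<Longrightarrow> \<bar>g t - sqrt (\<Sum>p<P j. \<rho> p * (convolution (f p) (1 - t))\<^sup>2)\<bar> \<le> 1 / real (Suc j)"
      by metis
    show ?thesis
    proof (rule uniform_limit_theorem[of _ "\<lambda>j t. sqrt (\<Sum>p<P j. \<rho> p * (convolution (f p) (1 - t))\<^sup>2)" sequentially])
      have "continuous_on {0..1} (\<lambda>t. convolution (f p) (1 - t))" for p
        by (rule continuous_on_compose2[OF continuous_convolution[OF f]]) (auto intro!: continuous_intros)
      then show "\<forall>\<^sub>F j in sequentially. continuous_on {0..1} (\<lambda>t. sqrt (\<Sum>p<P j. \<rho> p * (convolution (f p) (1 - t))\<^sup>2))"
        by (intro always_eventually allI continuous_intros)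
      show "uniform_limit {0..1} (\<lambda>j t. sqrt (\<Sum>p<P j. \<rho> p * (convolution (f p) (1 - t))\<^sup>2)) g sequentially"
        unfolding uniform_limit_sequentially_iff dist_real_def
      proof (intro allI impI)
        fix e :: real assume "e > 0"
        then obtain N where N: "inverse (real (Suc N)) < e" using reals_Archimedean by blast
        have "\<bar>sqrt (\<Sum>p<P j. \<rho> p * (convolution (f p) (1 - t))\<^sup>2) - g t\<bar> < e" if "j \<ge> N" "t \<in> {0..1}" for j t
        proof -
          have "1 / real (Suc j) \<le> inverse (real (Suc N))" using that by (simp add: divide_inverse)
          with P[OF that(2), of j] N show ?thesis by (simp add: abs_minus_commute)
        qed
        then show "\<exists>N. \<forall>n\<ge>N. \<forall>x\<in>{0..1}. \<bar>sqrt (\<Sum>p<P n. \<rho> p * (convolution (f p) (1 - x))\<^sup>2) - g x\<bar> < e" by blast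
      qed
    qed simp
  qed
  have approx: "\<exists>N. \<forall>n\<ge>N. \<forall>k\<le>n. \<bar>gn n k - g (real k / real n)\<bar> \<le> e" if e: "e > 0" for e
  proof -
    from e have "e / 3 > 0" by simp
    from tl[OF this] obtain P where
      P1: "\<And>t. t \<in> {0..1} \<Longrightarrow> \<bar>g t - sqrt (\<Sum>p<P. \<rho> p * (convolution (f p) (1 - t))\<^sup>2)\<bar> \<le> e / 3" and
      P2: "\<And>n k. k \<le> n \<Longrightarrow> \<bar>gn n k - sqrt (\<Sum>p<P. \<rho> p * (grid_sum n k (f p))\<^sup>2)\<bar> \<le> e / 3" by blast
    define A where "A = (\<Sum>p<P. sqrt (\<rho> p)) + 1"
    have A: "A > 0" unfolding A_def by (intro add_nonneg_pos sum_nonneg) (auto simp: \<rho>)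
    from e A have "e / (3 * A) > 0" by simp
    then have "\<forall>p. \<exists>M. \<forall>n\<ge>M. \<forall>k\<le>n. \<bar>grid_sum n k (f p) - convolution (f p) (1 - real k / real n)\<bar> < e / (3 * A)"
      using grid_sum_uniform[OF f] by blast
    then obtain M where M: "\<And>p n k. n \<ge> M p \<Longrightarrow> k \<le> n \<Longrightarrow> \<bar>grid_sum n k (f p) - convolution (f p) (1 - real k / real n)\<bar> < e / (3 * A)"
      by metis
    have "\<bar>gn n k - g (real k / real n)\<bar> \<le> e" if n: "n \<ge> Max (M ` {..P})" and k: "k \<le> n" for n k
    proof -
      have t: "real k / real n \<in> {0..1}" using k by (auto simp: divide_le_eq)
      have "\<bar>sqrt (\<Sum>p<P. \<rho> p * (grid_sum n k (f p))\<^sup>2) - sqrt (\<Sum>p<P. \<rho> p * (convolution (f p) (1 - real k / real n))\<^sup>2)\<bar>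
        \<le> (\<Sum>p<P. sqrt (\<rho> p) * \<bar>grid_sum n k (f p) - convolution (f p) (1 - real k / real n)\<bar>)"
        by (rule sqrt_sum_weighted_diff_le) (rule \<rho>)
      also have "\<dots> \<le> (\<Sum>p<P. sqrt (\<rho> p) * (e / (3 * A)))"
      proof (intro sum_mono mult_left_mono)
        fix p assume "p \<in> {..<P}"
        then have "M p \<le> Max (M ` {..P})" by (intro Max_ge) auto
        with n have "n \<ge> M p" by linarith
        from M[OF this k] show "\<bar>grid_sum n k (f p) - convolution (f p) (1 - real k / real n)\<bar> \<le> e / (3 * A)" by simp
      qed (simp add: \<rho>)
      also have "\<dots> \<le> A * (e / (3 * A))"
        using e A by (simp only: sum_distrib_right[symmetric]) (intro mult_right_mono, auto simp: A_def)
      also have "\<dots> = e / 3" using A by simp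
      finally show ?thesis using P1[OF t] P2[OF k] unfolding abs_le_iff by linarith
    qed
    then show ?thesis by blast
  qed
  have "(\<lambda>n. Max (gn n ` {1..<n}) - Max ((\<lambda>k. g (real k / real n)) ` {1..<n})) \<longlonglongrightarrow> 0"
  proof (rule LIMSEQ_I)
    fix e :: real assume e: "e > 0"
    then have "e / 2 > 0" by simp
    from approx[OF this] obtain N where N: "\<And>n k. n \<ge> N \<Longrightarrow> k \<le> n \<Longrightarrow> \<bar>gn n k - g (real k / real n)\<bar> \<le> e / 2" by blast
    have "norm (Max (gn n ` {1..<n}) - Max ((\<lambda>k. g (real k / real n)) ` {1..<n}) - 0) < e" if "n \<ge> max N 2" for n
    proof -
      have "\<bar>Max (gn n ` {1..<n}) - Max ((\<lambda>k. g (real k / real n)) ` {1..<n})\<bar> \<le> e / 2"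
        using that by (intro Max_diff_le N) auto
      with e show ?thesis by simp
    qed
    then show "\<exists>no. \<forall>n\<ge>no. norm (Max (gn n ` {1..<n}) - Max ((\<lambda>k. g (real k / real n)) ` {1..<n}) - 0) < e" by blast
  qed
  from tendsto_add[OF this grid_Max_tendsto_SUP[OF cont]]
  show ?thesis by (simp add: g_def gn_def)
qed

section \<open>Cadlag paths and the weak limit of the statistic\<close>

text \<open>The condition on \<open>a\<close> says that \<open>s\<close> and \<open>t\<close> lie on
  the same side of it, with \<open>a\<close> counted to the right; there the left limit or the value
  at \<open>a\<close> is close to both.\<close>

lemma cadlag01_local:
  fixes x :: "real \<Rightarrow> 'h::metric_space"
  assumes x: "cadlag01 x" and e: "e > 0" and a: "a \<in> {0..1}"
  shows "\<exists>\<eta>>0. \<forall>s\<in>{0..1} \<inter> ball a \<eta>. \<forall>t\<in>{0..1} \<inter> ball a \<eta>. s \<le> t \<longrightarrow> a \<notin> {s<..t} \<longrightarrow> dist (x s) (x t) < e"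
proof -
  have e2: "e / 2 > 0" using e by simp
  have "\<exists>b>a. \<forall>u\<in>{0..1}. a \<le> u \<and> u < b \<longrightarrow> dist (x u) (x a) < e / 2"
  proof (cases "a < 1")
    case True
    with x a have "(x \<longlongrightarrow> x a) (at_right a)" by (auto simp: cadlag01_def)
    from tendstoD[OF this e2] obtain b where "b > a" "\<forall>y>a. y < b \<longrightarrow> dist (x y) (x a) < e / 2"
      by (auto simp: eventually_at_right_field)
    then show ?thesis using e2 by (intro exI[of _ b]) (auto simp: le_less)
  next
    case False
    show ?thesis
    proof (rule exI[of _ 2], intro conjI ballI impI)
      show "2 > a" using a by simp
      fix u assume "u \<in> {0..1}" "a \<le> u \<and> u < 2"
      then have "u = a" using a False by simp
      then show "dist (x u) (x a) < e / 2" using e2 by simp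
    qed
  qed
  then obtain b where b: "b > a" "\<And>u. u \<in> {0..1} \<Longrightarrow> a \<le> u \<Longrightarrow> u < b \<Longrightarrow> dist (x u) (x a) < e / 2" by blast
  have "\<exists>c<a. \<exists>l. \<forall>u\<in>{0..1}. c < u \<and> u < a \<longrightarrow> dist (x u) l < e / 2"
  proof (cases "a > 0")
    case True
    then have "a \<in> {0<..1}" using a by simp
    moreover have "\<forall>t\<in>{0<..1}. \<exists>l. (x \<longlongrightarrow> l) (at_left t)" using x by (simp add: cadlag01_def)
    ultimately obtain l where "(x \<longlongrightarrow> l) (at_left a)" by blast
    from tendstoD[OF this e2] obtain c where "c < a" "\<forall>y>c. y < a \<longrightarrow> dist (x y) l < e / 2"
      by (auto simp: eventually_at_left_field)
    then show ?thesis by blast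
  next
    case False
    then show ?thesis using a by (intro exI[of _ "a - 1"]) auto
  qed
  then obtain c l where c: "c < a" "\<And>u. u \<in> {0..1} \<Longrightarrow> c < u \<Longrightarrow> u < a \<Longrightarrow> dist (x u) l < e / 2" by blast
  show ?thesis
  proof (rule exI[of _ "min (b - a) (a - c)"], intro conjI ballI impI)
    show "0 < min (b - a) (a - c)" using b c by simp
    fix s t assume st: "s \<in> {0..1} \<inter> ball a (min (b - a) (a - c))" "t \<in> {0..1} \<inter> ball a (min (b - a) (a - c))"
      "s \<le> t" "a \<notin> {s<..t}"
    then consider "t < a" | "a \<le> s" by fastforce
    then show "dist (x s) (x t) < e"
    proof cases
      case 1
      then have "c < s" "c < t" "s < a" using st by (auto simp: dist_real_def)
      then have "dist (x s) l < e / 2" "dist (x t) l < e / 2" using st 1 by (simp_all only: c(2) Int_iff)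
      then show ?thesis by (rule dist_triangle_half_l)
    next
      case 2
      then have "s < b" "t < b" "a \<le> t" using st by (auto simp: dist_real_def)
      then have "dist (x s) (x a) < e / 2" "dist (x t) (x a) < e / 2" using st 2 by (simp_all only: b(2) Int_iff)
      then show ?thesis by (rule dist_triangle_half_l)
    qed
  qed
qed

text \<open>A Lebesgue number argument. \<open>T\<close> consists of the centres of a finite cover
  and of a grid finer than its Lebesgue number, so an interval free of \<open>T\<close> lies in one
  ball and does not cross its centre.\<close>

lemma cadlag01_partition:
  fixes x :: "real \<Rightarrow> 'h::metric_space"
  assumes x: "cadlag01 x" and e: "e > 0"
  obtains T where "finite T" "\<And>s t. s \<in> {0..1} \<Longrightarrow> t \<in> {0..1} \<Longrightarrow> s \<le> t \<Longrightarrow> {s<..t} \<inter> T = {} \<Longrightarrow> dist (x s) (x t) < e"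
proof -
  obtain \<eta> where \<eta>: "\<And>a. a \<in> {0..1} \<Longrightarrow> \<eta> a > 0" "\<And>a s t. a \<in> {0..1} \<Longrightarrow> s \<in> {0..1} \<inter> ball a (\<eta> a) \<Longrightarrow>
      t \<in> {0..1} \<inter> ball a (\<eta> a) \<Longrightarrow> s \<le> t \<Longrightarrow> a \<notin> {s<..t} \<Longrightarrow> dist (x s) (x t) < e"
    using cadlag01_local[OF x e] by metis
  have "{0..1} \<subseteq> (\<Union>a\<in>{0..1::real}. ball a (\<eta> a))" using \<eta>(1) by force
  then obtain C where C: "C \<subseteq> {0..1}" "finite C" "{0..1} \<subseteq> (\<Union>a\<in>C. ball a (\<eta> a))"
    using compactE_image[OF compact_Icc, of "{0..1::real}" "\<lambda>a. ball a (\<eta> a)" 0 1] by (metis open_ball)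
  from Heine_Borel_lemma[OF compact_Icc C(3)] obtain r where r: "r > 0" "\<And>s. s \<in> {0..1} \<Longrightarrow> \<exists>a\<in>C. ball s r \<subseteq> ball a (\<eta> a)"
    by auto
  obtain N :: nat where N: "1 / r < real N" using reals_Archimedean2 by blast
  then have N0: "real N > 0" using r by (meson less_trans zero_less_divide_1_iff)
  have Nr: "1 / real N < r" using N N0 r by (simp add: field_simps)
  define T where "T = C \<union> (\<lambda>i. real i / real N) ` {..N}"
  show ?thesis
  proof (rule that[of T])
    show "finite T" using C by (simp add: T_def)
    fix s t assume st: "s \<in> {0..1}" "t \<in> {0..1::real}" "s \<le> t" "{s<..t} \<inter> T = {}"
    define k where "k = nat \<lfloor>s * real N\<rfloor>"
    have k: "real k \<le> s * real N" "s * real N < real k + 1"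
      using st N0 by (auto simp: k_def)
    have "t < real (Suc k) / real N"
    proof (rule ccontr)
      assume "\<not> t < real (Suc k) / real N"
      then have le: "real (Suc k) / real N \<le> t" by simp
      then have "real (Suc k) \<le> t * real N" using N0 by (simp add: divide_le_eq)
      also have "\<dots> \<le> real N" using st N0 by simp
      finally have "Suc k \<le> N" by simp
      moreover have "s < real (Suc k) / real N" using k N0 by (simp add: less_divide_eq)
      moreover have "real (Suc k) / real N \<in> T" if "Suc k \<le> N"
        unfolding T_def by (intro UnI2 image_eqI[of _ _ "Suc k"]) (use that in auto)
      ultimately have "real (Suc k) / real N \<in> {s<..t} \<inter> T" using le by simp
      with st(4) show False by blast
    qed
    also have "real (Suc k) / real N \<le> s + 1 / real N" using k N0 by (simp add: field_simps)
    finally have "t \<in> ball s r" "s \<in> ball s r" using Nr st r by (auto simp: dist_real_def)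
    with r(2)[OF st(1)] obtain a where a: "a \<in> C" "s \<in> ball a (\<eta> a)" "t \<in> ball a (\<eta> a)" by blast
    moreover have "a \<notin> {s<..t}" using a(1) st(4) by (auto simp: T_def)
    ultimately show "dist (x s) (x t) < e" using C(1) st by (intro \<eta>(2)[of a]) auto
  qed
qed

lemma cadlag01_bounded:
  fixes x :: "real \<Rightarrow> 'h::real_normed_vector"
  assumes x: "cadlag01 x"
  obtains B where "B > 0" "\<And>t. t \<in> {0..1} \<Longrightarrow> norm (x t) \<le> B"
proof -
  obtain T where T: "finite T" "\<And>s t. s \<in> {0..1} \<Longrightarrow> t \<in> {0..1} \<Longrightarrow> s \<le> t \<Longrightarrow> {s<..t} \<inter> T = {} \<Longrightarrow> dist (x s) (x t) < 1"
    using cadlag01_partition[OF x, of 1] by auto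
  let ?T = "insert 0 T \<inter> {0..1}"
  define B where "B = Max ((\<lambda>t. norm (x t)) ` ?T) + 1"
  have fin: "finite ?T" using T by simp
  have B: "norm (x t) \<le> B" if t: "t \<in> {0..1}" for t
  proof -
    define \<tau> where "\<tau> = Max {s\<in>?T. s \<le> t}"
    have fin': "finite {s\<in>?T. s \<le> t}" by (rule finite_subset[OF _ fin]) auto
    have "{s\<in>?T. s \<le> t} \<noteq> {}" using t by auto
    then have "\<tau> \<in> {s\<in>?T. s \<le> t}" unfolding \<tau>_def using fin' by (intro Max_in)
    then have \<tau>: "\<tau> \<in> ?T" "\<tau> \<le> t" by auto
    have \<tau>_ge: "s \<le> \<tau>" if "s \<in> ?T" "s \<le> t" for s unfolding \<tau>_def using fin' that by (intro Max_ge) auto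
    have "s \<notin> T" if s: "s \<in> {\<tau><..t}" for s
    proof
      assume "s \<in> T"
      moreover have "s \<in> {0..1}" using s t \<tau>(1) by auto
      ultimately have "s \<le> \<tau>" using s by (intro \<tau>_ge) auto
      with s show False by simp
    qed
    then have \<tau>': "{\<tau><..t} \<inter> T = {}" by blast
    have "dist (x \<tau>) (x t) < 1" using \<tau> \<tau>' t by (intro T(2)) auto
    moreover have "norm (x \<tau>) \<le> Max ((\<lambda>t. norm (x t)) ` ?T)" using fin \<tau> by (intro Max_ge) auto
    moreover have "norm (x t) \<le> norm (x \<tau>) + dist (x \<tau>) (x t)"
      using norm_triangle_sub[of "x t" "x \<tau>"] by (simp add: dist_norm norm_minus_commute)
    ultimately show ?thesis by (simp add: B_def)
  qed
  have "norm (x 0) \<le> Max ((\<lambda>t. norm (x t)) ` ?T)" using fin by (intro Max_ge) auto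
  then have "B > 0" using norm_ge_zero[of "x 0"] unfolding B_def by linarith
  with B that show ?thesis by blast
qed

text \<open>The least multiple of \<open>1 / (n + 1)\<close> strictly above \<open>s\<close>, cut
  off at 1: approach from the right is what right continuity can use, and at \<open>s = 1\<close>
  the value is exact.\<close>

definition grid_point :: "nat \<Rightarrow> real \<Rightarrow> real" where
  "grid_point n s = min 1 ((real_of_int \<lfloor>real (Suc n) * s\<rfloor> + 1) / real (Suc n))"

lemma cadlag01_grid_point_LIMSEQ:
  assumes x: "cadlag01 x" and s: "s \<in> {0..1}"
  shows "(\<lambda>n. x (grid_point n s)) \<longlonglongrightarrow> x s"
proof (cases "s = 1")
  case True
  have "grid_point n s = 1" for n by (simp add: grid_point_def True)
  then show ?thesis by (simp add: True)
next
  case False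
  with s have s1: "s < 1" "s \<ge> 0" by auto
  have gt: "s < (real_of_int \<lfloor>real (Suc n) * s\<rfloor> + 1) / real (Suc n)"
    and le: "(real_of_int \<lfloor>real (Suc n) * s\<rfloor> + 1) / real (Suc n) \<le> s + 1 / real (Suc n)" for n
  proof -
    have p: "real (Suc n) > 0" by simp
    have "real (Suc n) * s < real_of_int \<lfloor>real (Suc n) * s\<rfloor> + 1" by linarith
    then show "s < (real_of_int \<lfloor>real (Suc n) * s\<rfloor> + 1) / real (Suc n)"
      using p by (simp add: less_divide_eq mult.commute del: of_nat_Suc)
    have "real_of_int \<lfloor>real (Suc n) * s\<rfloor> \<le> real (Suc n) * s" by linarith
    then have "(real_of_int \<lfloor>real (Suc n) * s\<rfloor> + 1) / real (Suc n) \<le> (real (Suc n) * s + 1) / real (Suc n)"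
      using p by (intro divide_right_mono) auto
    also have "\<dots> = s + 1 / real (Suc n)" using p by (simp add: add_divide_distrib del: of_nat_Suc)
    finally show "(real_of_int \<lfloor>real (Suc n) * s\<rfloor> + 1) / real (Suc n) \<le> s + 1 / real (Suc n)" .
  qed
  have "(\<lambda>n. s + 1 / real (Suc n)) \<longlonglongrightarrow> s + 0" by (intro tendsto_intros LIMSEQ_Suc[OF lim_1_over_n])
  then have up: "(\<lambda>n. s + 1 / real (Suc n)) \<longlonglongrightarrow> s" by simp
  have "(\<lambda>n. grid_point n s) \<longlonglongrightarrow> s"
  proof (rule real_tendsto_sandwich[OF _ _ tendsto_const up])
    show "\<forall>\<^sub>F n in sequentially. s \<le> grid_point n s" using gt s1 by (intro always_eventually allI) (simp add: grid_point_def less_imp_le)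
    show "\<forall>\<^sub>F n in sequentially. grid_point n s \<le> s + 1 / real (Suc n)"
      using le by (intro always_eventually allI) (simp add: grid_point_def min_le_iff_disj)
  qed
  moreover have "\<forall>\<^sub>F n in sequentially. grid_point n s \<in> {s<..} \<and> grid_point n s \<noteq> s"
  proof (intro always_eventually allI)
    fix n have "s < grid_point n s" using gt[of n] s1 by (simp add: grid_point_def)
    then show "grid_point n s \<in> {s<..} \<and> grid_point n s \<noteq> s" by simp
  qed
  ultimately have "filterlim (\<lambda>n. grid_point n s) (at_right s) sequentially"
    by (auto simp: filterlim_at)
  moreover have "(x \<longlongrightarrow> x s) (at_right s)" using x s1 by (auto simp: cadlag01_def)
  ultimately show ?thesis using filterlim_compose by blast
qed

definition cadlag_process :: "'a measure \<Rightarrow> ('a \<Rightarrow> real \<Rightarrow> 'h::{real_normed_vector,second_countable_topology}) \<Rightarrow> bool" where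
  "cadlag_process M Y \<longleftrightarrow> (\<forall>t. (\<lambda>\<omega>. Y \<omega> t) \<in> borel_measurable M) \<and> (\<forall>\<omega>\<in>space M. cadlag01 (Y \<omega>))"

text \<open>The path read at grid points takes only countably many times, and right continuity lets
  it converge to the process. Joint measurability makes the window averages random
  variables.\<close>

lemma cadlag_process_joint_measurable:
  assumes Y: "cadlag_process M Y"
  shows "(\<lambda>(\<omega>, s::real). indicator {0..1} s *\<^sub>R Y \<omega> s) \<in> borel_measurable (M \<Otimes>\<^sub>M lborel)"
proof (rule borel_measurable_LIMSEQ_metric)
  fix n
  have [measurable]: "(\<lambda>\<omega>. Y \<omega> t) \<in> borel_measurable M" for t using Y by (simp add: cadlag_process_def)
  have 1: "(\<lambda>p. \<lfloor>real (Suc n) * snd p\<rfloor>) \<in> measurable (M \<Otimes>\<^sub>M lborel) (count_space UNIV)" by measurable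
  have "(\<lambda>p. Y (fst p) (min 1 ((real_of_int \<lfloor>real (Suc n) * snd p\<rfloor> + 1) / real (Suc n)))) \<in> borel_measurable (M \<Otimes>\<^sub>M lborel)"
    by (rule measurable_compose_countable[OF _ 1, of "\<lambda>i p. Y (fst p) (min 1 ((real_of_int i + 1) / real (Suc n)))"]) measurable
  then have "(\<lambda>p. indicator {0..1} (snd p) *\<^sub>R Y (fst p) (grid_point n (snd p))) \<in> borel_measurable (M \<Otimes>\<^sub>M lborel)"
    unfolding grid_point_def by measurable
  then show "(\<lambda>(\<omega>, s::real). indicator {0..1} s *\<^sub>R Y \<omega> (grid_point n s)) \<in> borel_measurable (M \<Otimes>\<^sub>M lborel)"
    by (simp add: case_prod_beta)
next
  fix p :: "_ \<times> real" assume p: "p \<in> space (M \<Otimes>\<^sub>M lborel)"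
  obtain \<omega> s where ps: "p = (\<omega>, s)" by force
  then have "\<omega> \<in> space M" using p by (auto simp: space_pair_measure)
  then have c: "cadlag01 (Y \<omega>)" using Y by (simp add: cadlag_process_def)
  have "(\<lambda>n. indicator {0..1} s *\<^sub>R Y \<omega> (grid_point n s)) \<longlonglongrightarrow> indicator {0..1} s *\<^sub>R Y \<omega> s"
  proof (cases "s \<in> {0..1}")
    case True
    then show ?thesis using cadlag01_grid_point_LIMSEQ[OF c True] by simp
  qed simp
  then show "(\<lambda>n. case p of (\<omega>, s) \<Rightarrow> indicator {0..1} s *\<^sub>R Y \<omega> (grid_point n s)) \<longlonglongrightarrow> (case p of (\<omega>, s) \<Rightarrow> indicator {0..1} s *\<^sub>R Y \<omega> s)"
    by (simp add: ps)
qed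

lemma cadlag01_measurable:
  fixes x :: "real \<Rightarrow> 'h::{real_normed_vector,second_countable_topology}"
  assumes x: "cadlag01 x"
  shows "(\<lambda>s. indicator {0..1} s *\<^sub>R x s) \<in> borel_measurable lborel"
proof -
  \<comment> \<open>A single path is treated as a process on a one-point space.\<close>
  have "cadlag_process (count_space {()}) (\<lambda>_. x)" using x by (simp add: cadlag_process_def)
  from cadlag_process_joint_measurable[OF this]
  have "(\<lambda>s::real. case ((), s) of (\<omega>, s) \<Rightarrow> indicator {0..1} s *\<^sub>R x s) \<in> borel_measurable lborel"
    by (rule measurable_Pair2) simp
  then show ?thesis by simp
qed

lemma cadlag01_integrable:
  fixes x :: "real \<Rightarrow> 'h::{banach,second_countable_topology}"
  assumes x: "cadlag01 x" and w: "w \<in> borel_measurable lborel" "\<And>s. \<bar>w s\<bar> \<le> K * indicator {0..1} s"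
  shows "integrable lborel (\<lambda>s. w s *\<^sub>R x s)"
proof -
  obtain B where B: "B > 0" "\<And>t. t \<in> {0..1} \<Longrightarrow> norm (x t) \<le> B" using cadlag01_bounded[OF x] by blast
  have eq: "w s *\<^sub>R x s = w s *\<^sub>R (indicator {0..1} s *\<^sub>R x s)" for s
    using w(2)[of s] by (cases "s \<in> {0..1}") simp_all
  show ?thesis
  proof (rule Bochner_Integration.integrable_bound)
    show "integrable lborel (\<lambda>s. K * B * indicator {0..1::real} s)" by simp
    show "(\<lambda>s. w s *\<^sub>R x s) \<in> borel_measurable lborel"
      unfolding eq using w(1) cadlag01_measurable[OF x] by measurable
    have "norm (w s *\<^sub>R x s) \<le> norm (K * B * indicator {0..1::real} s)" for s
    proof (cases "s \<in> {0..1}")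
      case True
      have "\<bar>w s\<bar> * norm (x s) \<le> K * B" using w(2)[of s] B(2)[OF True] True by (intro mult_mono) auto
      then show ?thesis using True by simp
    next
      case False
      then show ?thesis using w(2)[of s] by simp
    qed
    then show "AE s in lborel. norm (w s *\<^sub>R x s) \<le> norm (K * B * indicator {0..1::real} s)" by simp
  qed
qed

section \<open>Averages of a path over short windows\<close>

lemma integrable_indicator_Icc: "integrable lborel (indicator {a..b::real} :: real \<Rightarrow> real)"
  by (intro integrable_real_indicator) (auto simp: emeasure_lborel_Icc_eq)

text \<open>The factor \<open>1 - d\<close> keeps every window of length \<open>d\<close> inside the
  unit interval, from [0, d] at \<open>t = 0\<close> to [1 - d, 1] at \<open>t = 1\<close>, while
  \<open>t\<close> remains in its own window.\<close>

definition window :: "real \<Rightarrow> real \<Rightarrow> real set" where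
  "window d t = {(1 - d) * t..(1 - d) * t + d}"

definition smooth :: "real \<Rightarrow> (real \<Rightarrow> 'h::{banach,second_countable_topology}) \<Rightarrow> real \<Rightarrow> 'h" where
  "smooth d z t = (1 / d) *\<^sub>R (LINT s|lborel. indicator (window d t) s *\<^sub>R z s)"

lemma window_subset: "0 < d \<Longrightarrow> d \<le> 1 \<Longrightarrow> t \<in> {0..1} \<Longrightarrow> window d t \<subseteq> {0..1}"
proof
  fix s assume d: "0 < d" "d \<le> 1" and t: "t \<in> {0..1}" and s: "s \<in> window d t"
  have "0 \<le> (1 - d) * t" "(1 - d) * t \<le> (1 - d) * 1" using d t mult_left_mono[of t 1 "1 - d"] by auto
  with s show "s \<in> {0..1}" by (auto simp: window_def)
qed

lemma indicator_window_bound: "0 < d \<Longrightarrow> d \<le> 1 \<Longrightarrow> t \<in> {0..1} \<Longrightarrow> \<bar>indicator (window d t) s :: real\<bar> \<le> 1 * indicator {0..1::real} s"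
  using window_subset[of d t] by (auto simp: indicator_def)

lemma window_measurable [measurable]: "window d t \<in> sets lborel"
  by (simp add: window_def)

lemma window_dist: "0 < d \<Longrightarrow> d \<le> 1 \<Longrightarrow> t \<in> {0..1} \<Longrightarrow> s \<in> window d t \<Longrightarrow> \<bar>s - t\<bar> \<le> d"
proof -
  assume d: "0 < d" "d \<le> 1" and t: "t \<in> {0..1}" and s: "s \<in> window d t"
  have "0 \<le> d * t" "d * t \<le> d * 1" using d t mult_left_mono[of t 1 d] by auto
  with s show ?thesis by (auto simp: window_def algebra_simps abs_le_iff)
qed

locale smoothing =
  fixes d :: real assumes d: "0 < d" "d \<le> 1"
begin

lemma integrable_window:
  fixes z :: "real \<Rightarrow> 'h::{banach,second_countable_topology}"
  assumes z: "cadlag01 z" and t: "t \<in> {0..1}"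
  shows "integrable lborel (\<lambda>s. indicator (window d t) s *\<^sub>R z s)"
  by (rule cadlag01_integrable[OF z _ indicator_window_bound[OF d t]]) measurable

lemma integral_window: "t \<in> {0..1} \<Longrightarrow> (LINT s|lborel. indicator (window d t) s) = d"
  using d by (simp add: window_def)

lemma smooth_near:
  fixes z :: "real \<Rightarrow> 'h::{banach,second_countable_topology}"
  assumes z: "cadlag01 z" and t: "t \<in> {0..1}" and e: "\<And>s. s \<in> window d t \<Longrightarrow> norm (z s - c) \<le> e"
  shows "norm (smooth d z t - c) \<le> e"
proof -
  have ic: "integrable lborel (\<lambda>s. indicator (window d t) s *\<^sub>R c)"
    by (intro integrable_scaleR_left integrable_real_indicator) (auto simp: window_def emeasure_lborel_Icc_eq)
  have "(LINT s|lborel. indicator (window d t) s *\<^sub>R c) = d *\<^sub>R c"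
    using integral_window[OF t] by (subst integral_scaleR_left) (auto simp: window_def emeasure_lborel_Icc_eq intro!: integrable_real_indicator split: if_splits)
  then have "smooth d z t - c = (1 / d) *\<^sub>R ((LINT s|lborel. indicator (window d t) s *\<^sub>R z s) - (LINT s|lborel. indicator (window d t) s *\<^sub>R c))"
    using d by (simp add: smooth_def scaleR_diff_right)
  also have "(LINT s|lborel. indicator (window d t) s *\<^sub>R z s) - (LINT s|lborel. indicator (window d t) s *\<^sub>R c) =
    (LINT s|lborel. indicator (window d t) s *\<^sub>R (z s - c))"
    unfolding scaleR_diff_right by (rule Bochner_Integration.integral_diff[symmetric, OF integrable_window[OF z t] ic])
  finally have eq: "norm (smooth d z t - c) = (1 / d) * norm (LINT s|lborel. indicator (window d t) s *\<^sub>R (z s - c))" using d by simp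
  have "norm (LINT s|lborel. indicator (window d t) s *\<^sub>R (z s - c)) \<le> (LINT s|lborel. e * indicator (window d t) s)"
  proof (rule Bochner_Integration.integral_norm_bound_integral)
    show "integrable lborel (\<lambda>s. indicator (window d t) s *\<^sub>R (z s - c))"
      unfolding scaleR_diff_right by (rule Bochner_Integration.integrable_diff[OF integrable_window[OF z t] ic])
    show "integrable lborel (\<lambda>s. e * indicator (window d t) s)"
      unfolding window_def by (intro integrable_mult_right integrable_indicator_Icc)
  qed (use e in \<open>auto simp: indicator_def\<close>)
  also have "\<dots> = e * d" using integral_window[OF t] by simp
  finally show ?thesis unfolding eq using d by (simp add: divide_le_eq)
qed

lemma norm_smooth_le:
  fixes z :: "real \<Rightarrow> 'h::{banach,second_countable_topology}"
  assumes z: "cadlag01 z" and t: "t \<in> {0..1}" and B: "\<And>s. s \<in> {0..1} \<Longrightarrow> norm (z s) \<le> B"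
  shows "norm (smooth d z t) \<le> B"
proof -
  have "norm (smooth d z t - 0) \<le> B"
    by (rule smooth_near[OF z t]) (use B window_subset[OF d t] in auto)
  then show ?thesis by simp
qed

text \<open>Averages see only the L1 distance of two paths, and that distance is continuous in the
  Skorokhod sense; values at single times are not.\<close>

lemma smooth_diff_le:
  fixes y z :: "real \<Rightarrow> 'h::{banach,second_countable_topology}"
  assumes y: "cadlag01 y" and z: "cadlag01 z" and t: "t \<in> {0..1}"
  shows "norm (smooth d y t - smooth d z t) \<le> (LINT s|lborel. indicator {0..1} s * norm (y s - z s)) / d"
proof -
  have "norm (smooth d y t - smooth d z t) = norm (LINT s|lborel. indicator (window d t) s *\<^sub>R (y s - z s)) / d"
    unfolding smooth_def scaleR_diff_right[symmetric]
    by (subst Bochner_Integration.integral_diff[symmetric, OF integrable_window[OF y t] integrable_window[OF z t]])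
      (use d in \<open>simp add: scaleR_diff_right\<close>)
  also have "\<dots> \<le> (LINT s|lborel. indicator {0..1} s * norm (y s - z s)) / d"
  proof (rule divide_right_mono, rule Bochner_Integration.integral_norm_bound_integral)
    show "integrable lborel (\<lambda>s. indicator (window d t) s *\<^sub>R (y s - z s))"
      unfolding scaleR_diff_right by (rule Bochner_Integration.integrable_diff[OF integrable_window[OF y t] integrable_window[OF z t]])
    have "integrable lborel (\<lambda>s. indicator {0..1} s *\<^sub>R y s)" "integrable lborel (\<lambda>s. indicator {0..1} s *\<^sub>R z s)"
      by (rule cadlag01_integrable[OF y, of _ 1] cadlag01_integrable[OF z, of _ 1]; simp)+
    from Bochner_Integration.integrable_norm[OF Bochner_Integration.integrable_diff[OF this]]
    show "integrable lborel (\<lambda>s. indicator {0..1} s * norm (y s - z s))"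
      by (simp add: scaleR_diff_right[symmetric])
    fix s
    show "norm (indicator (window d t) s *\<^sub>R (y s - z s)) \<le> indicator {0..1} s * norm (y s - z s)"
      using window_subset[OF d t] by (auto simp: indicator_def)
  qed (use d in auto)
  finally show ?thesis .
qed

text \<open>Two windows of equal length differ only in two end pieces, each of length at most
  \<open>\<bar>s - t\<bar>\<close>.\<close>

lemma smooth_lipschitz:
  fixes z :: "real \<Rightarrow> 'h::{banach,second_countable_topology}"
  assumes z: "cadlag01 z" and B: "\<And>s. s \<in> {0..1} \<Longrightarrow> norm (z s) \<le> B" and st: "s \<in> {0..1}" "t \<in> {0..1}"
  shows "norm (smooth d z s - smooth d z t) \<le> 2 * B / d * \<bar>s - t\<bar>"
proof -
  have main: "norm (smooth d z s - smooth d z t) \<le> 2 * B / d * (t - s)" if st: "s \<in> {0..1}" "t \<in> {0..1}" "s \<le> t" for s t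
  proof -
    define a b where "a = (1 - d) * s" and "b = (1 - d) * t"
    have ab: "a \<le> b" "b - a \<le> t - s"
    proof -
      show "a \<le> b" unfolding a_def b_def using d st by (intro mult_left_mono) auto
      have "b - a = (1 - d) * (t - s)" by (simp add: a_def b_def algebra_simps)
      also have "\<dots> \<le> 1 * (t - s)" using d st by (intro mult_right_mono) auto
      finally show "b - a \<le> t - s" by simp
    qed
    have B0: "B \<ge> 0" using B[of 0] norm_ge_zero[of "z 0"] by (simp del: norm_ge_zero)
    have "norm (smooth d z s - smooth d z t) = norm (LINT u|lborel. indicator (window d s) u *\<^sub>R z u - indicator (window d t) u *\<^sub>R z u) / d"
      unfolding smooth_def scaleR_diff_right[symmetric]
      by (subst Bochner_Integration.integral_diff[symmetric, OF integrable_window[OF z st(1)] integrable_window[OF z st(2)]])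
        (use d in \<open>simp\<close>)
    also have "\<dots> \<le> (LINT u|lborel. B * indicator {a..b} u + B * indicator {a + d..b + d} u) / d"
    proof (rule divide_right_mono, rule Bochner_Integration.integral_norm_bound_integral)
      show "integrable lborel (\<lambda>u. indicator (window d s) u *\<^sub>R z u - indicator (window d t) u *\<^sub>R z u)"
        by (rule Bochner_Integration.integrable_diff[OF integrable_window[OF z st(1)] integrable_window[OF z st(2)]])
      show "integrable lborel (\<lambda>u. B * indicator {a..b} u + B * indicator {a + d..b + d} u)"
        by (intro Bochner_Integration.integrable_add integrable_mult_right integrable_indicator_Icc)
      fix u
      have w: "window d s = {a..a + d}" "window d t = {b..b + d}" by (auto simp: window_def a_def b_def)
      show "norm (indicator (window d s) u *\<^sub>R z u - indicator (window d t) u *\<^sub>R z u) \<le> B * indicator {a..b} u + B * indicator {a + d..b + d} u"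
      proof (cases "u \<in> {0..1}")
        case True
        then have "norm (z u) \<le> B" by (rule B)
        then show ?thesis unfolding w using ab B0 by (auto simp: indicator_def)
      next
        case False
        then have "u \<notin> window d s" "u \<notin> window d t" using window_subset[OF d st(1)] window_subset[OF d st(2)] by auto
        then show ?thesis using B0 by simp
      qed
    qed (use d in auto)
    also have "(LINT u|lborel. B * indicator {a..b} u + B * indicator {a + d..b + d} u) = 2 * B * (b - a)"
      using ab by (subst Bochner_Integration.integral_add) (auto intro!: integrable_mult_right integrable_indicator_Icc)
    also have "2 * B * (b - a) / d \<le> (2 * B * (t - s)) / d" using ab d B0 by (intro divide_right_mono mult_left_mono) auto
    finally show ?thesis by simp
  qed
  show ?thesis using main[of s t] main[of t s] st by (cases "s \<le> t") (auto simp: norm_minus_commute)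
qed

lemma smooth_measurable:
  assumes Y: "cadlag_process M Y" and t: "t \<in> {0..1}"
  shows "(\<lambda>\<omega>. smooth d (Y \<omega>) t) \<in> borel_measurable M"
proof -
  have eq: "indicator (window d t) s *\<^sub>R Y \<omega> s = indicator (window d t) s *\<^sub>R (indicator {0..1} s *\<^sub>R Y \<omega> s)" for s \<omega>
    using window_subset[OF d t] by (auto simp: indicator_def)
  have [measurable]: "(\<lambda>p. indicator {0..1} (snd p) *\<^sub>R Y (fst p) (snd p)) \<in> borel_measurable (M \<Otimes>\<^sub>M lborel)"
    using cadlag_process_joint_measurable[OF Y] by (simp add: case_prod_beta)
  have "(\<lambda>p. indicator (window d t) (snd p) *\<^sub>R (indicator {0..1} (snd p) *\<^sub>R Y (fst p) (snd p))) \<in> borel_measurable (M \<Otimes>\<^sub>M lborel)"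
    by measurable
  then have "(\<lambda>\<omega>. LINT s|lborel. indicator (window d t) s *\<^sub>R (indicator {0..1} s *\<^sub>R Y \<omega> s)) \<in> borel_measurable M"
    by (intro lborel.borel_measurable_lebesgue_integral) (simp add: case_prod_beta)
  then show ?thesis unfolding smooth_def eq by measurable
qed

end

definition bridge :: "(real \<Rightarrow> 'h::real_vector) \<Rightarrow> real \<Rightarrow> 'h" where
  "bridge z u = z u - u *\<^sub>R z 1"

lemma bridge_1 [simp]: "bridge z 1 = 0"
  by (simp add: bridge_def)

lemma norm_bridge_diff_le:
  fixes y z :: "real \<Rightarrow> 'h::real_normed_vector"
  assumes "\<And>t. t \<in> {0..1} \<Longrightarrow> norm (y t - z t) \<le> e" "t \<in> {0..1}"
  shows "norm (bridge y t - bridge z t) \<le> 2 * e"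
proof -
  have "bridge y t - bridge z t = (y t - z t) - t *\<^sub>R (y 1 - z 1)"
    by (simp add: bridge_def algebra_simps)
  also have "norm \<dots> \<le> norm (y t - z t) + \<bar>t\<bar> * norm (y 1 - z 1)"
    using norm_triangle_ineq4[of "y t - z t" "t *\<^sub>R (y 1 - z 1)"] by simp
  also have "\<dots> \<le> e + 1 * e" using assms by (intro add_mono mult_mono) auto
  finally show ?thesis by simp
qed

section \<open>The discrete functional and its dependence on the grid\<close>

context kernel begin

text \<open>The left-tagged Riemann-Stieltjes sum of \<open>w\<close> against \<open>h\<close>
  shifted by \<open>k / n\<close>, over the grid points from \<open>k / n\<close> on.\<close>

definition disc :: "nat \<Rightarrow> nat \<Rightarrow> (real \<Rightarrow> 'h::real_vector) \<Rightarrow> 'h" where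
  "disc n k w = (\<Sum>j\<in>{k..<n}. (h ((real (Suc j) - real k) / real n) - h ((real j - real k) / real n)) *\<^sub>R w (real j / real n))"

lemma disc_diff: "disc n k (\<lambda>t. y t - z t) = disc n k y - disc n k z"
  by (simp add: disc_def scaleR_diff_right sum_subtractf)

lemma norm_disc_le:
  fixes w :: "real \<Rightarrow> 'h::real_normed_vector"
  assumes B: "\<And>t. t \<in> {0..1} \<Longrightarrow> norm (w t) \<le> B" and k: "k \<le> n"
  shows "norm (disc n k w) \<le> V * B"
proof -
  have B0: "B \<ge> 0" using B[of 0] norm_ge_zero[of "w 0"] by (simp del: norm_ge_zero)
  let ?a = "\<lambda>j. h ((real (Suc j) - real k) / real n) - h ((real j - real k) / real n)"
  have "norm (disc n k w) \<le> (\<Sum>j\<in>{k..<n}. \<bar>?a j\<bar> * B)"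
    unfolding disc_def by (intro order_trans[OF norm_sum sum_mono]) (auto intro!: mult_left_mono B simp: divide_le_eq)
  also have "\<dots> = (\<Sum>j\<in>{k..<n}. \<bar>?a j\<bar>) * B" by (simp add: sum_distrib_right)
  also have "(\<Sum>j\<in>{k..<n}. \<bar>?a j\<bar>) = (\<Sum>j<n - k. \<bar>?a (j + k)\<bar>)"
    using k sum.shift_bounds_nat_ivl[of "\<lambda>j. \<bar>?a j\<bar>" 0 k "n - k"] by (simp add: atLeast0LessThan)
  also have "\<dots> = (\<Sum>j<n - k. \<bar>h (real (Suc j) / real n) - h (real j / real n)\<bar>)"
    by (simp add: algebra_simps)
  also have "\<dots> * B \<le> V * B"
    using B0 by (intro mult_right_mono variation[of "\<lambda>j. real j / real n"]) (auto simp: divide_le_eq intro!: divide_right_mono)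
  finally show ?thesis .
qed

lemma disc_eq_grid_sum:
  assumes k: "k \<le> n" and n: "n > 0"
  shows "disc n k (\<lambda>t. f (1 - t)) = grid_sum n k f"
proof -
  have "disc n k (\<lambda>t. f (1 - t)) = (\<Sum>j<n - k. (h ((real (Suc (j + k)) - real k) / real n) - h ((real (j + k) - real k) / real n)) * f (1 - real (j + k) / real n))"
    unfolding disc_def
    using k sum.shift_bounds_nat_ivl[of "\<lambda>j. (h ((real (Suc j) - real k) / real n) - h ((real j - real k) / real n)) * f (1 - real j / real n)" 0 k "n - k"]
    by (simp add: atLeast0LessThan)
  also have "\<dots> = grid_sum n k f"
    unfolding grid_sum_def by (intro sum.cong) (simp_all add: mult.commute add.commute)
  finally show ?thesis .
qed

text \<open>The Abel dual of \<open>disc\<close>: here \<open>h\<close> is the integrand and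
  \<open>w\<close> the integrator. The shift is a real number, so that grids of different size can
  be compared at one shift.\<close>

definition dual_sum :: "nat \<Rightarrow> real \<Rightarrow> (real \<Rightarrow> 'h::real_vector) \<Rightarrow> 'h" where
  "dual_sum n \<kappa> w = (\<Sum>i<n. h (real (Suc i) / real n - \<kappa>) *\<^sub>R (w (real (Suc i) / real n) - w (real i / real n)))"

text \<open>The boundary term at 1 vanishes with \<open>w 1\<close>, the one at 0 because
  \<open>h\<close> is zero left of the origin; for the same reason the terms below \<open>k\<close>
  vanish and the sum can start at \<open>k\<close>.\<close>

lemma disc_by_parts:
  fixes w :: "real \<Rightarrow> 'h::real_vector"
  assumes w: "w 1 = 0" and k: "1 \<le> k" "k \<le> n"
  shows "disc n k w = - dual_sum n (real k / real n) w"
proof -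
  define a where "a i = h (real i / real n - real k / real n)" for i
  have n: "real n > 0" using k by simp
  have tele: "(\<Sum>i<m. a (Suc i) *\<^sub>R (w (real (Suc i) / real n) - w (real i / real n))) + (\<Sum>i<m. (a (Suc i) - a i) *\<^sub>R w (real i / real n))
     = a m *\<^sub>R w (real m / real n) - a 0 *\<^sub>R w 0" for m
    by (induction m) (simp_all add: algebra_simps del: of_nat_Suc)
  have a0: "a i = 0" if "i \<le> k" for i
    unfolding a_def diff_divide_distrib[symmetric] using that n k by (intro h_zero) (auto simp: divide_le_eq le_divide_eq)
  have "(\<Sum>i<n. (a (Suc i) - a i) *\<^sub>R w (real i / real n)) = (\<Sum>i\<in>{k..<n}. (a (Suc i) - a i) *\<^sub>R w (real i / real n))"
    by (rule sum.mono_neutral_right) (auto simp: a0)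
  also have "\<dots> = disc n k w"
    unfolding disc_def by (simp only: a_def diff_divide_distrib)
  finally have "dual_sum n (real k / real n) w + disc n k w = 0"
    using tele[of n] n w a0[of 0] unfolding dual_sum_def a_def by simp
  then show ?thesis by (simp add: eq_neg_iff_add_eq_0 add.commute)
qed

text \<open>The increments of a Lipschitz path have total length at most \<open>L\<close>, so a
  shift costs no more than the Hoelder modulus of \<open>h\<close>.\<close>

lemma dual_sum_shift:
  fixes w :: "real \<Rightarrow> 'h::real_normed_vector"
  assumes L: "\<And>s t. s \<in> {0..1} \<Longrightarrow> t \<in> {0..1} \<Longrightarrow> norm (w s - w t) \<le> L * \<bar>s - t\<bar>" and L0: "L \<ge> 0"
    and \<kappa>: "\<kappa> \<in> {0..1}" "\<kappa>' \<in> {0..1}" and n: "n > 0"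
  shows "norm (dual_sum n \<kappa> w - dual_sum n \<kappa>' w) \<le> L * (\<beta> * \<bar>\<kappa> - \<kappa>'\<bar> powr \<alpha>)"
proof -
  have n: "real n > 0" using n by simp
  have "norm (dual_sum n \<kappa> w - dual_sum n \<kappa>' w) =
      norm (\<Sum>i<n. (h (real (Suc i) / real n - \<kappa>) - h (real (Suc i) / real n - \<kappa>')) *\<^sub>R (w (real (Suc i) / real n) - w (real i / real n)))"
    unfolding dual_sum_def by (simp only: sum_subtractf[symmetric] scaleR_diff_left)
  also have "\<dots> \<le> (\<Sum>i<n. (\<beta> * \<bar>\<kappa> - \<kappa>'\<bar> powr \<alpha>) * (L * (1 / real n)))"
  proof (rule order_trans[OF norm_sum sum_mono])
    fix i assume i: "i \<in> {..<n}"
    have t: "real (Suc i) / real n \<in> {0..1}" "real i / real n \<in> {0..1}" using i by (auto simp: divide_le_eq)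
    have "\<bar>h (real (Suc i) / real n - \<kappa>) - h (real (Suc i) / real n - \<kappa>')\<bar> \<le> \<beta> * \<bar>(real (Suc i) / real n - \<kappa>) - (real (Suc i) / real n - \<kappa>')\<bar> powr \<alpha>"
      using t \<kappa> unfolding atLeastAtMost_iff by (intro hoelder) (simp_all only: atLeastAtMost_iff, linarith+)
    moreover have "norm (w (real (Suc i) / real n) - w (real i / real n)) \<le> L * (1 / real n)"
      using L[OF t] n by (simp add: diff_divide_distrib[symmetric])
    ultimately show "norm ((h (real (Suc i) / real n - \<kappa>) - h (real (Suc i) / real n - \<kappa>')) *\<^sub>R (w (real (Suc i) / real n) - w (real i / real n)))
       \<le> (\<beta> * \<bar>\<kappa> - \<kappa>'\<bar> powr \<alpha>) * (L * (1 / real n))"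
      using L0 \<beta> by (simp only: norm_scaleR) (intro mult_mono, auto simp: abs_minus_commute simp del: of_nat_Suc)
  qed
  also have "\<dots> = L * (\<beta> * \<bar>\<kappa> - \<kappa>'\<bar> powr \<alpha>)" using n by simp
  finally show ?thesis .
qed

text \<open>Increments of \<open>w\<close> telescope over the subdivided cells, so refining only
  moves the point where \<open>h\<close> is evaluated, and by at most \<open>1 / n\<close>.\<close>

lemma dual_sum_refine:
  fixes w :: "real \<Rightarrow> 'h::real_normed_vector"
  assumes L: "\<And>s t. s \<in> {0..1} \<Longrightarrow> t \<in> {0..1} \<Longrightarrow> norm (w s - w t) \<le> L * \<bar>s - t\<bar>" and L0: "L \<ge> 0"
    and \<kappa>: "\<kappa> \<in> {0..1}" and n: "n > 0" and m: "m > 0"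
  shows "norm (dual_sum n \<kappa> w - dual_sum (n * m) \<kappa> w) \<le> L * (\<beta> * (1 / real n) powr \<alpha>)"
proof -
  define N where "N = real (n * m)"
  have N: "N > 0" "real n > 0" "real m > 0" "N = real n * real m" using n m by (auto simp: N_def)
  define g where "g l = w (real l / N)" for l
  have gn: "w (real i / real n) = g (i * m)" for i using N by (simp add: g_def)
  have blk: "{i * m..<i * m + m} = {i * m..<Suc i * m}" for i by (simp add: add.commute)
  have dn: "dual_sum n \<kappa> w = (\<Sum>i<n. \<Sum>l\<in>{i * m..<i * m + m}. h (real (Suc i) / real n - \<kappa>) *\<^sub>R (g (Suc l) - g l))"
  proof -
    have "g (Suc i * m) - g (i * m) = (\<Sum>l\<in>{i * m..<i * m + m}. g (Suc l) - g l)" for i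
      unfolding blk by (rule sum_Suc_diff'[symmetric]) simp
    then show ?thesis unfolding dual_sum_def gn by (simp only: scaleR_sum_right)
  qed
  have dN: "dual_sum (n * m) \<kappa> w = (\<Sum>i<n. \<Sum>l\<in>{i * m..<i * m + m}. h (real (Suc l) / N - \<kappa>) *\<^sub>R (g (Suc l) - g l))"
    unfolding dual_sum_def N_def[symmetric] g_def[symmetric] by (rule sum.nat_group[symmetric])
  have "dual_sum n \<kappa> w - dual_sum (n * m) \<kappa> w =
     (\<Sum>i<n. \<Sum>l\<in>{i * m..<i * m + m}. (h (real (Suc i) / real n - \<kappa>) - h (real (Suc l) / N - \<kappa>)) *\<^sub>R (g (Suc l) - g l))"
    unfolding dn dN by (simp only: sum_subtractf[symmetric] scaleR_diff_left)
  also have "norm \<dots> \<le> (\<Sum>i<n. \<Sum>l\<in>{i * m..<i * m + m}. (\<beta> * (1 / real n) powr \<alpha>) * (L * (1 / N)))"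
  proof (rule order_trans[OF norm_sum sum_mono], rule order_trans[OF norm_sum sum_mono])
    fix i l assume i: "i \<in> {..<n}" and l: "l \<in> {i * m..<i * m + m}"
    have lnm: "Suc l \<le> n * m"
    proof -
      have "Suc l \<le> Suc i * m" using l by auto
      also have "\<dots> \<le> n * m" using i by (intro mult_le_mono1) auto
      finally show ?thesis .
    qed
    have tl: "real (Suc l) / N \<in> {0..1}" "real l / N \<in> {0..1}"
    proof -
      have "real (Suc l) \<le> N" unfolding N_def using lnm by (simp only: of_nat_le_iff)
      then show "real (Suc l) / N \<in> {0..1}" "real l / N \<in> {0..1}" using N by (auto simp: divide_le_eq)
    qed
    have ti: "real (Suc i) / real n \<in> {0..1}" using i by (auto simp: divide_le_eq)
    have d1: "real (Suc l) / N \<le> real (Suc i) / real n"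
    proof -
      have "real (Suc l) \<le> real (Suc i * m)" using l by (subst of_nat_le_iff) auto
      also have "\<dots> = real (Suc i) * real m" by (rule of_nat_mult)
      finally have "real (Suc l) / N \<le> (real (Suc i) * real m) / N" using N(1) by (intro divide_right_mono) auto
      also have "\<dots> = real (Suc i) / real n" using N by simp
      finally show ?thesis .
    qed
    have d2: "real (Suc i) / real n \<le> real (Suc l) / N + 1 / real n"
    proof -
      have "real (i * m) \<le> real (Suc l)" using l by (subst of_nat_le_iff) auto
      then have "real i / real n \<le> real (Suc l) / N" using N by (simp add: field_simps del: of_nat_Suc)
      moreover have "real (Suc i) / real n = real i / real n + 1 / real n" by (simp add: add_divide_distrib)
      ultimately show ?thesis by linarith
    qed
    have "\<bar>h (real (Suc i) / real n - \<kappa>) - h (real (Suc l) / N - \<kappa>)\<bar> \<le> \<beta> * \<bar>(real (Suc i) / real n - \<kappa>) - (real (Suc l) / N - \<kappa>)\<bar> powr \<alpha>"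
      using tl ti \<kappa> unfolding atLeastAtMost_iff by (intro hoelder) (simp_all only: atLeastAtMost_iff, linarith+)
    also have "\<dots> \<le> \<beta> * (1 / real n) powr \<alpha>"
      using d1 d2 \<alpha> \<beta> by (intro mult_left_mono powr_mono2) auto
    finally have "\<bar>h (real (Suc i) / real n - \<kappa>) - h (real (Suc l) / N - \<kappa>)\<bar> \<le> \<beta> * (1 / real n) powr \<alpha>" .
    moreover have "norm (g (Suc l) - g l) \<le> L * (1 / N)"
      using L[OF tl] N by (simp add: g_def diff_divide_distrib[symmetric])
    ultimately show "norm ((h (real (Suc i) / real n - \<kappa>) - h (real (Suc l) / N - \<kappa>)) *\<^sub>R (g (Suc l) - g l)) \<le> (\<beta> * (1 / real n) powr \<alpha>) * (L * (1 / N))"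
      using L0 \<beta> by (simp only: norm_scaleR) (intro mult_mono, auto)
  qed
  also have "\<dots> = L * (\<beta> * (1 / real n) powr \<alpha>)" using N by simp
  finally show ?thesis .
qed

text \<open>Refine both grids to \<open>n * m\<close>, change the shift there, and return: three
  errors of the same size.\<close>

lemma disc_compare:
  fixes w :: "real \<Rightarrow> 'h::real_normed_vector"
  assumes L: "\<And>s t. s \<in> {0..1} \<Longrightarrow> t \<in> {0..1} \<Longrightarrow> norm (w s - w t) \<le> L * \<bar>s - t\<bar>" and L0: "L \<ge> 0" and w: "w 1 = 0"
    and k: "k \<in> {1..<n}" and k': "k' \<in> {1..<m}" and close: "\<bar>real k / real n - real k' / real m\<bar> \<le> 1 / real r"
    and r: "r > 0" "r \<le> n" "r \<le> m"
  shows "norm (disc n k w - disc m k' w) \<le> 3 * (L * (\<beta> * (1 / real r) powr \<alpha>))"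
proof -
  let ?\<kappa> = "real k / real n" and ?\<kappa>' = "real k' / real m"
  have \<kappa>: "?\<kappa> \<in> {0..1}" "?\<kappa>' \<in> {0..1}" using k k' by (auto simp: divide_le_eq)
  have nm: "n > 0" "m > 0" "n * m > 0" using k k' by auto
  have mono: "L * (\<beta> * x powr \<alpha>) \<le> L * (\<beta> * (1 / real r) powr \<alpha>)" if "0 \<le> x" "x \<le> 1 / real r" for x
    using that L0 \<alpha> \<beta> by (intro mult_left_mono powr_mono2) auto
  have "1 / real n \<le> 1 / real r" "1 / real m \<le> 1 / real r" using r by (auto simp: frac_le)
  then have 1: "norm (dual_sum n ?\<kappa> w - dual_sum (n * m) ?\<kappa> w) \<le> L * (\<beta> * (1 / real r) powr \<alpha>)"
    and 2: "norm (dual_sum m ?\<kappa>' w - dual_sum (n * m) ?\<kappa>' w) \<le> L * (\<beta> * (1 / real r) powr \<alpha>)"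
    using order_trans[OF dual_sum_refine[OF L L0 \<kappa>(1) nm(1,2)] mono]
      order_trans[OF dual_sum_refine[OF L L0 \<kappa>(2) nm(2,1)] mono] by (auto simp: mult.commute)
  have 3: "norm (dual_sum (n * m) ?\<kappa> w - dual_sum (n * m) ?\<kappa>' w) \<le> L * (\<beta> * (1 / real r) powr \<alpha>)"
    using order_trans[OF dual_sum_shift[OF L L0 \<kappa> nm(3)] mono] close by auto
  have eq: "disc n k w - disc m k' w = - ((dual_sum n ?\<kappa> w - dual_sum (n * m) ?\<kappa> w) +
     ((dual_sum (n * m) ?\<kappa> w - dual_sum (n * m) ?\<kappa>' w) - (dual_sum m ?\<kappa>' w - dual_sum (n * m) ?\<kappa>' w)))"
    using disc_by_parts[of w k n, OF w] disc_by_parts[of w k' m, OF w] k k' by (simp add: algebra_simps)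
  have "norm (disc n k w - disc m k' w) \<le> norm (dual_sum n ?\<kappa> w - dual_sum (n * m) ?\<kappa> w) +
     (norm (dual_sum (n * m) ?\<kappa> w - dual_sum (n * m) ?\<kappa>' w) + norm (dual_sum m ?\<kappa>' w - dual_sum (n * m) ?\<kappa>' w))"
    unfolding eq norm_minus_cancel by (rule order_trans[OF norm_triangle_ineq add_left_mono[OF norm_triangle_ineq4]])
  with 1 2 3 show ?thesis by linarith
qed

lemma grid_index_near:
  assumes k: "k \<in> {1..<n}" and m: "m \<ge> 2"
  obtains k' where "k' \<in> {1..<m}" "\<bar>real k / real n - real k' / real m\<bar> \<le> 1 / real m"
proof -
  define x where "x = real k / real n * real m"
  have n: "real n > 0" "real m > 0" using k m by auto
  have x: "x > 0" "x < real m" using k n by (auto simp: x_def divide_less_eq)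
  define j where "j = nat \<lfloor>x\<rfloor>"
  have j: "real j \<le> x" "x < real j + 1" using x by (auto simp: j_def)
  have jm: "j < m" using j x by linarith
  \<comment> \<open>Rounding down may give 0, which is not an admissible index; 1 is still within
    distance one of \<open>x\<close>.\<close>
  define k' where "k' = max 1 j"
  have kn: "real k / real n = x / real m" using n by (simp add: x_def)
  have "\<bar>x - real k'\<bar> \<le> 1" using j x by (auto simp: k'_def max_def)
  then have "\<bar>x - real k'\<bar> / real m \<le> 1 / real m" using n by (intro divide_right_mono) auto
  then have "\<bar>real k / real n - real k' / real m\<bar> \<le> 1 / real m"
    using n unfolding kn diff_divide_distrib[symmetric] by simp
  moreover have "k' \<in> {1..<m}" using jm m by (auto simp: k'_def)
  ultimately show ?thesis using that by blast
qed

text \<open>\<open>R\<close> is the identity for the unweighted statistic and the inverse root of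
  \<open>C + lam 0 * Id\<close> for the weighted one, so that both share one limit argument.\<close>

definition Phi :: "('h::real_normed_vector \<Rightarrow>\<^sub>L 'h) \<Rightarrow> nat \<Rightarrow> (real \<Rightarrow> 'h) \<Rightarrow> real" where
  "Phi R n z = Max ((\<lambda>k. norm (R (disc n k (bridge z)))) ` {1..<n})"

lemma Phi_lipschitz:
  assumes e: "\<And>t. t \<in> {0..1} \<Longrightarrow> norm (y t - z t) \<le> e" and n: "n \<ge> 2"
  shows "\<bar>Phi R n y - Phi R n z\<bar> \<le> norm R * (V * (2 * e))"
  unfolding Phi_def
proof (rule Max_diff_le)
  fix k assume k: "k \<in> {1..<n}"
  have "\<bar>norm (R (disc n k (bridge y))) - norm (R (disc n k (bridge z)))\<bar> \<le> norm (R (disc n k (bridge y) - disc n k (bridge z)))"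
    by (simp add: blinfun.diff_right norm_triangle_ineq3)
  also have "\<dots> \<le> norm R * norm (disc n k (bridge y) - disc n k (bridge z))" by (rule norm_blinfun)
  also have "\<dots> \<le> norm R * (V * (2 * e))"
    unfolding disc_diff[symmetric] using k
    by (intro mult_left_mono norm_disc_le norm_bridge_diff_le e) auto
  finally show "\<bar>norm (R (disc n k (bridge y))) - norm (R (disc n k (bridge z)))\<bar> \<le> norm R * (V * (2 * e))" .
qed (use n in auto)

lemma Max_le_Max_add:
  fixes f :: "'i \<Rightarrow> real" and g :: "'j \<Rightarrow> real"
  assumes "finite I" "I \<noteq> {}" "finite J" "\<And>i. i \<in> I \<Longrightarrow> \<exists>j\<in>J. f i \<le> g j + e"
  shows "Max (f ` I) \<le> Max (g ` J) + e"
proof (subst Max_le_iff)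
  show "\<forall>a\<in>f ` I. a \<le> Max (g ` J) + e"
  proof
    fix a assume "a \<in> f ` I"
    then obtain i where i: "i \<in> I" "a = f i" by blast
    then obtain j where j: "j \<in> J" "f i \<le> g j + e" using assms by blast
    moreover have "g j \<le> Max (g ` J)" using j assms by (intro Max_ge) auto
    ultimately show "a \<le> Max (g ` J) + e" using i by linarith
  qed
qed (use assms in auto)

lemma Phi_compare:
  assumes L: "\<And>s t. s \<in> {0..1} \<Longrightarrow> t \<in> {0..1} \<Longrightarrow> norm (bridge z s - bridge z t) \<le> L * \<bar>s - t\<bar>" and L0: "L \<ge> 0"
    and m: "2 \<le> m" "m \<le> n"
  shows "\<bar>Phi R n z - Phi R m z\<bar> \<le> norm R * (3 * (L * (\<beta> * (1 / real m) powr \<alpha>)))"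
proof -
  let ?e = "norm R * (3 * (L * (\<beta> * (1 / real m) powr \<alpha>)))"
  have le: "Phi R a z \<le> Phi R b z + ?e" if ab: "2 \<le> a" "2 \<le> b" "m \<le> a" "m \<le> b" for a b
    unfolding Phi_def
  proof (rule Max_le_Max_add)
    fix k assume k: "k \<in> {1..<a}"
    obtain k' where k': "k' \<in> {1..<b}" "\<bar>real k / real a - real k' / real b\<bar> \<le> 1 / real b"
      using grid_index_near[OF k ab(2)] by blast
    have "1 / real b \<le> 1 / real m" using ab m by (simp add: frac_le)
    then have cl: "\<bar>real k / real a - real k' / real b\<bar> \<le> 1 / real m" using k'(2) by linarith
    have "norm (R (disc a k (bridge z))) - norm (R (disc b k' (bridge z))) \<le> norm (R (disc a k (bridge z) - disc b k' (bridge z)))"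
      by (simp add: blinfun.diff_right norm_triangle_ineq2)
    also have "\<dots> \<le> norm R * norm (disc a k (bridge z) - disc b k' (bridge z))" by (rule norm_blinfun)
    also have "\<dots> \<le> ?e"
      using m ab by (intro mult_left_mono disc_compare[OF L L0 bridge_1 k k'(1) cl]) auto
    finally show "\<exists>j\<in>{1..<b}. norm (R (disc a k (bridge z))) \<le> norm (R (disc b j (bridge z))) + ?e"
      using k'(1) by (intro bexI[of _ k']) auto
  qed (use ab in auto)
  from le[of n m] le[of m n] m show ?thesis by (simp add: abs_le_iff)
qed

end

locale smoothed_kernel = kernel + smoothing
begin

text \<open>Averaging costs the Lipschitz bound of \<open>Phi\<close>. Exchanging the grid needs a
  Lipschitz path: the averaged one has constant \<open>2 * B / d\<close>, and tying it down adds
  \<open>B\<close>.\<close>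

lemma Phi_smooth_compare:
  fixes z :: "real \<Rightarrow> 'h::{banach,second_countable_topology}"
  assumes z: "cadlag01 z" and B: "\<And>t. t \<in> {0..1} \<Longrightarrow> norm (z t) \<le> B"
    and e: "\<And>t. t \<in> {0..1} \<Longrightarrow> norm (z t - smooth d z t) \<le> e" and m: "2 \<le> m" "m \<le> n"
  shows "\<bar>Phi R n z - Phi R m (smooth d z)\<bar> \<le> norm R * (V * (2 * e)) + norm R * (3 * (((2 / d + 1) * B) * (\<beta> * (1 / real m) powr \<alpha>)))"
proof -
  have B0: "B \<ge> 0" using B[of 0] norm_ge_zero[of "z 0"] by (simp del: norm_ge_zero)
  have "norm (bridge (smooth d z) s - bridge (smooth d z) t) \<le> ((2 / d + 1) * B) * \<bar>s - t\<bar>" if "s \<in> {0..1}" "t \<in> {0..1}" for s t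
  proof -
    have "bridge (smooth d z) s - bridge (smooth d z) t = (smooth d z s - smooth d z t) - (s - t) *\<^sub>R smooth d z 1"
      by (simp add: bridge_def algebra_simps)
    also have "norm \<dots> \<le> norm (smooth d z s - smooth d z t) + \<bar>s - t\<bar> * norm (smooth d z 1)"
      using norm_triangle_ineq4[of "smooth d z s - smooth d z t" "(s - t) *\<^sub>R smooth d z 1"] by simp
    also have "\<dots> \<le> 2 * B / d * \<bar>s - t\<bar> + \<bar>s - t\<bar> * B"
      using that by (intro add_mono mult_left_mono smooth_lipschitz[OF z B] norm_smooth_le[OF z _ B]) auto
    finally show ?thesis by (simp add: algebra_simps)
  qed
  from Phi_compare[OF this _ m, of R] have "\<bar>Phi R n (smooth d z) - Phi R m (smooth d z)\<bar> \<le> norm R * (3 * (((2 / d + 1) * B) * (\<beta> * (1 / real m) powr \<alpha>)))"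
    using B0 d by simp
  moreover have "\<bar>Phi R n z - Phi R n (smooth d z)\<bar> \<le> norm R * (V * (2 * e))"
    using m by (intro Phi_lipschitz e) auto
  ultimately show ?thesis by linarith
qed

end

lemma continuous_on_imp_cadlag01:
  fixes z :: "real \<Rightarrow> 'h::metric_space"
  assumes z: "continuous_on {0..1} z"
  shows "cadlag01 z"
  unfolding cadlag01_def
proof (intro conjI ballI)
  fix t :: real assume t: "t \<in> {0..<1}"
  have "(z \<longlongrightarrow> z t) (at t within {0..1})" using z t by (auto simp: continuous_on_def)
  then have "(z \<longlongrightarrow> z t) (at t within {t..1})" by (rule tendsto_within_subset) (use t in auto)
  then show "(z \<longlongrightarrow> z t) (at_right t)" using t by (simp add: at_within_Icc_at_right)
next
  fix t :: real assume t: "t \<in> {0<..1}"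
  have "(z \<longlongrightarrow> z t) (at t within {0..1})" using z t by (auto simp: continuous_on_def)
  then have "(z \<longlongrightarrow> z t) (at t within {0..t})" by (rule tendsto_within_subset) (use t in auto)
  then have "(z \<longlongrightarrow> z t) (at_left t)" using t by (simp add: at_within_Icc_at_left)
  then show "\<exists>l. (z \<longlongrightarrow> l) (at_left t)" by blast
qed

section \<open>Time changes and Skorokhod continuity\<close>

lemma time_change_range:
  assumes l: "l \<in> time_changes01" and u: "u \<in> {0..1}"
  shows "l u \<in> {0..1}"
proof -
  have m: "strict_mono_on {0..1} l" and e: "l 0 = 0" "l 1 = 1" using l by (auto simp: time_changes01_def)
  have "l 0 \<le> l u" "l u \<le> l 1" using u
    by (auto intro!: strict_mono_on_leD[OF m])
  then show ?thesis using e by simp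
qed

lemma time_change_surj:
  assumes l: "l \<in> time_changes01" and t: "t \<in> {0..1}"
  obtains u where "u \<in> {0..1}" "l u = t"
proof -
  have "continuous_on {0..1} l" and e: "l 0 = 0" "l 1 = 1" using l by (auto simp: time_changes01_def)
  then have "\<exists>x. 0 \<le> x \<and> x \<le> 1 \<and> l x = t" using t by (intro IVT') auto
  then show ?thesis using that by auto
qed

text \<open>The real infimum and suprema in \<open>skorokhod_dist\<close> are meaningful only for
  bounded sets; boundedness holds because cadlag paths are bounded and time changes stay in the unit
  interval.\<close>

lemma skorokhod_distD:
  fixes x y :: "real \<Rightarrow> 'h::real_normed_vector"
  assumes x: "cadlag01 x" and y: "cadlag01 y" and r: "skorokhod_dist x y < r"
  obtains l where "l \<in> time_changes01" "\<And>u. u \<in> {0..1} \<Longrightarrow> \<bar>l u - u\<bar> < r" "\<And>u. u \<in> {0..1} \<Longrightarrow> norm (x u - y (l u)) < r"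
proof -
  obtain A where A: "\<And>t. t \<in> {0..1} \<Longrightarrow> norm (x t) \<le> A" using cadlag01_bounded[OF x] by blast
  obtain B where B: "\<And>t. t \<in> {0..1} \<Longrightarrow> norm (y t) \<le> B" using cadlag01_bounded[OF y] by blast
  have b1: "bdd_above ((\<lambda>t. \<bar>l t - t\<bar>) ` {0..1})" if l: "l \<in> time_changes01" for l
  proof (rule bdd_aboveI2[of _ _ 1])
    fix t :: real assume t: "t \<in> {0..1}"
    from time_change_range[OF l t] t show "\<bar>l t - t\<bar> \<le> 1" by (auto simp: abs_le_iff)
  qed
  have b2: "bdd_above ((\<lambda>t. dist (x t) (y (l t))) ` {0..1})" if l: "l \<in> time_changes01" for l
  proof (rule bdd_aboveI2[of _ _ "A + B"])
    fix t :: real assume t: "t \<in> {0..1}"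
    have "dist (x t) (y (l t)) \<le> norm (x t) + norm (y (l t))" by (simp add: dist_norm norm_triangle_ineq4)
    with A[OF t] B[OF time_change_range[OF l t]] show "dist (x t) (y (l t)) \<le> A + B" by linarith
  qed
  let ?m = "\<lambda>l. max (SUP t\<in>{0..1}. \<bar>l t - t\<bar>) (SUP t\<in>{0..1}. dist (x t) (y (l t)))"
  have ne: "time_changes01 \<noteq> {}"
  proof -
    have "(\<lambda>t. t) \<in> time_changes01" by (auto simp: time_changes01_def strict_mono_on_def)
    then show ?thesis by blast
  qed
  have bb: "bdd_below (?m ` time_changes01)"
  proof (rule bdd_belowI2[of _ 0])
    fix l assume l: "l \<in> time_changes01"
    have "0 \<le> \<bar>l 0 - 0\<bar>" by simp
    also have "\<dots> \<le> (SUP t\<in>{0..1}. \<bar>l t - t\<bar>)" by (rule cSUP_upper[OF _ b1[OF l]]) simp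
    finally show "0 \<le> ?m l" by simp
  qed
  have "(INF l\<in>time_changes01. ?m l) < r" using r by (simp add: skorokhod_dist_def)
  then obtain l where l: "l \<in> time_changes01" "?m l < r"
    using cINF_less_iff[OF ne bb] by blast
  show ?thesis
  proof (rule that[OF l(1)])
    fix u :: real assume u: "u \<in> {0..1}"
    have "\<bar>l u - u\<bar> \<le> (SUP t\<in>{0..1}. \<bar>l t - t\<bar>)" by (rule cSUP_upper[OF u b1[OF l(1)]])
    with l(2) show "\<bar>l u - u\<bar> < r" by simp
    have "dist (x u) (y (l u)) \<le> (SUP t\<in>{0..1}. dist (x t) (y (l t)))" by (rule cSUP_upper[OF u b2[OF l(1)]])
    with l(2) show "norm (x u - y (l u)) < r" by (simp add: dist_norm)
  qed
qed

text \<open>Outside small neighbourhoods of the finite set \<open>T\<close> of essential jumps,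
  moving the time by less than \<open>r\<close> changes \<open>x\<close> by less than
  \<open>e / 4\<close>. Near \<open>T\<close> the difference is merely bounded, but these
  neighbourhoods are short.\<close>

lemma skorokhod_imp_L1:
  fixes x :: "real \<Rightarrow> 'h::{banach,second_countable_topology}"
  assumes x: "cadlag01 x" and e: "e > 0"
  obtains r where "r > 0" "\<And>y. cadlag01 y \<Longrightarrow> skorokhod_dist x y < r \<Longrightarrow> (LINT s|lborel. indicator {0..1} s * norm (y s - x s)) \<le> e"
proof -
  obtain B where B: "B > 0" "\<And>t. t \<in> {0..1} \<Longrightarrow> norm (x t) \<le> B" using cadlag01_bounded[OF x] by blast
  have "e / 4 > 0" using e by simp
  then obtain T where T: "finite T" "\<And>s t. s \<in> {0..1} \<Longrightarrow> t \<in> {0..1} \<Longrightarrow> s \<le> t \<Longrightarrow> {s<..t} \<inter> T = {} \<Longrightarrow> dist (x s) (x t) < e / 4"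
    using cadlag01_partition[OF x] by metis
  \<comment> \<open>\<open>r * D\<close> bounds the integral over the intervals of radius
    \<open>r\<close> around \<open>T\<close>, where the paths differ by at most
    \<open>2 * B + 1\<close>. The 1 added to the cardinality keeps \<open>D\<close> positive when
    \<open>T\<close> is empty.\<close>
  define D where "D = (2 * B + 1) * (2 * (real (card T) + 1))"
  have D: "D > 0" using B by (simp add: D_def)
  define r where "r = min 1 (min (e / 4) (e / (4 * D)))"
  have r: "r > 0" "r \<le> 1" "r \<le> e / 4" "r * D \<le> e / 4"
  proof -
    show "r > 0" using e D by (simp add: r_def)
    show "r \<le> 1" "r \<le> e / 4" by (simp_all add: r_def)
    have "r * D \<le> (e / (4 * D)) * D" using D by (intro mult_right_mono) (simp_all add: r_def)
    then show "r * D \<le> e / 4" using D by simp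
  qed
  show ?thesis
  proof (rule that[OF r(1)])
    fix y assume y: "cadlag01 y" and sk: "skorokhod_dist x y < r"
    obtain l where l: "l \<in> time_changes01" "\<And>u. u \<in> {0..1} \<Longrightarrow> \<bar>l u - u\<bar> < r" "\<And>u. u \<in> {0..1} \<Longrightarrow> norm (x u - y (l u)) < r"
      using skorokhod_distD[OF x y sk] by blast
    define G where "G s = (r + e / 4) * indicator {0..1} s + (\<Sum>\<tau>\<in>T. (2 * B + 1) * indicator {\<tau> - r..\<tau> + r} s)" for s :: real
    have "(LINT s|lborel. indicator {0..1} s * norm (y s - x s)) \<le> (LINT s|lborel. G s)"
    proof (rule integral_mono)
      have "integrable lborel (\<lambda>s. indicator {0..1} s *\<^sub>R y s)" "integrable lborel (\<lambda>s. indicator {0..1} s *\<^sub>R x s)"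
        by (rule cadlag01_integrable[OF y, of _ 1] cadlag01_integrable[OF x, of _ 1]; simp)+
      from Bochner_Integration.integrable_norm[OF Bochner_Integration.integrable_diff[OF this]]
      show "integrable lborel (\<lambda>s. indicator {0..1} s * norm (y s - x s))"
        by (simp add: scaleR_diff_right[symmetric])
      show "integrable lborel G" unfolding G_def
        by (intro Bochner_Integration.integrable_add Bochner_Integration.integrable_sum integrable_mult_right integrable_indicator_Icc)
      fix s :: real
      have sn: "(\<Sum>\<tau>\<in>T. (2 * B + 1) * indicator {\<tau> - r..\<tau> + r} s) \<ge> (0::real)" using B by (intro sum_nonneg) auto
      show "indicator {0..1} s * norm (y s - x s) \<le> G s"
      proof (cases "s \<in> {0..1}")
        case s: True
        obtain u where u: "u \<in> {0..1}" "l u = s" using time_change_surj[OF l(1) s] by blast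
        have us: "\<bar>s - u\<bar> < r" "norm (x u - y s) < r" using l(2,3)[OF u(1)] u(2) by auto
        show ?thesis
        proof (cases "\<exists>\<tau>\<in>T. s \<in> {\<tau> - r..\<tau> + r}")
          case True
          then obtain \<tau> where \<tau>: "\<tau> \<in> T" "s \<in> {\<tau> - r..\<tau> + r}" by blast
          have "(2 * B + 1) * indicator {\<tau> - r..\<tau> + r} s \<le> (\<Sum>\<tau>\<in>T. (2 * B + 1) * indicator {\<tau> - r..\<tau> + r} s :: real)"
            using \<tau>(1) T(1) B by (intro member_le_sum) auto
          moreover have "norm (y s - x s) \<le> 2 * B + 1"
          proof -
            have "norm (y s) \<le> norm (x u) + norm (x u - y s)"
              using norm_triangle_sub[of "y s" "x u"] by (simp add: norm_minus_commute)
            then have "norm (y s) \<le> B + 1" using us B(2)[OF u(1)] r by linarith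
            then show ?thesis using norm_triangle_ineq4[of "y s" "x s"] B(2)[OF s] by linarith
          qed
          ultimately show ?thesis using \<tau>(2) s r e by (simp add: G_def)
        next
          case False
          have "dist (x u) (x s) < e / 4"
          proof (cases "u \<le> s")
            case True
            have "{u<..s} \<inter> T = {}"
            proof (rule ccontr)
              assume "{u<..s} \<inter> T \<noteq> {}"
              then obtain \<tau> where "\<tau> \<in> T" "u < \<tau>" "\<tau> \<le> s" by auto
              then have "s \<in> {\<tau> - r..\<tau> + r}" using us r by auto
              with False \<open>\<tau> \<in> T\<close> show False by blast
            qed
            then show ?thesis using True u s by (intro T(2)) auto
          next
            case us': False
            have "{s<..u} \<inter> T = {}"
            proof (rule ccontr)
              assume "{s<..u} \<inter> T \<noteq> {}"
              then obtain \<tau> where "\<tau> \<in> T" "s < \<tau>" "\<tau> \<le> u" by auto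
              then have "s \<in> {\<tau> - r..\<tau> + r}" using us r by auto
              with False \<open>\<tau> \<in> T\<close> show False by blast
            qed
            then have "dist (x s) (x u) < e / 4" using us' u s by (intro T(2)) auto
            then show ?thesis by (simp add: dist_commute)
          qed
          moreover have "norm (y s - x s) \<le> norm (x u - y s) + dist (x u) (x s)"
            using norm_triangle_ineq4[of "x u - x s" "x u - y s"] by (simp add: dist_norm add.commute)
          ultimately have "norm (y s - x s) \<le> r + e / 4" using us by linarith
          then show ?thesis using s sn by (simp add: G_def)
        qed
      next
        case False
        then show ?thesis using sn by (simp add: G_def)
      qed
    qed
    also have "(LINT s|lborel. G s) = (r + e / 4) + (\<Sum>\<tau>\<in>T. (2 * B + 1) * (2 * r))"
    proof -
      have "(LINT s|lborel. G s) = (LINT s|lborel. (r + e / 4) * indicator {0..1::real} s) + (LINT s|lborel. (\<Sum>\<tau>\<in>T. (2 * B + 1) * indicator {\<tau> - r..\<tau> + r} s))"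
        unfolding G_def
        by (rule Bochner_Integration.integral_add) (intro Bochner_Integration.integrable_sum integrable_mult_right integrable_indicator_Icc)+
      also have "(LINT s|lborel. (\<Sum>\<tau>\<in>T. (2 * B + 1) * indicator {\<tau> - r..\<tau> + r} s)) = (\<Sum>\<tau>\<in>T. LINT s|lborel. (2 * B + 1) * indicator {\<tau> - r..\<tau> + r} s)"
        by (intro Bochner_Integration.integral_sum integrable_mult_right integrable_indicator_Icc)
      finally show ?thesis using r by simp
    qed
    also have "\<dots> = r + e / 4 + r * ((2 * B + 1) * (2 * real (card T)))" by (simp add: mult_ac)
    also have "\<dots> \<le> r + e / 4 + r * D" unfolding D_def using r B by (intro add_left_mono mult_left_mono) auto
    also have "\<dots> \<le> e" using r e by linarith
    finally show "(LINT s|lborel. indicator {0..1} s * norm (y s - x s)) \<le> e" .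
  qed
qed

context smoothing begin

text \<open>\<open>osc 1\<close> is the smoothing error, \<open>osc 0\<close> the supremum norm.\<close>
definition osc :: "real \<Rightarrow> (real \<Rightarrow> 'h::{banach,second_countable_topology}) \<Rightarrow> real" where
  "osc \<kappa> z = (SUP t\<in>{0..1}. norm (z t - \<kappa> *\<^sub>R smooth d z t))"

lemma osc_bound:
  assumes z: "cadlag01 z" and B: "\<And>t. t \<in> {0..1} \<Longrightarrow> norm (z t) \<le> B" and t: "t \<in> {0..1}"
  shows "norm (z t - \<kappa> *\<^sub>R smooth d z t) \<le> B + \<bar>\<kappa>\<bar> * B"
proof -
  have "norm (z t - \<kappa> *\<^sub>R smooth d z t) \<le> norm (z t) + \<bar>\<kappa>\<bar> * norm (smooth d z t)"
    using norm_triangle_ineq4[of "z t" "\<kappa> *\<^sub>R smooth d z t"] by simp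
  also have "\<dots> \<le> B + \<bar>\<kappa>\<bar> * B" by (intro add_mono mult_left_mono norm_smooth_le[OF z t B] B t) auto
  finally show ?thesis .
qed

lemma osc_bdd:
  assumes z: "cadlag01 z"
  shows "bdd_above ((\<lambda>t. norm (z t - \<kappa> *\<^sub>R smooth d z t)) ` {0..1})"
proof -
  obtain B where "\<And>t. t \<in> {0..1} \<Longrightarrow> norm (z t) \<le> B" using cadlag01_bounded[OF z] by blast
  from osc_bound[OF z this] show ?thesis by (intro bdd_aboveI2) blast
qed

lemma osc_upper: "cadlag01 z \<Longrightarrow> t \<in> {0..1} \<Longrightarrow> norm (z t - \<kappa> *\<^sub>R smooth d z t) \<le> osc \<kappa> z"
  unfolding osc_def by (rule cSUP_upper[OF _ osc_bdd])

lemma osc_nonneg: "cadlag01 z \<Longrightarrow> osc \<kappa> z \<ge> 0"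
  using osc_upper[of z 0 \<kappa>] norm_ge_zero[of "z 0 - \<kappa> *\<^sub>R smooth d z 0"] by (simp del: norm_ge_zero)

text \<open>The supremum is invariant under a common reparametrization of path and smoothed path, which
  makes it Skorokhod continuous at every path and not only at the continuous ones.\<close>
lemma osc_skorokhod:
  fixes x :: "real \<Rightarrow> 'h::{banach,second_countable_topology}"
  assumes x: "cadlag01 x" and e: "e > 0"
  obtains r where "r > 0" "\<And>y. cadlag01 y \<Longrightarrow> skorokhod_dist x y < r \<Longrightarrow> \<bar>osc \<kappa> y - osc \<kappa> x\<bar> \<le> e"
proof -
  obtain B where B: "B > 0" "\<And>t. t \<in> {0..1} \<Longrightarrow> norm (x t) \<le> B" using cadlag01_bounded[OF x] by blast
  \<comment> \<open>The error is split into thirds: distance of the paths after the time change, L1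
    error of the averages, and displacement of the averaged path.\<close>
  define e1 where "e1 = e * d / (3 * (\<bar>\<kappa>\<bar> + 1))"
  have e1: "e1 > 0" using e d by (simp add: e1_def)
  obtain r1 where r1: "r1 > 0" "\<And>y. cadlag01 y \<Longrightarrow> skorokhod_dist x y < r1 \<Longrightarrow> (LINT s|lborel. indicator {0..1} s * norm (y s - x s)) \<le> e1"
    using skorokhod_imp_L1[OF x e1] by blast
  define L where "L = 2 * B / d"
  have L: "L > 0" using B d by (simp add: L_def)
  define r where "r = min r1 (min (e / 3) (e / (3 * (\<bar>\<kappa>\<bar> + 1) * L)))"
  have r: "r > 0" "r \<le> r1" "r \<le> e / 3" "\<bar>\<kappa>\<bar> * (L * r) \<le> e / 3"
  proof -
    show "r > 0" using r1 e L by (simp add: r_def add_nonneg_pos)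
    show "r \<le> r1" by (simp add: r_def)
    show "r \<le> e / 3" unfolding r_def by (rule order_trans[OF min.cobounded2 min.cobounded1])
    have "r \<le> e / (3 * (\<bar>\<kappa>\<bar> + 1) * L)" unfolding r_def by (rule order_trans[OF min.cobounded2 min.cobounded2])
    then have "\<bar>\<kappa>\<bar> * (L * r) \<le> (\<bar>\<kappa>\<bar> + 1) * (L * (e / (3 * (\<bar>\<kappa>\<bar> + 1) * L)))"
      using L \<open>r > 0\<close> by (intro mult_mono mult_left_mono) auto
    also have "\<dots> = e / 3"
    proof -
      have "c * (L * (e / (3 * c * L))) = e / 3" if "c \<noteq> 0" for c using L that by (simp add: field_simps)
      moreover have "(\<bar>\<kappa>\<bar> + 1) \<noteq> 0" by linarith
      ultimately show ?thesis by blast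
    qed
    finally show "\<bar>\<kappa>\<bar> * (L * r) \<le> e / 3" .
  qed
  have \<kappa>e: "\<bar>\<kappa>\<bar> * (e1 / d) \<le> e / 3"
  proof -
    have "\<bar>\<kappa>\<bar> * (e1 / d) \<le> (\<bar>\<kappa>\<bar> + 1) * (e1 / d)" using e1 d by (intro mult_right_mono) auto
    also have "\<dots> = e / 3"
    proof -
      have "c * (e * d / (3 * c) / d) = e / 3" if "c \<noteq> 0" for c using d that by (simp add: field_simps)
      moreover have "(\<bar>\<kappa>\<bar> + 1) \<noteq> 0" by linarith
      ultimately show ?thesis unfolding e1_def by blast
    qed
    finally show ?thesis .
  qed
  show ?thesis
  proof (rule that[OF r(1)])
    fix y assume y: "cadlag01 y" and sk: "skorokhod_dist x y < r"
    obtain l where l: "l \<in> time_changes01" "\<And>u. u \<in> {0..1} \<Longrightarrow> \<bar>l u - u\<bar> < r" "\<And>u. u \<in> {0..1} \<Longrightarrow> norm (x u - y (l u)) < r"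
      using skorokhod_distD[OF x y sk] by blast
    have int: "(LINT s|lborel. indicator {0..1} s * norm (y s - x s)) \<le> e1" using r1(2)[OF y] sk r(2) by simp
    have main: "norm ((y (l u) - \<kappa> *\<^sub>R smooth d y (l u)) - (x u - \<kappa> *\<^sub>R smooth d x u)) \<le> e" if u: "u \<in> {0..1}" for u
    proof -
      have lu: "l u \<in> {0..1}" by (rule time_change_range[OF l(1) u])
      have 1: "norm (smooth d y (l u) - smooth d x (l u)) \<le> e1 / d"
        using smooth_diff_le[OF y x lu] divide_right_mono[OF int, of d] d by linarith
      have 2: "norm (smooth d x (l u) - smooth d x u) \<le> L * r"
      proof -
        have "norm (smooth d x (l u) - smooth d x u) \<le> 2 * B / d * \<bar>l u - u\<bar>" by (rule smooth_lipschitz[OF x B(2) lu u])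
        also have "\<dots> \<le> L * r" unfolding L_def[symmetric] using L l(2)[OF u] by (intro mult_left_mono) auto
        finally show ?thesis .
      qed
      have "(y (l u) - \<kappa> *\<^sub>R smooth d y (l u)) - (x u - \<kappa> *\<^sub>R smooth d x u) =
         - (x u - y (l u)) - \<kappa> *\<^sub>R ((smooth d y (l u) - smooth d x (l u)) + (smooth d x (l u) - smooth d x u))"
        by (simp add: algebra_simps)
      also have "norm \<dots> \<le> norm (x u - y (l u)) + \<bar>\<kappa>\<bar> * (norm (smooth d y (l u) - smooth d x (l u)) + norm (smooth d x (l u) - smooth d x u))"
      proof -
        have "norm (- A - k *\<^sub>R (B + C)) \<le> norm A + \<bar>k\<bar> * (norm B + norm C)" for A B C :: 'h and k
          using norm_triangle_ineq4[of "- A" "k *\<^sub>R (B + C)"] mult_left_mono[OF norm_triangle_ineq[of B C], of "\<bar>k\<bar>"] by simp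
        then show ?thesis by blast
      qed
      also have "\<dots> \<le> r + \<bar>\<kappa>\<bar> * (e1 / d + L * r)" using l(3)[OF u] 1 2 by (intro add_mono mult_left_mono) auto
      also have "\<dots> \<le> e" using r(3,4) \<kappa>e unfolding distrib_left by linarith
      finally show ?thesis .
    qed
    have "osc \<kappa> y \<le> osc \<kappa> x + e"
      unfolding osc_def[of \<kappa> y]
    proof (rule cSUP_least)
      fix t :: real assume t: "t \<in> {0..1}"
      obtain u where u: "u \<in> {0..1}" "l u = t" using time_change_surj[OF l(1) t] by blast
      have "norm (y t - \<kappa> *\<^sub>R smooth d y t) \<le> norm (x u - \<kappa> *\<^sub>R smooth d x u) + e"
        using main[OF u(1)] norm_triangle_ineq2[of "y t - \<kappa> *\<^sub>R smooth d y t" "x u - \<kappa> *\<^sub>R smooth d x u"] u(2) by simp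
      with osc_upper[OF x u(1), of \<kappa>] show "norm (y t - \<kappa> *\<^sub>R smooth d y t) \<le> osc \<kappa> x + e" by linarith
    qed simp
    moreover have "osc \<kappa> x \<le> osc \<kappa> y + e"
      unfolding osc_def[of \<kappa> x]
    proof (rule cSUP_least)
      fix u :: real assume u: "u \<in> {0..1}"
      have "norm (x u - \<kappa> *\<^sub>R smooth d x u) \<le> norm (y (l u) - \<kappa> *\<^sub>R smooth d y (l u)) + e"
        using main[OF u] norm_triangle_ineq3[of "y (l u) - \<kappa> *\<^sub>R smooth d y (l u)" "x u - \<kappa> *\<^sub>R smooth d x u"] by linarith
      with osc_upper[OF y time_change_range[OF l(1) u], of \<kappa>] show "norm (x u - \<kappa> *\<^sub>R smooth d x u) \<le> osc \<kappa> y + e" by linarith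
    qed simp
    ultimately show "\<bar>osc \<kappa> y - osc \<kappa> x\<bar> \<le> e" by (simp add: abs_le_iff)
  qed
qed

lemma smooth_cadlag01:
  fixes z :: "real \<Rightarrow> 'h::{banach,second_countable_topology}"
  assumes z: "cadlag01 z"
  shows "cadlag01 (smooth d z)"
proof (rule continuous_on_imp_cadlag01)
  obtain B where B: "B > 0" "\<And>t. t \<in> {0..1} \<Longrightarrow> norm (z t) \<le> B" using cadlag01_bounded[OF z] by blast
  have "(2 * B / d)-lipschitz_on {0..1} (smooth d z)"
    using smooth_lipschitz[OF z B(2)] B(1) d by (intro lipschitz_onI) (auto simp: dist_norm dist_real_def)
  then show "continuous_on {0..1} (smooth d z)" by (rule lipschitz_on_continuous_on)
qed

text \<open>Right continuity, used along the rational points \<open>grid_point n t\<close>, reduces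
  the supremum to a countable one.\<close>

lemma osc_measurable:
  assumes Y: "cadlag_process M Y"
  shows "(\<lambda>\<omega>. osc \<kappa> (Y \<omega>)) \<in> borel_measurable M"
proof -
  let ?Q = "\<rat> \<inter> {0..1::real}"
  let ?g = "\<lambda>\<omega> t. norm (Y \<omega> t - \<kappa> *\<^sub>R smooth d (Y \<omega>) t)"
  have c: "cadlag01 (Y \<omega>)" if "\<omega> \<in> space M" for \<omega> using Y that by (simp add: cadlag_process_def)
  have bdd: "bdd_above (?g \<omega> ` ?Q)" if "\<omega> \<in> space M" for \<omega>
    by (rule bdd_above_mono[OF osc_bdd[OF c[OF that]]]) auto
  have eq: "osc \<kappa> (Y \<omega>) = (SUP t\<in>?Q. ?g \<omega> t)" if \<omega>: "\<omega> \<in> space M" for \<omega>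
  proof (rule antisym)
    show "osc \<kappa> (Y \<omega>) \<le> (SUP t\<in>?Q. ?g \<omega> t)" unfolding osc_def
    proof (rule cSUP_least)
      fix t :: real assume t: "t \<in> {0..1}"
      have "(\<lambda>n. ?g \<omega> (grid_point n t)) \<longlonglongrightarrow> ?g \<omega> t"
        by (intro tendsto_intros cadlag01_grid_point_LIMSEQ c \<omega> t smooth_cadlag01)
      moreover have "?g \<omega> (grid_point n t) \<le> (SUP t\<in>?Q. ?g \<omega> t)" for n
      proof (rule cSUP_upper[OF _ bdd[OF \<omega>]])
        have "real_of_int \<lfloor>real (Suc n) * t\<rfloor> \<ge> 0" using t by simp
        then show "grid_point n t \<in> ?Q"
          by (auto simp: grid_point_def min_def intro!: Rats_divide Rats_add simp del: of_nat_Suc)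
      qed
      ultimately show "?g \<omega> t \<le> (SUP t\<in>?Q. ?g \<omega> t)" by (intro LIMSEQ_le_const2) auto
    qed simp
    show "(SUP t\<in>?Q. ?g \<omega> t) \<le> osc \<kappa> (Y \<omega>)"
    proof (rule cSUP_least)
      have "0 \<in> ?Q" by simp
      then show "?Q \<noteq> {}" by blast
    qed (use osc_upper[OF c[OF \<omega>]] in auto)
  qed
  have "countable ?Q" using countable_rat by (rule countable_subset[rotated]) auto
  then have "(\<lambda>\<omega>. SUP t\<in>?Q. ?g \<omega> t) \<in> borel_measurable M"
  proof (rule borel_measurable_cSUP[OF _ _ bdd])
    fix t assume t: "t \<in> ?Q"
    have [measurable]: "(\<lambda>\<omega>. Y \<omega> t) \<in> borel_measurable M" using Y by (simp add: cadlag_process_def)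
    have [measurable]: "(\<lambda>\<omega>. smooth d (Y \<omega>) t) \<in> borel_measurable M" using t by (intro smooth_measurable[OF Y]) auto
    show "(\<lambda>\<omega>. ?g \<omega> t) \<in> borel_measurable M" by measurable
  qed
  then show ?thesis by (rule measurable_cong[THEN iffD2, rotated]) (rule eq)
qed

end

lemma (in smoothed_kernel) Phi_smooth_skorokhod:
  fixes x :: "real \<Rightarrow> 'h::{banach,second_countable_topology}"
  assumes x: "cadlag01 x" and e: "e > 0" and m: "m \<ge> 2"
  obtains r where "r > 0" "\<And>y. cadlag01 y \<Longrightarrow> skorokhod_dist x y < r \<Longrightarrow> \<bar>Phi R m (smooth d y) - Phi R m (smooth d x)\<bar> \<le> e"
proof -
  define c where "c = norm R * (V * 2) + 1"
  have c: "c > 0" using V_nonneg by (simp add: c_def add_nonneg_pos)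
  from e d c have "e * d / c > 0" by simp
  then obtain r where r: "r > 0" "\<And>y. cadlag01 y \<Longrightarrow> skorokhod_dist x y < r \<Longrightarrow> (LINT s|lborel. indicator {0..1} s * norm (y s - x s)) \<le> e * d / c"
    using skorokhod_imp_L1[OF x] by blast
  show ?thesis
  proof (rule that[OF r(1)])
    fix y assume y: "cadlag01 y" and sk: "skorokhod_dist x y < r"
    have "norm (smooth d y t - smooth d x t) \<le> e / c" if t: "t \<in> {0..1}" for t
    proof -
      have "norm (smooth d y t - smooth d x t) \<le> (e * d / c) / d"
        by (rule order_trans[OF smooth_diff_le[OF y x t] divide_right_mono[OF r(2)[OF y sk]]]) (use d in simp)
      then show ?thesis using d by simp
    qed
    from Phi_lipschitz[where R = R and y = "smooth d y" and z = "smooth d x", OF this m] have "\<bar>Phi R m (smooth d y) - Phi R m (smooth d x)\<bar> \<le> (norm R * (V * 2)) * (e / c)" by simp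
    also have "\<dots> \<le> c * (e / c)" using e c by (intro mult_right_mono) (auto simp: c_def)
    finally show "\<bar>Phi R m (smooth d y) - Phi R m (smooth d x)\<bar> \<le> e" using c by simp
  qed
qed

lemma (in kernel) Phi_measurable:
  fixes R :: "'h::{banach,second_countable_topology} \<Rightarrow>\<^sub>L 'h"
  assumes Y: "\<And>t. t \<in> {0..1} \<Longrightarrow> (\<lambda>\<omega>. Y \<omega> t) \<in> borel_measurable M"
  shows "(\<lambda>\<omega>. Phi R n (Y \<omega>)) \<in> borel_measurable M"
  unfolding Phi_def
proof (rule borel_measurable_Max)
  fix k assume k: "k \<in> {1..<n}"
  have d: "(\<lambda>\<omega>. disc n k (bridge (Y \<omega>))) \<in> borel_measurable M"
    unfolding disc_def
  proof (intro borel_measurable_sum borel_measurable_scaleR borel_measurable_const)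
    fix j assume "j \<in> {k..<n}"
    then have "(\<lambda>\<omega>. Y \<omega> (real j / real n)) \<in> borel_measurable M" "(\<lambda>\<omega>. Y \<omega> 1) \<in> borel_measurable M"
      by (auto intro!: Y simp: divide_le_eq)
    then show "(\<lambda>\<omega>. bridge (Y \<omega>) (real j / real n)) \<in> borel_measurable M" unfolding bridge_def by measurable
  qed
  have "(\<lambda>x. R x) \<in> borel_measurable borel" by (intro borel_measurable_continuous_onI continuous_intros)
  from measurable_compose[OF d this] show "(\<lambda>\<omega>. norm (R (disc n k (bridge (Y \<omega>))))) \<in> borel_measurable M" by measurable
qed simp

section \<open>From the partial sums to the Brownian motion\<close>

lemma weak_conv_D_imp:
  fixes f :: "(real \<Rightarrow> 'h::metric_space) \<Rightarrow> real"
  assumes w: "weak_conv_D M Z N W"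
    and bd: "\<And>x. cadlag01 x \<Longrightarrow> \<bar>f x\<bar> \<le> 1"
    and ct: "\<And>x e. cadlag01 x \<Longrightarrow> e > 0 \<Longrightarrow> \<exists>r>0. \<forall>y. cadlag01 y \<and> skorokhod_dist x y < r \<longrightarrow> \<bar>f y - f x\<bar> \<le> e"
  shows "(\<lambda>n. LINT \<omega>|M. f (Z n \<omega>)) \<longlonglongrightarrow> (LINT \<omega>|N. f (W \<omega>))"
proof (rule w[unfolded weak_conv_D_def, THEN spec[of _ f], THEN mp], intro conjI allI impI)
  show "\<exists>B. \<forall>x. cadlag01 x \<longrightarrow> \<bar>f x\<bar> \<le> B" using bd by blast
  fix x :: "real \<Rightarrow> 'h" and e :: real assume x: "cadlag01 x" and e: "0 < e"
  from e have "e / 2 > 0" by simp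
  from ct[OF x this] obtain r where r: "r > 0" "\<And>y. cadlag01 y \<Longrightarrow> skorokhod_dist x y < r \<Longrightarrow> \<bar>f y - f x\<bar> \<le> e / 2" by blast
  show "\<exists>d>0. \<forall>y. cadlag01 y \<and> skorokhod_dist x y < d \<longrightarrow> \<bar>f y - f x\<bar> < e"
  proof (rule exI[of _ r], intro conjI r(1) allI impI)
    fix y assume "cadlag01 y \<and> skorokhod_dist x y < r"
    then have "\<bar>f y - f x\<bar> \<le> e / 2" using r(2) by blast
    with e show "\<bar>f y - f x\<bar> < e" by linarith
  qed
qed

lemma (in prob_space) integral_diff_le:
  fixes X Y H :: "'a \<Rightarrow> real"
  assumes m: "X \<in> borel_measurable M" "Y \<in> borel_measurable M" "H \<in> borel_measurable M"
    and b: "\<And>\<omega>. \<omega> \<in> space M \<Longrightarrow> \<bar>X \<omega>\<bar> \<le> b" "\<And>\<omega>. \<omega> \<in> space M \<Longrightarrow> \<bar>Y \<omega>\<bar> \<le> b" "\<And>\<omega>. \<omega> \<in> space M \<Longrightarrow> \<bar>H \<omega>\<bar> \<le> b"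
    and le: "\<And>\<omega>. \<omega> \<in> space M \<Longrightarrow> \<bar>X \<omega> - Y \<omega>\<bar> \<le> H \<omega>"
  shows "\<bar>(LINT \<omega>|M. X \<omega>) - (LINT \<omega>|M. Y \<omega>)\<bar> \<le> (LINT \<omega>|M. H \<omega>)"
proof -
  have i: "integrable M X" "integrable M Y" "integrable M H"
    by (rule integrable_const_bound[of _ b]; use m b in auto)+
  have "(LINT \<omega>|M. X \<omega>) - (LINT \<omega>|M. Y \<omega>) = (LINT \<omega>|M. X \<omega> - Y \<omega>)"
    by (rule Bochner_Integration.integral_diff[symmetric, OF i(1,2)])
  also have "\<bar>\<dots>\<bar> \<le> (LINT \<omega>|M. \<bar>X \<omega> - Y \<omega>\<bar>)" by (rule integral_abs_bound)
  also have "\<dots> \<le> (LINT \<omega>|M. H \<omega>)"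
    using i le by (intro integral_mono) auto
  finally show ?thesis .
qed

text \<open>Weak convergence handles bounded functionals only; this turns the truncation of a linear
  error bound into a multiple of truncated functionals.\<close>

lemma min_one_sum_le:
  fixes p q a b :: real
  assumes "p \<ge> 0" "q \<ge> 0" "a \<ge> 0" "b \<ge> 0"
  shows "min 1 (a * p + b * q) \<le> (1 + a + b) * (min 1 p + min 1 q)"
proof (cases "p \<le> 1 \<and> q \<le> 1")
  case True
  have "a * p + b * q \<le> (1 + a + b) * p + (1 + a + b) * q"
    using assms by (intro add_mono mult_right_mono) auto
  moreover have "min 1 p = p" "min 1 q = q" using True by simp_all
  moreover have "min 1 (a * p + b * q) \<le> a * p + b * q" by simp
  ultimately show ?thesis by (simp only: distrib_left)
next
  case False
  then have "1 \<le> min 1 p + min 1 q" using assms by (auto simp: min_def)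
  then have "1 * 1 \<le> (1 + a + b) * (min 1 p + min 1 q)" using assms by (intro mult_mono) auto
  then show ?thesis by simp
qed

lemma min_one_diff: "\<bar>min 1 a - min 1 (b::real)\<bar> \<le> \<bar>a - b\<bar>"
  by (simp add: min_def abs_if)

lemma osc_tendsto_0:
  fixes z :: "real \<Rightarrow> 'h::{banach,second_countable_topology}"
  assumes z: "continuous_on {0..1} z" and dj: "\<And>j. smoothing (d j)" and d0: "d \<longlonglongrightarrow> 0"
  shows "(\<lambda>j. smoothing.osc (d j) 1 z) \<longlonglongrightarrow> 0"
proof (rule LIMSEQ_I)
  fix e :: real assume e: "e > 0"
  have c: "cadlag01 z" by (rule continuous_on_imp_cadlag01[OF z])
  have "uniformly_continuous_on {0..1} z" by (rule compact_uniformly_continuous[OF z]) simp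
  then obtain r where r: "r > 0" "\<And>s t. s \<in> {0..1} \<Longrightarrow> t \<in> {0..1} \<Longrightarrow> \<bar>s - t\<bar> < r \<Longrightarrow> norm (z s - z t) < e / 2"
    using e unfolding uniformly_continuous_on_def dist_norm real_norm_def by (metis half_gt_zero)
  from order_tendstoD(2)[OF d0 r(1)] obtain N where N: "\<And>j. j \<ge> N \<Longrightarrow> d j < r" by (auto simp: eventually_sequentially)
  have "norm (smoothing.osc (d j) 1 z - 0) < e" if j: "j \<ge> N" for j
  proof -
    interpret smoothing "d j" by (rule dj)
    have "osc 1 z \<le> e / 2" unfolding osc_def
    proof (rule cSUP_least)
      fix t :: real assume t: "t \<in> {0..1}"
      have "norm (smooth (d j) z t - z t) \<le> e / 2"
      proof (rule smooth_near[OF c t])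
        fix s assume s: "s \<in> window (d j) t"
        have "\<bar>s - t\<bar> < r" using window_dist[OF d t s] N[OF j] by linarith
        moreover have "s \<in> {0..1}" using window_subset[OF d t] s by blast
        ultimately show "norm (z s - z t) \<le> e / 2" using r(2)[of s t] t by simp
      qed
      then show "norm (z t - 1 *\<^sub>R smooth (d j) z t) \<le> e / 2" by (simp add: norm_minus_commute)
    qed simp
    with osc_nonneg[OF c, of 1] e show ?thesis by simp
  qed
  then show "\<exists>no. \<forall>j\<ge>no. norm (smoothing.osc (d j) 1 z - 0) < e" by blast
qed

lemma (in smoothed_kernel) approx_expectation:
  fixes Y :: "'a \<Rightarrow> real \<Rightarrow> 'h::{banach,second_countable_topology}"
  assumes P: "prob_space P" and Y: "cadlag_process P Y"
    and g[measurable]: "g \<in> borel_measurable borel" and gb: "\<And>x. 0 \<le> g x" "\<And>x. g x \<le> (1::real)"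
    and Ka: "K \<ge> 0" "a \<ge> 0"
    and pw: "\<And>z. cadlag01 z \<Longrightarrow> \<bar>g (Phi R n z) - g (Phi R m (smooth d z))\<bar> \<le> K * (min 1 (osc 1 z) + min 1 (a * osc 0 z))"
  shows "\<bar>(LINT \<omega>|P. g (Phi R n (Y \<omega>))) - (LINT \<omega>|P. g (Phi R m (smooth d (Y \<omega>))))\<bar> \<le>
    K * ((LINT \<omega>|P. min 1 (osc 1 (Y \<omega>))) + (LINT \<omega>|P. min 1 (a * osc 0 (Y \<omega>))))"
proof -
  interpret P: prob_space P by (rule P)
  have c: "cadlag01 (Y \<omega>)" if "\<omega> \<in> space P" for \<omega> using Y that by (simp add: cadlag_process_def)
  have Ym: "(\<lambda>\<omega>. Y \<omega> t) \<in> borel_measurable P" for t using Y by (simp add: cadlag_process_def)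
  note [measurable] = osc_measurable[OF Y] Phi_measurable[OF Ym] Phi_measurable[OF smooth_measurable[OF Y]]
  have b1: "\<bar>min 1 (osc 1 (Y \<omega>))\<bar> \<le> 1" and b2: "\<bar>min 1 (a * osc 0 (Y \<omega>))\<bar> \<le> 1" if "\<omega> \<in> space P" for \<omega>
    using osc_nonneg[OF c[OF that], of 1] osc_nonneg[OF c[OF that], of 0] Ka by (auto simp: min_def)
  have i1: "integrable P (\<lambda>\<omega>. min 1 (osc 1 (Y \<omega>)))" and i2: "integrable P (\<lambda>\<omega>. min 1 (a * osc 0 (Y \<omega>)))"
    by (rule P.integrable_const_bound[of _ 1]; use b1 b2 in auto)+
  have "\<bar>(LINT \<omega>|P. g (Phi R n (Y \<omega>))) - (LINT \<omega>|P. g (Phi R m (smooth d (Y \<omega>))))\<bar> \<le>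
    (LINT \<omega>|P. K * (min 1 (osc 1 (Y \<omega>)) + min 1 (a * osc 0 (Y \<omega>))))"
  proof (rule P.integral_diff_le[where b = "1 + 2 * K"])
    fix \<omega> assume \<omega>: "\<omega> \<in> space P"
    show "\<bar>g (Phi R n (Y \<omega>)) - g (Phi R m (smooth d (Y \<omega>)))\<bar> \<le> K * (min 1 (osc 1 (Y \<omega>)) + min 1 (a * osc 0 (Y \<omega>)))"
      by (rule pw[OF c[OF \<omega>]])
    show "\<bar>g (Phi R n (Y \<omega>))\<bar> \<le> 1 + 2 * K" "\<bar>g (Phi R m (smooth d (Y \<omega>)))\<bar> \<le> 1 + 2 * K"
      using gb(2)[of "Phi R n (Y \<omega>)"] gb(2)[of "Phi R m (smooth d (Y \<omega>))"] Ka by (simp_all add: gb(1))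
    have "\<bar>min 1 (osc 1 (Y \<omega>)) + min 1 (a * osc 0 (Y \<omega>))\<bar> \<le> 2" using b1[OF \<omega>] b2[OF \<omega>] by linarith
    then have "K * \<bar>min 1 (osc 1 (Y \<omega>)) + min 1 (a * osc 0 (Y \<omega>))\<bar> \<le> K * 2" by (rule mult_left_mono[OF _ Ka(1)])
    then show "\<bar>K * (min 1 (osc 1 (Y \<omega>)) + min 1 (a * osc 0 (Y \<omega>)))\<bar> \<le> 1 + 2 * K" using Ka(1) by (simp add: abs_mult)
  qed measurable
  also have "\<dots> = K * ((LINT \<omega>|P. min 1 (osc 1 (Y \<omega>))) + (LINT \<omega>|P. min 1 (a * osc 0 (Y \<omega>))))"
    using i1 i2 by simp
  finally show ?thesis .
qed

text \<open>First \<open>d\<close> is chosen so that the smoothing error is small under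
  \<open>W\<close>, then \<open>a\<close> so that \<open>a\<close> times the supremum norm is small,
  then \<open>m\<close> so that passing from any larger grid to \<open>m\<close> costs at most
  \<open>a\<close> times that norm. The truncated errors \<open>F1\<close>, \<open>F2\<close> and
  the smoothed statistic \<open>F3\<close> are bounded and Skorokhod continuous, so all three
  expectations converge, and on both sides the statistic differs from \<open>F3\<close> by at most
  \<open>K * (F1 + F2)\<close>.\<close>

theorem (in kernel) Phi_weak_limit:
  fixes Z :: "nat \<Rightarrow> 'a \<Rightarrow> real \<Rightarrow> 'h::{banach,second_countable_topology}" and W :: "'b \<Rightarrow> real \<Rightarrow> 'h"
  assumes M: "prob_space M" and N: "prob_space N"
    and Z: "\<And>n. cadlag_process M (Z n)" and W: "\<And>t. (\<lambda>\<omega>. W \<omega> t) \<in> borel_measurable N"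
      "\<And>\<omega>. \<omega> \<in> space N \<Longrightarrow> continuous_on {0..1} (W \<omega>)"
    and conv: "weak_conv_D M Z N W"
    and g: "\<And>x. 0 \<le> g x" "\<And>x. g x \<le> 1" "\<And>x y. \<bar>g x - g y\<bar> \<le> Lg * \<bar>x - y\<bar>" "Lg \<ge> (0::real)"
  shows "(\<lambda>n. (LINT \<omega>|M. g (Phi R n (Z n \<omega>))) - (LINT \<omega>|N. g (Phi R n (W \<omega>)))) \<longlonglongrightarrow> 0"
proof (rule LIMSEQ_I)
  interpret M: prob_space M by (rule M)
  interpret N: prob_space N by (rule N)
  fix e :: real assume e: "e > 0"
  have Wc: "cadlag01 (W \<omega>)" if "\<omega> \<in> space N" for \<omega> by (rule continuous_on_imp_cadlag01[OF W(2)[OF that]])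
  have Wp: "cadlag_process N W" using W(1) Wc by (simp add: cadlag_process_def)
  have Zc: "cadlag01 (Z n \<omega>)" if "\<omega> \<in> space M" for n \<omega> using Z that by (simp add: cadlag_process_def)
  have "(Lg)-lipschitz_on UNIV g" using g(3,4) by (intro lipschitz_onI) (auto simp: dist_real_def)
  then have "continuous_on UNIV g" by (rule lipschitz_on_continuous_on)
  then have [measurable]: "g \<in> borel_measurable borel" by (rule borel_measurable_continuous_onI)
  define c1 where "c1 = Lg * (norm R * (V * 2))"
  have c1: "c1 \<ge> 0" unfolding c1_def using g(4) V_nonneg by simp
  define K where "K = 1 + c1 + Lg"
  have K: "K > 0" unfolding K_def using c1 g(4) by linarith
  \<comment> \<open>Replacing the statistic by \<open>F3\<close> then costs at most
    \<open>2 * K * \<eta> = e / 4\<close> on each side, and convergence for \<open>F3\<close>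
    another \<open>e / 4\<close>.\<close>
  define \<eta> where "\<eta> = e / (8 * K)"
  have \<eta>: "\<eta> > 0" "K * \<eta> = e / 8" using e K by (simp_all add: \<eta>_def)
  define dj where "dj j = 1 / real (Suc j)" for j
  have dj: "smoothing (dj j)" for j by unfold_locales (auto simp: dj_def)
  have dj0: "dj \<longlonglongrightarrow> 0" unfolding dj_def[abs_def] by (rule LIMSEQ_Suc[OF lim_1_over_n])
  have "(\<lambda>j. LINT \<omega>|N. min 1 (smoothing.osc (dj j) 1 (W \<omega>))) \<longlonglongrightarrow> (LINT \<omega>|N. 0)"
  proof (rule integral_dominated_convergence[where w="\<lambda>_. 1"])
    show "(\<lambda>\<omega>. min 1 (smoothing.osc (dj j) 1 (W \<omega>))) \<in> borel_measurable N" for j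
      by (intro borel_measurable_min borel_measurable_const smoothing.osc_measurable[OF dj Wp])
    show "AE \<omega> in N. (\<lambda>j. min 1 (smoothing.osc (dj j) 1 (W \<omega>))) \<longlonglongrightarrow> 0"
    proof (rule AE_I2)
      fix \<omega> assume "\<omega> \<in> space N"
      from tendsto_min[OF tendsto_const osc_tendsto_0[OF W(2)[OF this] dj dj0], of 1]
      show "(\<lambda>j. min 1 (smoothing.osc (dj j) 1 (W \<omega>))) \<longlonglongrightarrow> 0" by simp
    qed
    show "AE \<omega> in N. norm (min 1 (smoothing.osc (dj j) 1 (W \<omega>))) \<le> 1" for j
      by (rule AE_I2) (use smoothing.osc_nonneg[OF dj Wc] in \<open>auto simp: min_def\<close>)
  qed auto
  then have lim1: "(\<lambda>j. LINT \<omega>|N. min 1 (smoothing.osc (dj j) 1 (W \<omega>))) \<longlonglongrightarrow> 0" by simp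
  from order_tendstoD(2)[OF lim1 \<eta>(1)] obtain j0 where j0: "(LINT \<omega>|N. min 1 (smoothing.osc (dj j0) 1 (W \<omega>))) < \<eta>"
    by (auto simp: eventually_sequentially)
  define d where "d = dj j0"
  interpret smoothing d unfolding d_def by (rule dj)
  interpret smoothed_kernel h \<alpha> \<beta> V d by unfold_locales
  have "(\<lambda>j. LINT \<omega>|N. min 1 (dj j * osc 0 (W \<omega>))) \<longlonglongrightarrow> (LINT \<omega>|N. 0)"
  proof (rule integral_dominated_convergence[where w="\<lambda>_. 1"])
    show "(\<lambda>\<omega>. min 1 (dj j * osc 0 (W \<omega>))) \<in> borel_measurable N" for j
      by (intro borel_measurable_min borel_measurable_const borel_measurable_times osc_measurable[OF Wp])
    show "AE \<omega> in N. (\<lambda>j. min 1 (dj j * osc 0 (W \<omega>))) \<longlonglongrightarrow> 0"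
    proof (rule AE_I2)
      fix \<omega>
      from tendsto_min[OF tendsto_const tendsto_mult_right[OF dj0, of "osc 0 (W \<omega>)"], of 1]
      show "(\<lambda>j. min 1 (dj j * osc 0 (W \<omega>))) \<longlonglongrightarrow> 0" by simp
    qed
    show "AE \<omega> in N. norm (min 1 (dj j * osc 0 (W \<omega>))) \<le> 1" for j
      by (rule AE_I2) (use osc_nonneg[OF Wc] in \<open>auto simp: min_def dj_def\<close>)
  qed auto
  then have lim2: "(\<lambda>j. LINT \<omega>|N. min 1 (dj j * osc 0 (W \<omega>))) \<longlonglongrightarrow> 0" by simp
  from order_tendstoD(2)[OF lim2 \<eta>(1)] obtain j1 where j1: "(LINT \<omega>|N. min 1 (dj j1 * osc 0 (W \<omega>))) < \<eta>"
    by (auto simp: eventually_sequentially)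
  define a where "a = dj j1"
  have a: "a > 0" by (simp add: a_def dj_def)
  define F1 where "F1 z = min 1 (osc 1 z)" for z :: "real \<Rightarrow> 'h"
  define F2 where "F2 z = min 1 (a * osc 0 z)" for z :: "real \<Rightarrow> 'h"
  have F1b: "0 \<le> F1 z" "F1 z \<le> 1" and F2b: "0 \<le> F2 z" "F2 z \<le> 1" if "cadlag01 z" for z
    using osc_nonneg[OF that, of 1] osc_nonneg[OF that, of 0] a by (auto simp: F1_def F2_def)
  have W1: "(LINT \<omega>|N. F1 (W \<omega>)) < \<eta>" using j0 by (simp add: F1_def d_def)
  have W2: "(LINT \<omega>|N. F2 (W \<omega>)) < \<eta>" using j1 by (simp add: F2_def a_def)
  have C1: "(\<lambda>n. LINT \<omega>|M. F1 (Z n \<omega>)) \<longlonglongrightarrow> (LINT \<omega>|N. F1 (W \<omega>))"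
  proof (rule weak_conv_D_imp[OF conv])
    fix x :: "real \<Rightarrow> 'h" and e :: real assume x: "cadlag01 x" and e: "e > 0"
    obtain r where r: "r > 0" "\<And>y. cadlag01 y \<Longrightarrow> skorokhod_dist x y < r \<Longrightarrow> \<bar>osc 1 y - osc 1 x\<bar> \<le> e"
      using osc_skorokhod[OF x e] by blast
    have "\<bar>F1 y - F1 x\<bar> \<le> e" if "cadlag01 y \<and> skorokhod_dist x y < r" for y
      using r(2)[of y] that min_one_diff[of "osc 1 y" "osc 1 x"] unfolding F1_def by linarith
    with r(1) show "\<exists>r>0. \<forall>y. cadlag01 y \<and> skorokhod_dist x y < r \<longrightarrow> \<bar>F1 y - F1 x\<bar> \<le> e" by blast
  qed (use F1b in \<open>auto simp: abs_le_iff\<close>)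
  have C2: "(\<lambda>n. LINT \<omega>|M. F2 (Z n \<omega>)) \<longlonglongrightarrow> (LINT \<omega>|N. F2 (W \<omega>))"
  proof (rule weak_conv_D_imp[OF conv])
    fix x :: "real \<Rightarrow> 'h" and e :: real assume x: "cadlag01 x" and e: "e > 0"
    from e a have "e / a > 0" by simp
    then obtain r where r: "r > 0" "\<And>y. cadlag01 y \<Longrightarrow> skorokhod_dist x y < r \<Longrightarrow> \<bar>osc 0 y - osc 0 x\<bar> \<le> e / a"
      using osc_skorokhod[OF x] by blast
    have "\<bar>F2 y - F2 x\<bar> \<le> e" if y: "cadlag01 y \<and> skorokhod_dist x y < r" for y
    proof -
      have "\<bar>F2 y - F2 x\<bar> \<le> \<bar>a * osc 0 y - a * osc 0 x\<bar>" unfolding F2_def by (rule min_one_diff)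
      also have "\<dots> = a * \<bar>osc 0 y - osc 0 x\<bar>" using a by (simp add: right_diff_distrib[symmetric] abs_mult)
      also have "\<dots> \<le> a * (e / a)" using r(2)[of y] y a by (intro mult_left_mono) auto
      finally show ?thesis using a by simp
    qed
    with r(1) show "\<exists>r>0. \<forall>y. cadlag01 y \<and> skorokhod_dist x y < r \<longrightarrow> \<bar>F2 y - F2 x\<bar> \<le> e" by blast
  qed (use F2b in \<open>auto simp: abs_le_iff\<close>)
  define b0 where "b0 = norm R * (3 * ((2 / d + 1) * \<beta>))"
  have b0: "b0 \<ge> 0" using d \<beta> by (simp add: b0_def)
  have "(\<lambda>m. b0 * (1 / real m) powr \<alpha>) \<longlonglongrightarrow> b0 * 0"
    using \<alpha> by (intro tendsto_mult tendsto_const tendsto_zero_powrI[OF lim_1_over_n]) auto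
  then have "(\<lambda>m. b0 * (1 / real m) powr \<alpha>) \<longlonglongrightarrow> 0" by simp
  from order_tendstoD(2)[OF this a] obtain m0 where m0: "\<And>m. m \<ge> m0 \<Longrightarrow> b0 * (1 / real m) powr \<alpha> < a"
    by (auto simp: eventually_sequentially)
  define m where "m = max 2 m0"
  have m: "m \<ge> 2" "b0 * (1 / real m) powr \<alpha> \<le> a" using m0[of m] by (auto simp: m_def)
  define F3 where "F3 z = g (Phi R m (smooth d z))" for z :: "real \<Rightarrow> 'h"
  have C3: "(\<lambda>n. LINT \<omega>|M. F3 (Z n \<omega>)) \<longlonglongrightarrow> (LINT \<omega>|N. F3 (W \<omega>))"
  proof (rule weak_conv_D_imp[OF conv])
    fix x :: "real \<Rightarrow> 'h" and e :: real assume x: "cadlag01 x" and e: "e > 0"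
    from e g(4) have "e / (Lg + 1) > 0" by simp
    then obtain r where r: "r > 0" "\<And>y. cadlag01 y \<Longrightarrow> skorokhod_dist x y < r \<Longrightarrow> \<bar>Phi R m (smooth d y) - Phi R m (smooth d x)\<bar> \<le> e / (Lg + 1)"
      using Phi_smooth_skorokhod[OF x _ m(1)] by metis
    have "\<bar>F3 y - F3 x\<bar> \<le> e" if y: "cadlag01 y \<and> skorokhod_dist x y < r" for y
    proof -
      have "\<bar>F3 y - F3 x\<bar> \<le> Lg * \<bar>Phi R m (smooth d y) - Phi R m (smooth d x)\<bar>" unfolding F3_def by (rule g(3))
      also have "\<dots> \<le> (Lg + 1) * (e / (Lg + 1))" using r(2)[of y] y g(4) by (intro mult_mono) auto
      finally show ?thesis using g(4) by simp
    qed
    with r(1) show "\<exists>r>0. \<forall>y. cadlag01 y \<and> skorokhod_dist x y < r \<longrightarrow> \<bar>F3 y - F3 x\<bar> \<le> e" by blast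
  qed (use g in \<open>auto simp: F3_def abs_le_iff\<close>)
  have pw: "\<bar>g (Phi R n z) - F3 z\<bar> \<le> K * (F1 z + F2 z)" if z: "cadlag01 z" and n: "n \<ge> m" for z n
  proof -
    have o: "osc 1 z \<ge> 0" "osc 0 z \<ge> 0" by (rule osc_nonneg[OF z])+
    have "\<bar>Phi R n z - Phi R m (smooth d z)\<bar> \<le> norm R * (V * (2 * osc 1 z)) + norm R * (3 * (((2 / d + 1) * osc 0 z) * (\<beta> * (1 / real m) powr \<alpha>)))"
      using osc_upper[OF z, of _ 0] osc_upper[OF z, of _ 1] by (intro Phi_smooth_compare[OF z _ _ m(1) n]) auto
    also have "\<dots> = norm R * (V * 2) * osc 1 z + (b0 * (1 / real m) powr \<alpha>) * osc 0 z" by (simp add: b0_def algebra_simps)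
    also have "\<dots> \<le> norm R * (V * 2) * osc 1 z + a * osc 0 z" using m(2) o by (intro add_left_mono mult_right_mono)
    finally have "Lg * \<bar>Phi R n z - Phi R m (smooth d z)\<bar> \<le> Lg * (norm R * (V * 2) * osc 1 z + a * osc 0 z)" by (rule mult_left_mono[OF _ g(4)])
    then have "\<bar>g (Phi R n z) - F3 z\<bar> \<le> c1 * osc 1 z + Lg * (a * osc 0 z)"
      using g(3)[of "Phi R n z" "Phi R m (smooth d z)"] by (simp add: F3_def c1_def algebra_simps)
    moreover have "\<bar>g (Phi R n z) - F3 z\<bar> \<le> 1" using g(1,2) unfolding F3_def by (simp add: abs_le_iff) (metis add.right_neutral add_mono diff_le_eq)
    ultimately have "\<bar>g (Phi R n z) - F3 z\<bar> \<le> min 1 (c1 * osc 1 z + Lg * (a * osc 0 z))" by simp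
    also have "\<dots> \<le> K * (F1 z + F2 z)" unfolding K_def F1_def F2_def using o a c1 g(4) by (intro min_one_sum_le) auto
    finally show ?thesis .
  qed
  note approx = approx_expectation[where a = a and K = K and g = g and R = R and m = m, folded F1_def F2_def F3_def]
  have apM: "\<bar>(LINT \<omega>|M. g (Phi R n (Z n \<omega>))) - (LINT \<omega>|M. F3 (Z n \<omega>))\<bar> \<le> K * ((LINT \<omega>|M. F1 (Z n \<omega>)) + (LINT \<omega>|M. F2 (Z n \<omega>)))"
    if "n \<ge> m" for n
    using K a by (intro approx M Z g(1,2) pw that) auto
  have apN: "\<bar>(LINT \<omega>|N. g (Phi R n (W \<omega>))) - (LINT \<omega>|N. F3 (W \<omega>))\<bar> \<le> K * ((LINT \<omega>|N. F1 (W \<omega>)) + (LINT \<omega>|N. F2 (W \<omega>)))"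
    if "n \<ge> m" for n
    using K a by (intro approx N Wp g(1,2) pw that) auto
  have "\<forall>\<^sub>F n in sequentially. (LINT \<omega>|M. F1 (Z n \<omega>)) < \<eta> \<and> (LINT \<omega>|M. F2 (Z n \<omega>)) < \<eta> \<and>
      dist (LINT \<omega>|M. F3 (Z n \<omega>)) (LINT \<omega>|N. F3 (W \<omega>)) < e / 4 \<and> n \<ge> m"
    using e by (intro eventually_conj order_tendstoD(2)[OF C1 W1] order_tendstoD(2)[OF C2 W2] tendstoD[OF C3] eventually_ge_at_top) auto
  then obtain n0 where n0: "\<And>n. n \<ge> n0 \<Longrightarrow> (LINT \<omega>|M. F1 (Z n \<omega>)) < \<eta> \<and> (LINT \<omega>|M. F2 (Z n \<omega>)) < \<eta> \<and>
      dist (LINT \<omega>|M. F3 (Z n \<omega>)) (LINT \<omega>|N. F3 (W \<omega>)) < e / 4 \<and> n \<ge> m"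
    by (auto simp: eventually_sequentially)
  have "norm ((LINT \<omega>|M. g (Phi R n (Z n \<omega>))) - (LINT \<omega>|N. g (Phi R n (W \<omega>))) - 0) < e" if "n \<ge> n0" for n
  proof -
    note n = n0[OF that]
    have "K * ((LINT \<omega>|M. F1 (Z n \<omega>)) + (LINT \<omega>|M. F2 (Z n \<omega>))) \<le> K * (\<eta> + \<eta>)"
      using n K by (intro mult_left_mono) auto
    then have 1: "\<bar>(LINT \<omega>|M. g (Phi R n (Z n \<omega>))) - (LINT \<omega>|M. F3 (Z n \<omega>))\<bar> \<le> e / 4"
      using apM[of n] n \<eta>(2) by (simp add: distrib_left)
    have "K * ((LINT \<omega>|N. F1 (W \<omega>)) + (LINT \<omega>|N. F2 (W \<omega>))) \<le> K * (\<eta> + \<eta>)"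
      using W1 W2 K by (intro mult_left_mono) auto
    then have 2: "\<bar>(LINT \<omega>|N. g (Phi R n (W \<omega>))) - (LINT \<omega>|N. F3 (W \<omega>))\<bar> \<le> e / 4"
      using apN[of n] n \<eta>(2) by (simp add: distrib_left)
    have 3: "\<bar>(LINT \<omega>|M. F3 (Z n \<omega>)) - (LINT \<omega>|N. F3 (W \<omega>))\<bar> < e / 4" using n by (simp add: dist_real_def)
    from 1 2 3 e show ?thesis unfolding real_norm_def diff_zero abs_le_iff abs_less_iff by linarith
  qed
  then show "\<exists>no. \<forall>n\<ge>no. norm ((LINT \<omega>|M. g (Phi R n (Z n \<omega>))) - (LINT \<omega>|N. g (Phi R n (W \<omega>))) - 0) < e" by blast
qed

section \<open>Brownian motion and Brownian bridges\<close>

text \<open>Passage from lists to a finite index set, in which one time may occur with several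
  directions.\<close>

lemma hilbert_brownian_motion_finite:
  assumes W: "hilbert_brownian_motion N W C" and I: "finite I" and t: "\<And>i. i \<in> I \<Longrightarrow> t i \<in> {0..1}"
  shows "is_normal N (\<lambda>\<omega>. \<Sum>i\<in>I. c i * inner (W \<omega> (t i)) (x i)) 0
    (\<Sum>i\<in>I. \<Sum>j\<in>I. c i * c j * min (t i) (t j) * inner (C (x i)) (x j))"
proof -
  obtain f where f: "bij_betw f {0..<card I} I" using ex_bij_betw_nat_finite[OF I] by blast
  define n where "n = card I"
  define ts where "ts = map (\<lambda>k. t (f k)) [0..<n]"
  define xs where "xs = map (\<lambda>k. x (f k)) [0..<n]"
  define cs where "cs = map (\<lambda>k. c (f k)) [0..<n]"
  have fI: "f k \<in> I" if "k < n" for k using f that unfolding n_def bij_betw_def by auto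
  have len: "length ts = n" "length xs = n" "length cs = n" by (simp_all add: ts_def xs_def cs_def)
  have "set ts \<subseteq> {0..1}" using t fI by (fastforce simp: ts_def)
  then have "is_normal N (\<lambda>\<omega>. \<Sum>j<length ts. cs!j * inner (W \<omega> (ts!j)) (xs!j)) 0
          (\<Sum>i<length ts. \<Sum>j<length ts. cs!i * cs!j * min (ts!i) (ts!j) * inner (C (xs!i)) (xs!j))"
    using W len unfolding hilbert_brownian_motion_def by (metis (no_types, lifting))
  moreover have re: "(\<Sum>j<n. G (f j)) = (\<Sum>i\<in>I. G i)" for G :: "_ \<Rightarrow> real"
    using sum.reindex_bij_betw[OF f, of G] by (simp add: n_def atLeast0LessThan)
  ultimately show ?thesis
    unfolding len by (simp add: ts_def xs_def cs_def re[symmetric])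
qed

lemma std_brownian_bridge_finite:
  assumes B: "std_brownian_bridge N B" and I: "finite I" and t: "\<And>i. i \<in> I \<Longrightarrow> t i \<in> {0..1}"
  shows "is_normal N (\<lambda>\<omega>. \<Sum>i\<in>I. c i * B \<omega> (t i)) 0
    (\<Sum>i\<in>I. \<Sum>j\<in>I. c i * c j * (min (t i) (t j) - t i * t j))"
proof -
  obtain f where f: "bij_betw f {0..<card I} I" using ex_bij_betw_nat_finite[OF I] by blast
  define n where "n = card I"
  define ts where "ts = map (\<lambda>k. t (f k)) [0..<n]"
  define cs where "cs = map (\<lambda>k. c (f k)) [0..<n]"
  have fI: "f k \<in> I" if "k < n" for k using f that unfolding n_def bij_betw_def by auto
  have len: "length ts = n" "length cs = n" by (simp_all add: ts_def cs_def)
  have "set ts \<subseteq> {0..1}" using t fI by (fastforce simp: ts_def)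
  then have "is_normal N (\<lambda>\<omega>. \<Sum>j<length ts. cs!j * B \<omega> (ts!j)) 0
          (\<Sum>i<length ts. \<Sum>j<length ts. cs!i * cs!j * (min (ts!i) (ts!j) - ts!i * ts!j))"
    using B len unfolding std_brownian_bridge_def by (metis (no_types, lifting))
  moreover have re: "(\<Sum>j<n. G (f j)) = (\<Sum>i\<in>I. G i)" for G :: "_ \<Rightarrow> real"
    using sum.reindex_bij_betw[OF f, of G] by (simp add: n_def atLeast0LessThan)
  ultimately show ?thesis
    unfolding len by (simp add: ts_def cs_def re[symmetric])
qed

locale gaussian_setup = spectral_expansion v C lam for v :: "nat \<Rightarrow> 'h::{real_inner,banach,second_countable_topology}" and C lam +
  fixes N' :: "'c measure" and W :: "'c \<Rightarrow> real \<Rightarrow> 'h" and N :: "'b measure" and B :: "nat \<Rightarrow> 'b \<Rightarrow> real \<Rightarrow> real"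
  assumes prob_N': "prob_space N'" and W: "hilbert_brownian_motion N' W C"
    and prob_N: "prob_space N" and B: "\<And>p. std_brownian_bridge N (B p)"
    and B_indep: "prob_space.indep_vars N (\<lambda>_. PiM UNIV (\<lambda>_. borel)) B UNIV"
begin

lemma W_measurable: "(\<lambda>\<omega>. W \<omega> t) \<in> borel_measurable N'"
  using W by (simp add: hilbert_brownian_motion_def)

lemma W_continuous: "\<omega> \<in> space N' \<Longrightarrow> continuous_on {0..1} (W \<omega>)"
  using W by (simp add: hilbert_brownian_motion_def)

lemma B_measurable: "(\<lambda>\<omega>. B p \<omega> t) \<in> borel_measurable N"
  using B[of p] by (simp add: std_brownian_bridge_def)

lemma B_continuous: "\<omega> \<in> space N \<Longrightarrow> continuous_on {0..1} (B p \<omega>)"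
  using B[of p] by (simp add: std_brownian_bridge_def)

text \<open>\<open>lam p\<close> is the variance of the coordinate of \<open>W 1\<close> along
  \<open>v p\<close>, and \<open>is_normal\<close> admits no negative variance.\<close>

lemma lam_nonneg: "lam p \<ge> 0"
proof -
  have "is_normal N' (\<lambda>\<omega>. \<Sum>i\<in>{()}. 1 * inner (W \<omega> 1) (v p)) 0
    (\<Sum>i\<in>{()}. \<Sum>j\<in>{()}. 1 * 1 * min 1 1 * inner (C (v p)) (v p))"
    by (rule hilbert_brownian_motion_finite[OF W]) auto
  then show ?thesis by (auto simp: is_normal_def inner_C_v)
qed

text \<open>The variance of the combination, with coefficients \<open>a\<close>, of a standard
  Brownian bridge at the times \<open>s\<close>.\<close>

definition bridge_variance :: "'j set \<Rightarrow> ('j \<Rightarrow> real) \<Rightarrow> ('j \<Rightarrow> real) \<Rightarrow> real" where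
  "bridge_variance J s a = (\<Sum>i\<in>J. \<Sum>j\<in>J. a i * a j * (min (s i) (s j) - s i * s j))"

text \<open>Tying down adds the time 1, indexed by \<open>None\<close>, with coefficient
  \<open>- A p\<close>. Mixed terms in \<open>p\<close> and \<open>q\<close> drop out because
  \<open>C\<close> is diagonal, and in each remaining block the terms at time 1 turn min(s, t) into
  min(s, t) - s t.\<close>

lemma char_W:
  assumes J: "finite J" and s: "\<And>i. i \<in> J \<Longrightarrow> s i \<in> {0..1}"
  shows "(CLINT \<omega>|N'. iexp (\<Sum>x\<in>{..<P} \<times> J. a x * inner (bridge (W \<omega>) (s (snd x))) (v (fst x)))) =
    complex_of_real (exp (- (\<Sum>p<P. lam p * bridge_variance J s (\<lambda>i. a (p, i))) / 2))"
proof -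
  define A where "A p = (\<Sum>i\<in>J. a (p, i) * s i)" for p
  define J' where "J' = insert None (Some ` J)"
  define t where "t x = (case x of None \<Rightarrow> 1 | Some i \<Rightarrow> s i)" for x
  define c where "c p x = (case x of None \<Rightarrow> - A p | Some i \<Rightarrow> a (p, i))" for p x
  have J': "finite J'" using J by (simp add: J'_def)
  have t: "t x \<in> {0..1}" if "x \<in> J'" for x using that s by (auto simp: t_def J'_def)
  have sJ': "(\<Sum>x\<in>J'. G x) = G None + (\<Sum>i\<in>J. G (Some i))" for G :: "_ \<Rightarrow> real"
    unfolding J'_def using J by (subst sum.insert) (auto simp: sum.reindex)
  have "is_normal N' (\<lambda>\<omega>. \<Sum>y\<in>{..<P} \<times> J'. c (fst y) (snd y) * inner (W \<omega> (t (snd y))) (v (fst y))) 0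
    (\<Sum>y\<in>{..<P} \<times> J'. \<Sum>z\<in>{..<P} \<times> J'. c (fst y) (snd y) * c (fst z) (snd z) * min (t (snd y)) (t (snd z)) * inner (C (v (fst y))) (v (fst z)))"
    using J' t by (intro hilbert_brownian_motion_finite[OF W]) auto
  moreover have "(\<Sum>y\<in>{..<P} \<times> J'. c (fst y) (snd y) * inner (W \<omega> (t (snd y))) (v (fst y))) =
    (\<Sum>x\<in>{..<P} \<times> J. a x * inner (bridge (W \<omega>) (s (snd x))) (v (fst x)))" for \<omega>
  proof -
    have "(\<Sum>x\<in>J'. c p x * inner (W \<omega> (t x)) (v p)) = (\<Sum>i\<in>J. a (p, i) * inner (bridge (W \<omega>) (s i)) (v p))" for p
      unfolding sJ' by (simp add: c_def t_def A_def bridge_def inner_diff_left right_diff_distrib sum_subtractf sum_distrib_right mult.assoc)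
    then have "(\<Sum>p<P. \<Sum>x\<in>J'. c p x * inner (W \<omega> (t x)) (v p)) = (\<Sum>p<P. \<Sum>i\<in>J. a (p, i) * inner (bridge (W \<omega>) (s i)) (v p))" by simp
    then show ?thesis by (simp add: sum.cartesian_product')
  qed
  moreover have "(\<Sum>y\<in>{..<P} \<times> J'. \<Sum>z\<in>{..<P} \<times> J'. c (fst y) (snd y) * c (fst z) (snd z) * min (t (snd y)) (t (snd z)) * inner (C (v (fst y))) (v (fst z)))
    = (\<Sum>p<P. lam p * bridge_variance J s (\<lambda>i. a (p, i)))"
  proof -
    have one: "(\<Sum>x\<in>J'. \<Sum>y\<in>J'. c p x * c p y * min (t x) (t y)) = bridge_variance J s (\<lambda>i. a (p, i))" for p
    proof -
      have m1: "min (s i) 1 = s i" "min 1 (s i) = s i" if "i \<in> J" for i using s[OF that] by auto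
      have "(\<Sum>x\<in>J'. \<Sum>y\<in>J'. c p x * c p y * min (t x) (t y)) =
        (A p * A p - (\<Sum>j\<in>J. A p * a (p, j) * min 1 (s j))) +
        (\<Sum>i\<in>J. - (a (p, i) * A p * min (s i) 1) + (\<Sum>j\<in>J. a (p, i) * a (p, j) * min (s i) (s j)))"
        unfolding sJ' by (simp add: c_def t_def sum_negf)
      also have "(\<Sum>j\<in>J. A p * a (p, j) * min 1 (s j)) = A p * A p"
        unfolding A_def[of p] by (simp add: m1 sum_distrib_left mult.assoc)
      also have "(\<Sum>i\<in>J. - (a (p, i) * A p * min (s i) 1) + (\<Sum>j\<in>J. a (p, i) * a (p, j) * min (s i) (s j))) =
        (\<Sum>i\<in>J. \<Sum>j\<in>J. a (p, i) * a (p, j) * (min (s i) (s j) - s i * s j))"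
      proof (rule sum.cong[OF refl])
        fix i assume i: "i \<in> J"
        have "a (p, i) * A p * s i = (\<Sum>j\<in>J. a (p, i) * a (p, j) * (s i * s j))"
          unfolding A_def by (simp add: sum_distrib_left sum_distrib_right mult_ac)
        then show "- (a (p, i) * A p * min (s i) 1) + (\<Sum>j\<in>J. a (p, i) * a (p, j) * min (s i) (s j)) =
           (\<Sum>j\<in>J. a (p, i) * a (p, j) * (min (s i) (s j) - s i * s j))"
          by (simp add: m1[OF i] right_diff_distrib sum_subtractf)
      qed
      finally show ?thesis by (simp add: bridge_variance_def)
    qed
    have "(\<Sum>y\<in>{..<P} \<times> J'. \<Sum>z\<in>{..<P} \<times> J'. c (fst y) (snd y) * c (fst z) (snd z) * min (t (snd y)) (t (snd z)) * inner (C (v (fst y))) (v (fst z)))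
      = (\<Sum>p<P. \<Sum>x\<in>J'. \<Sum>q<P. \<Sum>y\<in>J'. c p x * c q y * min (t x) (t y) * (if p = q then lam p else 0))"
      by (simp only: sum.cartesian_product' inner_C_v fst_conv snd_conv)
    also have "\<dots> = (\<Sum>p<P. \<Sum>x\<in>J'. \<Sum>y\<in>J'. c p x * c p y * min (t x) (t y) * lam p)"
    proof (intro sum.cong refl)
      fix p x assume p: "p \<in> {..<P}"
      have "(\<Sum>q<P. \<Sum>y\<in>J'. c p x * c q y * min (t x) (t y) * (if p = q then lam p else 0)) =
        (\<Sum>q<P. if p = q then (\<Sum>y\<in>J'. c p x * c q y * min (t x) (t y) * lam p) else 0)"
        by (intro sum.cong) auto
      then show "(\<Sum>q<P. \<Sum>y\<in>J'. c p x * c q y * min (t x) (t y) * (if p = q then lam p else 0)) = (\<Sum>y\<in>J'. c p x * c p y * min (t x) (t y) * lam p)"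
        using p by (simp add: sum.delta)
    qed
    also have "\<dots> = (\<Sum>p<P. lam p * bridge_variance J s (\<lambda>i. a (p, i)))"
      unfolding one[symmetric] by (simp add: sum_distrib_left mult.commute)
    finally show ?thesis .
  qed
  ultimately have "is_normal N' (\<lambda>\<omega>. \<Sum>x\<in>{..<P} \<times> J. a x * inner (bridge (W \<omega>) (s (snd x))) (v (fst x))) 0
    (\<Sum>p<P. lam p * bridge_variance J s (\<lambda>i. a (p, i)))" by simp
  from integral_iexp_is_normal[OF prob_N' this] show ?thesis .
qed

text \<open>Independence makes the characteristic function a product over \<open>p\<close>. The
  bridge covariance is unchanged when all times are reversed, so the reversed bridges give the same
  exponent as \<open>char_W\<close>.\<close>

lemma char_B:
  assumes J: "finite J" and s: "\<And>i. i \<in> J \<Longrightarrow> s i \<in> {0..1}"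
  shows "(CLINT \<omega>|N. iexp (\<Sum>x\<in>{..<P} \<times> J. a x * (sqrt (lam (fst x)) * B (fst x) \<omega> (1 - s (snd x))))) =
    complex_of_real (exp (- (\<Sum>p<P. lam p * bridge_variance J s (\<lambda>i. a (p, i))) / 2))"
proof -
  interpret N: prob_space N by (rule prob_N)
  define Y where "Y p \<omega> = (\<Sum>i\<in>J. (a (p, i) * sqrt (lam p)) * B p \<omega> (1 - s i))" for p \<omega>
  have Ysum: "(\<Sum>x\<in>{..<P} \<times> J. a x * (sqrt (lam (fst x)) * B (fst x) \<omega> (1 - s (snd x)))) = (\<Sum>p<P. Y p \<omega>)" for \<omega>
    by (simp add: Y_def sum.cartesian_product' mult.assoc)
  have Ym[measurable]: "Y p \<in> borel_measurable N" for p
    unfolding Y_def[abs_def] using B_measurable by measurable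
  have "N.indep_vars (\<lambda>_. PiM UNIV (\<lambda>_. borel)) B {..<P}" by (rule N.indep_vars_subset[OF B_indep]) auto
  from N.indep_vars_compose2[OF this, of "\<lambda>p w. \<Sum>i\<in>J. (a (p, i) * sqrt (lam p)) * w (1 - s i)" "\<lambda>_. borel"]
  have ind: "N.indep_vars (\<lambda>_. borel) Y {..<P}" by (simp add: Y_def[abs_def])
  have one: "char (distr N borel (Y p)) 1 = complex_of_real (exp (- (lam p * bridge_variance J s (\<lambda>i. a (p, i))) / 2))" for p
  proof -
    have "is_normal N (\<lambda>\<omega>. \<Sum>i\<in>J. (a (p, i) * sqrt (lam p)) * B p \<omega> (1 - s i)) 0
      (\<Sum>i\<in>J. \<Sum>j\<in>J. (a (p, i) * sqrt (lam p)) * (a (p, j) * sqrt (lam p)) * (min (1 - s i) (1 - s j) - (1 - s i) * (1 - s j)))"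
      using s by (intro std_brownian_bridge_finite[OF B J]) auto
    moreover have "(\<Sum>i\<in>J. \<Sum>j\<in>J. (a (p, i) * sqrt (lam p)) * (a (p, j) * sqrt (lam p)) * (min (1 - s i) (1 - s j) - (1 - s i) * (1 - s j)))
      = lam p * bridge_variance J s (\<lambda>i. a (p, i))"
      unfolding bridge_variance_def sum_distrib_left
    proof (intro sum.cong refl)
      fix i j
      have "sqrt (lam p) * sqrt (lam p) = lam p" using lam_nonneg by simp
      moreover have "(x * r) * (y * r) * z = (r * r) * (x * y * z)" for x y z r :: real by (simp only: mult_ac)
      moreover have "min (1 - s i) (1 - s j) - (1 - s i) * (1 - s j) = min (s i) (s j) - s i * s j"
        by (simp add: min_def algebra_simps)
      ultimately show "(a (p, i) * sqrt (lam p)) * (a (p, j) * sqrt (lam p)) * (min (1 - s i) (1 - s j) - (1 - s i) * (1 - s j))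
        = lam p * (a (p, i) * a (p, j) * (min (s i) (s j) - s i * s j))"
        by (simp only:)
    qed
    ultimately have "is_normal N (Y p) 0 (lam p * bridge_variance J s (\<lambda>i. a (p, i)))" by (simp add: Y_def[abs_def])
    from integral_iexp_is_normal[OF prob_N this] show ?thesis by (simp add: char_def integral_distr)
  qed
  have "(CLINT \<omega>|N. iexp (\<Sum>p<P. Y p \<omega>)) = char (distr N borel (\<lambda>\<omega>. \<Sum>p<P. Y p \<omega>)) 1"
    by (simp add: char_def integral_distr)
  also have "\<dots> = (\<Prod>p<P. char (distr N borel (Y p)) 1)" by (rule N.char_distr_sum[OF ind])
  also have "\<dots> = complex_of_real (\<Prod>p<P. exp (- (lam p * bridge_variance J s (\<lambda>i. a (p, i))) / 2))" by (simp add: one)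
  also have "(\<Prod>p<P. exp (- (lam p * bridge_variance J s (\<lambda>i. a (p, i))) / 2)) = exp (- (\<Sum>p<P. lam p * bridge_variance J s (\<lambda>i. a (p, i))) / 2)"
    by (simp add: exp_sum[symmetric] sum_negf sum_divide_distrib)
  finally show ?thesis unfolding Ysum .
qed

text \<open>The only link between the two probability spaces; every transfer from \<open>W\<close>
  to the bridges is an instance of it.\<close>

theorem law_eq:
  fixes F :: "(nat \<times> 'j \<Rightarrow> real) \<Rightarrow> real"
  assumes J: "finite J" and s: "\<And>i. i \<in> J \<Longrightarrow> s i \<in> {0..1}"
    and F: "F \<in> borel_measurable (PiM ({..<P} \<times> J) (\<lambda>_. borel))"
  shows "(LINT \<omega>|N'. F (\<lambda>x\<in>{..<P} \<times> J. inner (bridge (W \<omega>) (s (snd x))) (v (fst x)))) =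
    (LINT \<omega>|N. F (\<lambda>x\<in>{..<P} \<times> J. sqrt (lam (fst x)) * B (fst x) \<omega> (1 - s (snd x))))"
proof (rule integral_eqI_char[OF prob_N' prob_N _ _ _ _ F])
  show "finite ({..<P} \<times> J)" using J by simp
  fix x
  show "(\<lambda>\<omega>. inner (bridge (W \<omega>) (s (snd x))) (v (fst x))) \<in> borel_measurable N'"
    unfolding bridge_def using W_measurable by measurable
  show "(\<lambda>\<omega>. sqrt (lam (fst x)) * B (fst x) \<omega> (1 - s (snd x))) \<in> borel_measurable N"
    using B_measurable by measurable
next
  fix a
  show "(CLINT \<omega>|N'. iexp (\<Sum>x\<in>{..<P} \<times> J. a x * inner (bridge (W \<omega>) (s (snd x))) (v (fst x)))) =
    (CLINT \<omega>|N. iexp (\<Sum>x\<in>{..<P} \<times> J. a x * (sqrt (lam (fst x)) * B (fst x) \<omega> (1 - s (snd x)))))"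
    by (rule trans[OF char_W[OF J s] char_B[OF J s, symmetric]])
qed

text \<open>The coordinates of the vector \<open>W 1\<close> tend to zero, so by dominated
  convergence their characteristic functions at 1, which are \<open>exp (- lam p / 2)\<close>, tend
  to 1.\<close>

lemma lam_tendsto_0: "lam \<longlonglongrightarrow> 0"
proof -
  interpret N': prob_space N' by (rule prob_N')
  have "(CLINT \<omega>|N'. iexp (inner (W \<omega> 1) (v p))) = complex_of_real (exp (- lam p / 2))" for p
  proof -
    have "is_normal N' (\<lambda>\<omega>. \<Sum>i\<in>{()}. 1 * inner (W \<omega> 1) (v p)) 0
      (\<Sum>i\<in>{()}. \<Sum>j\<in>{()}. 1 * 1 * min 1 1 * inner (C (v p)) (v p))"
      by (rule hilbert_brownian_motion_finite[OF W]) auto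
    then have "is_normal N' (\<lambda>\<omega>. inner (W \<omega> 1) (v p)) 0 (lam p)" by (simp add: inner_C_v)
    from integral_iexp_is_normal[OF prob_N' this] show ?thesis by simp
  qed
  moreover have "(\<lambda>p. CLINT \<omega>|N'. iexp (inner (W \<omega> 1) (v p))) \<longlonglongrightarrow> (CLINT \<omega>|N'. 1)"
  proof (rule integral_dominated_convergence[where w = "\<lambda>_. 1"])
    have "(\<lambda>p. iexp (inner (W \<omega> 1) (v p))) \<longlonglongrightarrow> iexp 0" for \<omega>
    proof -
      have "(\<lambda>p. (inner (v p) (W \<omega> 1))\<^sup>2) \<longlonglongrightarrow> 0" using norm_sq_sums[of "W \<omega> 1"] by (intro summable_LIMSEQ_zero) (rule sums_summable)
      from tendsto_real_sqrt[OF this] have "(\<lambda>p. \<bar>inner (v p) (W \<omega> 1)\<bar>) \<longlonglongrightarrow> 0" by simp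
      then have "(\<lambda>p. inner (v p) (W \<omega> 1)) \<longlonglongrightarrow> 0" by (rule tendsto_rabs_zero_cancel)
      then have "(\<lambda>p. inner (W \<omega> 1) (v p)) \<longlonglongrightarrow> 0" by (simp add: inner_commute)
      then show ?thesis by (intro isCont_tendsto_compose[OF isCont_iexp])
    qed
    then show "AE \<omega> in N'. (\<lambda>p. iexp (inner (W \<omega> 1) (v p))) \<longlonglongrightarrow> 1" by simp
    show "(\<lambda>\<omega>. iexp (inner (W \<omega> 1) (v p))) \<in> borel_measurable N'" for p
      using W_measurable[of 1] by measurable
  qed auto
  ultimately have "(\<lambda>p. complex_of_real (exp (- lam p / 2))) \<longlonglongrightarrow> complex_of_real 1" by (simp add: N'.prob_space)
  then have "(\<lambda>p. exp (- lam p / 2)) \<longlonglongrightarrow> 1" by (simp only: tendsto_of_real_iff)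
  then have "(\<lambda>p. ln (exp (- lam p / 2))) \<longlonglongrightarrow> ln 1" by (intro tendsto_ln) auto
  then have "(\<lambda>p. -2 * (- lam p / 2)) \<longlonglongrightarrow> -2 * 0" by (intro tendsto_mult tendsto_const) simp
  then show ?thesis by simp
qed

end

section \<open>Uniform tails of expansions along a path\<close>

lemma (in orthonormal_basis) tail_sum_le: "(\<Sum>p\<in>{P..<Q}. (inner (v p) x)\<^sup>2) \<le> (norm x)\<^sup>2"
proof -
  have "(\<Sum>p\<in>{P..<Q}. (inner (v p) x)\<^sup>2) \<le> (\<Sum>p. (inner (v p) x)\<^sup>2)"
    using norm_sq_sums[of x] by (intro sum_le_suminf) (auto simp: sums_iff)
  then show ?thesis using norm_sq_sums[of x] by (simp add: sums_iff)
qed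

lemma (in orthonormal_basis) tail_sum_small:
  assumes e: "e > 0"
  obtains P where "\<And>Q. (\<Sum>p\<in>{P..<Q}. (inner (v p) x)\<^sup>2) \<le> e"
proof -
  have "summable (\<lambda>p. (inner (v p) x)\<^sup>2)" using norm_sq_sums[of x] by (simp add: sums_iff)
  then obtain P where P: "\<And>m n. m \<ge> P \<Longrightarrow> norm (\<Sum>p\<in>{m..<n}. (inner (v p) x)\<^sup>2) < e"
    using e unfolding summable_Cauchy by blast
  have "(\<Sum>p\<in>{P..<Q}. (inner (v p) x)\<^sup>2) \<le> e" for Q
    using P[of P Q] by (simp add: abs_less_iff)
  then show ?thesis by (rule that)
qed

text \<open>Tails are small at finitely many times, and every time is close to one of them by
  uniform continuity. Squaring a sum doubles both parts, hence the two budgets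
  \<open>e / 4\<close>.\<close>

lemma (in orthonormal_basis) uniform_tail_sum:
  assumes z: "continuous_on {0..1::real} z" and e: "e > 0"
  obtains P where "\<And>t Q. t \<in> {0..1} \<Longrightarrow> (\<Sum>p\<in>{P..<Q}. (inner (v p) (z t))\<^sup>2) \<le> e"
proof -
  have "uniformly_continuous_on {0..1} z" by (rule compact_uniformly_continuous[OF z]) simp
  moreover have "sqrt (e / 4) > 0" using e by simp
  ultimately obtain r where r: "r > 0" "\<And>s t. s \<in> {0..1} \<Longrightarrow> t \<in> {0..1} \<Longrightarrow> \<bar>s - t\<bar> < r \<Longrightarrow> norm (z s - z t) < sqrt (e / 4)"
    unfolding uniformly_continuous_on_def dist_norm real_norm_def by metis
  obtain N :: nat where N: "1 / r < real N" using reals_Archimedean2 by blast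
  then have N0: "real N > 0" using r by (meson less_trans zero_less_divide_1_iff)
  have Nr: "1 / real N < r" using N N0 r by (simp add: field_simps)
  have "e / 4 > 0" using e by simp
  then have "\<forall>i. \<exists>P. \<forall>Q. (\<Sum>p\<in>{P..<Q}. (inner (v p) (z (real i / real N)))\<^sup>2) \<le> e / 4"
    using tail_sum_small by metis
  then obtain P where P: "\<And>i Q. (\<Sum>p\<in>{P i..<Q}. (inner (v p) (z (real i / real N)))\<^sup>2) \<le> e / 4" by metis
  define P0 where "P0 = Max (P ` {..N})"
  show ?thesis
  proof (rule that[of P0])
    fix t :: real and Q assume t: "t \<in> {0..1}"
    define i where "i = nat \<lfloor>t * real N\<rfloor>"
    have i: "real i \<le> t * real N" "t * real N < real i + 1" using t N0 by (auto simp: i_def)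
    have "t * real N \<le> 1 * real N" using t N0 by (intro mult_right_mono) auto
    with i have iN: "i \<le> N" by linarith
    have ti: "real i / real N \<in> {0..1}" using iN N0 by (auto simp: divide_le_eq)
    have "\<bar>t - real i / real N\<bar> = (t * real N - real i) / real N" using i N0 by (simp add: field_simps)
    also have "\<dots> \<le> 1 / real N" using i N0 by (intro divide_right_mono) auto
    finally have close: "norm (z t - z (real i / real N)) < sqrt (e / 4)" using Nr by (intro r(2) t ti) linarith
    then have "(norm (z t - z (real i / real N)))\<^sup>2 \<le> (sqrt (e / 4))\<^sup>2" by (intro power_mono) auto
    then have close2: "(norm (z t - z (real i / real N)))\<^sup>2 \<le> e / 4" using e by simp
    have PP: "P i \<le> P0" unfolding P0_def using iN by (intro Max_ge) auto
    have "(\<Sum>p\<in>{P0..<Q}. (inner (v p) (z (real i / real N)))\<^sup>2) \<le> (\<Sum>p\<in>{P i..<Q}. (inner (v p) (z (real i / real N)))\<^sup>2)"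
      using PP by (intro sum_mono2) auto
    with P[of i Q] have b: "(\<Sum>p\<in>{P0..<Q}. (inner (v p) (z (real i / real N)))\<^sup>2) \<le> e / 4" by linarith
    have "(\<Sum>p\<in>{P0..<Q}. (inner (v p) (z t))\<^sup>2) \<le>
      (\<Sum>p\<in>{P0..<Q}. 2 * (inner (v p) (z t - z (real i / real N)))\<^sup>2 + 2 * (inner (v p) (z (real i / real N)))\<^sup>2)"
    proof (rule sum_mono)
      fix p
      have "(x + y)\<^sup>2 \<le> 2 * x\<^sup>2 + 2 * y\<^sup>2" for x y :: real
        using sum_squares_bound[of x y] by (simp add: power2_sum)
      from this[of "inner (v p) (z t - z (real i / real N))" "inner (v p) (z (real i / real N))"]
      show "(inner (v p) (z t))\<^sup>2 \<le> 2 * (inner (v p) (z t - z (real i / real N)))\<^sup>2 + 2 * (inner (v p) (z (real i / real N)))\<^sup>2"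
        by (simp add: inner_diff_right)
    qed
    also have "\<dots> = 2 * (\<Sum>p\<in>{P0..<Q}. (inner (v p) (z t - z (real i / real N)))\<^sup>2) + 2 * (\<Sum>p\<in>{P0..<Q}. (inner (v p) (z (real i / real N)))\<^sup>2)"
      by (simp add: sum.distrib sum_distrib_left)
    also have "\<dots> \<le> 2 * (e / 4) + 2 * (e / 4)"
      using order_trans[OF tail_sum_le close2] b by (intro add_mono mult_left_mono) auto
    finally show "(\<Sum>p\<in>{P0..<Q}. (inner (v p) (z t))\<^sup>2) \<le> e" by simp
  qed
qed

context gaussian_setup begin

text \<open>Dyadic grids are nested, which makes the tail maxima increase in \<open>m\<close>, and
  they are dense, so continuous paths are determined by them.\<close>

definition dyadic :: "nat \<Rightarrow> nat \<Rightarrow> real" where "dyadic m i = real i / 2 ^ m"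

lemma dyadic_range: "i \<le> 2 ^ m \<Longrightarrow> dyadic m i \<in> {0..1}"
proof -
  assume "i \<le> 2 ^ m"
  then have "real i \<le> real (2 ^ m)" by (rule of_nat_mono)
  then show ?thesis by (auto simp: dyadic_def divide_le_eq)
qed

text \<open>\<open>m\<close> limits both the number of coordinates and the fineness of the grid, so
  that this depends on finitely many variables and \<open>law_eq\<close> applies; the reversed times
  match those of \<open>law_eq\<close>.\<close>

definition tailB :: "nat \<Rightarrow> nat \<Rightarrow> 'b \<Rightarrow> real" where
  "tailB P m \<omega> = Max ((\<lambda>i. \<Sum>p\<in>{P..<m}. lam p * (B p \<omega> (1 - dyadic m i))\<^sup>2) ` {..2 ^ m})"

definition tailW :: "nat \<Rightarrow> nat \<Rightarrow> 'c \<Rightarrow> real" where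
  "tailW P m \<omega> = Max ((\<lambda>i. \<Sum>p\<in>{P..<m}. (inner (v p) (bridge (W \<omega>) (dyadic m i)))\<^sup>2) ` {..2 ^ m})"

lemma tail_law:
  "(LINT \<omega>|N'. min 1 (tailW P m \<omega>)) = (LINT \<omega>|N. min 1 (tailB P m \<omega>))"
proof -
  define F where "F x = min 1 (Max ((\<lambda>i. \<Sum>p\<in>{P..<m}. (x (p, i))\<^sup>2) ` {..2 ^ m}))" for x :: "nat \<times> nat \<Rightarrow> real"
  have "F \<in> borel_measurable (PiM ({..<m} \<times> {..2 ^ m}) (\<lambda>_. borel))"
    unfolding F_def[abs_def]
    by (intro borel_measurable_min borel_measurable_const borel_measurable_Max borel_measurable_sum borel_measurable_power measurable_component_singleton) auto
  from law_eq[OF _ _ this, of "dyadic m"] dyadic_range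
  have "(LINT \<omega>|N'. F (\<lambda>x\<in>{..<m} \<times> {..2 ^ m}. inner (bridge (W \<omega>) (dyadic m (snd x))) (v (fst x)))) =
    (LINT \<omega>|N. F (\<lambda>x\<in>{..<m} \<times> {..2 ^ m}. sqrt (lam (fst x)) * B (fst x) \<omega> (1 - dyadic m (snd x))))" by simp
  moreover have "F (\<lambda>x\<in>{..<m} \<times> {..2 ^ m}. inner (bridge (W \<omega>) (dyadic m (snd x))) (v (fst x))) = min 1 (tailW P m \<omega>)" for \<omega>
    unfolding F_def tailW_def by (intro arg_cong2[of _ _ _ _ min] arg_cong[of _ _ Max] image_cong sum.cong refl) (auto simp: inner_commute)
  moreover have "F (\<lambda>x\<in>{..<m} \<times> {..2 ^ m}. sqrt (lam (fst x)) * B (fst x) \<omega> (1 - dyadic m (snd x))) = min 1 (tailB P m \<omega>)" for \<omega>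
    unfolding F_def tailB_def by (intro arg_cong2[of _ _ _ _ min] arg_cong[of _ _ Max] image_cong sum.cong refl) (auto simp: power_mult_distrib lam_nonneg)
  ultimately show ?thesis by simp
qed

lemma tailB_upper: "i \<le> 2 ^ m \<Longrightarrow> (\<Sum>p\<in>{P..<m}. lam p * (B p \<omega> (1 - dyadic m i))\<^sup>2) \<le> tailB P m \<omega>"
  unfolding tailB_def by (intro Max_ge) auto

lemma tailB_nonneg: "tailB P m \<omega> \<ge> 0"
  using tailB_upper[where i = 0 and m = m and P = P and \<omega> = \<omega>] sum_nonneg[of "{P..<m}" "\<lambda>p. lam p * (B p \<omega> (1 - dyadic m 0))\<^sup>2"] by (simp add: lam_nonneg)

lemma tailW_nonneg: "tailW P m \<omega> \<ge> 0"
proof -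
  have "0 \<le> (\<Sum>p\<in>{P..<m}. (inner (v p) (bridge (W \<omega>) (dyadic m 0)))\<^sup>2)" by (intro sum_nonneg) auto
  also have "\<dots> \<le> tailW P m \<omega>" unfolding tailW_def by (intro Max_ge) auto
  finally show ?thesis .
qed

lemma tailB_mono:
  assumes "P' \<le> P" "m \<le> n"
  shows "tailB P m \<omega> \<le> tailB P' n \<omega>"
  unfolding tailB_def[of P m]
proof (subst Max_le_iff)
  show "\<forall>a\<in>(\<lambda>i. \<Sum>p\<in>{P..<m}. lam p * (B p \<omega> (1 - dyadic m i))\<^sup>2) ` {..2 ^ m}. a \<le> tailB P' n \<omega>"
  proof
    fix a assume "a \<in> (\<lambda>i. \<Sum>p\<in>{P..<m}. lam p * (B p \<omega> (1 - dyadic m i))\<^sup>2) ` {..2 ^ m}"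
    then obtain i where i: "i \<le> 2 ^ m" "a = (\<Sum>p\<in>{P..<m}. lam p * (B p \<omega> (1 - dyadic m i))\<^sup>2)" by auto
    have pw: "(2::real) ^ n = 2 ^ m * 2 ^ (n - m)" "(2::nat) ^ n = 2 ^ m * 2 ^ (n - m)" using assms by (simp_all add: power_add[symmetric])
    have d: "dyadic m i = dyadic n (i * 2 ^ (n - m))" unfolding dyadic_def pw by simp
    have "a \<le> (\<Sum>p\<in>{P'..<n}. lam p * (B p \<omega> (1 - dyadic n (i * 2 ^ (n - m))))\<^sup>2)"
      unfolding i d[symmetric] using assms by (intro sum_mono2) (auto simp: lam_nonneg)
    also have "\<dots> \<le> tailB P' n \<omega>" using i unfolding pw(2) by (intro tailB_upper) (simp add: pw(2))
    finally show "a \<le> tailB P' n \<omega>" .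
  qed
qed auto

lemma tailB_measurable [measurable]: "tailB P m \<in> borel_measurable N"
  unfolding tailB_def[abs_def] using B_measurable
  by (intro borel_measurable_Max borel_measurable_sum borel_measurable_times borel_measurable_power borel_measurable_const) auto

lemma tailW_measurable [measurable]: "tailW P m \<in> borel_measurable N'"
  unfolding tailW_def[abs_def] bridge_def using W_measurable
  by (intro borel_measurable_Max borel_measurable_sum borel_measurable_power) (auto intro!: borel_measurable_inner)

lemma continuous_bridge: "\<omega> \<in> space N' \<Longrightarrow> continuous_on {0..1} (bridge (W \<omega>))"
  unfolding bridge_def[abs_def] using W_continuous by (intro continuous_intros)

text \<open>The tails of the continuous
  Hilbert-space valued path vanish uniformly, and their law is that of the tails of the series.\<close>
lemma AE_tails:
  "AE \<omega> in N. \<forall>e>0. \<exists>P. \<forall>Q. \<forall>s\<in>{0..1}. (\<Sum>p\<in>{P..<Q}. lam p * (B p \<omega> s)\<^sup>2) \<le> e"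
proof -
  interpret N: prob_space N by (rule prob_N)
  interpret N': prob_space N' by (rule prob_N')
  \<comment> \<open>Truncation at 1 supplies integrability without any moment bound on the
    paths.\<close>
  define SW where "SW P \<omega> = (SUP m. min 1 (tailW P m \<omega>))" for P \<omega>
  define SB where "SB P \<omega> = (SUP m. min 1 (tailB P m \<omega>))" for P \<omega>
  have bdW: "bdd_above (range (\<lambda>m. min 1 (tailW P m \<omega>)))" and bdB: "bdd_above (range (\<lambda>m. min 1 (tailB P m \<omega>')))" for P \<omega> \<omega>'
    by (rule bdd_aboveI2[of _ _ 1], simp)+
  have [measurable]: "SW P \<in> borel_measurable N'" "SB P \<in> borel_measurable N" for P
    unfolding SW_def[abs_def] SB_def[abs_def] using bdW bdB by (auto intro!: borel_measurable_cSUP)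
  have SW_ge: "min 1 (tailW P m \<omega>) \<le> SW P \<omega>" and SB_ge: "min 1 (tailB P m \<omega>') \<le> SB P \<omega>'" for P m \<omega> \<omega>'
    unfolding SW_def SB_def by (rule cSUP_upper[OF _ bdW] cSUP_upper[OF _ bdB], simp)+
  have SW01: "0 \<le> SW P \<omega>" "SW P \<omega> \<le> 1" for P \<omega>
    using SW_ge[of P 0 \<omega>] tailW_nonneg[of P 0 \<omega>] by (auto simp: SW_def intro!: cSUP_least)
  have SB01: "0 \<le> SB P \<omega>" "SB P \<omega> \<le> 1" for P \<omega>
    using SB_ge[of P 0 \<omega>] tailB_nonneg[of P 0 \<omega>] by (auto simp: SB_def intro!: cSUP_least)
  have "(\<lambda>P. LINT \<omega>|N'. SW P \<omega>) \<longlonglongrightarrow> (LINT \<omega>|N'. 0)"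
  proof (rule integral_dominated_convergence[where w = "\<lambda>_. 1"])
    show "AE \<omega> in N'. (\<lambda>P. SW P \<omega>) \<longlonglongrightarrow> 0"
    proof (rule AE_I2, rule LIMSEQ_I)
      fix \<omega> and e :: real assume \<omega>: "\<omega> \<in> space N'" and e: "e > 0"
      from e have "e / 2 > 0" by simp
      then obtain P0 where P0: "\<And>t Q. t \<in> {0..1} \<Longrightarrow> (\<Sum>p\<in>{P0..<Q}. (inner (v p) (bridge (W \<omega>) t))\<^sup>2) \<le> e / 2"
        using uniform_tail_sum[OF continuous_bridge[OF \<omega>]] by metis
      have "norm (SW P \<omega> - 0) < e" if P: "P \<ge> P0" for P
      proof -
        have "SW P \<omega> \<le> e / 2" unfolding SW_def
        proof (rule cSUP_least)
          fix m
          have "tailW P m \<omega> \<le> e / 2" unfolding tailW_def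
          proof (subst Max_le_iff)
            show "\<forall>a\<in>(\<lambda>i. \<Sum>p\<in>{P..<m}. (inner (v p) (bridge (W \<omega>) (dyadic m i)))\<^sup>2) ` {..2 ^ m}. a \<le> e / 2"
            proof
              fix a assume "a \<in> (\<lambda>i. \<Sum>p\<in>{P..<m}. (inner (v p) (bridge (W \<omega>) (dyadic m i)))\<^sup>2) ` {..2 ^ m}"
              then obtain i where i: "i \<le> 2 ^ m" "a = (\<Sum>p\<in>{P..<m}. (inner (v p) (bridge (W \<omega>) (dyadic m i)))\<^sup>2)" by auto
              have "a \<le> (\<Sum>p\<in>{P0..<m}. (inner (v p) (bridge (W \<omega>) (dyadic m i)))\<^sup>2)" unfolding i using P by (intro sum_mono2) auto
              also have "\<dots> \<le> e / 2" by (rule P0[OF dyadic_range[OF i(1)]])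
              finally show "a \<le> e / 2" .
            qed
          qed auto
          then show "min 1 (tailW P m \<omega>) \<le> e / 2" by simp
        qed simp
        with SW01(1)[of P \<omega>] e show ?thesis by simp
      qed
      then show "\<exists>no. \<forall>P\<ge>no. norm (SW P \<omega> - 0) < e" by blast
    qed
    show "AE \<omega> in N'. norm (SW P \<omega>) \<le> 1" for P using SW01 by auto
  qed auto
  then have limW: "(\<lambda>P. LINT \<omega>|N'. SW P \<omega>) \<longlonglongrightarrow> 0" by simp
  \<comment> \<open>\<open>tail_law\<close> compares the two sides for each \<open>m\<close>; on the
    bridge side the expectations increase to that of \<open>SB\<close>.\<close>
  have ESB: "(LINT \<omega>|N. SB P \<omega>) \<le> (LINT \<omega>|N'. SW P \<omega>)" for P
  proof (rule LIMSEQ_le_const2)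
    show "(\<lambda>m. LINT \<omega>|N. min 1 (tailB P m \<omega>)) \<longlonglongrightarrow> (LINT \<omega>|N. SB P \<omega>)"
    proof (rule integral_dominated_convergence[where w = "\<lambda>_. 1"])
      show "AE \<omega> in N. (\<lambda>m. min 1 (tailB P m \<omega>)) \<longlonglongrightarrow> SB P \<omega>"
      proof (rule AE_I2)
        fix \<omega>
        have "incseq (\<lambda>m. min 1 (tailB P m \<omega>))" using tailB_mono[of P P] by (intro incseq_SucI min.mono) auto
        from LIMSEQ_incseq_SUP[OF bdB this] show "(\<lambda>m. min 1 (tailB P m \<omega>)) \<longlonglongrightarrow> SB P \<omega>" by (simp add: SB_def)
      qed
      show "AE \<omega> in N. norm (min 1 (tailB P m \<omega>)) \<le> 1" for m using tailB_nonneg by (intro AE_I2) (simp add: min_def)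
    qed auto
    have "(LINT \<omega>|N. min 1 (tailB P m \<omega>)) \<le> (LINT \<omega>|N'. SW P \<omega>)" for m
    proof -
      have "(LINT \<omega>|N'. min 1 (tailW P m \<omega>)) \<le> (LINT \<omega>|N'. SW P \<omega>)"
      proof (rule integral_mono)
        show "integrable N' (\<lambda>\<omega>. min 1 (tailW P m \<omega>))" using tailW_nonneg
          by (intro N'.integrable_const_bound[of _ 1] AE_I2) (auto simp: min_def)
        show "integrable N' (SW P)" using SW01 by (intro N'.integrable_const_bound[of _ 1] AE_I2) auto
      qed (rule SW_ge)
      then show ?thesis unfolding tail_law .
    qed
    then show "\<exists>M. \<forall>m\<ge>M. (LINT \<omega>|N. min 1 (tailB P m \<omega>)) \<le> (LINT \<omega>|N'. SW P \<omega>)" by blast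
  qed
  have SB_dec: "SB P \<omega> \<le> SB P' \<omega>" if "P' \<le> P" for P P' \<omega>
    unfolding SB_def[of P]
  proof (rule cSUP_least)
    fix m
    have "min 1 (tailB P m \<omega>) \<le> min 1 (tailB P' m \<omega>)" using tailB_mono[OF that order_refl] by (intro min.mono) auto
    then show "min 1 (tailB P m \<omega>) \<le> SB P' \<omega>" using SB_ge[of P' m \<omega>] by linarith
  qed simp
  define S where "S \<omega> = lim (\<lambda>P. SB P \<omega>)" for \<omega>
  have S: "(\<lambda>P. SB P \<omega>) \<longlonglongrightarrow> S \<omega>" for \<omega>
  proof -
    have "decseq (\<lambda>P. SB P \<omega>)" using SB_dec by (simp add: decseq_def)
    from decseq_convergent[OF this, of 0] SB01 show ?thesis unfolding S_def by (metis limI)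
  qed
  have [measurable]: "S \<in> borel_measurable N" by (rule borel_measurable_LIMSEQ_real[OF S]) measurable
  have S01: "0 \<le> S \<omega>" "S \<omega> \<le> 1" for \<omega>
    using LIMSEQ_le_const[OF S, of 0] LIMSEQ_le_const2[OF S, of _ 1] SB01 by blast+
  have intS: "integrable N S" using S01 by (intro N.integrable_const_bound[of _ 1] AE_I2) auto
  have "(LINT \<omega>|N. S \<omega>) \<le> (LINT \<omega>|N'. SW P \<omega>)" for P
  proof -
    have "(LINT \<omega>|N. S \<omega>) \<le> (LINT \<omega>|N. SB P \<omega>)"
    proof (rule integral_mono[OF intS])
      show "integrable N (SB P)" using SB01 by (intro N.integrable_const_bound[of _ 1] AE_I2) auto
      show "S \<omega> \<le> SB P \<omega>" for \<omega>
        by (rule LIMSEQ_le_const2[OF S]) (use SB_dec in blast)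
    qed
    with ESB[of P] show ?thesis by linarith
  qed
  then have "(LINT \<omega>|N. S \<omega>) \<le> 0" by (intro LIMSEQ_le_const[OF limW]) auto
  moreover have "(LINT \<omega>|N. S \<omega>) \<ge> 0" using S01 by (intro integral_nonneg_AE AE_I2) auto
  ultimately have "(LINT \<omega>|N. S \<omega>) = 0" by simp
  then have "AE \<omega> in N. S \<omega> = 0" using integral_nonneg_eq_0_iff_AE[OF intS] S01 by auto
  then show ?thesis using AE_space
  proof (eventually_elim, intro allI impI)
    fix \<omega> and e :: real assume S0: "S \<omega> = 0" and \<omega>: "\<omega> \<in> space N" and e: "e > 0"
    \<comment> \<open>Below 1 the truncation is inactive, so smallness of \<open>SB\<close> bounds
      every \<open>tailB\<close> itself.\<close>
    define e' where "e' = min e (1 / 2)"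
    have e': "e' > 0" "e' \<le> e" "e' < 1" using e by (auto simp: e'_def)
    obtain P where P: "SB P \<omega> < e'"
      using order_tendstoD(2)[OF S[of \<omega>], of e'] S0 e' by (auto simp: eventually_sequentially)
    have tB: "tailB P m \<omega> \<le> e'" for m using SB_ge[of P m \<omega>] P e' by (auto simp: min_def split: if_splits)
    have "(\<Sum>p\<in>{P..<Q}. lam p * (B p \<omega> s)\<^sup>2) \<le> e" if s: "s \<in> {0..1}" for Q s
    proof -
      define t where "t = 1 - s"
      \<comment> \<open>\<open>1 - s\<close> is rounded down to the dyadic grid; continuity of each
        bridge carries the bound on finite tails from the grid to \<open>s\<close>.\<close>
      define i where "i m = nat \<lfloor>t * 2 ^ m\<rfloor>" for m :: nat
      have t: "t \<in> {0..1}" using s by (auto simp: t_def)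
      have im: "real (i m) \<le> t * 2 ^ m" "t * 2 ^ m < real (i m) + 1" for m using t by (auto simp: i_def)
      have i2: "i m \<le> 2 ^ m" for m
      proof -
        have "t * 2 ^ m \<le> 1 * 2 ^ m" using t by (intro mult_right_mono) auto
        moreover have "real (2 ^ m) = (2::real) ^ m" by simp
        ultimately have "real (i m) \<le> real (2 ^ m)" using im(1)[of m] by linarith
        then show ?thesis by (rule of_nat_le_iff[where 'a = real, THEN iffD1])
      qed
      have lo: "t - (1 / 2) ^ m \<le> dyadic m (i m)" and up: "dyadic m (i m) \<le> t" for m
      proof -
        have "t - (1 / 2) ^ m = (t * 2 ^ m - 1) / 2 ^ m" by (simp add: diff_divide_distrib power_one_over)
        also have "\<dots> \<le> real (i m) / 2 ^ m" using im(2)[of m] by (intro divide_right_mono) auto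
        finally show "t - (1 / 2) ^ m \<le> dyadic m (i m)" by (simp only: dyadic_def)
        show "dyadic m (i m) \<le> t" using im(1)[of m] by (simp add: dyadic_def divide_le_eq)
      qed
      have "(\<lambda>m. t - (1 / 2) ^ m) \<longlonglongrightarrow> t - 0" by (intro tendsto_intros LIMSEQ_power_zero) simp
      then have lo': "(\<lambda>m. t - (1 / 2) ^ m) \<longlonglongrightarrow> t" by simp
      have "(\<lambda>m. dyadic m (i m)) \<longlonglongrightarrow> t"
        by (rule real_tendsto_sandwich[OF _ _ lo' tendsto_const]) (intro always_eventually allI lo up)+
      then have "(\<lambda>m. 1 - dyadic m (i m)) \<longlonglongrightarrow> s" unfolding t_def by (auto intro: tendsto_eq_intros)
      then have Bl: "(\<lambda>m. B p \<omega> (1 - dyadic m (i m))) \<longlonglongrightarrow> B p \<omega> s" for p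
        using dyadic_range[OF i2] s by (intro continuous_on_tendsto_compose[OF B_continuous[OF \<omega>]]) auto
      have "(\<lambda>m. \<Sum>p\<in>{P..<Q}. lam p * (B p \<omega> (1 - dyadic m (i m)))\<^sup>2) \<longlonglongrightarrow> (\<Sum>p\<in>{P..<Q}. lam p * (B p \<omega> s)\<^sup>2)"
        by (intro tendsto_intros Bl)
      moreover have "(\<Sum>p\<in>{P..<Q}. lam p * (B p \<omega> (1 - dyadic m (i m)))\<^sup>2) \<le> e'" if "m \<ge> Q" for m
      proof -
        have "(\<Sum>p\<in>{P..<Q}. lam p * (B p \<omega> (1 - dyadic m (i m)))\<^sup>2) \<le> (\<Sum>p\<in>{P..<m}. lam p * (B p \<omega> (1 - dyadic m (i m)))\<^sup>2)"
          using that by (intro sum_mono2) (auto simp: lam_nonneg)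
        also have "\<dots> \<le> tailB P m \<omega>" by (rule tailB_upper[OF i2])
        finally show ?thesis using tB[of m] by linarith
      qed
      ultimately have "(\<Sum>p\<in>{P..<Q}. lam p * (B p \<omega> s)\<^sup>2) \<le> e'" by (intro LIMSEQ_le_const2) auto
      with e'(2) show ?thesis by linarith
    qed
    then show "\<exists>P. \<forall>Q. \<forall>s\<in>{0..1}. (\<Sum>p\<in>{P..<Q}. lam p * (B p \<omega> s)\<^sup>2) \<le> e" by blast
  qed
qed

end

text \<open>\<open>R\<close> is diagonal in the basis of \<open>C\<close>, with entries
  \<open>r\<close>: all equal to 1 in the unweighted case, and
  \<open>1 / sqrt (lam 0 + lam p)\<close> in the weighted one.\<close>

locale limit_setup = gaussian_setup v C lam N' W N B + kernel h \<alpha> \<beta> V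
  for v :: "nat \<Rightarrow> 'h::{real_inner,banach,second_countable_topology}" and C lam
    and N' :: "'c measure" and W and N :: "'b measure" and B and h \<alpha> \<beta> V +
  fixes R :: "'h \<Rightarrow>\<^sub>L 'h" and r :: "nat \<Rightarrow> real"
  assumes R: "\<And>p y. inner (v p) (R y) = r p * inner (v p) y"
begin

definition \<rho> :: "nat \<Rightarrow> real" where "\<rho> p = lam p * (r p)\<^sup>2"

lemma \<rho>_nonneg: "\<rho> p \<ge> 0"
  by (simp add: \<rho>_def lam_nonneg)

lemma r_le: "\<bar>r p\<bar> \<le> norm R"
proof -
  have "r p = inner (v p) (R (v p))" by (simp add: R orthonormal)
  also have "\<bar>\<dots>\<bar> \<le> norm (v p) * norm (R (v p))" by (rule Cauchy_Schwarz_ineq2)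
  also have "\<dots> \<le> norm R" using norm_blinfun[of R "v p"] by simp
  finally show ?thesis .
qed

definition Psi :: "nat \<Rightarrow> 'b \<Rightarrow> real" where
  "Psi n \<omega> = Max ((\<lambda>k. sqrt (\<Sum>p. \<rho> p * (grid_sum n k (B p \<omega>))\<^sup>2)) ` {1..<n})"

definition limit :: "'b \<Rightarrow> real" where
  "limit \<omega> = (SUP t\<in>{0<..<1}. sqrt (\<Sum>p. \<rho> p * (convolution (B p \<omega>) (1 - t))\<^sup>2))"

lemma AE_rho_tails:
  "AE \<omega> in N. \<forall>e>0. \<exists>P. \<forall>Q. \<forall>s\<in>{0..1}. (\<Sum>p\<in>{P..<Q}. \<rho> p * (B p \<omega> s)\<^sup>2) \<le> e"
  using AE_tails
proof (eventually_elim, intro allI impI)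
  fix \<omega> and e :: real
  assume T: "\<forall>e>0. \<exists>P. \<forall>Q. \<forall>s\<in>{0..1}. (\<Sum>p\<in>{P..<Q}. lam p * (B p \<omega> s)\<^sup>2) \<le> e" and e: "e > 0"
  define K where "K = (norm R)\<^sup>2 + 1"
  have K: "K > 0" by (simp add: K_def add_nonneg_pos)
  with e have "e / K > 0" by simp
  with T obtain P where P: "\<And>Q s. s \<in> {0..1} \<Longrightarrow> (\<Sum>p\<in>{P..<Q}. lam p * (B p \<omega> s)\<^sup>2) \<le> e / K" by blast
  have rK: "(r p)\<^sup>2 \<le> K" for p
  proof -
    have "(r p)\<^sup>2 \<le> (norm R)\<^sup>2" using r_le[of p] by (metis abs_ge_zero power2_abs power_mono)
    then show ?thesis by (simp add: K_def)
  qed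
  have "(\<Sum>p\<in>{P..<Q}. \<rho> p * (B p \<omega> s)\<^sup>2) \<le> e" if s: "s \<in> {0..1}" for Q s
  proof -
    have "(\<Sum>p\<in>{P..<Q}. \<rho> p * (B p \<omega> s)\<^sup>2) \<le> (\<Sum>p\<in>{P..<Q}. K * (lam p * (B p \<omega> s)\<^sup>2))"
    proof (rule sum_mono)
      fix p
      have "\<rho> p * (B p \<omega> s)\<^sup>2 = (r p)\<^sup>2 * (lam p * (B p \<omega> s)\<^sup>2)" by (simp add: \<rho>_def)
      also have "\<dots> \<le> K * (lam p * (B p \<omega> s)\<^sup>2)" using rK lam_nonneg by (intro mult_right_mono) auto
      finally show "\<rho> p * (B p \<omega> s)\<^sup>2 \<le> K * (lam p * (B p \<omega> s)\<^sup>2)" .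
    qed
    also have "\<dots> = K * (\<Sum>p\<in>{P..<Q}. lam p * (B p \<omega> s)\<^sup>2)" by (simp add: sum_distrib_left)
    also have "\<dots> \<le> K * (e / K)" using K by (intro mult_left_mono P s) auto
    finally show ?thesis using K by simp
  qed
  then show "\<exists>P. \<forall>Q. \<forall>s\<in>{0..1}. (\<Sum>p\<in>{P..<Q}. \<rho> p * (B p \<omega> s)\<^sup>2) \<le> e" by blast
qed

lemma grid_sum_measurable: "(\<lambda>\<omega>. grid_sum n k (B p \<omega>)) \<in> borel_measurable N"
  unfolding grid_sum_def using B_measurable by measurable

lemma Psi_measurable: "Psi n \<in> borel_measurable N"
  unfolding Psi_def[abs_def]
proof (rule borel_measurable_Max)
  fix k
  note [measurable] = grid_sum_measurable
  show "(\<lambda>\<omega>. sqrt (\<Sum>p. \<rho> p * (grid_sum n k (B p \<omega>))\<^sup>2)) \<in> borel_measurable N" by measurable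
qed simp

lemma limit_measurable: "limit \<in> borel_measurable N"
  unfolding limit_def[abs_def]
proof (rule borel_measurable_SUP_sqrt_suminf)
  fix p t assume t: "t \<in> {0<..<1::real}"
  have "(\<lambda>\<omega>. convolution (B p \<omega>) (1 - t)) \<in> borel_measurable N"
  proof (rule borel_measurable_LIMSEQ_real)
    fix \<omega> assume "\<omega> \<in> space N"
    then show "(\<lambda>m. Rsum m (B p \<omega>) (1 - t)) \<longlonglongrightarrow> convolution (B p \<omega>) (1 - t)"
      using t by (intro Rsum_LIMSEQ B_continuous) auto
  next
    fix m
    show "(\<lambda>\<omega>. Rsum m (B p \<omega>) (1 - t)) \<in> borel_measurable N"
      unfolding Rsum_def using B_measurable by measurable
  qed
  then show "(\<lambda>\<omega>. \<rho> p * (convolution (B p \<omega>) (1 - t))\<^sup>2) \<in> borel_measurable N" by measurable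
next
  fix p \<omega> assume \<omega>: "\<omega> \<in> space N"
  show "continuous_on {0<..<1} (\<lambda>t. \<rho> p * (convolution (B p \<omega>) (1 - t))\<^sup>2)"
    by (intro continuous_intros continuous_on_compose2[OF continuous_convolution[OF B_continuous[OF \<omega>]]]) auto
next
  show "0 \<le> \<rho> p * (convolution (B p \<omega>) (1 - t))\<^sup>2" for p \<omega> t using \<rho>_nonneg by simp
qed

lemma AE_Psi_tendsto: "AE \<omega> in N. (\<lambda>n. Psi n \<omega>) \<longlonglongrightarrow> limit \<omega>"
  using AE_rho_tails AE_space
proof eventually_elim
  case (elim \<omega>)
  have "\<And>e. e > 0 \<Longrightarrow> \<exists>P. \<forall>Q. \<forall>s\<in>{0..1}. (\<Sum>p\<in>{P..<Q}. \<rho> p * (B p \<omega> s)\<^sup>2) \<le> e" using elim(1) by blast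
  from Max_grid_sum_tendsto[OF \<rho>_nonneg B_continuous[OF elim(2)] this]
  show ?case by (simp add: Psi_def limit_def)
qed

lemma norm_R_disc_sums:
  "(\<lambda>p. (r p)\<^sup>2 * (disc n k (\<lambda>u. inner (bridge w u) (v p)))\<^sup>2) sums (norm (R (disc n k (bridge w))))\<^sup>2"
proof -
  have "inner (v p) (R (disc n k (bridge w))) = r p * disc n k (\<lambda>u. inner (bridge w u) (v p))" for p
    by (simp add: R disc_def inner_sum_right inner_commute)
  then show ?thesis using norm_sq_sums[of "R (disc n k (bridge w))"] by (simp add: power_mult_distrib)
qed

lemma disc_B: "k \<in> {1..<n} \<Longrightarrow> disc n k (\<lambda>u. sqrt (lam p) * B p \<omega> (1 - u)) = sqrt (lam p) * grid_sum n k (B p \<omega>)"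
proof -
  assume "k \<in> {1..<n}"
  then have "disc n k (\<lambda>u. B p \<omega> (1 - u)) = grid_sum n k (B p \<omega>)" by (intro disc_eq_grid_sum) auto
  moreover have "disc n k (\<lambda>u. sqrt (lam p) * B p \<omega> (1 - u)) = sqrt (lam p) * disc n k (\<lambda>u. B p \<omega> (1 - u))"
    by (simp add: disc_def sum_distrib_left mult_ac)
  ultimately show ?thesis by simp
qed

text \<open>\<open>law_eq\<close> covers the coordinates below \<open>P\<close>, and both sides
  converge as \<open>P\<close> grows: for \<open>W\<close> by the norm expansion of a fixed vector,
  for the bridges by almost sure summability.\<close>

lemma Phi_Psi_law:
  assumes n: "n \<ge> 2" and g: "continuous_on UNIV g" "\<And>x. 0 \<le> g x" "\<And>x. g x \<le> (1::real)"
  shows "(LINT \<omega>|N'. g (Phi R n (W \<omega>))) = (LINT \<omega>|N. g (Psi n \<omega>))"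
proof -
  interpret N: prob_space N by (rule prob_N)
  interpret N': prob_space N' by (rule prob_N')
  have gm[measurable]: "g \<in> borel_measurable borel" by (rule borel_measurable_continuous_onI[OF g(1)])
  have gl: "(\<lambda>P. g (x P)) \<longlonglongrightarrow> g y" if "x \<longlonglongrightarrow> y" for x y
    by (rule continuous_on_tendsto_compose[OF g(1) that]) auto
  define s where "s i = real i / real n" for i
  have s: "s i \<in> {0..1}" if "i \<in> {..n}" for i using that n by (auto simp: s_def divide_le_eq)
  define a where "a k j = h ((real (Suc j) - real k) / real n) - h ((real j - real k) / real n)" for k j
  have disc_a: "disc n k w = (\<Sum>j\<in>{k..<n}. a k j * w (s j))" for k and w :: "real \<Rightarrow> real"
    by (simp add: disc_def a_def s_def)
  define F where "F P x = g (Max ((\<lambda>k. sqrt (\<Sum>p<P. (r p)\<^sup>2 * (\<Sum>j\<in>{k..<n}. a k j * x (p, j))\<^sup>2)) ` {1..<n}))"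
    for P and x :: "nat \<times> nat \<Rightarrow> real"
  have Fm: "F P \<in> borel_measurable (PiM ({..<P} \<times> {..n}) (\<lambda>_. borel))" for P
    unfolding F_def[abs_def]
    by (intro measurable_compose[OF _ gm] borel_measurable_Max borel_measurable_sqrt borel_measurable_sum borel_measurable_times
      borel_measurable_const borel_measurable_power measurable_component_singleton) auto
  define FW where "FW P \<omega> = g (Max ((\<lambda>k. sqrt (\<Sum>p<P. (r p)\<^sup>2 * (disc n k (\<lambda>u. inner (bridge (W \<omega>) u) (v p)))\<^sup>2)) ` {1..<n}))" for P \<omega>
  define FB where "FB P \<omega> = g (Max ((\<lambda>k. sqrt (\<Sum>p<P. \<rho> p * (grid_sum n k (B p \<omega>))\<^sup>2)) ` {1..<n}))" for P \<omega>
  have W_eq: "F P (\<lambda>x\<in>{..<P} \<times> {..n}. inner (bridge (W \<omega>) (s (snd x))) (v (fst x))) = FW P \<omega>" for P \<omega>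
    unfolding F_def FW_def disc_a
    by (intro arg_cong[of _ _ g] arg_cong[of _ _ Max] image_cong refl arg_cong[of _ _ sqrt] sum.cong
        arg_cong2[of _ _ _ _ "(*)"] arg_cong[of _ _ "\<lambda>x. x\<^sup>2"]) auto
  have B_eq: "F P (\<lambda>x\<in>{..<P} \<times> {..n}. sqrt (lam (fst x)) * B (fst x) \<omega> (1 - s (snd x))) = FB P \<omega>" for P \<omega>
  proof -
    have "(\<Sum>p<P. (r p)\<^sup>2 * (\<Sum>j\<in>{k..<n}. a k j * (\<lambda>x\<in>{..<P} \<times> {..n}. sqrt (lam (fst x)) * B (fst x) \<omega> (1 - s (snd x))) (p, j))\<^sup>2)
      = (\<Sum>p<P. \<rho> p * (grid_sum n k (B p \<omega>))\<^sup>2)" if k: "k \<in> {1..<n}" for k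
    proof (rule sum.cong[OF refl])
      fix p assume p: "p \<in> {..<P}"
      have "(\<Sum>j\<in>{k..<n}. a k j * (\<lambda>x\<in>{..<P} \<times> {..n}. sqrt (lam (fst x)) * B (fst x) \<omega> (1 - s (snd x))) (p, j)) =
        (\<Sum>j\<in>{k..<n}. a k j * (sqrt (lam p) * B p \<omega> (1 - s j)))"
        using p by (intro sum.cong) auto
      also have "\<dots> = disc n k (\<lambda>u. sqrt (lam p) * B p \<omega> (1 - u))" by (simp only: disc_a)
      also have "\<dots> = sqrt (lam p) * grid_sum n k (B p \<omega>)" by (rule disc_B[OF k])
      finally show "(r p)\<^sup>2 * (\<Sum>j\<in>{k..<n}. a k j * (\<lambda>x\<in>{..<P} \<times> {..n}. sqrt (lam (fst x)) * B (fst x) \<omega> (1 - s (snd x))) (p, j))\<^sup>2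
        = \<rho> p * (grid_sum n k (B p \<omega>))\<^sup>2"
        by (simp add: \<rho>_def power_mult_distrib lam_nonneg mult_ac)
    qed
    then show ?thesis unfolding F_def FB_def
      by (intro arg_cong[of _ _ g] arg_cong[of _ _ Max] image_cong refl arg_cong[of _ _ sqrt])
  qed
  have law: "(LINT \<omega>|N'. FW P \<omega>) = (LINT \<omega>|N. FB P \<omega>)" for P
    using law_eq[of "{..n}" s "F P" P] s Fm by (simp add: W_eq B_eq)
  have ne: "{1..<n} \<noteq> {}" using n by auto
  have mW: "FW P \<in> borel_measurable N'" for P
    unfolding FW_def[abs_def] disc_a bridge_def
  proof (intro measurable_compose[OF _ gm] borel_measurable_Max)
    note [measurable] = W_measurable
    show "(\<lambda>\<omega>. sqrt (\<Sum>p<P. (r p)\<^sup>2 * (\<Sum>j\<in>{k..<n}. a k j * inner (W \<omega> (s j) - s j *\<^sub>R W \<omega> 1) (v p))\<^sup>2)) \<in> borel_measurable N'" for k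
      by measurable
  qed simp
  have mB: "FB P \<in> borel_measurable N" for P
    unfolding FB_def[abs_def]
  proof (intro measurable_compose[OF _ gm] borel_measurable_Max)
    note [measurable] = grid_sum_measurable
    show "(\<lambda>\<omega>. sqrt (\<Sum>p<P. \<rho> p * (grid_sum n k (B p \<omega>))\<^sup>2)) \<in> borel_measurable N" for k by measurable
  qed simp
  have bW: "norm (FW P \<omega>) \<le> 1" for P \<omega> using g(2,3) by (simp add: FW_def)
  have bB: "norm (FB P \<omega>) \<le> 1" for P \<omega> using g(2,3) by (simp add: FB_def)
  have "(\<lambda>P. LINT \<omega>|N'. FW P \<omega>) \<longlonglongrightarrow> (LINT \<omega>|N'. g (Phi R n (W \<omega>)))"
  proof (rule integral_dominated_convergence[where w = "\<lambda>_. 1"])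
    show "(\<lambda>\<omega>. g (Phi R n (W \<omega>))) \<in> borel_measurable N'"
      by (intro measurable_compose[OF _ gm] Phi_measurable W_measurable)
    show "AE \<omega> in N'. (\<lambda>P. FW P \<omega>) \<longlonglongrightarrow> g (Phi R n (W \<omega>))"
    proof (rule AE_I2)
      fix \<omega>
      have "(\<lambda>P. sqrt (\<Sum>p<P. (r p)\<^sup>2 * (disc n k (\<lambda>u. inner (bridge (W \<omega>) u) (v p)))\<^sup>2)) \<longlonglongrightarrow> norm (R (disc n k (bridge (W \<omega>))))" for k
        using tendsto_real_sqrt[OF norm_R_disc_sums[unfolded sums_def]] by simp
      then show "(\<lambda>P. FW P \<omega>) \<longlonglongrightarrow> g (Phi R n (W \<omega>))"
        unfolding FW_def Phi_def by (intro gl tendsto_Max_image ne) auto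
    qed
  qed (use mW bW in auto)
  moreover have "(\<lambda>P. LINT \<omega>|N. FB P \<omega>) \<longlonglongrightarrow> (LINT \<omega>|N. g (Psi n \<omega>))"
  proof (rule integral_dominated_convergence[where w = "\<lambda>_. 1"])
    show "(\<lambda>\<omega>. g (Psi n \<omega>)) \<in> borel_measurable N" by (intro measurable_compose[OF _ gm] Psi_measurable)
    show "AE \<omega> in N. (\<lambda>P. FB P \<omega>) \<longlonglongrightarrow> g (Psi n \<omega>)"
      using AE_rho_tails
    proof eventually_elim
      case (elim \<omega>)
      then obtain P where P: "\<And>Q s. s \<in> {0..1} \<Longrightarrow> (\<Sum>p\<in>{P..<Q}. \<rho> p * (B p \<omega> s)\<^sup>2) \<le> 1" using zero_less_one by blast
      have "(\<lambda>P. sqrt (\<Sum>p<P. \<rho> p * (grid_sum n k (B p \<omega>))\<^sup>2)) \<longlonglongrightarrow> sqrt (\<Sum>p. \<rho> p * (grid_sum n k (B p \<omega>))\<^sup>2)" if k: "k \<in> {1..<n}" for k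
      proof (intro tendsto_real_sqrt summable_LIMSEQ sqrt_suminf_tail(1))
        show "0 \<le> \<rho> p * (grid_sum n k (B p \<omega>))\<^sup>2" for p using \<rho>_nonneg by simp
        show "(\<Sum>p\<in>{P..<Q}. \<rho> p * (grid_sum n k (B p \<omega>))\<^sup>2) \<le> V\<^sup>2 * 1" for Q
          using k by (intro grid_sum_tail_le \<rho>_nonneg P) auto
      qed
      then show ?case unfolding FB_def Psi_def by (intro gl tendsto_Max_image ne) auto
    qed
  qed (use mB bB in auto)
  ultimately show ?thesis unfolding law by (rule LIMSEQ_unique)
qed

theorem Phi_limit:
  fixes Z :: "nat \<Rightarrow> 'a \<Rightarrow> real \<Rightarrow> 'h"
  assumes M: "prob_space M" and Z: "\<And>n. cadlag_process M (Z n)" and conv: "weak_conv_D M Z N' W"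
    and g: "\<And>x. 0 \<le> g x" "\<And>x. g x \<le> 1" "\<And>x y. \<bar>g x - g y\<bar> \<le> Lg * \<bar>x - y\<bar>" "Lg \<ge> (0::real)"
  shows "(\<lambda>n. LINT \<omega>|M. g (Phi R n (Z n \<omega>))) \<longlonglongrightarrow> (LINT \<omega>|N. g (limit \<omega>))"
proof -
  have "(Lg)-lipschitz_on UNIV g" using g(3,4) by (intro lipschitz_onI) (auto simp: dist_real_def)
  then have gc: "continuous_on UNIV g" by (rule lipschitz_on_continuous_on)
  then have gm: "g \<in> borel_measurable borel" by (rule borel_measurable_continuous_onI)
  interpret N: prob_space N by (rule prob_N)
  have "(\<lambda>n. LINT \<omega>|N. g (Psi n \<omega>)) \<longlonglongrightarrow> (LINT \<omega>|N. g (limit \<omega>))"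
  proof (rule integral_dominated_convergence[where w = "\<lambda>_. 1"])
    show "(\<lambda>\<omega>. g (limit \<omega>)) \<in> borel_measurable N" "(\<lambda>\<omega>. g (Psi n \<omega>)) \<in> borel_measurable N" for n
      by (intro measurable_compose[OF _ gm] Psi_measurable limit_measurable)+
    show "AE \<omega> in N. (\<lambda>n. g (Psi n \<omega>)) \<longlonglongrightarrow> g (limit \<omega>)"
      using AE_Psi_tendsto
    proof eventually_elim
      case (elim \<omega>)
      show ?case by (rule continuous_on_tendsto_compose[OF gc elim]) auto
    qed
  qed (use g in auto)
  moreover have "\<forall>\<^sub>F n in sequentially. (LINT \<omega>|N. g (Psi n \<omega>)) = (LINT \<omega>|N'. g (Phi R n (W \<omega>)))"
    using eventually_ge_at_top[of 2] by eventually_elim (rule Phi_Psi_law[OF _ gc g(1,2), symmetric])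
  ultimately have "(\<lambda>n. LINT \<omega>|N'. g (Phi R n (W \<omega>))) \<longlonglongrightarrow> (LINT \<omega>|N. g (limit \<omega>))"
    by (rule Lim_transform_eventually)
  from tendsto_add[OF Phi_weak_limit[OF M prob_N' Z W_measurable W_continuous conv g] this, of R]
  show ?thesis by simp
qed

end

section \<open>The limit theorem\<close>

text \<open>Weak convergence on the line is tested by the functions \<open>cts_step\<close>, which
  take values in the unit interval and have Lipschitz constant \<open>1 / (y - x)\<close>. This
  fixes the class of test functions \<open>g\<close>.\<close>

lemma weak_conv_m_distrI:
  assumes M: "prob_space M" and N: "prob_space N"
    and T: "\<And>n. T n \<in> borel_measurable M" and Y: "Y \<in> borel_measurable N"
    and conv: "\<And>g L. (\<And>x. 0 \<le> g x) \<Longrightarrow> (\<And>x. g x \<le> 1) \<Longrightarrow> (\<And>x y. \<bar>g x - g y\<bar> \<le> L * \<bar>x - y\<bar>) \<Longrightarrow> L \<ge> 0 \<Longrightarrow>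
      (\<lambda>n. LINT \<omega>|M. g (T n \<omega>)) \<longlonglongrightarrow> (LINT \<omega>|N. g (Y \<omega>) :: real)"
  shows "weak_conv_m (\<lambda>n. distr M borel (T n)) (distr N borel Y)"
proof (rule integral_cts_step_conv_imp_weak_conv)
  show "real_distribution (distr M borel (T n))" for n
    by (rule prob_space.real_distribution_distr[OF M T])
  show "real_distribution (distr N borel Y)"
    by (rule prob_space.real_distribution_distr[OF N Y])
next
  fix x y :: real assume xy: "x < y"
  have m: "cts_step x y \<in> borel_measurable borel"
    by (intro borel_measurable_continuous_onI uniformly_continuous_imp_continuous cts_step_uniformly_continuous xy)
  have clamp: "cts_step x y u = max 0 (min 1 ((y - u) / (y - x)))" for u
    using xy by (auto simp: cts_step_def max_def min_def field_simps)
  have "(\<lambda>n. LINT \<omega>|M. cts_step x y (T n \<omega>)) \<longlonglongrightarrow> (LINT \<omega>|N. cts_step x y (Y \<omega>))"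
  proof (rule conv)
    show "0 \<le> cts_step x y u" "cts_step x y u \<le> 1" for u unfolding clamp by auto
    show "1 / (y - x) \<ge> 0" using xy by simp
    show "\<bar>cts_step x y u - cts_step x y w\<bar> \<le> 1 / (y - x) * \<bar>u - w\<bar>" for u w
    proof -
      have "\<bar>cts_step x y u - cts_step x y w\<bar> \<le> \<bar>(y - u) / (y - x) - (y - w) / (y - x)\<bar>"
        unfolding clamp max_def min_def abs_if by auto
      also have "\<dots> = \<bar>(w - u) / (y - x)\<bar>" by (simp add: diff_divide_distrib[symmetric])
      also have "\<dots> = 1 / (y - x) * \<bar>u - w\<bar>" using xy by (simp add: abs_minus_commute)
      finally show ?thesis .
    qed
  qed
  then show "(\<lambda>n. integral\<^sup>L (distr M borel (T n)) (cts_step x y)) \<longlonglongrightarrow> integral\<^sup>L (distr N borel Y) (cts_step x y)"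
    by (simp add: integral_distr T Y m)
qed

lemma integral_min_1_small:
  assumes N: "prob_space N" and Y: "Y \<in> borel_measurable N" and e: "e > (0::real)"
  shows "\<exists>a>0. (LINT \<omega>|N. min 1 (a * \<bar>Y \<omega>\<bar>)) < e"
proof -
  interpret prob_space N by (rule N)
  have "(\<lambda>m. LINT \<omega>|N. min 1 (1 / real (Suc m) * \<bar>Y \<omega>\<bar>)) \<longlonglongrightarrow> (LINT \<omega>|N. 0)"
  proof (rule integral_dominated_convergence[where w = "\<lambda>_. 1"])
    show "(\<lambda>\<omega>. min 1 (1 / real (Suc m) * \<bar>Y \<omega>\<bar>)) \<in> borel_measurable N" for m using Y by measurable
    show "AE \<omega> in N. (\<lambda>m. min 1 (1 / real (Suc m) * \<bar>Y \<omega>\<bar>)) \<longlonglongrightarrow> 0"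
    proof (rule AE_I2)
      fix \<omega>
      have "(\<lambda>m. min 1 (1 / real (Suc m) * \<bar>Y \<omega>\<bar>)) \<longlonglongrightarrow> min 1 (0 * \<bar>Y \<omega>\<bar>)"
        by (intro tendsto_min tendsto_const tendsto_mult LIMSEQ_inverse_real_of_nat[unfolded inverse_eq_divide])
      then show "(\<lambda>m. min 1 (1 / real (Suc m) * \<bar>Y \<omega>\<bar>)) \<longlonglongrightarrow> 0" by simp
    qed
  qed auto
  then have "\<forall>\<^sub>F m in sequentially. (LINT \<omega>|N. min 1 (1 / real (Suc m) * \<bar>Y \<omega>\<bar>)) < e"
    using e by (intro order_tendstoD) simp_all
  then obtain m where "(LINT \<omega>|N. min 1 (1 / real (Suc m) * \<bar>Y \<omega>\<bar>)) < e"
    by (auto dest: eventually_happens)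
  then show ?thesis by (intro exI[of _ "1 / real (Suc m)"]) simp
qed

text \<open>A Slutsky argument in which the error is relative: off an event of vanishing probability
  it is a small multiple of \<open>F\<close>, and convergence of the truncated expectations of
  \<open>F\<close> to those of the single variable \<open>Y\<close> makes this multiple negligible.
  The bound starts at \<open>n = 2\<close> because the maxima range over
  \<open>{1..<n}\<close>.\<close>

lemma integral_diff_tendsto_0:
  fixes T U F D :: "nat \<Rightarrow> 'a \<Rightarrow> real" and g :: "real \<Rightarrow> real"
  assumes M: "prob_space M" and N: "prob_space N"
    and T: "\<And>n. T n \<in> borel_measurable M" and U: "\<And>n. U n \<in> borel_measurable M"
    and F: "\<And>n. F n \<in> borel_measurable M" and D: "\<And>n. D n \<in> borel_measurable M" and Y: "Y \<in> borel_measurable N"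
    and g: "\<And>x. 0 \<le> g x" "\<And>x. g x \<le> 1" "\<And>x y. \<bar>g x - g y\<bar> \<le> L * \<bar>x - y\<bar>" "L \<ge> 0"
    and tight: "\<And>a. a > 0 \<Longrightarrow> (\<lambda>n. LINT \<omega>|M. min 1 (a * \<bar>F n \<omega>\<bar>)) \<longlonglongrightarrow> (LINT \<omega>|N. min 1 (a * \<bar>Y \<omega>\<bar>))"
    and D0: "\<And>e. e > 0 \<Longrightarrow> (\<lambda>n. measure M {\<omega>\<in>space M. D n \<omega> > e}) \<longlonglongrightarrow> 0"
    and close: "\<And>a. a > 0 \<Longrightarrow> \<exists>\<delta>>0. \<forall>n\<ge>2. \<forall>\<omega>\<in>space M. D n \<omega> \<le> \<delta> \<longrightarrow> \<bar>T n \<omega> - U n \<omega>\<bar> \<le> a * \<bar>F n \<omega>\<bar>"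
  shows "(\<lambda>n. (LINT \<omega>|M. g (T n \<omega>)) - (LINT \<omega>|M. g (U n \<omega>))) \<longlonglongrightarrow> 0"
proof (rule LIMSEQ_I)
  fix e :: real assume e: "e > 0"
  interpret prob_space M by (rule M)
  have "L-lipschitz_on UNIV g" using g(3,4) by (intro lipschitz_onI) (auto simp: dist_real_def)
  then have [measurable]: "g \<in> borel_measurable borel"
    by (intro borel_measurable_continuous_onI lipschitz_on_continuous_on)
  note [measurable] = T U F D
  obtain a where a: "a > 0" "(LINT \<omega>|N. min 1 (a * \<bar>Y \<omega>\<bar>)) < e / 2"
    using integral_min_1_small[OF N Y, of "e / 2"] e by auto
  have "a / (L + 1) > 0" using a g(4) by simp
  from close[OF this] obtain \<delta> where \<delta>: "\<delta> > 0"
    "\<And>n \<omega>. n \<ge> 2 \<Longrightarrow> \<omega> \<in> space M \<Longrightarrow> D n \<omega> \<le> \<delta> \<Longrightarrow> \<bar>T n \<omega> - U n \<omega>\<bar> \<le> a / (L + 1) * \<bar>F n \<omega>\<bar>" by blast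
  have "\<forall>\<^sub>F n in sequentially. (LINT \<omega>|M. min 1 (a * \<bar>F n \<omega>\<bar>)) < e / 2"
    by (rule order_tendstoD(2)[OF tight[OF a(1)] a(2)])
  moreover have "\<forall>\<^sub>F n in sequentially. measure M {\<omega>\<in>space M. D n \<omega> > \<delta>} < e / 2"
    using e by (intro order_tendstoD(2)[OF D0[OF \<delta>(1)]]) simp
  ultimately have "\<forall>\<^sub>F n in sequentially. norm ((LINT \<omega>|M. g (T n \<omega>)) - (LINT \<omega>|M. g (U n \<omega>)) - 0) < e"
    using eventually_ge_at_top[of 2]
  proof eventually_elim
    case (elim n)
    let ?A = "{\<omega>\<in>space M. D n \<omega> > \<delta>}"
    have [measurable]: "?A \<in> sets M" by measurable
    have int: "integrable M (\<lambda>\<omega>. g (T n \<omega>))" "integrable M (\<lambda>\<omega>. g (U n \<omega>))"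
      "integrable M (\<lambda>\<omega>. min 1 (a * \<bar>F n \<omega>\<bar>))" "integrable M (\<lambda>\<omega>. indicator ?A \<omega> :: real)"
      using g(1,2) a(1) by (auto intro!: integrable_const_bound[where B = 1] simp: indicator_def)
    have pt: "\<bar>g (T n \<omega>) - g (U n \<omega>)\<bar> \<le> indicator ?A \<omega> + min 1 (a * \<bar>F n \<omega>\<bar>)" if \<omega>: "\<omega> \<in> space M" for \<omega>
    proof (cases "D n \<omega> > \<delta>")
      case True
      have "0 \<le> min 1 (a * \<bar>F n \<omega>\<bar>)" using a(1) by simp
      moreover have "\<bar>g (T n \<omega>) - g (U n \<omega>)\<bar> \<le> 1"
        using g(1,2)[of "T n \<omega>"] g(1,2)[of "U n \<omega>"] by (simp add: abs_if)
      ultimately show ?thesis using True \<omega> by simp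
    next
      case False
      then have "\<bar>T n \<omega> - U n \<omega>\<bar> \<le> a / (L + 1) * \<bar>F n \<omega>\<bar>" using \<delta>(2)[OF elim(3) \<omega>] by simp
      then have "L * \<bar>T n \<omega> - U n \<omega>\<bar> \<le> L * (a / (L + 1) * \<bar>F n \<omega>\<bar>)" using g(4) by (rule mult_left_mono)
      also have "\<dots> = L / (L + 1) * (a * \<bar>F n \<omega>\<bar>)" by simp
      also have "\<dots> \<le> 1 * (a * \<bar>F n \<omega>\<bar>)" using g(4) a(1) by (intro mult_right_mono) auto
      finally have "\<bar>g (T n \<omega>) - g (U n \<omega>)\<bar> \<le> a * \<bar>F n \<omega>\<bar>" using g(3)[of "T n \<omega>" "U n \<omega>"] by linarith
      moreover have "\<bar>g (T n \<omega>) - g (U n \<omega>)\<bar> \<le> 1"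
        using g(1,2)[of "T n \<omega>"] g(1,2)[of "U n \<omega>"] by (simp add: abs_if)
      ultimately have "\<bar>g (T n \<omega>) - g (U n \<omega>)\<bar> \<le> min 1 (a * \<bar>F n \<omega>\<bar>)" by simp
      moreover have "indicator ?A \<omega> \<ge> (0::real)" by simp
      ultimately show ?thesis by linarith
    qed
    have "\<bar>(LINT \<omega>|M. g (T n \<omega>)) - (LINT \<omega>|M. g (U n \<omega>))\<bar> = \<bar>LINT \<omega>|M. g (T n \<omega>) - g (U n \<omega>)\<bar>"
      using int by simp
    also have "\<dots> \<le> (LINT \<omega>|M. \<bar>g (T n \<omega>) - g (U n \<omega>)\<bar>)" by (rule integral_abs_bound)
    also have "\<dots> \<le> (LINT \<omega>|M. indicator ?A \<omega> + min 1 (a * \<bar>F n \<omega>\<bar>))"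
      using int pt by (intro integral_mono) auto
    also have "\<dots> = measure M ?A + (LINT \<omega>|M. min 1 (a * \<bar>F n \<omega>\<bar>))"
      using int by simp
    also have "\<dots> < e" using elim by linarith
    finally show ?case by simp
  qed
  then show "\<exists>no. \<forall>n\<ge>no. norm ((LINT \<omega>|M. g (T n \<omega>)) - (LINT \<omega>|M. g (U n \<omega>)) - 0) < e"
    unfolding eventually_sequentially .
qed

lemma cadlag01_floor: "cadlag01 (\<lambda>t. f (nat \<lfloor>t * real n\<rfloor>))"
proof (cases "n = 0")
  case True
  then show ?thesis by (auto simp: cadlag01_def)
next
  case False
  then have n: "real n > 0" by simp
  show ?thesis unfolding cadlag01_def
  proof (intro conjI ballI exI)
    fix t :: real
    have "t * real n < of_int (\<lfloor>t * real n\<rfloor> + 1)" by linarith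
    then have "t < of_int (\<lfloor>t * real n\<rfloor> + 1) / real n" using n by (simp add: pos_less_divide_eq)
    then have "\<forall>\<^sub>F s in at_right t. s \<in> {t<..<of_int (\<lfloor>t * real n\<rfloor> + 1) / real n}"
      by (rule eventually_at_right_real)
    then have "\<forall>\<^sub>F s in at_right t. f (nat \<lfloor>s * real n\<rfloor>) = f (nat \<lfloor>t * real n\<rfloor>)"
    proof eventually_elim
      case (elim s)
      then have "t * real n < s * real n" "s * real n < of_int (\<lfloor>t * real n\<rfloor> + 1)"
        using n by (simp_all add: pos_less_divide_eq)
      then have "\<lfloor>s * real n\<rfloor> = \<lfloor>t * real n\<rfloor>" by linarith
      then show ?case by simp
    qed
    then show "((\<lambda>t. f (nat \<lfloor>t * real n\<rfloor>)) \<longlongrightarrow> f (nat \<lfloor>t * real n\<rfloor>)) (at_right t)"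
      by (rule tendsto_eventually)
  next
    fix t :: real
    \<comment> \<open>The value of the floor just left of \<open>t\<close>, also when
      \<open>t * real n\<close> is an integer.\<close>
    let ?m = "\<lceil>t * real n\<rceil> - 1"
    have "of_int ?m < t * real n" by linarith
    then have "of_int ?m / real n < t" using n by (simp add: pos_divide_less_eq)
    then have "\<forall>\<^sub>F s in at_left t. s \<in> {of_int ?m / real n<..<t}" by (rule eventually_at_left_real)
    then have "\<forall>\<^sub>F s in at_left t. f (nat \<lfloor>s * real n\<rfloor>) = f (nat ?m)"
    proof eventually_elim
      case (elim s)
      then have "s * real n < t * real n" "of_int ?m < s * real n"
        using n by (simp_all add: pos_divide_less_eq)
      then have "\<lfloor>s * real n\<rfloor> = ?m" by linarith
      then show ?case by simp
    qed
    then show "((\<lambda>t. f (nat \<lfloor>t * real n\<rfloor>)) \<longlongrightarrow> f (nat ?m)) (at_left t)" by (rule tendsto_eventually)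
  qed
qed

text \<open>The increments of the tied-down partial sum path are the centred observations divided by
  \<open>sqrt n\<close>, so the weighted sum is a \<open>dual_sum\<close> and
  \<open>disc_by_parts\<close> applies. The sign disappears under the norm.\<close>

lemma (in kernel) weighted_sum_eq_disc:
  fixes x :: "nat \<Rightarrow> 'h::real_vector"
  assumes k: "1 \<le> k" "k \<le> n"
  shows "(1 / sqrt (real n)) *\<^sub>R (\<Sum>i=1..n. h ((real i - real k) / real n) *\<^sub>R (x i - (1 / real n) *\<^sub>R (\<Sum>i=1..n. x i))) =
    - disc n k (bridge (\<lambda>t. (1 / sqrt (real n)) *\<^sub>R (\<Sum>i=1..nat \<lfloor>t * real n\<rfloor>. x i)))"
proof -
  define z where "z t = (1 / sqrt (real n)) *\<^sub>R (\<Sum>i=1..nat \<lfloor>t * real n\<rfloor>. x i)" for t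
  have n: "real n > 0" using k by simp
  have zi: "z (real i / real n) = (1 / sqrt (real n)) *\<^sub>R (\<Sum>i=1..i. x i)" for i
    using n by (simp add: z_def)
  have z1: "z 1 = (1 / sqrt (real n)) *\<^sub>R (\<Sum>i=1..n. x i)" by (simp add: z_def)
  have "bridge z (real (Suc i) / real n) - bridge z (real i / real n) =
      (1 / sqrt (real n)) *\<^sub>R (x (Suc i) - (1 / real n) *\<^sub>R (\<Sum>i=1..n. x i))" for i
  proof -
    have "bridge z (real (Suc i) / real n) - bridge z (real i / real n) =
      (z (real (Suc i) / real n) - z (real i / real n)) - (real (Suc i) / real n - real i / real n) *\<^sub>R z 1"
      unfolding bridge_def by (simp only: scaleR_diff_left algebra_simps)
    also have "z (real (Suc i) / real n) - z (real i / real n) = (1 / sqrt (real n)) *\<^sub>R x (Suc i)"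
      unfolding zi by (simp add: scaleR_add_right)
    also have "real (Suc i) / real n - real i / real n = 1 / real n" by (simp add: diff_divide_distrib[symmetric])
    finally show ?thesis unfolding z1 by (simp add: scaleR_diff_right mult.commute)
  qed
  then have "dual_sum n (real k / real n) (bridge z) =
      (\<Sum>i<n. h (real (Suc i) / real n - real k / real n) *\<^sub>R ((1 / sqrt (real n)) *\<^sub>R (x (Suc i) - (1 / real n) *\<^sub>R (\<Sum>i=1..n. x i))))"
    unfolding dual_sum_def by (simp only:)
  also have "\<dots> = (1 / sqrt (real n)) *\<^sub>R (\<Sum>i<n. h ((real (Suc i) - real k) / real n) *\<^sub>R (x (Suc i) - (1 / real n) *\<^sub>R (\<Sum>i=1..n. x i)))"
    unfolding scaleR_sum_right by (intro sum.cong refl) (simp add: diff_divide_distrib mult.commute)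
  also have "\<dots> = (1 / sqrt (real n)) *\<^sub>R (\<Sum>i=1..n. h ((real i - real k) / real n) *\<^sub>R (x i - (1 / real n) *\<^sub>R (\<Sum>i=1..n. x i)))"
    unfolding One_nat_def sum.atLeast1_atMost_eq ..
  finally show ?thesis
    using disc_by_parts[where w = "bridge z", OF bridge_1 k] by (simp add: z_def[abs_def])
qed

lemma kernelI:
  assumes bv: "bounded_variation_on h (-1) 1" and zero: "\<And>x. x \<in> {-1..0} \<Longrightarrow> h x = 0"
    and ab: "\<alpha> > 0" "\<beta> > 0" and hoelder: "\<forall>s\<in>{0..1}. \<forall>t\<in>{0..1}. \<bar>h t - h s\<bar> \<le> \<beta> * \<bar>s - t\<bar> powr \<alpha>"
  shows "kernel h \<alpha> \<beta> (real_of_ereal (total_variation_on h (-1) 1))"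
proof
  let ?V = "total_variation_on h (-1) 1"
  fix p and m :: nat assume p: "p 0 = (-1::real)" "p m = 1" "\<And>j. j < m \<Longrightarrow> p j \<le> p (Suc j)"
  have le: "ereal (\<Sum>j<m. \<bar>h (p (Suc j)) - h (p j)\<bar>) \<le> ?V"
    unfolding total_variation_on_def by (rule SUP_upper2[of "(p, m)"]) (use p in auto)
  moreover have "?V \<noteq> \<infinity>" using bv by (simp add: bounded_variation_on_def)
  moreover have "?V \<noteq> -\<infinity>" using le by auto
  ultimately show "(\<Sum>j<m. \<bar>h (p (Suc j)) - h (p j)\<bar>) \<le> real_of_ereal ?V"
    by (cases ?V) auto
qed (use assms in auto)

lemma self_adjoint_shift:
  assumes A: "psd_op A"
  shows "self_adjoint_op (A + l *\<^sub>R id_blinfun)" "l * (norm x)\<^sup>2 \<le> inner ((A + l *\<^sub>R id_blinfun) x) x"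
proof -
  have Ax: "(A + l *\<^sub>R id_blinfun) y = A y + l *\<^sub>R y" for y by (simp add: blinfun.bilinear_simps)
  show "self_adjoint_op (A + l *\<^sub>R id_blinfun)"
    using A unfolding Ax psd_op_def self_adjoint_op_def by (simp add: inner_add_left inner_add_right)
  show "l * (norm x)\<^sup>2 \<le> inner ((A + l *\<^sub>R id_blinfun) x) x"
    using A unfolding Ax psd_op_def by (simp add: inner_add_left power2_norm_eq_inner)
qed

text \<open>\<open>S\<close> applied twice multiplies \<open>x\<close> by \<open>1 / m\<close>, so
  \<open>S\<close> multiplies \<open>S x - x / sqrt m\<close> by \<open>- 1 / sqrt m\<close>; a
  positive definite operator allows this only for the zero vector.\<close>

lemma is_inv_sqrt_eigenvector:
  assumes S: "is_inv_sqrt A S" and x: "A x = m *\<^sub>R x" and m: "m > 0"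
  shows "S x = (1 / sqrt m) *\<^sub>R x"
proof (rule ccontr)
  let ?s = "1 / sqrt m" and ?y = "S x - (1 / sqrt m) *\<^sub>R x"
  assume "S x \<noteq> (1 / sqrt m) *\<^sub>R x"
  then have y: "?y \<noteq> 0" by simp
  have "S (S (A x)) = x" using S by (simp add: is_inv_sqrt_def)
  then have "m *\<^sub>R S (S x) = x" by (simp add: x blinfun.scaleR_right)
  then have "(1 / m) *\<^sub>R (m *\<^sub>R S (S x)) = (1 / m) *\<^sub>R x" by simp
  then have SS: "S (S x) = (1 / m) *\<^sub>R x" using m by simp
  have ss: "?s * ?s = 1 / m" using m by (simp add: field_simps)
  have "S ?y = S (S x) - ?s *\<^sub>R S x" by (simp add: blinfun.bilinear_simps)
  also have "\<dots> = (- ?s) *\<^sub>R ?y" unfolding SS scaleR_diff_right scaleR_scaleR using ss by simp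
  finally have "inner (S ?y) ?y = - ?s * (norm ?y)\<^sup>2" by (simp add: power2_norm_eq_inner)
  also have "\<dots> < 0" using y m by simp
  finally have "inner (S ?y) ?y < 0" .
  moreover have "inner (S ?y) ?y > 0" using S y unfolding is_inv_sqrt_def pd_op_def by blast
  ultimately show False by simp
qed

text \<open>Near \<open>C\<close> the shift by the largest eigenvalue stays above
  \<open>lam 0 / 2\<close>, so both shifted operators are coercive with one constant and
  \<open>is_inv_sqrt_perturb\<close> applies.\<close>

lemma norm_inv_sqrt_op_perturb:
  fixes v :: "nat \<Rightarrow> 'h::{real_inner,banach}"
  assumes "spectral_op v C lam" and lam: "lam \<longlonglongrightarrow> 0" "lam 0 > 0" and a: "a > 0"
  obtains \<delta> where "\<delta> > 0"
    "\<And>A y. psd_op A \<Longrightarrow> \<exists>l. is_largest_eigenvalue A l \<Longrightarrow> norm (A - C) \<le> \<delta> \<Longrightarrow>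
      \<bar>norm (inv_sqrt_op (A + largest_eigenvalue A *\<^sub>R id_blinfun) y) -
       norm (inv_sqrt_op (C + lam 0 *\<^sub>R id_blinfun) y)\<bar> \<le> a * norm y"
proof -
  interpret spectral_op v C lam by fact
  define c where "c = lam 0 / 2"
  have c: "c > 0" using lam by (simp add: c_def)
  \<comment> \<open>\<open>lam 0 / 4\<close> keeps the estimated shift above \<open>c\<close>. The
    shifted operators differ by at most \<open>2 * \<delta>\<close>, and the second bound makes the
    square root of this at most \<open>a * c\<close>.\<close>
  define \<delta> where "\<delta> = min (lam 0 / 4) ((a * c)\<^sup>2 / 2)"
  have \<delta>: "\<delta> > 0" "2 * \<delta> < lam 0" "\<delta> \<le> c" "2 * \<delta> \<le> (a * c)\<^sup>2"
    using lam c a by (auto simp: \<delta>_def c_def min_def)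
  show ?thesis
  proof (rule that[OF \<delta>(1)])
    fix A y assume A: "psd_op A" "\<exists>l. is_largest_eigenvalue A l" "norm (A - C) \<le> \<delta>"
    let ?l = "largest_eigenvalue A"
    have l: "\<bar>?l - lam 0\<bar> \<le> \<delta>"
      by (rule largest_eigenvalue_perturb[OF complete_UNIV A(1,3) \<delta>(2) lam(1) A(2)])
    then have cl: "c \<le> ?l" "c \<le> lam 0" using \<delta>(3) lam(2) unfolding c_def by linarith+
    have shift: "c * (norm x)\<^sup>2 \<le> inner ((A' + l *\<^sub>R id_blinfun) x) x" if "psd_op A'" "c \<le> l" for A' :: "'h \<Rightarrow>\<^sub>L 'h" and l x
      using self_adjoint_shift(2)[OF that(1), of l x] mult_right_mono[OF that(2), of "(norm x)\<^sup>2"] by simp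
    have inv: "is_inv_sqrt (A' + l *\<^sub>R id_blinfun) (inv_sqrt_op (A' + l *\<^sub>R id_blinfun))" if "psd_op A'" "c \<le> l" for A' :: "'h \<Rightarrow>\<^sub>L 'h" and l
      by (rule is_inv_sqrt_inv_sqrt_op[OF self_adjoint_shift(1)[OF that(1)] c shift[OF that]])
    have "norm ((A + ?l *\<^sub>R id_blinfun) - (C + lam 0 *\<^sub>R id_blinfun)) = norm ((A - C) + (?l - lam 0) *\<^sub>R id_blinfun)"
      by (simp add: algebra_simps)
    also have "\<dots> \<le> norm (A - C) + \<bar>?l - lam 0\<bar> * norm (id_blinfun :: 'h \<Rightarrow>\<^sub>L 'h)"
      by (rule norm_triangle_le) simp
    also have "\<dots> \<le> \<delta> + \<delta> * 1" using A(3) l \<delta>(1) norm_blinfun_id_le by (intro add_mono mult_mono) auto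
    finally have "norm ((A + ?l *\<^sub>R id_blinfun) - (C + lam 0 *\<^sub>R id_blinfun)) \<le> (a * c)\<^sup>2" using \<delta>(4) by simp
    then have "sqrt (norm ((A + ?l *\<^sub>R id_blinfun) - (C + lam 0 *\<^sub>R id_blinfun))) \<le> a * c"
      using a c by (intro real_le_lsqrt) auto
    then have le: "sqrt (norm ((A + ?l *\<^sub>R id_blinfun) - (C + lam 0 *\<^sub>R id_blinfun))) / c \<le> a"
      using c by (simp add: pos_divide_le_eq)
    have "\<bar>norm (inv_sqrt_op (A + ?l *\<^sub>R id_blinfun) y) - norm (inv_sqrt_op (C + lam 0 *\<^sub>R id_blinfun) y)\<bar>
      \<le> sqrt (norm ((A + ?l *\<^sub>R id_blinfun) - (C + lam 0 *\<^sub>R id_blinfun))) / c * norm y"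
      by (rule is_inv_sqrt_perturb[OF inv[OF A(1) cl(1)] inv[OF psd_C cl(2)] self_adjoint_shift(1)[OF psd_C] c
            shift[OF A(1) cl(1)] shift[OF psd_C cl(2)]])
    also have "\<dots> \<le> a * norm y" using le by (rule mult_right_mono) simp
    finally show "\<bar>norm (inv_sqrt_op (A + ?l *\<^sub>R id_blinfun) y) - norm (inv_sqrt_op (C + lam 0 *\<^sub>R id_blinfun) y)\<bar> \<le> a * norm y" .
  qed
qed

theorem theorem3p1:
  fixes M :: "'a measure"
    and eps :: "int \<Rightarrow> 'a \<Rightarrow> 'h::{real_inner, banach, second_countable_topology}"
    and mu :: "nat \<Rightarrow> nat \<Rightarrow> 'h"
    and lam :: "nat \<Rightarrow> real" and v :: "nat \<Rightarrow> 'h"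
    and h :: "real \<Rightarrow> real"
    and Chat :: "nat \<Rightarrow> 'a \<Rightarrow> ('h \<Rightarrow>\<^sub>L 'h)"
    and N :: "'b measure" and B :: "nat \<Rightarrow> 'b \<Rightarrow> real \<Rightarrow> real"
  defines "C \<equiv> (\<Sum>\<^sub>\<infinity>r. autocov_op M eps r)"
  defines "X \<equiv> (\<lambda>n i \<omega>. mu n i + eps (int i) \<omega>)"
  defines "Xbar \<equiv> (\<lambda>n \<omega>. (1 / real n) *\<^sub>R (\<Sum>i=1..n. X n i \<omega>))"
  defines "S \<equiv> (\<lambda>n k \<omega>. (1 / sqrt (real n)) *\<^sub>R
                 (\<Sum>i=1..n. h ((real i - real k) / real n) *\<^sub>R (X n i \<omega> - Xbar n \<omega>)))"
  defines "T_FF \<equiv> (\<lambda>n \<omega>. Max ((\<lambda>k. norm (S n k \<omega>)) ` {1..<n}))"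
  defines "T_WF \<equiv> (\<lambda>n \<omega>. Max ((\<lambda>k. norm (inv_sqrt_op
                 (Chat n \<omega> + largest_eigenvalue (Chat n \<omega>) *\<^sub>R id_blinfun) (S n k \<omega>))) ` {1..<n}))"
  defines "G \<equiv> (\<lambda>p \<omega> t. RS_integral (\<lambda>y. B p \<omega> (1 - t - y)) h 0 (1 - t))"
  assumes M: "prob_space M"
    \<comment> \<open>(A1)\<close>
    and eps_meas: "\<And>i. eps i \<in> borel_measurable M"
    and centered: "\<And>i. integrable M (eps i) \<and> (LINT \<omega>|M. eps i \<omega>) = 0"
    and stationary: "strictly_stationary M eps"
    and moment: "\<exists>k>2. integrable M (\<lambda>\<omega>. norm (eps 1 \<omega>) powr k)"
    and cov_summable: "(\<lambda>r. norm (autocov_op M eps r)) summable_on UNIV"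
    and C_nonzero: "C \<noteq> 0"
    and v_orthonormal: "\<And>p q. inner (v p) (v q) = (if p = q then 1 else 0)"
    and v_complete: "closure (span (range v)) = UNIV"
    and lam_decr: "\<And>p. lam (Suc p) \<le> lam p"
    and C_spectral: "\<And>x. (\<lambda>p. (lam p * inner (v p) x) *\<^sub>R v p) sums (C x)"
    and cov_coord_summable:
      "summable (\<lambda>p. \<Sum>\<^sub>\<infinity>l::int. \<bar>covar M (\<lambda>\<omega>. inner (eps 0 \<omega>) (v p)) (\<lambda>\<omega>. inner (eps l \<omega>) (v p))\<bar>)"
      "\<And>p. (\<lambda>l::int. \<bar>covar M (\<lambda>\<omega>. inner (eps 0 \<omega>) (v p)) (\<lambda>\<omega>. inner (eps l \<omega>) (v p))\<bar>) summable_on UNIV"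
    \<comment> \<open>(A2)\<close>
    and A2: "\<exists>(N' :: (real \<Rightarrow> 'h) measure) W. prob_space N' \<and> hilbert_brownian_motion N' W C \<and>
               weak_conv_D M (\<lambda>n \<omega> t. (1 / sqrt (real n)) *\<^sub>R (\<Sum>i=1..nat \<lfloor>t * real n\<rfloor>. eps (int i) \<omega>)) N' W"
    \<comment> \<open>conditions on h\<close>
    and h_nonconst: "\<exists>s\<in>{-1..1}. \<exists>t\<in>{-1..1}. h s \<noteq> h t"
    and h_zero: "\<And>x. x \<in> {-1..0} \<Longrightarrow> h x = 0"
    and h_bv: "bounded_variation_on h (-1) 1"
    and h_hoelder: "\<exists>\<alpha>>0. \<exists>\<beta>>0. \<forall>s\<in>{0..1}. \<forall>t\<in>{0..1}. \<bar>h t - h s\<bar> \<le> \<beta> * \<bar>s - t\<bar> powr \<alpha>"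
    \<comment> \<open>the estimator Chat: random bounded self-adjoint psd operator with a largest eigenvalue\<close>
    and Chat_meas: "\<And>n x. (\<lambda>\<omega>. blinfun_apply (Chat n \<omega>) x) \<in> borel_measurable M"
    and Chat_psd: "\<And>n \<omega>. \<omega> \<in> space M \<Longrightarrow> psd_op (Chat n \<omega>)"
    and Chat_eig: "\<And>n \<omega>. \<omega> \<in> space M \<Longrightarrow> \<exists>l. is_largest_eigenvalue (Chat n \<omega>) l"
    \<comment> \<open>the limit: i.i.d. standard Brownian bridges\<close>
    and N: "prob_space N"
    and B_bridge: "\<And>p. std_brownian_bridge N (B p)"
    and B_indep: "prob_space.indep_vars N (\<lambda>_. PiM UNIV (\<lambda>_. borel)) B UNIV"
    \<comment> \<open>null hypothesis\<close>
    and H0: "\<And>n i. i \<in> {1..n} \<Longrightarrow> mu n i = mu n 1"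
  shows "weak_conv_m (\<lambda>n. distr M borel (T_FF n))
           (distr N borel (\<lambda>\<omega>. SUP t\<in>{0<..<1}. sqrt (\<Sum>p. lam p * (G p \<omega> t)\<^sup>2))) \<and>
         ((\<forall>e>0. (\<lambda>n. measure M {\<omega>\<in>space M. norm (Chat n \<omega> - C) > e}) \<longlonglongrightarrow> 0) \<longrightarrow>
         weak_conv_m (\<lambda>n. distr M borel (T_WF n))
           (distr N borel (\<lambda>\<omega>. SUP t\<in>{0<..<1}.
               sqrt (\<Sum>p. lam p / (lam 0 + lam p) * (G p \<omega> t)\<^sup>2))))"
proof -
  obtain N' :: "(real \<Rightarrow> 'h) measure" and W where N': "prob_space N'" and W: "hilbert_brownian_motion N' W C"
    and conv: "weak_conv_D M (\<lambda>n \<omega> t. (1 / sqrt (real n)) *\<^sub>R (\<Sum>i=1..nat \<lfloor>t * real n\<rfloor>. eps (int i) \<omega>)) N' W"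
    using A2 by blast
  obtain \<alpha> \<beta> where ab: "\<alpha> > 0" "\<beta> > 0"
    and hoelder: "\<forall>s\<in>{0..1}. \<forall>t\<in>{0..1}. \<bar>h t - h s\<bar> \<le> \<beta> * \<bar>s - t\<bar> powr \<alpha>"
    using h_hoelder by blast
  define V where "V = real_of_ereal (total_variation_on h (-1) 1)"
  interpret kernel h \<alpha> \<beta> V
    unfolding V_def by (rule kernelI[OF h_bv h_zero ab hoelder])
  interpret gaussian_setup v C lam N' W N B
    by (intro gaussian_setup.intro gaussian_setup_axioms.intro spectral_expansion.intro spectral_expansion_axioms.intro
        orthonormal_basis.intro v_orthonormal v_complete C_spectral N' W N B_bridge B_indep)
  \<comment> \<open>Nonnegativity of \<open>lam\<close> has just become available from the Brownian
    motion.\<close>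
  interpret spectral_op v C lam
    using lam_nonneg lam_decr by unfold_locales
  have lam0: "lam 0 > 0" by (rule lam0_pos[OF C_nonzero])
  interpret M: prob_space M by (rule M)
  define Z where "Z n \<omega> t = (1 / sqrt (real n)) *\<^sub>R (\<Sum>i=1..nat \<lfloor>t * real n\<rfloor>. eps (int i) \<omega>)" for n \<omega> t
  have conv: "weak_conv_D M Z N' W" using conv by (simp add: Z_def[abs_def])
  note [measurable] = eps_meas
  have Z_meas [measurable]: "(\<lambda>\<omega>. Z n \<omega> t) \<in> borel_measurable M" for n t unfolding Z_def by measurable
  have Z: "cadlag_process M (Z n)" for n
    unfolding cadlag_process_def
  proof (intro conjI allI ballI)
    show "cadlag01 (Z n \<omega>)" for \<omega>
      using cadlag01_floor[of "\<lambda>m. (1 / sqrt (real n)) *\<^sub>R (\<Sum>i=1..m. eps (int i) \<omega>)" n]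
      by (simp add: Z_def[abs_def])
  qed (rule Z_meas)
  \<comment> \<open>Under the null hypothesis the common mean cancels against the sample mean, and
    only the errors remain.\<close>
  have S_eq: "S n k \<omega> = - disc n k (bridge (Z n \<omega>))" if k: "k \<in> {1..<n}" for n k \<omega>
  proof -
    have n: "real n > 0" using k by auto
    have X_eq: "X n i \<omega> = mu n 1 + eps (int i) \<omega>" if "i \<in> {1..n}" for i
      using H0[OF that] by (simp add: X_def)
    then have "(\<Sum>i=1..n. X n i \<omega>) = (\<Sum>i=1..n. mu n 1 + eps (int i) \<omega>)" by (rule sum.cong[OF refl])
    then have "(\<Sum>i=1..n. X n i \<omega>) = real n *\<^sub>R mu n 1 + (\<Sum>i=1..n. eps (int i) \<omega>)"
      by (simp add: sum.distrib scaleR_conv_of_real sum_constant_scaleR)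
    then have "Xbar n \<omega> = mu n 1 + (1 / real n) *\<^sub>R (\<Sum>i=1..n. eps (int i) \<omega>)"
      using n by (simp add: Xbar_def scaleR_add_right)
    then have "S n k \<omega> = (1 / sqrt (real n)) *\<^sub>R
        (\<Sum>i=1..n. h ((real i - real k) / real n) *\<^sub>R (eps (int i) \<omega> - (1 / real n) *\<^sub>R (\<Sum>i=1..n. eps (int i) \<omega>)))"
      unfolding S_def by (intro arg_cong[where f = "\<lambda>x. _ *\<^sub>R x"] sum.cong refl) (simp add: X_eq)
    also have "\<dots> = - disc n k (bridge (Z n \<omega>))"
      unfolding Z_def[abs_def] using k by (intro weighted_sum_eq_disc) auto
    finally show ?thesis .
  qed
  have norm_S: "norm (R (S n k \<omega>)) = norm (R (disc n k (bridge (Z n \<omega>))))"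
    if "k \<in> {1..<n}" for n k \<omega> and R :: "'h \<Rightarrow>\<^sub>L 'h"
    by (simp add: S_eq[OF that] blinfun.minus_right)
  have Phi_eq: "Phi R n (Z n \<omega>) = Max ((\<lambda>k. norm (R (S n k \<omega>))) ` {1..<n})" for R n \<omega>
    unfolding Phi_def by (intro arg_cong[of _ _ Max] image_cong refl norm_S[symmetric])
  have T_FF_eq: "T_FF n \<omega> = Phi id_blinfun n (Z n \<omega>)" for n \<omega>
    by (simp add: T_FF_def Phi_eq)
  have S_meas [measurable]: "S n k \<in> borel_measurable M" for n k
    unfolding S_def Xbar_def X_def by measurable
  have T_FF_meas: "T_FF n \<in> borel_measurable M" for n
    unfolding T_FF_def by (rule borel_measurable_Max) simp_all
  have T_WF_meas: "T_WF n \<in> borel_measurable M" for n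
    unfolding T_WF_def
    by (intro borel_measurable_Max borel_measurable_norm_inv_sqrt_op[of v] orthonormal_basis_axioms
        Chat_meas Chat_psd Chat_eig S_meas) simp
  have G_eq: "G p \<omega> t = convolution (B p \<omega>) (1 - t)" for p \<omega> t
    by (simp add: G_def convolution_def)

  \<comment> \<open>With unit weights \<open>FF.\<rho>\<close> is \<open>lam\<close>.\<close>
  interpret FF: limit_setup v C lam N' W N B h \<alpha> \<beta> V id_blinfun "\<lambda>_. 1"
    by unfold_locales simp
  have FF_limit: "FF.limit = (\<lambda>\<omega>. SUP t\<in>{0<..<1}. sqrt (\<Sum>p. lam p * (G p \<omega> t)\<^sup>2))"
    by (simp add: FF.limit_def[abs_def] FF.\<rho>_def G_eq)
  have FF_conv: "(\<lambda>n. LINT \<omega>|M. g (T_FF n \<omega>)) \<longlonglongrightarrow> (LINT \<omega>|N. g (FF.limit \<omega>))"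
    if "\<And>x. 0 \<le> g x" "\<And>x. g x \<le> 1" "\<And>x y. \<bar>g x - g y\<bar> \<le> L * \<bar>x - y\<bar>" "L \<ge> (0::real)" for g L
    unfolding T_FF_eq by (rule FF.Phi_limit[OF M Z conv that])

  define A0 where "A0 = C + lam 0 *\<^sub>R id_blinfun"
  define R where "R = inv_sqrt_op A0"
  \<comment> \<open>\<open>lam 0 + lam p\<close> are the eigenvalues of \<open>A0\<close>, so
    \<open>R\<close> is diagonal with these entries and \<open>WF.\<rho> p\<close> becomes
    \<open>lam p / (lam 0 + lam p)\<close>.\<close>
  define r where "r p = 1 / sqrt (lam 0 + lam p)" for p
  have pos: "lam 0 + lam p > 0" for p using lam0 lam_nonneg[of p] by linarith
  have R_inv: "is_inv_sqrt A0 R"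
    unfolding R_def A0_def
    by (rule is_inv_sqrt_inv_sqrt_op[OF self_adjoint_shift(1)[OF psd_C] lam0 self_adjoint_shift(2)[OF psd_C]])
  have "A0 (v p) = (lam 0 + lam p) *\<^sub>R v p" for p
    by (simp add: A0_def blinfun.bilinear_simps C_v scaleR_add_left)
  then have R_v: "R (v p) = r p *\<^sub>R v p" for p
    unfolding r_def by (rule is_inv_sqrt_eigenvector[OF R_inv _ pos])
  interpret WF: limit_setup v C lam N' W N B h \<alpha> \<beta> V R r
  proof
    fix p y
    have "inner (v p) (R y) = inner (R (v p)) y"
      using R_inv by (simp add: is_inv_sqrt_def pd_op_def self_adjoint_op_def)
    then show "inner (v p) (R y) = r p * inner (v p) y" by (simp add: R_v)
  qed
  have WF_limit: "WF.limit = (\<lambda>\<omega>. SUP t\<in>{0<..<1}. sqrt (\<Sum>p. lam p / (lam 0 + lam p) * (G p \<omega> t)\<^sup>2))"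
  proof -
    have "WF.\<rho> p = lam p / (lam 0 + lam p)" for p
      using pos[of p] by (simp add: WF.\<rho>_def r_def power_divide)
    then show ?thesis by (simp add: WF.limit_def[abs_def] G_eq)
  qed
  have U_meas: "(\<lambda>\<omega>. Phi R n (Z n \<omega>)) \<in> borel_measurable M" for n
    by (rule Phi_measurable) measurable
  have D_meas: "(\<lambda>\<omega>. norm (Chat n \<omega> - C)) \<in> borel_measurable M" for n
    by (rule borel_measurable_norm_blinfun) (use Chat_meas in \<open>simp add: blinfun.diff_left\<close>)

  \<comment> \<open>The perturbation bound is proportional to the norm of its argument and holds
    uniformly in \<open>k\<close>, so the maxima differ by at most \<open>a\<close> times the
    unweighted statistic.\<close>
  have close: "\<exists>\<delta>>0. \<forall>n\<ge>2. \<forall>\<omega>\<in>space M. norm (Chat n \<omega> - C) \<le> \<delta> \<longrightarrow>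
      \<bar>T_WF n \<omega> - Phi R n (Z n \<omega>)\<bar> \<le> a * \<bar>T_FF n \<omega>\<bar>" if a: "a > 0" for a
  proof -
    obtain \<delta> where \<delta>: "\<delta> > 0" "\<And>A y. psd_op A \<Longrightarrow> \<exists>l. is_largest_eigenvalue A l \<Longrightarrow> norm (A - C) \<le> \<delta> \<Longrightarrow>
      \<bar>norm (inv_sqrt_op (A + largest_eigenvalue A *\<^sub>R id_blinfun) y) - norm (R y)\<bar> \<le> a * norm y"
      using norm_inv_sqrt_op_perturb[OF spectral_op_axioms lam_tendsto_0 lam0 a] unfolding R_def A0_def by blast
    have "\<bar>T_WF n \<omega> - Phi R n (Z n \<omega>)\<bar> \<le> a * \<bar>T_FF n \<omega>\<bar>"
      if n: "n \<ge> 2" and \<omega>: "\<omega> \<in> space M" and D: "norm (Chat n \<omega> - C) \<le> \<delta>" for n \<omega>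
      unfolding T_WF_def Phi_eq
    proof (rule Max_diff_le)
      fix k assume k: "k \<in> {1..<n}"
      have "\<bar>norm (inv_sqrt_op (Chat n \<omega> + largest_eigenvalue (Chat n \<omega>) *\<^sub>R id_blinfun) (S n k \<omega>)) - norm (R (S n k \<omega>))\<bar>
        \<le> a * norm (S n k \<omega>)"
        by (rule \<delta>(2)[OF Chat_psd[OF \<omega>] Chat_eig[OF \<omega>] D])
      also have "norm (S n k \<omega>) \<le> T_FF n \<omega>" unfolding T_FF_def using k by (intro Max_ge) auto
      then have "a * norm (S n k \<omega>) \<le> a * \<bar>T_FF n \<omega>\<bar>" using a by (intro mult_left_mono) auto
      finally show "\<bar>norm (inv_sqrt_op (Chat n \<omega> + largest_eigenvalue (Chat n \<omega>) *\<^sub>R id_blinfun) (S n k \<omega>)) - norm (R (S n k \<omega>))\<bar>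
        \<le> a * \<bar>T_FF n \<omega>\<bar>" .
    qed (use n in auto)
    with \<delta>(1) show ?thesis by blast
  qed
  \<comment> \<open>The already established limit of \<open>T_FF\<close>, tested with a truncated
    multiple of the absolute value, whose Lipschitz constant is \<open>a\<close>.\<close>
  have tight: "(\<lambda>n. LINT \<omega>|M. min 1 (a * \<bar>T_FF n \<omega>\<bar>)) \<longlonglongrightarrow> (LINT \<omega>|N. min 1 (a * \<bar>FF.limit \<omega>\<bar>))" if a: "a > 0" for a
  proof (rule FF_conv)
    show "\<bar>min 1 (a * \<bar>x\<bar>) - min 1 (a * \<bar>y\<bar>)\<bar> \<le> a * \<bar>x - y\<bar>" for x y
    proof -
      have "\<bar>min 1 (a * \<bar>x\<bar>) - min 1 (a * \<bar>y\<bar>)\<bar> \<le> \<bar>a * \<bar>x\<bar> - a * \<bar>y\<bar>\<bar>" by (rule min_one_diff)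
      also have "\<dots> = a * \<bar>\<bar>x\<bar> - \<bar>y\<bar>\<bar>" using a by (simp add: right_diff_distrib[symmetric] abs_mult)
      also have "\<dots> \<le> a * \<bar>x - y\<bar>" using a by (intro mult_left_mono) auto
      finally show ?thesis .
    qed
  qed (use a in auto)

  have WF_conv: "weak_conv_m (\<lambda>n. distr M borel (T_WF n)) (distr N borel WF.limit)"
    if D0: "\<forall>e>0. (\<lambda>n. measure M {\<omega>\<in>space M. norm (Chat n \<omega> - C) > e}) \<longlonglongrightarrow> 0"
  proof (rule weak_conv_m_distrI[OF M N T_WF_meas WF.limit_measurable])
    fix g :: "real \<Rightarrow> real" and L
    assume g: "\<And>x. 0 \<le> g x" "\<And>x. g x \<le> 1" "\<And>x y. \<bar>g x - g y\<bar> \<le> L * \<bar>x - y\<bar>" "L \<ge> 0"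
    have "(\<lambda>n. (LINT \<omega>|M. g (T_WF n \<omega>)) - (LINT \<omega>|M. g (Phi R n (Z n \<omega>)))) \<longlonglongrightarrow> 0"
      using D0 by (intro integral_diff_tendsto_0[OF M N T_WF_meas U_meas T_FF_meas D_meas FF.limit_measurable g tight _ close]) auto
    from tendsto_add[OF this WF.Phi_limit[OF M Z conv g]]
    show "(\<lambda>n. LINT \<omega>|M. g (T_WF n \<omega>)) \<longlonglongrightarrow> (LINT \<omega>|N. g (WF.limit \<omega>))" by simp
  qed
  have "weak_conv_m (\<lambda>n. distr M borel (T_FF n)) (distr N borel FF.limit)"
    by (rule weak_conv_m_distrI[OF M N T_FF_meas FF.limit_measurable]) (rule FF_conv)
  with WF_conv show ?thesis unfolding FF_limit WF_limit by blast
qed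

end
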